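(* Let $H$ be a Hopf algebra, $\delta$ a character on $H$ with $S_\delta^2=\mathrm{Id}$, and $R$ an $H$-algebra. There is a homotopy equivalence of towers of super-complexes $$\mathcal{X}_\delta(TR,IR)\simeq\theta(\Omega^*(R)_\delta).$$
   Context: $H$ is a Hopf algebra over $\mathbb{C}$ with counit $\epsilon$, antipode $S$, coproduct $\Delta(h)=\sum h_0\otimes h_1$; a character is a non-zero algebra map $\delta:H\to\mathbb{C}$; $S_\delta(h)=\sum\delta(h_0)S(h_1)$. For an $H$-module $V$, coinvariants ("coinv") means the span of the elements $hv-\delta(h)v$, and $V_\delta=V/\mathrm{coinv}$. An $H$-algebra is a (not necessarily unital) algebra $R$ with an action of the algebra $H$ satisfying $h(ab)=\sum h_0(a)h_1(b)$. $\tilde R$ is $R$ with a unit adjoined ($h\cdot1=\epsilon(h)1$). $\Omega^0(R)=R$, $\Omega^n(R)=\tilde R\otimes R^{\otimes n}$ ($n\ge1$), elements $a_0da_1\cdots da_n$, product determined by $(da)b=d(ab)-a\,db$, with diagonal $H$-action. $b(\omega\,da)=(-1)^{\deg\omega}[\omega,a]$, $b=0$ on $\Omega^0$; $k=1-(bd+db)$; $B=(1+k+\cdots+k^n)d$ on $\Omega^n(R)$. Since $S_\delta^2=\mathrm{Id}$ these descend and $(\Omega^*(R)_\delta,b,B)$ is a mixed complex. For a mixed complex $(M,b,B)$ the Hodge tower $\theta M=(\theta^nM)_{n\ge0}$ consists of the super-complexes $\theta^nM=\bigoplus_{k<n}M_k\oplus M_n/bM_{n+1}$, $\mathbb{Z}/2$-graded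 by parity of degree, with differential $b+B$, and the obvious projections $\theta^{n+1}M\to\theta^nM$. $TR=\bigoplus_{n\ge1}R^{\otimes n}$ is the non-unital tensor algebra with diagonal $H$-action, and $IR$ is the kernel of the multiplication map $TR\to R$. For an $H$-algebra $L$ with $H$-invariant ideal $J$ (with the convention that $J^0$ is $\tilde L$ when used as a coefficient of differentials), put $\Omega^1(L)_{\natural,\delta}=\Omega^1(L)/([\Omega^1(L),L]+\mathrm{coinv})$, $\natural$ the projection onto it. The tower $\mathcal{X}_\delta(L,J)=(\mathcal{X}^m_\delta(L,J))_{m\ge0}$ consists of the super-complexes $$\mathcal{X}^{2n+1}_\delta(L,J):\ L/(J^{n+1}+\mathrm{coinv})\rightleftarrows\Omega^1(L)_{\natural,\delta}/\natural(J^{n+1}dL+J^ndJ),$$ $$\mathcal{X}^{2n}_\delta(L,J):\ L/(J^{n+1}+[J^n,L]+\mathrm{coinv})\rightleftarrows\Omega^1(L)_{\natural,\delta}/\natural(J^ndL),$$ with maps $d(x)=\natural(dx)$, $b(\natural(x\,dy))=[x,y]$, and structure maps the obvious projections. A homotopy equivalence of towers of super-complexes is a map of towers (compatible with structure maps) admitting an inverse up to homotopies, all compatible with the structure maps. *)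

theory Defs
  imports Complex_Main "HOL-Library.Poly_Mapping"
begin

section \<open>Complex vector spaces and algebras\<close>

class complex_vector = ab_group_add +
  fixes scaleC :: "complex \<Rightarrow> 'a \<Rightarrow> 'a" (infixr "*\<^sub>C" 75)
  assumes scaleC_add_right: "c *\<^sub>C (x + y) = c *\<^sub>C x + c *\<^sub>C y"
    and scaleC_add_left: "(c + c') *\<^sub>C x = c *\<^sub>C x + c' *\<^sub>C x"
    and scaleC_scaleC: "c *\<^sub>C c' *\<^sub>C x = (c * c') *\<^sub>C x"
    and scaleC_one: "1 *\<^sub>C x = x"

global_interpretation cvec: vector_space "scaleC :: complex \<Rightarrow> 'a \<Rightarrow> 'a::complex_vector"
  by unfold_locales (simp_all add: scaleC_add_right scaleC_add_left scaleC_scaleC scaleC_one)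

abbreviation clinear :: "('a::complex_vector \<Rightarrow> 'b::complex_vector) \<Rightarrow> bool" where
  "clinear f \<equiv> Vector_Spaces.linear scaleC scaleC f"

lemma clinear_iff:
  "clinear f \<longleftrightarrow> (\<forall>x y. f (x + y) = f x + f y) \<and> (\<forall>c x. f (c *\<^sub>C x) = c *\<^sub>C f x)"
  unfolding Vector_Spaces.linear_iff by (simp add: cvec.vector_space_axioms)

lemma clinear_add: "clinear f \<Longrightarrow> f (x + y) = f x + f y"
  and clinear_scale: "clinear f \<Longrightarrow> f (c *\<^sub>C x) = c *\<^sub>C f x"
  by (simp_all add: clinear_iff)

lemma clinear_add_fun: "clinear f \<Longrightarrow> clinear g \<Longrightarrow> clinear (\<lambda>x. f x + g x)"
  unfolding clinear_iff by (simp add: scaleC_add_right algebra_simps)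

lemma clinear_scale_fun: "clinear f \<Longrightarrow> clinear (\<lambda>x. c *\<^sub>C f x)"
  unfolding clinear_iff by (simp add: scaleC_add_right scaleC_scaleC mult.commute)

lemma clinear_compose: "clinear f \<Longrightarrow> clinear g \<Longrightarrow> clinear (\<lambda>x. f (g x))"
  unfolding clinear_iff by simp

lemma clinear_diff: "clinear f \<Longrightarrow> f (x - y) = f x - f y"
  unfolding clinear_iff by (metis add_diff_cancel diff_add_cancel)

lemma clinear_zero: "clinear f \<Longrightarrow> f 0 = 0"
  using clinear_diff[of f 0 0] by simp

lemma clinear_eq_on_span:
  assumes "clinear f" "clinear g" "\<And>x. x \<in> B \<Longrightarrow> f x = g x" "x \<in> cvec.span B"
  shows "f x = g x"
  using assms(4)
proof (induct rule: cvec.span_induct_alt)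
  case base
  then show ?case using assms(1,2) by (simp add: clinear_zero)
next
  case (step c x y)
  then show ?case using assms(1-3) by (simp add: clinear_iff)
qed

text \<open>Algebras are associative and not necessarily unital.\<close>

class complex_algebra = complex_vector + ring +
  assumes mult_scaleC_left: "(c *\<^sub>C x) * y = c *\<^sub>C (x * y)"
    and mult_scaleC_right: "x * (c *\<^sub>C y) = c *\<^sub>C (x * y)"

class complex_algebra_1 = complex_algebra + ring_1

instantiation complex :: complex_algebra_1
begin
definition "scaleC_complex (c::complex) (x::complex) = c * x"
instance by intro_classes (simp_all add: scaleC_complex_def algebra_simps)
end

text \<open>The unitization: \<open>Adj c a\<close> is the element \<open>c 1 + a\<close>.\<close>

datatype 'a adj = Adj (scalar_part: complex) (alg_part: 'a)

instantiation adj :: (complex_algebra) complex_algebra_1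
begin
definition "0 = Adj 0 0"
definition "1 = Adj 1 0"
definition "x + y = Adj (scalar_part x + scalar_part y) (alg_part x + alg_part y)"
definition "x - y = Adj (scalar_part x - scalar_part y) (alg_part x - alg_part y)"
definition "- x = Adj (- scalar_part x) (- alg_part x)"
definition "x * y = Adj (scalar_part x * scalar_part y)
  (scalar_part x *\<^sub>C alg_part y + scalar_part y *\<^sub>C alg_part x + alg_part x * alg_part y)"
definition "c *\<^sub>C x = Adj (c * scalar_part x) (c *\<^sub>C alg_part x)"
instance
  by intro_classes
    (simp_all add: zero_adj_def one_adj_def plus_adj_def minus_adj_def uminus_adj_def times_adj_def
      scaleC_adj_def scaleC_add_right scaleC_add_left scaleC_scaleC mult_scaleC_left
      mult_scaleC_right algebra_simps scaleC_one)
end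

definition adj_incl :: "'a \<Rightarrow> 'a adj" where
  "adj_incl a = Adj 0 a"

section \<open>Tensor products\<close>

text \<open>Vector spaces given by generators and relations; \<open>'k \<Rightarrow>\<^sub>0 complex\<close> is the free vector
  space on \<open>'k\<close>.\<close>

instantiation poly_mapping :: (type, complex_vector) complex_vector
begin
lift_definition scaleC_poly_mapping :: "complex \<Rightarrow> ('a \<Rightarrow>\<^sub>0 'b) \<Rightarrow> 'a \<Rightarrow>\<^sub>0 'b"
  is "\<lambda>c f k. c *\<^sub>C f k"
  by (erule rev_finite_subset) auto
instance
  by (intro_classes; transfer)
    (simp_all add: scaleC_add_right scaleC_add_left scaleC_scaleC)
end

definition gen :: "'k \<Rightarrow> 'k \<Rightarrow>\<^sub>0 complex" where
  "gen k = Poly_Mapping.single k 1"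

definition free_ext :: "('k \<Rightarrow> 'v::complex_vector) \<Rightarrow> ('k \<Rightarrow>\<^sub>0 complex) \<Rightarrow> 'v" where
  "free_ext f p = (\<Sum>k\<in>Poly_Mapping.keys p. Poly_Mapping.lookup p k *\<^sub>C f k)"

lemma free_ext_superset:
  assumes "finite A" "Poly_Mapping.keys p \<subseteq> A"
  shows "free_ext f p = (\<Sum>k\<in>A. Poly_Mapping.lookup p k *\<^sub>C f k)"
  unfolding free_ext_def
  by (rule sum.mono_neutral_left) (use assms in \<open>auto simp: in_keys_iff\<close>)

lemma lookup_scaleC: "Poly_Mapping.lookup (c *\<^sub>C p) k = c *\<^sub>C Poly_Mapping.lookup p k"
  by transfer simp

lemma clinear_free_ext: "clinear (free_ext f)"
  unfolding clinear_iff
proof (intro conjI allI)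
  fix p q :: "'a \<Rightarrow>\<^sub>0 complex" and c :: complex
  let ?A = "Poly_Mapping.keys p \<union> Poly_Mapping.keys q"
  have "Poly_Mapping.keys (p + q) \<subseteq> ?A"
    by (rule Poly_Mapping.keys_add)
  then show "free_ext f (p + q) = free_ext f p + free_ext f q"
    by (simp add: free_ext_superset[of ?A] lookup_add scaleC_add_left sum.distrib)
  have "Poly_Mapping.keys (c *\<^sub>C p) \<subseteq> Poly_Mapping.keys p"
    by (auto simp: in_keys_iff lookup_scaleC scaleC_complex_def)
  then show "free_ext f (c *\<^sub>C p) = c *\<^sub>C free_ext f p"
    by (simp add: free_ext_superset[of "Poly_Mapping.keys p"] lookup_scaleC scaleC_complex_def
        scaleC_scaleC cvec.scale_sum_right)
qed

lemma free_ext_gen [simp]: "free_ext f (gen k) = f k"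
  by (simp add: free_ext_def gen_def)

lemma free_ext_vanishes_span:
  assumes "\<And>r. r \<in> A \<Longrightarrow> free_ext f r = 0" "p \<in> cvec.span A"
  shows "free_ext f p = 0"
  using assms(2)
proof (induct rule: cvec.span_induct_alt)
  case base
  then show ?case by (simp add: clinear_zero[OF clinear_free_ext])
next
  case (step c x y)
  then show ?case using clinear_free_ext[of f] assms(1) by (simp add: clinear_iff)
qed

lemma equivp_span: "equivp (\<lambda>p q. p - q \<in> cvec.span A)"
proof (rule equivpI)
  show "reflp (\<lambda>p q. p - q \<in> cvec.span A)"
    by (simp add: reflp_def cvec.span_zero)
  show "symp (\<lambda>p q. p - q \<in> cvec.span A)"
    by (rule sympI) (metis cvec.span_neg minus_diff_eq)
  show "transp (\<lambda>p q. p - q \<in> cvec.span A)"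
    by (rule transpI) (metis cvec.span_add diff_add_cancel add_diff_eq)
qed

lemma span_diff_add: "p - p' \<in> cvec.span A \<Longrightarrow> q - q' \<in> cvec.span A \<Longrightarrow>
    (p + q) - (p' + q') \<in> cvec.span A"
  by (metis add_diff_add cvec.span_add)

lemma span_diff_diff: "p - p' \<in> cvec.span A \<Longrightarrow> q - q' \<in> cvec.span A \<Longrightarrow>
    (p - q) - (p' - q') \<in> cvec.span A"
  using cvec.span_diff[of "p - p'" A "q - q'"] by (simp add: algebra_simps)

lemma span_diff_uminus: "p - p' \<in> cvec.span A \<Longrightarrow> - p - - p' \<in> cvec.span A"
  using cvec.span_neg[of "p - p'" A] by simp

lemma span_diff_scale: "p - p' \<in> cvec.span A \<Longrightarrow> c *\<^sub>C p - c *\<^sub>C p' \<in> cvec.span A"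
  using cvec.span_scale[of "p - p'" A c] by (simp add: cvec.scale_right_diff_distrib)

subsection \<open>Tensor product of two vector spaces\<close>

definition tensor_relators :: "('a::complex_vector \<times> 'b::complex_vector \<Rightarrow>\<^sub>0 complex) set" where
  "tensor_relators =
     {gen (x + x', y) - gen (x, y) - gen (x', y) | x x' y. True} \<union>
     {gen (x, y + y') - gen (x, y) - gen (x, y') | x y y'. True} \<union>
     {gen (c *\<^sub>C x, y) - c *\<^sub>C gen (x, y) | c x y. True} \<union>
     {gen (x, c *\<^sub>C y) - c *\<^sub>C gen (x, y) | c x y. True}"

quotient_type (overloaded) ('a, 'b) tensor =
  "'a::complex_vector \<times> 'b::complex_vector \<Rightarrow>\<^sub>0 complex" /
  "\<lambda>p q. p - q \<in> cvec.span tensor_relators"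
  by (rule equivp_span)

instantiation tensor :: (complex_vector, complex_vector) complex_vector
begin
lift_definition zero_tensor :: "('a, 'b) tensor" is 0 .
lift_definition plus_tensor :: "('a, 'b) tensor \<Rightarrow> ('a, 'b) tensor \<Rightarrow> ('a, 'b) tensor"
  is "(+)" by (rule span_diff_add)
lift_definition minus_tensor :: "('a, 'b) tensor \<Rightarrow> ('a, 'b) tensor \<Rightarrow> ('a, 'b) tensor"
  is "(-)" by (rule span_diff_diff)
lift_definition uminus_tensor :: "('a, 'b) tensor \<Rightarrow> ('a, 'b) tensor"
  is uminus by (rule span_diff_uminus)
lift_definition scaleC_tensor :: "complex \<Rightarrow> ('a, 'b) tensor \<Rightarrow> ('a, 'b) tensor"
  is scaleC by (rule span_diff_scale)
instance
  by (intro_classes; transfer)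
    (simp_all add: algebra_simps scaleC_add_right scaleC_add_left scaleC_scaleC cvec.span_zero)
end

lift_definition pure_tensor :: "'a::complex_vector \<Rightarrow> 'b::complex_vector \<Rightarrow> ('a, 'b) tensor"
    (infixr "\<otimes>" 70)
  is "\<lambda>x y. gen (x, y)" .

text \<open>The linear map \<open>x \<otimes> y \<mapsto> f x y\<close>. It is only meaningful for bilinear \<open>f\<close>, where the value
  does not depend on the representative. Thus \<open>tensor_lift (\<lambda>x y. f x y) (\<Delta> h)\<close> is
  \<open>\<Sum> f h\<^sub>0 h\<^sub>1\<close> in Sweedler notation.\<close>

definition tensor_lift ::
  "('a::complex_vector \<Rightarrow> 'b::complex_vector \<Rightarrow> 'c::complex_vector) \<Rightarrow> ('a, 'b) tensor \<Rightarrow> 'c" where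
  "tensor_lift f t = free_ext (\<lambda>(x, y). f x y) (rep_tensor t)"

subsection \<open>Tensor words\<close>

text \<open>The type \<open>('x, 'a) tens\<close> is the direct sum of the spaces \<open>X \<otimes> A\<^bsup>\<otimes>n\<^esup>\<close> over all \<open>n\<close>.
  The generator \<open>Snoc (... (Snoc (Init x) a\<^sub>1) ...) a\<^sub>n\<close> stands for
  \<open>x \<otimes> a\<^sub>1 \<otimes> \<dots> \<otimes> a\<^sub>n\<close>.\<close>

datatype ('x, 'a) word = Init 'x | Snoc "('x, 'a) word" 'a

primrec word_deg :: "('x, 'a) word \<Rightarrow> nat" where
  "word_deg (Init x) = 0"
| "word_deg (Snoc w a) = Suc (word_deg w)"

text \<open>\<open>word_add u v w\<close>: the three words agree except in one slot, where the entry of \<open>w\<close> is the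
  sum of those of \<open>u\<close> and \<open>v\<close>. Similarly for \<open>word_scale c u w\<close>.\<close>

inductive word_add :: "('x::complex_vector, 'a::complex_vector) word \<Rightarrow> ('x, 'a) word \<Rightarrow>
    ('x, 'a) word \<Rightarrow> bool" where
  "word_add (Init x) (Init y) (Init (x + y))"
| "word_add (Snoc w a) (Snoc w b) (Snoc w (a + b))"
| "word_add u v w \<Longrightarrow> word_add (Snoc u a) (Snoc v a) (Snoc w a)"

inductive word_scale :: "complex \<Rightarrow> ('x::complex_vector, 'a::complex_vector) word \<Rightarrow>
    ('x, 'a) word \<Rightarrow> bool" where
  "word_scale c (Init x) (Init (c *\<^sub>C x))"
| "word_scale c (Snoc w a) (Snoc w (c *\<^sub>C a))"
| "word_scale c u w \<Longrightarrow> word_scale c (Snoc u a) (Snoc w a)"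

definition tens_relators :: "(('x::complex_vector, 'a::complex_vector) word \<Rightarrow>\<^sub>0 complex) set" where
  "tens_relators = {gen w - gen u - gen v | u v w. word_add u v w} \<union>
     {gen w - c *\<^sub>C gen u | c u w. word_scale c u w}"

quotient_type (overloaded) ('x, 'a) tens =
  "('x::complex_vector, 'a::complex_vector) word \<Rightarrow>\<^sub>0 complex" /
  "\<lambda>p q. p - q \<in> cvec.span tens_relators"
  by (rule equivp_span)

instantiation tens :: (complex_vector, complex_vector) complex_vector
begin
lift_definition zero_tens :: "('a, 'b) tens" is 0 .
lift_definition plus_tens :: "('a, 'b) tens \<Rightarrow> ('a, 'b) tens \<Rightarrow> ('a, 'b) tens"
  is "(+)" by (rule span_diff_add)
lift_definition minus_tens :: "('a, 'b) tens \<Rightarrow> ('a, 'b) tens \<Rightarrow> ('a, 'b) tens"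
  is "(-)" by (rule span_diff_diff)
lift_definition uminus_tens :: "('a, 'b) tens \<Rightarrow> ('a, 'b) tens"
  is uminus by (rule span_diff_uminus)
lift_definition scaleC_tens :: "complex \<Rightarrow> ('a, 'b) tens \<Rightarrow> ('a, 'b) tens"
  is scaleC by (rule span_diff_scale)
instance
  by (intro_classes; transfer)
    (simp_all add: algebra_simps scaleC_add_right scaleC_add_left scaleC_scaleC cvec.span_zero)
end

lift_definition tword :: "('x::complex_vector, 'a::complex_vector) word \<Rightarrow> ('x, 'a) tens"
  is gen .

text \<open>Like \<open>tensor_lift\<close>, this is only meaningful when \<open>f\<close> is multilinear in the letters.\<close>

definition tens_lift :: "(('x::complex_vector, 'a::complex_vector) word \<Rightarrow> 'c::complex_vector) \<Rightarrow>
    ('x, 'a) tens \<Rightarrow> 'c" where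
  "tens_lift f t = free_ext f (rep_tens t)"

definition multilinear_word ::
  "(('x::complex_vector, 'a::complex_vector) word \<Rightarrow> 'c::complex_vector) \<Rightarrow> bool" where
  "multilinear_word f \<longleftrightarrow> (\<forall>u v w. word_add u v w \<longrightarrow> f w = f u + f v) \<and>
     (\<forall>c u w. word_scale c u w \<longrightarrow> f w = c *\<^sub>C f u)"

lemma multilinear_tword: "multilinear_word tword"
  unfolding multilinear_word_def
proof (intro conjI allI impI)
  fix u v w :: "('a, 'b) word" assume "word_add u v w"
  then have "gen w - (gen u + gen v) \<in> cvec.span tens_relators"
    by (intro cvec.span_base) (auto simp: tens_relators_def diff_diff_add)
  then show "tword w = tword u + tword v" by transfer
next
  fix u w :: "('a, 'b) word" and c assume "word_scale c u w"
  then have "gen w - c *\<^sub>C gen u \<in> cvec.span tens_relators"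
    by (intro cvec.span_base) (auto simp: tens_relators_def)
  then show "tword w = c *\<^sub>C tword u" by transfer
qed

lemma free_ext_tens_eq:
  assumes "multilinear_word f" "p - q \<in> cvec.span tens_relators"
  shows "free_ext f p = free_ext f q"
proof -
  note lin = clinear_free_ext[of f]
  have "free_ext f r = 0" if "r \<in> tens_relators" for r
    using that assms(1) lin unfolding tens_relators_def multilinear_word_def
    by (auto simp: clinear_diff[OF lin] clinear_iff)
  from free_ext_vanishes_span[of tens_relators f, OF this assms(2)] show ?thesis
    by (simp add: clinear_diff[OF lin])
qed

lemma tens_lift_abs:
  assumes "multilinear_word f"
  shows "tens_lift f (abs_tens p) = free_ext f p"
  unfolding tens_lift_def
  by (rule free_ext_tens_eq[OF assms])
    (use Quotient3_rep_abs[OF Quotient3_tens] equivp_reflp[OF tens_equivp] in blast)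

lemma tens_lift_tword:
  "multilinear_word f \<Longrightarrow> tens_lift f (tword w) = f w"
  by (simp add: tword.abs_eq tens_lift_abs)

lemma clinear_tens_lift:
  assumes "multilinear_word f"
  shows "clinear (tens_lift f)"
  unfolding clinear_iff
proof (intro conjI allI)
  note lin = clinear_free_ext[of f]
  fix s t :: "('a, 'b) tens" and c
  obtain p q where "s = abs_tens p" "t = abs_tens q"
    by (metis Quotient3_abs_rep[OF Quotient3_tens])
  then show "tens_lift f (s + t) = tens_lift f s + tens_lift f t"
    "tens_lift f (c *\<^sub>C s) = c *\<^sub>C tens_lift f s"
    using lin by (simp_all add: plus_tens.abs_eq scaleC_tens.abs_eq tens_lift_abs[OF assms] clinear_iff)
qed

lemma span_tword: "t \<in> cvec.span (range tword)"
proof -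
  have *: "abs_tens p = free_ext tword p" for p :: "('a, 'b) word \<Rightarrow>\<^sub>0 complex"
  proof (induct p rule: Poly_Mapping.update_induct)
    case const
    then show ?case
      by (simp add: clinear_zero[OF clinear_free_ext] zero_tens.abs_eq)
  next
    case (update p k c)
    have eq: "Poly_Mapping.update k c p = p + c *\<^sub>C gen k"
      using update(1) by (intro poly_mapping_eqI)
        (auto simp: lookup_update lookup_add lookup_scaleC gen_def lookup_single when_def
          scaleC_complex_def in_keys_iff)
    have "abs_tens (p + c *\<^sub>C gen k) = abs_tens p + c *\<^sub>C tword k"
      by (simp add: plus_tens.abs_eq scaleC_tens.abs_eq tword.abs_eq)
    moreover have "free_ext tword (p + c *\<^sub>C gen k) = free_ext tword p + c *\<^sub>C tword k"
      using clinear_free_ext[of "tword :: ('a, 'b) word \<Rightarrow> _"] by (simp add: clinear_iff)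
    ultimately show ?case
      unfolding eq using update(3) by simp
  qed
  have "free_ext tword p \<in> cvec.span (range tword)" for p :: "('a, 'b) word \<Rightarrow>\<^sub>0 complex"
    unfolding free_ext_def by (intro cvec.span_sum cvec.span_scale cvec.span_base) auto
  then show ?thesis
    by (metis * Quotient3_abs_rep[OF Quotient3_tens])
qed

lemma clinear_eq_on_tword:
  assumes "clinear f" "clinear g" "\<And>w. f (tword w) = g (tword w)"
  shows "f t = g t"
  by (rule clinear_eq_on_span[OF assms(1,2) _ span_tword]) (use assms(3) in auto)

definition tens_snoc :: "('x::complex_vector, 'a::complex_vector) tens \<Rightarrow> 'a \<Rightarrow> ('x, 'a) tens" where
  "tens_snoc t a = tens_lift (\<lambda>w. tword (Snoc w a)) t"

subsection \<open>The non-unital tensor algebra\<close>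

text \<open>\<open>TR\<close> is the direct sum of the \<open>R \<otimes> R\<^bsup>\<otimes>n\<^esup>\<close> over \<open>n \<ge> 0\<close>, with concatenation as
  product. The type is a copy of \<open>('a, 'a) tens\<close>, so that it can be an algebra.\<close>

typedef (overloaded) 'a talg = "UNIV :: ('a::complex_vector, 'a) tens set"
  by simp

setup_lifting type_definition_talg

primrec word_append :: "('a, 'a) word \<Rightarrow> ('a, 'a) word \<Rightarrow> ('a, 'a) word" where
  "word_append u (Init a) = Snoc u a"
| "word_append u (Snoc v a) = Snoc (word_append u v) a"

definition tens_mult :: "('a::complex_vector, 'a) tens \<Rightarrow> ('a, 'a) tens \<Rightarrow> ('a, 'a) tens" where
  "tens_mult s t = tens_lift (\<lambda>u. tens_lift (\<lambda>v. tword (word_append u v)) t) s"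

lemma word_add_append_right:
  "word_add u v w \<Longrightarrow> word_add (word_append z u) (word_append z v) (word_append z w)"
  by (induct rule: word_add.induct) (auto intro: word_add.intros)

lemma word_add_append_left:
  "word_add u v w \<Longrightarrow> word_add (word_append u z) (word_append v z) (word_append w z)"
  by (induct z) (auto intro: word_add.intros)

lemma word_scale_append_right:
  "word_scale c u w \<Longrightarrow> word_scale c (word_append z u) (word_append z w)"
  by (induct rule: word_scale.induct) (auto intro: word_scale.intros)

lemma word_scale_append_left:
  "word_scale c u w \<Longrightarrow> word_scale c (word_append u z) (word_append w z)"
  by (induct z) (auto intro: word_scale.intros)

lemma word_append_assoc: "word_append (word_append u v) w = word_append u (word_append v w)"
  by (induct w) auto

lemma multilinear_append_right: "multilinear_word (\<lambda>v. tword (word_append u v))"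
  using multilinear_tword unfolding multilinear_word_def
  by (blast intro: word_add_append_right word_scale_append_right)

lemma multilinear_append_left:
  "multilinear_word (\<lambda>u. tens_lift (\<lambda>v. tword (word_append u v)) t)"
  unfolding multilinear_word_def
proof (intro conjI allI impI)
  note lin = clinear_tens_lift[OF multilinear_append_right]
  note tw = multilinear_tword[unfolded multilinear_word_def]
  fix u v w :: "('a, 'a) word" assume *: "word_add u v w"
  show "tens_lift (\<lambda>z. tword (word_append w z)) t =
    tens_lift (\<lambda>z. tword (word_append u z)) t + tens_lift (\<lambda>z. tword (word_append v z)) t"
    by (rule clinear_eq_on_tword[OF lin clinear_add_fun[OF lin lin]])
      (simp only: tens_lift_tword[OF multilinear_append_right],
        rule tw[THEN conjunct1, rule_format, OF word_add_append_left[OF *]])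
next
  note lin = clinear_tens_lift[OF multilinear_append_right]
  note tw = multilinear_tword[unfolded multilinear_word_def]
  fix u w :: "('a, 'a) word" and c assume *: "word_scale c u w"
  show "tens_lift (\<lambda>z. tword (word_append w z)) t =
    c *\<^sub>C tens_lift (\<lambda>z. tword (word_append u z)) t"
    by (rule clinear_eq_on_tword[OF lin clinear_scale_fun[OF lin]])
      (simp only: tens_lift_tword[OF multilinear_append_right],
        rule tw[THEN conjunct2, rule_format, OF word_scale_append_left[OF *]])
qed

lemma clinear_tens_mult_left: "clinear (\<lambda>s. tens_mult s t)"
  unfolding tens_mult_def by (rule clinear_tens_lift[OF multilinear_append_left])

lemma tens_mult_tword: "tens_mult (tword u) t = tens_lift (\<lambda>v. tword (word_append u v)) t"
  unfolding tens_mult_def by (rule tens_lift_tword[OF multilinear_append_left])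

lemma clinear_tens_mult_right: "clinear (tens_mult s)"
  unfolding clinear_iff
proof (intro conjI allI)
  note lin = clinear_tens_lift[OF multilinear_append_right]
  note lin2 = clinear_tens_mult_left
  fix t t' :: "('a, 'a) tens" and c
  show "tens_mult s (t + t') = tens_mult s t + tens_mult s t'"
    by (rule clinear_eq_on_tword[OF lin2 clinear_add_fun[OF lin2 lin2]])
      (simp add: tens_mult_tword clinear_add[OF lin])
  show "tens_mult s (c *\<^sub>C t) = c *\<^sub>C tens_mult s t"
    by (rule clinear_eq_on_tword[OF lin2 clinear_scale_fun[OF lin2]])
      (simp add: tens_mult_tword clinear_scale[OF lin])
qed

lemma tens_mult_words: "tens_mult (tword u) (tword v) = tword (word_append u v)"
  by (simp add: tens_mult_tword tens_lift_tword[OF multilinear_append_right])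

lemma tens_mult_assoc: "tens_mult (tens_mult r s) t = tens_mult r (tens_mult s t)"
proof -
  note l = clinear_tens_mult_left and r = clinear_tens_mult_right
  have 1: "tens_mult (tens_mult (tword u) (tword v)) t = tens_mult (tword u) (tens_mult (tword v) t)"
    for u v
    by (rule clinear_eq_on_tword[OF r clinear_compose[OF r r]])
      (simp add: tens_mult_words word_append_assoc)
  have 2: "tens_mult (tens_mult (tword u) s) t = tens_mult (tword u) (tens_mult s t)" for u
    by (rule clinear_eq_on_tword[OF clinear_compose[OF l r] clinear_compose[OF r l]]) (rule 1)
  show ?thesis
    by (rule clinear_eq_on_tword[OF clinear_compose[OF l l] l]) (rule 2)
qed

instantiation talg :: (complex_vector) complex_algebra
begin
lift_definition zero_talg :: "'a talg" is 0 .
lift_definition plus_talg :: "'a talg \<Rightarrow> 'a talg \<Rightarrow> 'a talg" is "(+)" .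
lift_definition minus_talg :: "'a talg \<Rightarrow> 'a talg \<Rightarrow> 'a talg" is "(-)" .
lift_definition uminus_talg :: "'a talg \<Rightarrow> 'a talg" is uminus .
lift_definition scaleC_talg :: "complex \<Rightarrow> 'a talg \<Rightarrow> 'a talg" is scaleC .
lift_definition times_talg :: "'a talg \<Rightarrow> 'a talg \<Rightarrow> 'a talg" is tens_mult .
instance
proof (intro_classes; transfer)
  fix r s t :: "('a, 'a) tens" and c c' :: complex
  note l = clinear_tens_mult_left and r = clinear_tens_mult_right
  show "tens_mult (tens_mult r s) t = tens_mult r (tens_mult s t)"
    by (rule tens_mult_assoc)
  show "tens_mult (r + s) t = tens_mult r t + tens_mult s t"
    by (rule clinear_add[OF l])
  show "tens_mult r (s + t) = tens_mult r s + tens_mult r t"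
    by (rule clinear_add[OF r])
  show "tens_mult (c *\<^sub>C r) s = c *\<^sub>C tens_mult r s"
    by (rule clinear_scale[OF l])
  show "tens_mult r (c *\<^sub>C s) = c *\<^sub>C tens_mult r s"
    by (rule clinear_scale[OF r])
qed (simp_all add: algebra_simps scaleC_add_right scaleC_add_left scaleC_scaleC)
end

primrec word_prod :: "('a::times, 'a) word \<Rightarrow> 'a" where
  "word_prod (Init a) = a"
| "word_prod (Snoc w a) = word_prod w * a"

definition talg_prod :: "'a::complex_algebra talg \<Rightarrow> 'a" where
  "talg_prod t = tens_lift word_prod (Rep_talg t)"

definition IR :: "'a::complex_algebra talg set" where
  "IR = {t. talg_prod t = 0}"

section \<open>Hopf algebras and their actions\<close>

locale hopf_algebra =
  fixes \<Delta> :: "'h::complex_algebra_1 \<Rightarrow> ('h, 'h) tensor"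
    and \<epsilon> :: "'h \<Rightarrow> complex"
    and S :: "'h \<Rightarrow> 'h"
  assumes linear_comult: "clinear \<Delta>"
    and linear_counit: "clinear \<epsilon>"
    and linear_antipode: "clinear S"
    and coassoc: "tensor_lift (\<lambda>x y. tensor_lift (\<lambda>x\<^sub>0 x\<^sub>1. x\<^sub>0 \<otimes> x\<^sub>1 \<otimes> y) (\<Delta> x)) (\<Delta> h) =
      tensor_lift (\<lambda>x y. x \<otimes> \<Delta> y) (\<Delta> h)"
    and counit_left: "tensor_lift (\<lambda>x y. \<epsilon> x *\<^sub>C y) (\<Delta> h) = h"
    and counit_right: "tensor_lift (\<lambda>x y. \<epsilon> y *\<^sub>C x) (\<Delta> h) = h"
    and comult_mult: "\<Delta> (g * h) =
      tensor_lift (\<lambda>g\<^sub>0 g\<^sub>1. tensor_lift (\<lambda>h\<^sub>0 h\<^sub>1. (g\<^sub>0 * h\<^sub>0) \<otimes> (g\<^sub>1 * h\<^sub>1)) (\<Delta> h)) (\<Delta> g)"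
    and comult_one: "\<Delta> 1 = 1 \<otimes> 1"
    and counit_mult: "\<epsilon> (g * h) = \<epsilon> g * \<epsilon> h"
    and counit_one: "\<epsilon> 1 = 1"
    and antipode_left: "tensor_lift (\<lambda>x y. S x * y) (\<Delta> h) = \<epsilon> h *\<^sub>C 1"
    and antipode_right: "tensor_lift (\<lambda>x y. x * S y) (\<Delta> h) = \<epsilon> h *\<^sub>C 1"

definition character :: "('h::complex_algebra_1 \<Rightarrow> complex) \<Rightarrow> bool" where
  "character \<delta> \<longleftrightarrow> clinear \<delta> \<and> (\<forall>g h. \<delta> (g * h) = \<delta> g * \<delta> h) \<and> (\<exists>h. \<delta> h \<noteq> 0)"

definition twisted_antipode :: "('h::complex_algebra_1 \<Rightarrow> ('h, 'h) tensor) \<Rightarrow> ('h \<Rightarrow> 'h) \<Rightarrow>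
    ('h \<Rightarrow> complex) \<Rightarrow> 'h \<Rightarrow> 'h" where
  "twisted_antipode \<Delta> S \<delta> h = tensor_lift (\<lambda>h\<^sub>0 h\<^sub>1. \<delta> h\<^sub>0 *\<^sub>C S h\<^sub>1) (\<Delta> h)"

locale hopf_module_algebra =
  fixes \<Delta> :: "'h::complex_algebra_1 \<Rightarrow> ('h, 'h) tensor"
    and act :: "'h \<Rightarrow> 'a::complex_algebra \<Rightarrow> 'a"
  assumes act_linear_left: "clinear (\<lambda>h. act h a)"
    and act_linear_right: "clinear (act h)"
    and act_mult: "act (g * h) a = act g (act h a)"
    and act_one: "act 1 a = a"
    and act_prod: "act h (a * b) = tensor_lift (\<lambda>h\<^sub>0 h\<^sub>1. act h\<^sub>0 a * act h\<^sub>1 b) (\<Delta> h)"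

definition adj_act :: "('h \<Rightarrow> complex) \<Rightarrow> ('h \<Rightarrow> 'a \<Rightarrow> 'a) \<Rightarrow> 'h \<Rightarrow> 'a adj \<Rightarrow> 'a adj" where
  "adj_act \<epsilon> act h x = Adj (\<epsilon> h * scalar_part x) (act h (alg_part x))"

primrec diag_word :: "('h::complex_vector \<Rightarrow> ('h, 'h) tensor) \<Rightarrow>
    ('h \<Rightarrow> 'x::complex_vector \<Rightarrow> 'x) \<Rightarrow> ('h \<Rightarrow> 'a::complex_vector \<Rightarrow> 'a) \<Rightarrow>
    ('x, 'a) word \<Rightarrow> 'h \<Rightarrow> ('x, 'a) tens" where
  "diag_word \<Delta> actX act (Init x) = (\<lambda>h. tword (Init (actX h x)))"
| "diag_word \<Delta> actX act (Snoc w a) = (\<lambda>h.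
     tensor_lift (\<lambda>h\<^sub>0 h\<^sub>1. tens_snoc (diag_word \<Delta> actX act w h\<^sub>0) (act h\<^sub>1 a)) (\<Delta> h))"

definition diag_act :: "('h::complex_vector \<Rightarrow> ('h, 'h) tensor) \<Rightarrow>
    ('h \<Rightarrow> 'x::complex_vector \<Rightarrow> 'x) \<Rightarrow> ('h \<Rightarrow> 'a::complex_vector \<Rightarrow> 'a) \<Rightarrow>
    'h \<Rightarrow> ('x, 'a) tens \<Rightarrow> ('x, 'a) tens" where
  "diag_act \<Delta> actX act h t = tens_lift (\<lambda>w. diag_word \<Delta> actX act w h) t"

definition talg_act :: "('h::complex_vector \<Rightarrow> ('h, 'h) tensor) \<Rightarrow>
    ('h \<Rightarrow> 'a::complex_vector \<Rightarrow> 'a) \<Rightarrow> 'h \<Rightarrow> 'a talg \<Rightarrow> 'a talg" where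
  "talg_act \<Delta> act h t = Abs_talg (diag_act \<Delta> act act h (Rep_talg t))"

definition coinv :: "('h \<Rightarrow> 'v \<Rightarrow> 'v) \<Rightarrow> ('h \<Rightarrow> complex) \<Rightarrow> 'v::complex_vector set \<Rightarrow> 'v set" where
  "coinv act \<delta> V = cvec.span {act h v - \<delta> h *\<^sub>C v | h v. v \<in> V}"

section \<open>Noncommutative differential forms\<close>

text \<open>\<open>Snoc (... (Snoc (Init x) a\<^sub>1) ...) a\<^sub>n\<close> stands for \<open>x da\<^sub>1 \<dots> da\<^sub>n\<close>. The type contains
  the unitization itself in degree 0, of which \<open>\<Omega>\<^sup>0(R) = R\<close> is a subspace.\<close>

type_synonym 'a forms = "('a adj, 'a) tens"

definition Forms :: "nat \<Rightarrow> 'a::complex_algebra forms set" where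
  "Forms n = (if n = 0 then range (\<lambda>a. tword (Init (adj_incl a)))
     else cvec.span (tword ` {w. word_deg w = n}))"

definition forms_act :: "('h::complex_vector \<Rightarrow> ('h, 'h) tensor) \<Rightarrow> ('h \<Rightarrow> complex) \<Rightarrow>
    ('h \<Rightarrow> 'a::complex_algebra \<Rightarrow> 'a) \<Rightarrow> 'h \<Rightarrow> 'a forms \<Rightarrow> 'a forms" where
  "forms_act \<Delta> \<epsilon> act = diag_act \<Delta> (adj_act \<epsilon> act) act"

text \<open>Of the product on forms only the bimodule structure over the algebra is needed. The right
  multiplication is \<open>(\<omega> da) b = \<omega> d(ab) - (\<omega> a) db\<close>.\<close>

primrec word_lmul :: "'a::complex_algebra adj \<Rightarrow> ('a adj, 'a) word \<Rightarrow> ('a adj, 'a) word" where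
  "word_lmul x (Init y) = Init (x * y)"
| "word_lmul x (Snoc w a) = Snoc (word_lmul x w) a"

primrec word_rmul :: "('a::complex_algebra adj, 'a) word \<Rightarrow> 'a \<Rightarrow> 'a forms" where
  "word_rmul (Init x) = (\<lambda>b. tword (Init (x * adj_incl b)))"
| "word_rmul (Snoc w a) = (\<lambda>b. tword (Snoc w (a * b)) - tens_snoc (word_rmul w a) b)"

definition forms_lmul :: "'a::complex_algebra \<Rightarrow> 'a forms \<Rightarrow> 'a forms" where
  "forms_lmul a \<omega> = tens_lift (\<lambda>w. tword (word_lmul (adj_incl a) w)) \<omega>"

definition forms_rmul :: "'a::complex_algebra forms \<Rightarrow> 'a \<Rightarrow> 'a forms" where
  "forms_rmul \<omega> a = tens_lift (\<lambda>w. word_rmul w a) \<omega>"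

definition forms_comm :: "'a::complex_algebra forms \<Rightarrow> 'a \<Rightarrow> 'a forms" where
  "forms_comm \<omega> a = forms_rmul \<omega> a - forms_lmul a \<omega>"

text \<open>\<open>d(x da\<^sub>1 \<dots> da\<^sub>n) = 1 dx da\<^sub>1 \<dots> da\<^sub>n\<close>, with \<open>d1 = 0\<close>.\<close>

primrec word_d :: "('a::complex_algebra adj, 'a) word \<Rightarrow> ('a adj, 'a) word" where
  "word_d (Init x) = Snoc (Init 1) (alg_part x)"
| "word_d (Snoc w a) = Snoc (word_d w) a"

definition forms_d :: "'a::complex_algebra forms \<Rightarrow> 'a forms" where
  "forms_d \<omega> = tens_lift (\<lambda>w. tword (word_d w)) \<omega>"

primrec word_b :: "('a::complex_algebra adj, 'a) word \<Rightarrow> 'a forms" where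
  "word_b (Init x) = 0"
| "word_b (Snoc w a) = (-1) ^ word_deg w *\<^sub>C forms_comm (tword w) a"

definition forms_b :: "'a::complex_algebra forms \<Rightarrow> 'a forms" where
  "forms_b \<omega> = tens_lift word_b \<omega>"

definition forms_k :: "'a::complex_algebra forms \<Rightarrow> 'a forms" where
  "forms_k \<omega> = \<omega> - (forms_b (forms_d \<omega>) + forms_d (forms_b \<omega>))"

definition forms_B :: "'a::complex_algebra forms \<Rightarrow> 'a forms" where
  "forms_B \<omega> = tens_lift (\<lambda>w. \<Sum>i\<le>word_deg w. (forms_k ^^ i) (forms_d (tword w))) \<omega>"

section \<open>Towers of super-complexes\<close>

subsection \<open>Vector spaces with a carrier and their quotients\<close>

record 'v cspace =
  carrier :: "'v set"
  vzero :: 'v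
  vadd :: "'v \<Rightarrow> 'v \<Rightarrow> 'v"
  vscale :: "complex \<Rightarrow> 'v \<Rightarrow> 'v"

locale complex_space =
  fixes V :: "'v cspace"
  assumes zero_closed: "vzero V \<in> carrier V"
    and add_closed: "x \<in> carrier V \<Longrightarrow> y \<in> carrier V \<Longrightarrow> vadd V x y \<in> carrier V"
    and scale_closed: "x \<in> carrier V \<Longrightarrow> vscale V c x \<in> carrier V"
    and add_assoc: "x \<in> carrier V \<Longrightarrow> y \<in> carrier V \<Longrightarrow> z \<in> carrier V \<Longrightarrow>
      vadd V (vadd V x y) z = vadd V x (vadd V y z)"
    and add_commute: "x \<in> carrier V \<Longrightarrow> y \<in> carrier V \<Longrightarrow> vadd V x y = vadd V y x"
    and add_zero: "x \<in> carrier V \<Longrightarrow> vadd V x (vzero V) = x"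
    and add_inverse: "x \<in> carrier V \<Longrightarrow> vadd V x (vscale V (-1) x) = vzero V"
    and scale_add: "x \<in> carrier V \<Longrightarrow> y \<in> carrier V \<Longrightarrow>
      vscale V c (vadd V x y) = vadd V (vscale V c x) (vscale V c y)"
    and add_scale: "x \<in> carrier V \<Longrightarrow>
      vscale V (c + c') x = vadd V (vscale V c x) (vscale V c' x)"
    and scale_scale: "x \<in> carrier V \<Longrightarrow> vscale V c (vscale V c' x) = vscale V (c * c') x"
    and scale_one: "x \<in> carrier V \<Longrightarrow> vscale V 1 x = x"

definition linear_map :: "'v cspace \<Rightarrow> 'w cspace \<Rightarrow> ('v \<Rightarrow> 'w) \<Rightarrow> bool" where
  "linear_map V W f \<longleftrightarrow>
     (\<forall>x\<in>carrier V. f x \<in> carrier W) \<and>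
     (\<forall>x\<in>carrier V. \<forall>y\<in>carrier V. f (vadd V x y) = vadd W (f x) (f y)) \<and>
     (\<forall>c. \<forall>x\<in>carrier V. f (vscale V c x) = vscale W c (f x))"

definition cspace_on :: "'v::complex_vector set \<Rightarrow> 'v cspace" where
  "cspace_on A = \<lparr>carrier = A, vzero = 0, vadd = (+), vscale = scaleC\<rparr>"

definition coset :: "'v cspace \<Rightarrow> 'v set \<Rightarrow> 'v \<Rightarrow> 'v set" where
  "coset V N x = vadd V x ` N"

definition quotient :: "'v cspace \<Rightarrow> 'v set \<Rightarrow> 'v set cspace" where
  "quotient V N = \<lparr>carrier = coset V N ` carrier V,
     vzero = coset V N (vzero V),
     vadd = (\<lambda>X Y. \<Union>x\<in>X. \<Union>y\<in>Y. coset V N (vadd V x y)),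
     vscale = (\<lambda>c X. \<Union>x\<in>X. coset V N (vscale V c x))\<rparr>"

text \<open>The map on a quotient induced by a map that is constant on cosets.\<close>

definition descend :: "('v \<Rightarrow> 'w) \<Rightarrow> 'v set \<Rightarrow> 'w" where
  "descend f X = the_elem (f ` X)"

subsection \<open>Super-complexes and towers\<close>

record ('e, 'o) super_complex =
  ev :: "'e cspace"
  od :: "'o cspace"
  diff_ev :: "'e \<Rightarrow> 'o"
  diff_od :: "'o \<Rightarrow> 'e"

definition is_super_complex :: "('e, 'o) super_complex \<Rightarrow> bool" where
  "is_super_complex X \<longleftrightarrow> complex_space (ev X) \<and> complex_space (od X) \<and>
     linear_map (ev X) (od X) (diff_ev X) \<and> linear_map (od X) (ev X) (diff_od X) \<and>
     (\<forall>x\<in>carrier (ev X). diff_od X (diff_ev X x) = vzero (ev X)) \<and>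
     (\<forall>x\<in>carrier (od X). diff_ev X (diff_od X x) = vzero (od X))"

definition super_map :: "('e, 'o) super_complex \<Rightarrow> ('e2, 'o2) super_complex \<Rightarrow>
    ('e \<Rightarrow> 'e2) \<Rightarrow> ('o \<Rightarrow> 'o2) \<Rightarrow> bool" where
  "super_map X Y f g \<longleftrightarrow> linear_map (ev X) (ev Y) f \<and> linear_map (od X) (od Y) g \<and>
     (\<forall>x\<in>carrier (ev X). g (diff_ev X x) = diff_ev Y (f x)) \<and>
     (\<forall>x\<in>carrier (od X). f (diff_od X x) = diff_od Y (g x))"

text \<open>The structure maps \<open>proj_ev T m\<close>, \<open>proj_od T m\<close> go from level \<open>m + 1\<close> to level \<open>m\<close>.\<close>

record ('e, 'o) tower =
  level :: "nat \<Rightarrow> ('e, 'o) super_complex"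
  proj_ev :: "nat \<Rightarrow> 'e \<Rightarrow> 'e"
  proj_od :: "nat \<Rightarrow> 'o \<Rightarrow> 'o"

definition is_tower :: "('e, 'o) tower \<Rightarrow> bool" where
  "is_tower T \<longleftrightarrow> (\<forall>m. is_super_complex (level T m) \<and>
     super_map (level T (Suc m)) (level T m) (proj_ev T m) (proj_od T m))"

definition tower_map :: "('e, 'o) tower \<Rightarrow> ('e2, 'o2) tower \<Rightarrow>
    (nat \<Rightarrow> 'e \<Rightarrow> 'e2) \<Rightarrow> (nat \<Rightarrow> 'o \<Rightarrow> 'o2) \<Rightarrow> bool" where
  "tower_map T U f g \<longleftrightarrow> (\<forall>m. super_map (level T m) (level U m) (f m) (g m) \<and>
     (\<forall>x\<in>carrier (ev (level T (Suc m))). f m (proj_ev T m x) = proj_ev U m (f (Suc m) x)) \<and>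
     (\<forall>x\<in>carrier (od (level T (Suc m))). g m (proj_od T m x) = proj_od U m (g (Suc m) x)))"

text \<open>The homotopy consists of odd maps \<open>s m\<close> and \<open>t m\<close> compatible with the structure maps, such
  that \<open>(f, g) - (f', g')\<close> is the supercommutator of the homotopy with the differential.\<close>

definition tower_homotopic :: "('e, 'o) tower \<Rightarrow> ('e2, 'o2) tower \<Rightarrow>
    (nat \<Rightarrow> 'e \<Rightarrow> 'e2) \<Rightarrow> (nat \<Rightarrow> 'o \<Rightarrow> 'o2) \<Rightarrow>
    (nat \<Rightarrow> 'e \<Rightarrow> 'e2) \<Rightarrow> (nat \<Rightarrow> 'o \<Rightarrow> 'o2) \<Rightarrow> bool" where
  "tower_homotopic T U f g f' g' \<longleftrightarrow>
     (\<exists>(s :: nat \<Rightarrow> 'e \<Rightarrow> 'o2) (t :: nat \<Rightarrow> 'o \<Rightarrow> 'e2). \<forall>m.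
        linear_map (ev (level T m)) (od (level U m)) (s m) \<and>
        linear_map (od (level T m)) (ev (level U m)) (t m) \<and>
        (\<forall>x\<in>carrier (ev (level T (Suc m))). s m (proj_ev T m x) = proj_od U m (s (Suc m) x)) \<and>
        (\<forall>x\<in>carrier (od (level T (Suc m))). t m (proj_od T m x) = proj_ev U m (t (Suc m) x)) \<and>
        (\<forall>x\<in>carrier (ev (level T m)). f m x = vadd (ev (level U m)) (f' m x)
           (vadd (ev (level U m)) (diff_od (level U m) (s m x)) (t m (diff_ev (level T m) x)))) \<and>
        (\<forall>x\<in>carrier (od (level T m)). g m x = vadd (od (level U m)) (g' m x)
           (vadd (od (level U m)) (diff_ev (level U m) (t m x)) (s m (diff_od (level T m) x)))))"

definition tower_homotopy_equivalent :: "('e, 'o) tower \<Rightarrow> ('e2, 'o2) tower \<Rightarrow> bool" where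
  "tower_homotopy_equivalent T U \<longleftrightarrow> is_tower T \<and> is_tower U \<and>
     (\<exists>f g f' g'. tower_map T U f g \<and> tower_map U T f' g' \<and>
        tower_homotopic T T (\<lambda>m x. f' m (f m x)) (\<lambda>m x. g' m (g m x)) (\<lambda>m x. x) (\<lambda>m x. x) \<and>
        tower_homotopic U U (\<lambda>m x. f m (f' m x)) (\<lambda>m x. g m (g' m x)) (\<lambda>m x. x) (\<lambda>m x. x))"

subsection \<open>Mixed complexes and the Hodge tower\<close>

text \<open>\<open>mc_b M n\<close> and \<open>mc_B M n\<close> are the maps \<open>b\<close> and \<open>B\<close> on degree \<open>n\<close>.\<close>

record 'm mixed_complex =
  mc :: "nat \<Rightarrow> 'm cspace"
  mc_b :: "nat \<Rightarrow> 'm \<Rightarrow> 'm"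
  mc_B :: "nat \<Rightarrow> 'm \<Rightarrow> 'm"

text \<open>The direct sum of the \<open>M\<^sub>k\<close> with \<open>k \<le> n\<close> and \<open>k\<close> of parity \<open>p \<in> {0, 1}\<close>. Dividing it by
  the copy of \<open>b M\<^sub>n\<^sub>+\<^sub>1\<close> in degree \<open>n\<close> gives the parity \<open>p\<close> part of \<open>\<theta>\<^sup>n M\<close>.\<close>

definition trunc_sum :: "'m mixed_complex \<Rightarrow> nat \<Rightarrow> nat \<Rightarrow> (nat \<Rightarrow> 'm) cspace" where
  "trunc_sum M n p = \<lparr>
     carrier = {f. \<forall>k. f k \<in> carrier (mc M k) \<and> (n < k \<or> k mod 2 \<noteq> p \<longrightarrow> f k = vzero (mc M k))},
     vzero = (\<lambda>k. vzero (mc M k)),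
     vadd = (\<lambda>f g k. vadd (mc M k) (f k) (g k)),
     vscale = (\<lambda>c f k. vscale (mc M k) c (f k))\<rparr>"

definition top_boundaries :: "'m mixed_complex \<Rightarrow> nat \<Rightarrow> nat \<Rightarrow> (nat \<Rightarrow> 'm) set" where
  "top_boundaries M n p = {f \<in> carrier (trunc_sum M n p).
     (\<forall>k. k \<noteq> n \<longrightarrow> f k = vzero (mc M k)) \<and> f n \<in> mc_b M (Suc n) ` carrier (mc M (Suc n))}"

abbreviation hodge_proj :: "'m mixed_complex \<Rightarrow> nat \<Rightarrow> nat \<Rightarrow> (nat \<Rightarrow> 'm) \<Rightarrow> (nat \<Rightarrow> 'm) set" where
  "hodge_proj M n p \<equiv> coset (trunc_sum M n p) (top_boundaries M n p)"

text \<open>\<open>b + B\<close>, followed by truncation to degrees at most \<open>n\<close>.\<close>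

definition hodge_diff :: "'m mixed_complex \<Rightarrow> nat \<Rightarrow> (nat \<Rightarrow> 'm) \<Rightarrow> nat \<Rightarrow> 'm" where
  "hodge_diff M n f = (\<lambda>k. if n < k then vzero (mc M k)
     else vadd (mc M k) (mc_b M (Suc k) (f (Suc k)))
       (case k of 0 \<Rightarrow> vzero (mc M 0) | Suc j \<Rightarrow> mc_B M j (f j)))"

definition hodge_trunc :: "'m mixed_complex \<Rightarrow> nat \<Rightarrow> (nat \<Rightarrow> 'm) \<Rightarrow> nat \<Rightarrow> 'm" where
  "hodge_trunc M n f = (\<lambda>k. if n < k then vzero (mc M k) else f k)"

definition hodge_tower :: "'m mixed_complex \<Rightarrow> ((nat \<Rightarrow> 'm) set, (nat \<Rightarrow> 'm) set) tower" where
  "hodge_tower M = \<lparr>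
     level = (\<lambda>n. \<lparr>
       ev = quotient (trunc_sum M n 0) (top_boundaries M n 0),
       od = quotient (trunc_sum M n 1) (top_boundaries M n 1),
       diff_ev = descend (\<lambda>f. hodge_proj M n 1 (hodge_diff M n f)),
       diff_od = descend (\<lambda>f. hodge_proj M n 0 (hodge_diff M n f))\<rparr>),
     proj_ev = (\<lambda>n. descend (\<lambda>f. hodge_proj M n 0 (hodge_trunc M n f))),
     proj_od = (\<lambda>n. descend (\<lambda>f. hodge_proj M n 1 (hodge_trunc M n f)))\<rparr>"

text \<open>The mixed complex \<open>\<Omega>\<^sup>*(R)\<^sub>\<delta>\<close>.\<close>

definition coinv_forms :: "('h::complex_algebra_1 \<Rightarrow> ('h, 'h) tensor) \<Rightarrow> ('h \<Rightarrow> complex) \<Rightarrow>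
    ('h \<Rightarrow> complex) \<Rightarrow> ('h \<Rightarrow> 'a::complex_algebra \<Rightarrow> 'a) \<Rightarrow> nat \<Rightarrow> 'a forms set" where
  "coinv_forms \<Delta> \<epsilon> \<delta> act n = coinv (forms_act \<Delta> \<epsilon> act) \<delta> (Forms n)"

definition forms_mixed :: "('h::complex_algebra_1 \<Rightarrow> ('h, 'h) tensor) \<Rightarrow> ('h \<Rightarrow> complex) \<Rightarrow>
    ('h \<Rightarrow> complex) \<Rightarrow> ('h \<Rightarrow> 'a::complex_algebra \<Rightarrow> 'a) \<Rightarrow> 'a forms set mixed_complex" where
  "forms_mixed \<Delta> \<epsilon> \<delta> act =
     (let class = (\<lambda>n. coset (cspace_on (Forms n)) (coinv_forms \<Delta> \<epsilon> \<delta> act n)) in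
      \<lparr>mc = (\<lambda>n. quotient (cspace_on (Forms n)) (coinv_forms \<Delta> \<epsilon> \<delta> act n)),
       mc_b = (\<lambda>n. descend (\<lambda>\<omega>. class (n - 1) (forms_b \<omega>))),
       mc_B = (\<lambda>n. descend (\<lambda>\<omega>. class (Suc n) (forms_B \<omega>)))\<rparr>)"

section \<open>The tower \<open>\<X>\<^sub>\<delta>(L, J)\<close>\<close>

fun ideal_pow :: "'l::complex_algebra set \<Rightarrow> nat \<Rightarrow> 'l set" where
  "ideal_pow J 0 = UNIV"
| "ideal_pow J (Suc 0) = J"
| "ideal_pow J (Suc (Suc n)) = cvec.span {x * y | x y. x \<in> ideal_pow J (Suc n) \<and> y \<in> J}"

text \<open>\<open>J\<^sup>n\<close> as a set of coefficients of differentials, where \<open>J\<^sup>0\<close> is the unitization of \<open>L\<close>.\<close>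

definition ideal_coeff :: "'l::complex_algebra set \<Rightarrow> nat \<Rightarrow> 'l adj set" where
  "ideal_coeff J n = (if n = 0 then UNIV else adj_incl ` ideal_pow J n)"

definition one_forms :: "'l::complex_algebra adj set \<Rightarrow> 'l set \<Rightarrow> 'l forms set" where
  "one_forms A C = cvec.span {tword (Snoc (Init x) y) | x y. x \<in> A \<and> y \<in> C}"

text \<open>\<open>Omega1_nat\<close> is \<open>\<Omega>\<^sup>1(L)\<^sub>\<natural>\<^sub>,\<^sub>\<delta>\<close>, and \<open>nat_class\<close> is the projection \<open>\<natural>\<close>.\<close>

definition nat_relations :: "('h::complex_algebra_1 \<Rightarrow> ('h, 'h) tensor) \<Rightarrow> ('h \<Rightarrow> complex) \<Rightarrow>
    ('h \<Rightarrow> complex) \<Rightarrow> ('h \<Rightarrow> 'l::complex_algebra \<Rightarrow> 'l) \<Rightarrow> 'l forms set" where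
  "nat_relations \<Delta> \<epsilon> \<delta> act =
     cvec.span ({forms_comm \<omega> x | \<omega> x. \<omega> \<in> Forms 1} \<union> coinv_forms \<Delta> \<epsilon> \<delta> act 1)"

definition Omega1_nat :: "('h::complex_algebra_1 \<Rightarrow> ('h, 'h) tensor) \<Rightarrow> ('h \<Rightarrow> complex) \<Rightarrow>
    ('h \<Rightarrow> complex) \<Rightarrow> ('h \<Rightarrow> 'l::complex_algebra \<Rightarrow> 'l) \<Rightarrow> 'l forms set cspace" where
  "Omega1_nat \<Delta> \<epsilon> \<delta> act = quotient (cspace_on (Forms 1)) (nat_relations \<Delta> \<epsilon> \<delta> act)"

definition nat_class :: "('h::complex_algebra_1 \<Rightarrow> ('h, 'h) tensor) \<Rightarrow> ('h \<Rightarrow> complex) \<Rightarrow>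
    ('h \<Rightarrow> complex) \<Rightarrow> ('h \<Rightarrow> 'l::complex_algebra \<Rightarrow> 'l) \<Rightarrow> 'l forms \<Rightarrow> 'l forms set" where
  "nat_class \<Delta> \<epsilon> \<delta> act = coset (cspace_on (Forms 1)) (nat_relations \<Delta> \<epsilon> \<delta> act)"

definition X_ev_relations :: "('h \<Rightarrow> complex) \<Rightarrow> ('h \<Rightarrow> 'l::complex_algebra \<Rightarrow> 'l) \<Rightarrow> 'l set \<Rightarrow>
    nat \<Rightarrow> 'l set" where
  "X_ev_relations \<delta> act J m = (let n = m div 2 in
     if odd m then cvec.span (ideal_pow J (Suc n) \<union> coinv act \<delta> UNIV)
     else cvec.span (ideal_pow J (Suc n) \<union> {x * y - y * x | x y. x \<in> ideal_pow J n} \<union>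
       coinv act \<delta> UNIV))"

definition X_od_relations :: "'l::complex_algebra set \<Rightarrow> nat \<Rightarrow> 'l forms set" where
  "X_od_relations J m = (let n = m div 2 in
     if odd m then cvec.span (one_forms (ideal_coeff J (Suc n)) UNIV \<union> one_forms (ideal_coeff J n) J)
     else one_forms (ideal_coeff J n) UNIV)"

text \<open>The map \<open>x dy \<mapsto> [x, y]\<close> from one-forms to \<open>L\<close>.\<close>

primrec word_commutator :: "('l::complex_algebra adj, 'l) word \<Rightarrow> 'l" where
  "word_commutator (Init x) = 0"
| "word_commutator (Snoc w y) =
     (case w of Init x \<Rightarrow> alg_part (x * adj_incl y - adj_incl y * x) | Snoc _ _ \<Rightarrow> 0)"

definition form_commutator :: "'l::complex_algebra forms \<Rightarrow> 'l" where
  "form_commutator \<omega> = tens_lift word_commutator \<omega>"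

definition X_tower :: "('h::complex_algebra_1 \<Rightarrow> ('h, 'h) tensor) \<Rightarrow> ('h \<Rightarrow> complex) \<Rightarrow>
    ('h \<Rightarrow> complex) \<Rightarrow> ('h \<Rightarrow> 'l::complex_algebra \<Rightarrow> 'l) \<Rightarrow> 'l set \<Rightarrow>
    ('l set, 'l forms set set) tower" where
  "X_tower \<Delta> \<epsilon> \<delta> act J =
     (let L = cspace_on UNIV;
          P = X_ev_relations \<delta> act J;
          O1 = Omega1_nat \<Delta> \<epsilon> \<delta> act;
          nat = nat_class \<Delta> \<epsilon> \<delta> act;
          Q = (\<lambda>m. nat ` X_od_relations J m) in
      \<lparr>level = (\<lambda>m. \<lparr>
         ev = quotient L (P m),
         od = quotient O1 (Q m),
         diff_ev = descend (\<lambda>x. coset O1 (Q m) (nat (forms_d (tword (Init (adj_incl x)))))),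
         diff_od = descend (descend (\<lambda>\<omega>. coset L (P m) (form_commutator \<omega>)))\<rparr>),
       proj_ev = (\<lambda>m. descend (coset L (P m))),
       proj_od = (\<lambda>m. descend (coset O1 (Q m)))\<rparr>)"

end

theory Submission
  imports Defs "HOL-Computational_Algebra.Polynomial"
begin

text \<open>Both towers are towers of quotients of one space, the forms on \<open>R\<close>, by the same subspaces
  (coinvariants, forms of large degree or wrong parity, and boundaries in the top degree). For the
  Hodge tower the differential is \<open>b + B\<close>. For \<open>\<X>\<^sub>\<delta>(TR, IR)\<close> one uses the Cuntz-Quillen
  identification of \<open>TR\<close> with even forms under the Fedosov product and of \<open>\<Omega>\<^sup>1(TR)\<close> modulo
  commutators with odd forms; the differential becomes \<open>-(1 + k\<^sup>2 + \<dots> + k\<^bsup>2n-2\<^esup>) b + B\<close> in degree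
  \<open>2n\<close> and \<open>b - (1 + k) d\<close> in odd degrees. The two differentials are compared by maps that are
  polynomials in the Karoubi operator \<open>k\<close> in each degree, and the homotopies are built from \<open>b\<close>, \<open>d\<close>
  and polynomials in \<open>k\<close>, so all of them respect the coinvariants as soon as \<open>b\<close> does. No spectral
  decomposition is needed: the relations \<open>k\<^sup>n b = b\<close> and \<open>k\<^bsup>n+1\<^esup> d = d\<close> on forms of degree \<open>n\<close>
  reduce everything to congruences of polynomials modulo \<open>X\<^sup>n - 1\<close>. The Hopf algebra enters through
  one fact: modulo coinvariants two tensor factors may be exchanged when \<open>S\<^sub>\<delta>\<^sup>2 = 1\<close>.\<close>

section \<open>Linear maps and polynomials in an operator\<close>

text \<open>Between degrees n and n + 1 both b and d see k only modulo X^(n+1) - 1: k^(n+1) fixes b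
  of forms of degree n + 1 and d of forms of degree n. So a map given by a polynomial P_n in each
  degree commutes with b or d, up to prescribed coefficients, as soon as neighbouring P_n satisfy a
  congruence modulo X^(n+1) - 1. Signed products of the polynomials \<open>geom2\<close> turn
  \<open>D_X\<close> into \<open>D_hodge\<close> exactly. They are not invertible, but their values
  at X = 1, namely (-1)^i i!, are, and 1 - X acts as bd + db, so an error divisible by 1 - X is a
  candidate for a null-homotopic map. The obstacle: an inverse that is right at X = 1 leaves an
  error R_n = (1 - X) S_n. Neighbouring R_n are congruent, neighbouring S_n need not be, as division
  by 1 - X weakens the modulus, so d S_n is no homotopy. But R_n S_n and R_(n+1) S_(n+1) are both
  congruent to (1 - X) S_n S_(n+1); hence the squared error is contractible, and the inverse takes
  one Newton step. On the tensor algebra side, one-forms become odd forms by rotating letters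
  cyclically, so equivariance holds only modulo coinvariants.\<close>

lemma clinear_uminus: "clinear f \<Longrightarrow> f (- x) = - f x"
  using clinear_diff[of f 0 x] by (simp add: clinear_zero)

lemma clinear_sum: "clinear f \<Longrightarrow> f (\<Sum>i\<in>I. g i) = (\<Sum>i\<in>I. f (g i))"
  by (induct I rule: infinite_finite_induct) (simp_all add: clinear_zero clinear_add)

lemmas clinear_simps = clinear_add clinear_scale clinear_diff clinear_zero clinear_uminus clinear_sum

lemma clinear_diff_fun: "clinear f \<Longrightarrow> clinear g \<Longrightarrow> clinear (\<lambda>x. f x - g x)"
  unfolding clinear_iff by (simp add: cvec.scale_right_diff_distrib)

lemma clinear_uminus_fun: "clinear f \<Longrightarrow> clinear (\<lambda>x. - f x)"
  unfolding clinear_iff by simp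

lemma clinear_ident: "clinear (\<lambda>x. x)"
  unfolding clinear_iff by simp

lemma clinear_zero_fun: "clinear (\<lambda>x. 0)"
  unfolding clinear_iff by simp

lemma clinear_sum_fun: "(\<And>i. i \<in> I \<Longrightarrow> clinear (f i)) \<Longrightarrow> clinear (\<lambda>x. \<Sum>i\<in>I. f i x)"
  by (induct I rule: infinite_finite_induct) (simp_all add: clinear_zero_fun clinear_add_fun)

lemma clinear_funpow:
  fixes f :: "'a::complex_vector \<Rightarrow> 'a"
  shows "clinear f \<Longrightarrow> clinear (f ^^ n)"
proof (induct n)
  case 0
  then show ?case by (simp add: clinear_iff)
next
  case (Suc n)
  then show ?case using clinear_compose[of f "f ^^ n"] by (simp add: comp_def)
qed

lemma clinear_span_image:
  assumes "clinear f" "\<And>x. x \<in> A \<Longrightarrow> f x \<in> cvec.span B" "x \<in> cvec.span A"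
  shows "f x \<in> cvec.span B"
  using assms(3)
proof (induct rule: cvec.span_induct_alt)
  case base
  then show ?case using assms(1) by (simp add: clinear_zero cvec.span_zero)
next
  case (step c x y)
  then show ?case using assms(1,2)
    by (simp add: clinear_add clinear_scale cvec.span_add cvec.span_scale)
qed

lemma span_subset_span: "A \<subseteq> cvec.span B \<Longrightarrow> cvec.span A \<subseteq> cvec.span B"
  by (simp add: cvec.span_minimal)

lemma subspace_span_le: "x \<in> cvec.span A \<Longrightarrow> (\<And>y. y \<in> A \<Longrightarrow> y \<in> cvec.span B) \<Longrightarrow> x \<in> cvec.span B"
  using span_subset_span[of A B] by blast

section \<open>Polynomials evaluated at an operator\<close>

definition op_poly :: "('v \<Rightarrow> 'v) \<Rightarrow> complex poly \<Rightarrow> 'v::complex_vector \<Rightarrow> 'v" where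
  "op_poly k p v = (\<Sum>i\<le>degree p. coeff p i *\<^sub>C (k ^^ i) v)"

lemma op_poly_ge: "degree p \<le> n \<Longrightarrow> op_poly k p v = (\<Sum>i\<le>n. coeff p i *\<^sub>C (k ^^ i) v)"
  unfolding op_poly_def
  by (rule sum.mono_neutral_left) (auto simp: coeff_eq_0)

lemma op_poly_0 [simp]: "op_poly k 0 v = 0"
  by (simp add: op_poly_def)

lemma op_poly_1 [simp]: "op_poly k 1 v = v"
  by (simp add: op_poly_def scaleC_one)

lemma op_poly_add: "op_poly k (p + q) v = op_poly k p v + op_poly k q v"
proof -
  let ?n = "max (degree p) (degree q)"
  show ?thesis
    using degree_add_le_max[of p q]
    by (simp add: op_poly_ge[of _ ?n] scaleC_add_left sum.distrib)
qed

lemma op_poly_smult: "op_poly k (smult c p) v = c *\<^sub>C op_poly k p v"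
  using degree_smult_le[of c p]
  by (simp add: op_poly_ge[of _ "degree p"] cvec.scale_sum_right scaleC_scaleC)

lemma op_poly_minus: "op_poly k (- p) v = - op_poly k p v"
  using op_poly_smult[of k "-1" p v] by simp

lemma op_poly_diff: "op_poly k (p - q) v = op_poly k p v - op_poly k q v"
  using op_poly_add[of k p "- q" v] by (simp add: op_poly_minus)

lemma op_poly_sum: "op_poly k (\<Sum>i\<in>I. p i) v = (\<Sum>i\<in>I. op_poly k (p i) v)"
  by (induct I rule: infinite_finite_induct) (simp_all add: op_poly_add)

lemma op_poly_monom: "op_poly k (monom c n) v = c *\<^sub>C (k ^^ n) v"
proof -
  have "coeff (monom c n) i *\<^sub>C (k ^^ i) v = (if n = i then c *\<^sub>C (k ^^ i) v else 0)" for i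
    by simp
  then show ?thesis
    by (simp add: op_poly_ge[of _ n] degree_monom_le del: coeff_monom)
qed

lemma clinear_op_poly: "clinear k \<Longrightarrow> clinear (op_poly k p)"
  unfolding op_poly_def[abs_def]
  by (intro clinear_sum_fun clinear_scale_fun clinear_funpow)

lemma op_poly_pCons:
  assumes "clinear k"
  shows "op_poly k (pCons a p) v = a *\<^sub>C v + k (op_poly k p v)"
proof -
  have "op_poly k (pCons a p) v = (\<Sum>i\<le>Suc (degree p). coeff (pCons a p) i *\<^sub>C (k ^^ i) v)"
    by (rule op_poly_ge) (simp add: degree_pCons_le)
  also have "\<dots> = a *\<^sub>C v + (\<Sum>i\<le>degree p. coeff p i *\<^sub>C k ((k ^^ i) v))"
    by (simp add: sum.atMost_Suc_shift del: sum.atMost_Suc)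
  finally show ?thesis
    using assms by (simp add: op_poly_def clinear_sum clinear_scale)
qed

lemma op_poly_mult:
  assumes "clinear k"
  shows "op_poly k (p * q) v = op_poly k p (op_poly k q v)"
proof (induct p)
  case 0
  then show ?case by simp
next
  case (pCons a p)
  then show ?case
    by (simp add: op_poly_add op_poly_smult op_poly_pCons[OF assms])
qed

lemma op_poly_commute:
  assumes "clinear k" "clinear b" "\<And>v. b (k v) = k' (b v)"
  shows "b (op_poly k p v) = op_poly k' p (b v)"
proof -
  have "b ((k ^^ n) v) = (k' ^^ n) (b v)" for n
    by (induct n) (simp_all add: assms(3))
  then show ?thesis
    unfolding op_poly_def by (simp add: clinear_sum[OF assms(2)] clinear_scale[OF assms(2)])
qed

lemma op_poly_closed:
  assumes "\<And>v. v \<in> cvec.span A \<Longrightarrow> k v \<in> cvec.span A" "v \<in> cvec.span A"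
  shows "op_poly k p v \<in> cvec.span A"
proof -
  have "(k ^^ n) v \<in> cvec.span A" for n
    by (induct n) (simp_all add: assms)
  then show ?thesis
    unfolding op_poly_def by (intro cvec.span_sum cvec.span_scale) blast
qed

text \<open>A multiple of X^n - 1 kills every vector fixed by k^n, so on such vectors polynomials in
  k matter only as residue classes. Congruences of polynomials enter the comparison of the two
  towers through this.\<close>

lemma op_poly_cong_dvd:
  assumes "clinear k" "(k ^^ n) v = v" "(monom 1 n - 1) dvd (q - q')"
  shows "op_poly k q v = op_poly k q' v"
proof -
  obtain h where h: "q - q' = (monom 1 n - 1) * h"
    using assms(3) by blast
  have "op_poly k (q - q') v = op_poly k h (op_poly k (monom 1 n - 1) v)"
    unfolding h by (subst mult.commute) (rule op_poly_mult[OF assms(1)])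
  also have "\<dots> = 0"
    using assms(1,2) by (simp add: op_poly_diff op_poly_monom scaleC_one clinear_zero[OF clinear_op_poly])
  finally show ?thesis by (simp add: op_poly_diff)
qed

section \<open>Towers of quotients of one space\<close>

text \<open>\<open>\<pi>\<close> is a linear surjection with kernel \<open>K\<close> from a whole
  type onto the carrier of \<open>W\<close>. With a total map, cosets of cosets and families of
  cosets are all governed by subspaces of one ambient space.\<close>

definition presents :: "('v::complex_vector \<Rightarrow> 'w) \<Rightarrow> 'v set \<Rightarrow> 'w cspace \<Rightarrow> bool" where
  "presents \<pi> K W \<longleftrightarrow> carrier W = range \<pi> \<and> vzero W = \<pi> 0 \<and>
     (\<forall>x y. \<pi> (x + y) = vadd W (\<pi> x) (\<pi> y)) \<and> (\<forall>c x. \<pi> (c *\<^sub>C x) = vscale W c (\<pi> x)) \<and>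
     (\<forall>x y. \<pi> x = \<pi> y \<longleftrightarrow> x - y \<in> K)"

lemma presentsD:
  assumes "presents \<pi> K W"
  shows "carrier W = range \<pi>" "vzero W = \<pi> 0" "vadd W (\<pi> x) (\<pi> y) = \<pi> (x + y)"
    "vscale W c (\<pi> x) = \<pi> (c *\<^sub>C x)" "\<pi> x = \<pi> y \<longleftrightarrow> x - y \<in> K"
  using assms unfolding presents_def by auto

lemma complex_space_presents:
  assumes "presents \<pi> K W"
  shows "complex_space W"
proof -
  note D = presentsD(1-4)[OF assms]
  show ?thesis
  proof
    fix x assume "x \<in> carrier W"
    then obtain a where "x = \<pi> a" by (auto simp: D)
    moreover have "a + (-1) *\<^sub>C a = 0" by simp
    ultimately show "vadd W x (vscale W (- 1) x) = vzero W"
      by (simp only: D)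
  qed (auto simp: D scaleC_add_right scaleC_add_left scaleC_scaleC scaleC_one ac_simps)
qed

lemma presents_id: "presents (\<lambda>x. x) {0} (cspace_on UNIV)"
  by (auto simp: presents_def cspace_on_def)

lemma presents_projection:
  assumes "clinear \<pi>" "\<And>x. \<pi> x = 0 \<longleftrightarrow> x \<in> K"
  shows "presents \<pi> K (cspace_on (range \<pi>))"
  using assms(2)[of "_ - _"]
  by (auto simp: presents_def cspace_on_def clinear_simps[OF assms(1)])

text \<open>A change of ambient space, for which \<open>\<psi>\<close> need only be onto modulo the
  kernel. It later replaces one-forms on the tensor algebra by forms on the algebra itself.\<close>

lemma presents_pullback:
  assumes "presents \<pi> K W" "clinear \<psi>" "\<And>v. \<exists>u. v - \<psi> u \<in> K" "\<And>u. \<psi> u \<in> K \<longleftrightarrow> u \<in> K'"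
  shows "presents (\<lambda>x. \<pi> (\<psi> x)) K' W"
proof -
  have "range \<pi> = range (\<lambda>x. \<pi> (\<psi> x))"
    using assms(3) presentsD(5)[OF assms(1)] by (auto simp: image_iff)
  then show ?thesis
    using assms(4)[of "_ - _"] by (auto simp: presents_def presentsD[OF assms(1)] clinear_simps[OF assms(2)])
qed

text \<open>A full preimage is a union of fibres, and the fibre over \<open>\<rho> 0\<close> is
  \<open>K\<close>.\<close>

lemma subspace_presents_image:
  assumes "presents \<rho> K V" "\<And>x. \<rho> x \<in> N \<longleftrightarrow> x \<in> K'" "cvec.subspace K'"
  shows "K \<subseteq> K'"
proof
  fix x assume "x \<in> K"
  then have "\<rho> x = \<rho> 0"
    by (simp add: presentsD[OF assms(1)])
  then show "x \<in> K'"
    using assms(2)[of x] assms(2)[of 0] cvec.subspace_0[OF assms(3)] by simp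
qed

lemma coset_presents:
  assumes "presents \<rho> K V" "N \<subseteq> carrier V" "\<And>x. \<rho> x \<in> N \<longleftrightarrow> x \<in> K'"
  shows "coset V N (\<rho> x) = \<rho> ` ((+) x ` K')"
proof -
  have "N = \<rho> ` K'"
    using assms(2,3) presentsD(1)[OF assms(1)] by (auto 0 3)
  then show ?thesis
    by (simp add: coset_def image_image presentsD(3)[OF assms(1)])
qed

lemma coset_eq_iff:
  assumes "presents \<rho> K V" "N \<subseteq> carrier V" "\<And>x. \<rho> x \<in> N \<longleftrightarrow> x \<in> K'" "cvec.subspace K'"
  shows "coset V N (\<rho> x) = coset V N (\<rho> y) \<longleftrightarrow> x - y \<in> K'"
proof
  note K = subspace_presents_image[OF assms(1,3,4)]
  note c = coset_presents[OF assms(1-3)]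
  {
    assume "coset V N (\<rho> x) = coset V N (\<rho> y)"
    moreover have "\<rho> x \<in> coset V N (\<rho> x)"
      unfolding c using cvec.subspace_0[OF assms(4)] by (force simp: image_iff)
    ultimately obtain n where "n \<in> K'" "x - (y + n) \<in> K"
      unfolding c by (auto simp: presentsD[OF assms(1)])
    then have "(x - (y + n)) + n \<in> K'"
      using K cvec.subspace_add[OF assms(4)] by blast
    then show "x - y \<in> K'" by (simp add: algebra_simps)
  }
  {
    assume *: "x - y \<in> K'"
    have "(+) x ` K' = (+) y ` K'"
    proof (intro equalityI subsetI)
      fix z assume "z \<in> (+) x ` K'"
      then obtain n where "n \<in> K'" "z = x + n" by blast
      then show "z \<in> (+) y ` K'"
        using cvec.subspace_add[OF assms(4) * \<open>n \<in> K'\<close>] by (auto simp: image_iff algebra_simps intro!: bexI[of _ "x - y + n"])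
    next
      fix z assume "z \<in> (+) y ` K'"
      then obtain n where "n \<in> K'" "z = y + n" by blast
      then show "z \<in> (+) x ` K'"
        using cvec.subspace_diff[OF assms(4) \<open>n \<in> K'\<close> *] by (auto simp: image_iff algebra_simps intro!: bexI[of _ "n - (x - y)"])
    qed
    then show "coset V N (\<rho> x) = coset V N (\<rho> y)"
      by (simp add: c)
  }
qed

text \<open>Third isomorphism theorem: only the full preimage \<open>K'\<close> of \<open>N\<close>
  matters, so iterated quotients collapse to one. The unions in \<open>quotient\<close> run over all
  representatives, and each of them yields the same coset.\<close>

lemma presents_quotient:
  assumes "presents \<rho> K V" "N \<subseteq> carrier V" "\<And>x. \<rho> x \<in> N \<longleftrightarrow> x \<in> K'" "cvec.subspace K'"
  shows "presents (\<lambda>x. coset V N (\<rho> x)) K' (quotient V N)"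
proof -
  note c = coset_presents[OF assms(1-3)]
  note eq = coset_eq_iff[OF assms]
  note D = presentsD(1-4)[OF assms(1)]
  note 0 = cvec.subspace_0[OF assms(4)]
  have add: "vadd (quotient V N) (coset V N (\<rho> x)) (coset V N (\<rho> y)) = coset V N (\<rho> (x + y))" for x y
  proof -
    have "coset V N (\<rho> (x + n + (y + m))) = coset V N (\<rho> (x + y))" if "n \<in> K'" "m \<in> K'" for n m
      unfolding eq using cvec.subspace_add[OF assms(4) that] by (simp add: algebra_simps)
    then have "(\<Union>a\<in>\<rho> ` ((+) x ` K'). \<Union>b\<in>\<rho> ` ((+) y ` K'). coset V N (vadd V a b)) = coset V N (\<rho> (x + y))"
      using 0 by (auto simp: D)
    then show ?thesis by (simp add: quotient_def c)
  qed
  have scale: "vscale (quotient V N) r (coset V N (\<rho> x)) = coset V N (\<rho> (r *\<^sub>C x))" for r x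
  proof -
    have "coset V N (\<rho> (r *\<^sub>C (x + n))) = coset V N (\<rho> (r *\<^sub>C x))" if "n \<in> K'" for n
      unfolding eq using cvec.subspace_scale[OF assms(4) that] by (simp add: scaleC_add_right)
    then have "(\<Union>a\<in>\<rho> ` ((+) x ` K'). coset V N (vscale V r a)) = coset V N (\<rho> (r *\<^sub>C x))"
      using 0 by (auto simp: D)
    then show ?thesis by (simp add: quotient_def c)
  qed
  show ?thesis
    unfolding presents_def using eq
    by (auto simp: add scale) (auto simp: quotient_def D)
qed

text \<open>\<open>the_elem\<close> is meaningful only on a singleton, hence the hypothesis that
  \<open>F\<close> is constant along the coset.\<close>

lemma descend_coset:
  assumes "presents \<rho> K V" "N \<subseteq> carrier V" "\<And>x. \<rho> x \<in> N \<longleftrightarrow> x \<in> K'" "cvec.subspace K'"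
    and "\<And>y. y - x \<in> K' \<Longrightarrow> F (\<rho> y) = F (\<rho> x)"
  shows "descend F (coset V N (\<rho> x)) = F (\<rho> x)"
proof -
  have "F ` coset V N (\<rho> x) = {F (\<rho> x)}"
    unfolding coset_presents[OF assms(1-3)] using assms(5)[of "x + _"] cvec.subspace_0[OF assms(4)]
    by (auto simp: image_iff)
  then show ?thesis by (simp add: descend_def)
qed

text \<open>The representative is arbitrary; the choice is harmless once \<open>F\<close> carries
  one kernel into the other, as in the next lemma.\<close>

definition lift_map :: "('v \<Rightarrow> 'w) \<Rightarrow> ('v2 \<Rightarrow> 'w2) \<Rightarrow> ('v \<Rightarrow> 'v2) \<Rightarrow> 'w \<Rightarrow> 'w2" where
  "lift_map \<pi> \<pi>' F X = \<pi>' (F (SOME x. \<pi> x = X))"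

lemma lift_map:
  assumes "presents \<pi> K W" "presents \<pi>' K' W'" "clinear F" "\<And>x. x \<in> K \<Longrightarrow> F x \<in> K'"
  shows "lift_map \<pi> \<pi>' F (\<pi> x) = \<pi>' (F x)"
proof -
  let ?y = "SOME y. \<pi> y = \<pi> x"
  have "\<pi> ?y = \<pi> x"
    by (rule someI) simp
  then have "F ?y - F x \<in> K'"
    using assms(4) by (simp add: presentsD[OF assms(1)] flip: clinear_diff[OF assms(3)])
  then show ?thesis
    by (simp add: lift_map_def presentsD[OF assms(2)])
qed

lemma linear_map_presents:
  assumes "presents \<pi> K W" "presents \<pi>' K' W'" "clinear F" "\<And>x. f (\<pi> x) = \<pi>' (F x)"
  shows "linear_map W W' f"
  unfolding linear_map_def
  by (auto simp: presentsD[OF assms(1)] presentsD[OF assms(2)] assms(4) clinear_simps[OF assms(3)])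

text \<open>\<open>K m 0\<close> and \<open>K m 1\<close> are the kernels for the even and the odd part of level \<open>m\<close>; the structure maps
  are induced by the identity.\<close>

definition presents_tower :: "('v::complex_vector \<Rightarrow> 'v) \<Rightarrow> (nat \<Rightarrow> nat \<Rightarrow> 'v set) \<Rightarrow>
    (nat \<Rightarrow> 'v \<Rightarrow> 'e) \<Rightarrow> (nat \<Rightarrow> 'v \<Rightarrow> 'o) \<Rightarrow> ('e, 'o) tower \<Rightarrow> bool" where
  "presents_tower D K \<pi>e \<pi>o T \<longleftrightarrow> (\<forall>m.
     presents (\<pi>e m) (K m 0) (ev (level T m)) \<and> presents (\<pi>o m) (K m 1) (od (level T m)) \<and>
     (\<forall>x. diff_ev (level T m) (\<pi>e m x) = \<pi>o m (D x)) \<and>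
     (\<forall>x. diff_od (level T m) (\<pi>o m x) = \<pi>e m (D x)) \<and>
     (\<forall>x. proj_ev T m (\<pi>e (Suc m) x) = \<pi>e m x) \<and>
     (\<forall>x. proj_od T m (\<pi>o (Suc m) x) = \<pi>o m x))"

lemma presents_towerD:
  assumes "presents_tower D K \<pi>e \<pi>o T"
  shows "presents (\<pi>e m) (K m 0) (ev (level T m))" "presents (\<pi>o m) (K m 1) (od (level T m))"
    "diff_ev (level T m) (\<pi>e m x) = \<pi>o m (D x)" "diff_od (level T m) (\<pi>o m x) = \<pi>e m (D x)"
    "proj_ev T m (\<pi>e (Suc m) x) = \<pi>e m x" "proj_od T m (\<pi>o (Suc m) x) = \<pi>o m x"
  using assms unfolding presents_tower_def by auto

lemma is_tower_presents:
  assumes "presents_tower D K \<pi>e \<pi>o T" "clinear D" "\<And>x. D (D x) = 0"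
  shows "is_tower T"
proof -
  note D = presents_towerD[OF assms(1)]
  have 1: "is_super_complex (level T m)" for m
    unfolding is_super_complex_def
    using complex_space_presents[OF D(1)] complex_space_presents[OF D(2)]
      linear_map_presents[OF D(1) D(2) assms(2) D(3)] linear_map_presents[OF D(2) D(1) assms(2) D(4)]
    by (auto simp: presentsD[OF D(1)] presentsD[OF D(2)] D(3-) assms(3))
  have 2: "super_map (level T (Suc m)) (level T m) (proj_ev T m) (proj_od T m)" for m
    unfolding super_map_def
    using linear_map_presents[OF D(1) D(1) clinear_ident D(5)] linear_map_presents[OF D(2) D(2) clinear_ident D(6)]
    by (auto simp: presentsD(1)[OF D(1)] presentsD(1)[OF D(2)] D(3-))
  show ?thesis
    unfolding is_tower_def using 1 2 by blast
qed

lemma tower_map_presents: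
  assumes "presents_tower D K \<pi>e \<pi>o T" "presents_tower D' K \<pi>e' \<pi>o' U"
    and "clinear F" "\<And>m p x. x \<in> K m p \<Longrightarrow> F x \<in> K m p" "\<And>x. F (D x) = D' (F x)"
  shows "tower_map T U (\<lambda>m. lift_map (\<pi>e m) (\<pi>e' m) F) (\<lambda>m. lift_map (\<pi>o m) (\<pi>o' m) F)"
proof -
  note D = presents_towerD[OF assms(1)] and D' = presents_towerD[OF assms(2)]
  have le: "lift_map (\<pi>e m) (\<pi>e' m) F (\<pi>e m x) = \<pi>e' m (F x)"
    and lo: "lift_map (\<pi>o m) (\<pi>o' m) F (\<pi>o m x) = \<pi>o' m (F x)" for m x
    by (rule lift_map[OF D(1) D'(1) assms(3,4)], assumption)
      (rule lift_map[OF D(2) D'(2) assms(3,4)], assumption)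
  have "linear_map (ev (level T m)) (ev (level U m)) (lift_map (\<pi>e m) (\<pi>e' m) F)"
    "linear_map (od (level T m)) (od (level U m)) (lift_map (\<pi>o m) (\<pi>o' m) F)" for m
    by (rule linear_map_presents[OF D(1) D'(1) assms(3) le] linear_map_presents[OF D(2) D'(2) assms(3) lo])+
  then show ?thesis
    unfolding tower_map_def super_map_def
    by (auto simp: presentsD(1)[OF D(1)] presentsD(1)[OF D(2)] D(3-) D'(3-) le lo assms(5))
qed

text \<open>One operator \<open>h\<close> induces the homotopies of all levels and both parities. As
  the structure maps are induced by the identity, compatibility with them is automatic.\<close>

lemma tower_homotopic_presents:
  assumes "presents_tower D K \<pi>e \<pi>o T"
    and "clinear h" "\<And>m x. x \<in> K m 0 \<Longrightarrow> h x \<in> K m 1" "\<And>m x. x \<in> K m 1 \<Longrightarrow> h x \<in> K m 0"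
    and "\<And>x. F x = x + (D (h x) + h (D x))"
    and "\<And>m x. fe m (\<pi>e m x) = \<pi>e m (F x)" "\<And>m x. fo m (\<pi>o m x) = \<pi>o m (F x)"
  shows "tower_homotopic T T fe fo (\<lambda>m x. x) (\<lambda>m x. x)"
proof -
  note D = presents_towerD[OF assms(1)]
  have le: "lift_map (\<pi>e m) (\<pi>o m) h (\<pi>e m x) = \<pi>o m (h x)"
    and lo: "lift_map (\<pi>o m) (\<pi>e m) h (\<pi>o m x) = \<pi>e m (h x)" for m x
    by (rule lift_map[OF D(1) D(2) assms(2,3)], assumption)
      (rule lift_map[OF D(2) D(1) assms(2,4)], assumption)
  show ?thesis
    unfolding tower_homotopic_def
    by (intro exI[of _ "\<lambda>m. lift_map (\<pi>e m) (\<pi>o m) h"] exI[of _ "\<lambda>m. lift_map (\<pi>o m) (\<pi>e m) h"] allI conjI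
        linear_map_presents[OF D(1) D(2) assms(2) le] linear_map_presents[OF D(2) D(1) assms(2) lo])
      (auto simp: presentsD(1,3)[OF D(1)] presentsD(1,3)[OF D(2)]
        D(3-) le lo assms(5-))
qed

text \<open>Reduces the problem to operators on one vector space: the two towers share the kernels
  \<open>K m p\<close>, so intertwining maps and homotopies that respect these kernels are all that
  has to be found.\<close>

theorem tower_homotopy_equivalent_presents:
  assumes T: "presents_tower D K \<pi>e \<pi>o T" and U: "presents_tower D' K \<pi>e' \<pi>o' U"
    and D: "clinear D" "\<And>x. D (D x) = 0" and D': "clinear D'" "\<And>x. D' (D' x) = 0"
    and F: "clinear F" "\<And>m p x. x \<in> K m p \<Longrightarrow> F x \<in> K m p" "\<And>x. F (D x) = D' (F x)"
    and G: "clinear G" "\<And>m p x. x \<in> K m p \<Longrightarrow> G x \<in> K m p" "\<And>x. G (D' x) = D (G x)"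
    and h: "clinear h" "\<And>m x. x \<in> K m 0 \<Longrightarrow> h x \<in> K m 1" "\<And>m x. x \<in> K m 1 \<Longrightarrow> h x \<in> K m 0"
      "\<And>x. G (F x) = x + (D (h x) + h (D x))"
    and h': "clinear h'" "\<And>m x. x \<in> K m 0 \<Longrightarrow> h' x \<in> K m 1" "\<And>m x. x \<in> K m 1 \<Longrightarrow> h' x \<in> K m 0"
      "\<And>x. F (G x) = x + (D' (h' x) + h' (D' x))"
  shows "tower_homotopy_equivalent T U"
proof -
  note PT = presents_towerD[OF T] and PU = presents_towerD[OF U]
  have l: "lift_map (\<pi>e m) (\<pi>e' m) F (\<pi>e m x) = \<pi>e' m (F x)"
    "lift_map (\<pi>o m) (\<pi>o' m) F (\<pi>o m x) = \<pi>o' m (F x)"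
    "lift_map (\<pi>e' m) (\<pi>e m) G (\<pi>e' m x) = \<pi>e m (G x)"
    "lift_map (\<pi>o' m) (\<pi>o m) G (\<pi>o' m x) = \<pi>o m (G x)" for m x
    by (rule lift_map[OF PT(1) PU(1) F(1,2)] lift_map[OF PT(2) PU(2) F(1,2)]
        lift_map[OF PU(1) PT(1) G(1,2)] lift_map[OF PU(2) PT(2) G(1,2)], assumption)+
  have "tower_homotopic T T
      (\<lambda>m x. lift_map (\<pi>e' m) (\<pi>e m) G (lift_map (\<pi>e m) (\<pi>e' m) F x))
      (\<lambda>m x. lift_map (\<pi>o' m) (\<pi>o m) G (lift_map (\<pi>o m) (\<pi>o' m) F x)) (\<lambda>m x. x) (\<lambda>m x. x)"
    by (rule tower_homotopic_presents[OF T h]) (simp_all add: l)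
  moreover have "tower_homotopic U U
      (\<lambda>m x. lift_map (\<pi>e m) (\<pi>e' m) F (lift_map (\<pi>e' m) (\<pi>e m) G x))
      (\<lambda>m x. lift_map (\<pi>o m) (\<pi>o' m) F (lift_map (\<pi>o' m) (\<pi>o m) G x)) (\<lambda>m x. x) (\<lambda>m x. x)"
    by (rule tower_homotopic_presents[OF U h']) (simp_all add: l)
  ultimately show ?thesis
    unfolding tower_homotopy_equivalent_def
    using is_tower_presents[OF T D] is_tower_presents[OF U D']
      tower_map_presents[OF T U F] tower_map_presents[OF U T G] by blast
qed

lemma clinear_comp: "clinear g \<Longrightarrow> clinear f \<Longrightarrow> clinear (\<lambda>x. f (g x))"
  by (rule clinear_compose)

section \<open>Tensor words\<close>

lemma word_add_deg: "word_add u v w \<Longrightarrow> word_deg u = word_deg w \<and> word_deg v = word_deg w"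
  by (induct rule: word_add.induct) auto

lemma word_scale_deg: "word_scale c u w \<Longrightarrow> word_deg u = word_deg w"
  by (induct rule: word_scale.induct) auto

text \<open>The parameter \<open>p\<close> serves recursions that change an argument while
  descending the word, such as the multiplier in \<open>word_rmul\<close> or the Hopf algebra
  element in \<open>diag_word\<close>; the hypothesis on the shorter word is then available for
  every \<open>p\<close>.\<close>

lemma multilinear_wordI:
  assumes "\<And>p. clinear (\<lambda>x. f p (Init x))" "\<And>p w. clinear (\<lambda>a. f p (Snoc w a))"
    and "\<And>p u v w a. word_add u v w \<Longrightarrow> (\<And>p. f p w = f p u + f p v) \<Longrightarrow>
      f p (Snoc w a) = f p (Snoc u a) + f p (Snoc v a)"
    and "\<And>p c u w a. word_scale c u w \<Longrightarrow> (\<And>p. f p w = c *\<^sub>C f p u) \<Longrightarrow>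
      f p (Snoc w a) = c *\<^sub>C f p (Snoc u a)"
  shows "multilinear_word (f p)"
proof -
  have "f p w = f p u + f p v" if "word_add u v w" for u v w p
    using that
    by (induct arbitrary: p rule: word_add.induct)
      (simp_all add: clinear_add[OF assms(1)] clinear_add[OF assms(2)] assms(3))
  moreover have "f p w = c *\<^sub>C f p u" if "word_scale c u w" for c u w p
    using that
    by (induct arbitrary: p rule: word_scale.induct)
      (simp_all add: clinear_scale[OF assms(1)] clinear_scale[OF assms(2)] assms(4))
  ultimately show ?thesis
    unfolding multilinear_word_def by blast
qed

lemma tword_add: "word_add u v w \<Longrightarrow> tword w = tword u + tword v"
  and tword_scale: "word_scale c u w \<Longrightarrow> tword w = c *\<^sub>C tword u"
  using multilinear_tword unfolding multilinear_word_def by blast+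

lemma multilinear_Snoc: "multilinear_word (\<lambda>w. tword (Snoc w a))"
  unfolding multilinear_word_def
  by (auto intro: tword_add tword_scale word_add.intros word_scale.intros)

lemma clinear_snoc: "clinear (\<lambda>t. tens_snoc t a)"
  unfolding tens_snoc_def by (rule clinear_tens_lift[OF multilinear_Snoc])

lemma snoc_tword: "tens_snoc (tword w) a = tword (Snoc w a)"
  by (simp add: tens_snoc_def tens_lift_tword[OF multilinear_Snoc])

lemma clinear_tword_Init: "clinear (\<lambda>x. tword (Init x))"
  unfolding clinear_iff by (auto intro: tword_add tword_scale word_add.intros word_scale.intros)

lemma clinear_tword_Snoc: "clinear (\<lambda>a. tword (Snoc w a))"
  unfolding clinear_iff by (auto intro: tword_add tword_scale word_add.intros word_scale.intros)

lemma clinear_snoc_right: "clinear (\<lambda>a. tens_snoc t a)"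
  unfolding clinear_iff
proof (intro conjI allI)
  note l = clinear_snoc and r = clinear_tword_Snoc
  fix a b c
  show "tens_snoc t (a + b) = tens_snoc t a + tens_snoc t b"
    by (rule clinear_eq_on_tword[OF l clinear_add_fun[OF l l]]) (simp add: snoc_tword clinear_add[OF r])
  show "tens_snoc t (c *\<^sub>C a) = c *\<^sub>C tens_snoc t a"
    by (rule clinear_eq_on_tword[OF l clinear_scale_fun[OF l]]) (simp add: snoc_tword clinear_scale[OF r])
qed

lemmas snoc_simps = clinear_simps[OF clinear_snoc] clinear_simps[OF clinear_snoc_right]

abbreviation tens_init :: "'x::complex_vector \<Rightarrow> ('x, 'a::complex_vector) tens" where
  "tens_init x \<equiv> tword (Init x)"

lemma tens_init_0 [simp]: "tens_init 0 = 0"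
  by (rule clinear_zero[OF clinear_tword_Init])

lemma tens_induct:
  assumes "clinear f" "clinear g" "\<And>x. f (tens_init x) = g (tens_init x)"
    and "\<And>w a. f (tword w) = g (tword w) \<Longrightarrow> f (tens_snoc (tword w) a) = g (tens_snoc (tword w) a)"
  shows "f t = g t"
proof (rule clinear_eq_on_tword[OF assms(1,2)])
  show "f (tword w) = g (tword w)" for w
    by (induct w) (use assms(3,4) in \<open>auto simp: snoc_tword\<close>)
qed

text \<open>For forms this differs from \<open>Forms\<close> only in degree zero, where the adjoined
  unit is kept so that the operators need no case distinction. The unit is divided out later, as
  part of the kernels.\<close>

definition homog :: "nat \<Rightarrow> ('x::complex_vector, 'a::complex_vector) tens set" where
  "homog n = cvec.span (tword ` {w. word_deg w = n})"

lemma tword_homog: "tword w \<in> homog (word_deg w)"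
  unfolding homog_def by (rule cvec.span_base) auto

lemma subspace_homog: "cvec.subspace (homog n)"
  by (simp add: homog_def)

lemmas homog_simps = cvec.subspace_0[OF subspace_homog] cvec.subspace_add[OF subspace_homog]
  cvec.subspace_diff[OF subspace_homog] cvec.subspace_neg[OF subspace_homog]
  cvec.subspace_scale[OF subspace_homog] cvec.subspace_sum[OF subspace_homog]

lemma homog_map:
  assumes "clinear f" "\<And>w. word_deg w = n \<Longrightarrow> f (tword w) \<in> homog m" "t \<in> homog n"
  shows "f t \<in> homog m"
  using clinear_span_image[OF assms(1), of "tword ` {w. word_deg w = n}"] assms(2,3)
  unfolding homog_def by auto

lemma homog_eq:
  assumes "clinear f" "clinear g" "\<And>w. word_deg w = n \<Longrightarrow> f (tword w) = g (tword w)" "t \<in> homog n"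
  shows "f t = g t"
  using clinear_eq_on_span[OF assms(1,2), of "tword ` {w. word_deg w = n}"] assms(3,4)
  unfolding homog_def by auto

lemma snoc_homog: "t \<in> homog n \<Longrightarrow> tens_snoc t a \<in> homog (Suc n)"
  using homog_map[OF clinear_snoc, of n a "Suc n" t] tword_homog[of "Snoc _ a"] by (auto simp: snoc_tword)

lemma init_homog: "tens_init x \<in> homog 0"
  using tword_homog[of "Init x"] by simp

section \<open>The operators on forms\<close>

lemma scalar_part_simps [simp]:
  "scalar_part (x + y) = scalar_part x + scalar_part y" "scalar_part (x - y) = scalar_part x - scalar_part y"
  "scalar_part (- x) = - scalar_part x" "scalar_part (c *\<^sub>C x) = c * scalar_part x"
  "scalar_part (x * y) = scalar_part x * scalar_part y" "scalar_part 0 = 0" "scalar_part 1 = 1"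
  "scalar_part (adj_incl a) = 0"
  by (simp_all add: plus_adj_def minus_adj_def uminus_adj_def scaleC_adj_def times_adj_def zero_adj_def
      one_adj_def adj_incl_def)

lemma alg_part_simps [simp]:
  "alg_part (x + y) = alg_part x + alg_part y" "alg_part (x - y) = alg_part x - alg_part y"
  "alg_part (- x) = - alg_part x" "alg_part (c *\<^sub>C x) = c *\<^sub>C alg_part x"
  "alg_part (x * y) = scalar_part x *\<^sub>C alg_part y + scalar_part y *\<^sub>C alg_part x + alg_part x * alg_part y"
  "alg_part 0 = 0" "alg_part 1 = 0" "alg_part (adj_incl a) = a"
  by (simp_all add: plus_adj_def minus_adj_def uminus_adj_def scaleC_adj_def times_adj_def zero_adj_def
      one_adj_def adj_incl_def)

lemma adj_eqI: "scalar_part x = scalar_part y \<Longrightarrow> alg_part x = alg_part y \<Longrightarrow> x = y"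
  by (cases x; cases y) auto

lemma clinear_alg_part: "clinear alg_part"
  by (simp add: clinear_iff)

lemma clinear_adj_incl: "clinear adj_incl"
  by (auto simp: clinear_iff intro: adj_eqI)

lemma adj_incl_mult: "adj_incl (a * b) = adj_incl a * adj_incl b"
  by (auto intro: adj_eqI)

lemma adj_decompose: "x = scalar_part x *\<^sub>C 1 + adj_incl (alg_part x)"
  by (rule adj_eqI) simp_all

lemma tens_init_decompose:
  "tens_init x = scalar_part x *\<^sub>C tens_init 1 + tens_init (adj_incl (alg_part x))"
  using arg_cong[OF adj_decompose[of x], of tens_init]
  by (simp only: clinear_add[OF clinear_tword_Init] clinear_scale[OF clinear_tword_Init])

lemma clinear_mult_left: "clinear (\<lambda>x::'a::complex_algebra. x * y)"
  by (simp add: clinear_iff distrib_right mult_scaleC_left)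

lemma clinear_mult_right: "clinear (\<lambda>x::'a::complex_algebra. y * x)"
  by (simp add: clinear_iff distrib_left mult_scaleC_right)

lemma multilinear_word_lmul: "multilinear_word (\<lambda>w. tword (word_lmul x w))"
  by (rule multilinear_wordI[where f = "\<lambda>_::unit. \<lambda>w. tword (word_lmul x w)"])
    (simp_all add: clinear_snoc_right clinear_comp[OF clinear_mult_right clinear_tword_Init]
      snoc_simps flip: snoc_tword)

lemma clinear_lmul: "clinear (forms_lmul a)"
  unfolding forms_lmul_def by (rule clinear_tens_lift[OF multilinear_word_lmul])

lemma lmul_init: "forms_lmul a (tens_init x) = tens_init (adj_incl a * x)"
  by (simp add: forms_lmul_def tens_lift_tword[OF multilinear_word_lmul])

lemma lmul_snoc: "forms_lmul a (tens_snoc t b) = tens_snoc (forms_lmul a t) b"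
  by (rule clinear_eq_on_tword[OF clinear_comp[OF clinear_snoc clinear_lmul] clinear_comp[OF clinear_lmul clinear_snoc]])
    (simp add: forms_lmul_def tens_lift_tword[OF multilinear_word_lmul] snoc_tword)

lemma clinear_lmul_right: "clinear (\<lambda>a. forms_lmul a t)"
  unfolding clinear_iff
proof (intro conjI allI)
  fix a b c
  show "forms_lmul (a + b) t = forms_lmul a t + forms_lmul b t"
    by (rule tens_induct[OF clinear_lmul clinear_add_fun[OF clinear_lmul clinear_lmul]])
      (simp_all add: lmul_init lmul_snoc snoc_simps clinear_simps[OF clinear_adj_incl] distrib_right
        clinear_simps[OF clinear_tword_Init])
  show "forms_lmul (c *\<^sub>C a) t = c *\<^sub>C forms_lmul a t"
    by (rule tens_induct[OF clinear_lmul clinear_scale_fun[OF clinear_lmul]])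
      (simp_all add: lmul_init lmul_snoc snoc_simps clinear_simps[OF clinear_adj_incl] mult_scaleC_left
        clinear_simps[OF clinear_tword_Init])
qed

lemma clinear_word_rmul: "clinear (word_rmul w)"
proof (induct w)
  case (Init x)
  show ?case
    using clinear_comp[OF clinear_comp[OF clinear_adj_incl clinear_mult_right] clinear_tword_Init] by simp
next
  case (Snoc w b)
  then show ?case
    using clinear_diff_fun[OF clinear_comp[OF clinear_mult_right clinear_tword_Snoc] clinear_snoc_right] by simp
qed

lemma multilinear_word_rmul: "multilinear_word (\<lambda>w. word_rmul w b)"
proof (rule multilinear_wordI[where f = "\<lambda>b w. word_rmul w b"])
  show "clinear (\<lambda>x. word_rmul (Init x) p)" for p :: 'a
    by (simp add: clinear_comp[OF clinear_mult_left clinear_tword_Init])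
  show "clinear (\<lambda>a. word_rmul (Snoc w a) p)" for p :: 'a and w
    by (simp, intro clinear_diff_fun clinear_comp[OF clinear_mult_left clinear_tword_Snoc]
        clinear_comp[OF clinear_word_rmul clinear_snoc])
qed (simp_all add: snoc_simps algebra_simps cvec.scale_right_diff_distrib flip: snoc_tword,
    simp_all add: tword_add tword_scale snoc_simps)

lemma clinear_rmul: "clinear (\<lambda>t. forms_rmul t a)"
  unfolding forms_rmul_def by (rule clinear_tens_lift[OF multilinear_word_rmul])

lemma rmul_tword: "forms_rmul (tword w) a = word_rmul w a"
  by (simp add: forms_rmul_def tens_lift_tword[OF multilinear_word_rmul])

lemma rmul_init: "forms_rmul (tens_init x) a = tens_init (x * adj_incl a)"
  by (simp add: rmul_tword)

lemma clinear_rmul_right: "clinear (forms_rmul t)"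
  unfolding clinear_iff
proof (intro conjI allI)
  fix a b c
  show "forms_rmul t (a + b) = forms_rmul t a + forms_rmul t b"
    by (rule clinear_eq_on_tword[OF clinear_rmul clinear_add_fun[OF clinear_rmul clinear_rmul]])
      (simp add: rmul_tword clinear_add[OF clinear_word_rmul])
  show "forms_rmul t (c *\<^sub>C a) = c *\<^sub>C forms_rmul t a"
    by (rule clinear_eq_on_tword[OF clinear_rmul clinear_scale_fun[OF clinear_rmul]])
      (simp add: rmul_tword clinear_scale[OF clinear_word_rmul])
qed

lemma rmul_snoc: "forms_rmul (tens_snoc t a) b = tens_snoc t (a * b) - tens_snoc (forms_rmul t a) b"
  by (rule clinear_eq_on_tword[OF clinear_comp[OF clinear_snoc clinear_rmul]
        clinear_diff_fun[OF clinear_snoc clinear_comp[OF clinear_rmul clinear_snoc]]])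
    (simp add: snoc_tword rmul_tword)

lemma multilinear_word_d: "multilinear_word (\<lambda>w. tword (word_d w))"
  by (rule multilinear_wordI[where f = "\<lambda>_::unit. \<lambda>w. tword (word_d w)"])
    (simp_all add: clinear_snoc_right clinear_comp[OF clinear_alg_part clinear_snoc_right]
      snoc_simps flip: snoc_tword)

lemma clinear_d: "clinear forms_d"
  unfolding forms_d_def by (rule clinear_tens_lift[OF multilinear_word_d])

lemma d_init: "forms_d (tens_init x) = tens_snoc (tens_init 1) (alg_part x)"
  by (simp add: forms_d_def tens_lift_tword[OF multilinear_word_d] snoc_tword)

lemma d_snoc: "forms_d (tens_snoc t a) = tens_snoc (forms_d t) a"
  by (rule clinear_eq_on_tword[OF clinear_comp[OF clinear_snoc clinear_d] clinear_comp[OF clinear_d clinear_snoc]])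
    (simp add: forms_d_def tens_lift_tword[OF multilinear_word_d] snoc_tword)

lemmas forms_linear = clinear_simps[OF clinear_lmul] clinear_simps[OF clinear_lmul_right]
  clinear_simps[OF clinear_rmul] clinear_simps[OF clinear_rmul_right] clinear_simps[OF clinear_d] snoc_simps

lemma lmul_homog: "t \<in> homog n \<Longrightarrow> forms_lmul a t \<in> homog n"
proof (rule homog_map[OF clinear_lmul])
  show "forms_lmul a (tword w) \<in> homog n" if "word_deg w = n" for w :: "('a adj, 'a) word" and n
    using that by (induct w arbitrary: n) (auto simp: lmul_init lmul_snoc init_homog snoc_homog simp flip: snoc_tword)
qed

lemma rmul_homog: "t \<in> homog n \<Longrightarrow> forms_rmul t a \<in> homog n"
proof (rule homog_map[OF clinear_rmul])
  show "forms_rmul (tword w) a \<in> homog n" if "word_deg w = n" for w :: "('a adj, 'a) word" and n a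
    using that
  proof (induct w arbitrary: n a)
    case (Snoc w b)
    then show ?case
      using snoc_homog[OF tword_homog[of w]]
      by (auto simp: rmul_snoc snoc_homog homog_simps simp flip: snoc_tword)
  qed (auto simp: rmul_init init_homog)
qed

lemma d_homog: "t \<in> homog n \<Longrightarrow> forms_d t \<in> homog (Suc n)"
proof (rule homog_map[OF clinear_d])
  show "forms_d (tword w) \<in> homog (Suc n)" if "word_deg w = n" for w :: "('a adj, 'a) word" and n
    using that by (induct w arbitrary: n) (auto simp: d_init d_snoc init_homog snoc_homog simp flip: snoc_tword)
qed

lemma rmul_lmul: "forms_rmul (forms_lmul a t) b = forms_lmul a (forms_rmul t b)"
proof -
  have "\<forall>b. forms_rmul (forms_lmul a (tword w)) b = forms_lmul a (forms_rmul (tword w) b)" for w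
    by (induct w) (simp_all add: lmul_init rmul_init lmul_snoc rmul_snoc forms_linear mult.assoc flip: snoc_tword)
  with clinear_eq_on_tword[OF clinear_comp[OF clinear_lmul clinear_rmul] clinear_comp[OF clinear_rmul clinear_lmul]]
  show ?thesis by blast
qed

lemma rmul_rmul: "forms_rmul (forms_rmul t a) b = forms_rmul t (a * b)"
proof -
  have "\<forall>a b. forms_rmul (forms_rmul (tword w) a) b = forms_rmul (tword w) (a * b)" for w :: "('a adj, 'a) word"
    by (induct w) (simp_all add: rmul_init rmul_snoc forms_linear mult.assoc adj_incl_mult flip: snoc_tword)
  with clinear_eq_on_tword[OF clinear_comp[OF clinear_rmul clinear_rmul] clinear_rmul]
  show ?thesis by blast
qed

lemma lmul_lmul: "forms_lmul a (forms_lmul b t) = forms_lmul (a * b) t"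
  by (rule tens_induct[OF clinear_comp[OF clinear_lmul clinear_lmul] clinear_lmul])
    (simp_all add: lmul_init lmul_snoc adj_incl_mult mult.assoc)

lemma d_d: "forms_d (forms_d t) = 0"
  by (rule tens_induct[OF clinear_comp[OF clinear_d clinear_d] clinear_zero_fun])
    (simp_all add: d_init d_snoc forms_linear)

lemma d_rmul_tword: "forms_d (forms_rmul (tword w) a) =
    forms_rmul (forms_d (tword w)) a + (-1) ^ word_deg w *\<^sub>C tens_snoc (tword w) a"
proof (induct w arbitrary: a)
  case (Init x)
  \<comment> \<open>The scalar part has to be split off: d kills it, but it survives in
    \<open>tens_snoc (tens_init x) a\<close>.\<close>
  have "tens_init x = scalar_part x *\<^sub>C tens_init 1 + tens_init (adj_incl (alg_part x))"
    by (rule tens_init_decompose)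
  then have "tens_snoc (tens_init x) a = scalar_part x *\<^sub>C tens_snoc (tens_init 1) a +
      tens_snoc (tens_init (adj_incl (alg_part x))) a"
    by (metis snoc_simps(1,2))
  then show ?case
    by (simp add: rmul_init d_init rmul_snoc forms_linear scaleC_one)
next
  case (Snoc w b)
  then show ?case
    by (simp add: rmul_snoc d_snoc forms_linear flip: snoc_tword)
qed

lemma d_rmul:
  assumes "t \<in> homog n"
  shows "forms_d (forms_rmul t a) = forms_rmul (forms_d t) a + (-1) ^ n *\<^sub>C tens_snoc t a"
  by (rule homog_eq[OF clinear_comp[OF clinear_rmul clinear_d]
        clinear_add_fun[OF clinear_comp[OF clinear_d clinear_rmul] clinear_scale_fun[OF clinear_snoc]] _ assms])
    (auto simp: d_rmul_tword)

text \<open>This is the product da t. Only the bimodule structure on forms is defined, so the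
  product is read off from the Leibniz rule for d(a t).\<close>

definition dmul :: "'a::complex_algebra \<Rightarrow> 'a forms \<Rightarrow> 'a forms" where
  "dmul a t = forms_d (forms_lmul a t) - forms_lmul a (forms_d t)"

lemma clinear_dmul: "clinear (dmul a)"
  unfolding dmul_def
  by (intro clinear_diff_fun clinear_comp[OF clinear_lmul clinear_d] clinear_comp[OF clinear_d clinear_lmul])

lemma dmul_homog: "t \<in> homog n \<Longrightarrow> dmul a t \<in> homog (Suc n)"
  by (simp add: dmul_def lmul_homog d_homog homog_simps)

lemma dmul_snoc: "dmul a (tens_snoc t b) = tens_snoc (dmul a t) b"
  by (simp add: dmul_def lmul_snoc d_snoc forms_linear)

lemma dmul_init_1: "dmul a (tens_init 1) = tens_snoc (tens_init 1) a"
  by (simp add: dmul_def lmul_init d_init forms_linear)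

text \<open>The Leibniz rule applied to t b and to (a t) b produces the extra term a t db twice,
  with opposite signs.\<close>

lemma rmul_dmul: "forms_rmul (dmul a t) b = dmul a (forms_rmul t b)"
proof (rule clinear_eq_on_tword[OF clinear_comp[OF clinear_dmul clinear_rmul] clinear_comp[OF clinear_rmul clinear_dmul]])
  fix w :: "('a adj, 'a) word"
  show "forms_rmul (dmul a (tword w)) b = dmul a (forms_rmul (tword w) b)"
    using d_rmul[OF tword_homog[of w], of b] d_rmul[OF lmul_homog[OF tword_homog[of w]], of a b]
    by (simp add: dmul_def forms_linear rmul_lmul lmul_snoc flip: rmul_lmul)
qed

lemma dmul_d: "dmul a (forms_d t) = - forms_d (dmul a t)"
  by (simp add: dmul_def forms_linear d_d)

lemma dmul_lmul: "dmul a (forms_lmul b t) = dmul (a * b) t - forms_lmul a (dmul b t)"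
  by (simp add: dmul_def forms_linear lmul_lmul)

lemma d_lmul: "forms_d (forms_lmul a t) = dmul a t + forms_lmul a (forms_d t)"
  by (simp add: dmul_def)

section \<open>The Hochschild boundary\<close>

lemma clinear_comm: "clinear (\<lambda>t. forms_comm t a)"
  unfolding forms_comm_def by (intro clinear_diff_fun clinear_rmul clinear_lmul)

lemma clinear_comm_right: "clinear (forms_comm t)"
  unfolding forms_comm_def by (intro clinear_diff_fun clinear_rmul_right clinear_lmul_right)

lemma comm_homog: "t \<in> homog n \<Longrightarrow> forms_comm t a \<in> homog n"
  by (simp add: forms_comm_def lmul_homog rmul_homog homog_simps)

lemma multilinear_word_b: "multilinear_word word_b"
proof (rule multilinear_wordI[where f = "\<lambda>_::unit. word_b"])
  show "clinear (\<lambda>a. word_b (Snoc w a))" for w :: "('a adj, 'a) word"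
    using clinear_scale_fun[OF clinear_comm_right[of "tword w"], of "(-1) ^ word_deg w"] by simp
qed (auto simp: clinear_zero_fun tword_add tword_scale clinear_simps[OF clinear_comm] scaleC_add_right
    scaleC_scaleC mult.commute dest: word_add_deg word_scale_deg)

lemma clinear_b: "clinear forms_b"
  unfolding forms_b_def[abs_def] by (rule clinear_tens_lift[OF multilinear_word_b])

lemma b_init: "forms_b (tens_init x) = 0"
  by (simp add: forms_b_def tens_lift_tword[OF multilinear_word_b])

lemma b_snoc: "t \<in> homog n \<Longrightarrow> forms_b (tens_snoc t a) = (-1) ^ n *\<^sub>C (forms_rmul t a - forms_lmul a t)"
  by (rule homog_eq[OF clinear_comp[OF clinear_snoc clinear_b]
        clinear_scale_fun[OF clinear_diff_fun[OF clinear_rmul clinear_lmul]]])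
    (auto simp: forms_b_def tens_lift_tword[OF multilinear_word_b] snoc_tword forms_comm_def)

lemma b_homog: "t \<in> homog (Suc n) \<Longrightarrow> forms_b t \<in> homog n"
proof (rule homog_map[OF clinear_b])
  show "forms_b (tword w) \<in> homog n" if "word_deg w = Suc n" for w :: "('a adj, 'a) word"
    using that by (cases w) (auto simp: b_snoc[OF tword_homog] homog_simps lmul_homog rmul_homog tword_homog
        simp flip: snoc_tword)
qed

lemma b_homog_0: "t \<in> homog 0 \<Longrightarrow> forms_b t = 0"
proof (rule homog_eq[OF clinear_b clinear_zero_fun])
  show "forms_b (tword w) = 0" if "word_deg w = 0" for w :: "('a adj, 'a) word"
    using that by (cases w) (auto simp: b_init)
qed

lemma b_b: "forms_b (forms_b t) = 0"
proof (rule clinear_eq_on_tword[OF clinear_comp[OF clinear_b clinear_b] clinear_zero_fun])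
  fix w :: "('a adj, 'a) word"
  show "forms_b (forms_b (tword w)) = 0"
  proof (cases w)
    case (Init x)
    then show ?thesis by (simp add: b_init clinear_zero[OF clinear_b])
  next
    case w: (Snoc v a)
    show ?thesis
    proof (cases v)
      case (Init x)
      then show ?thesis
        using b_homog_0[OF b_homog[of "tword w" 0]] tword_homog[of w] w by simp
    next
      case (Snoc u c)
      note u = tword_homog[of u]
      \<comment> \<open>Up to sign this is [u, ca] - [uc, a] - [au, c], whose six terms
        cancel.\<close>
      have "forms_b (forms_rmul (tword v) a - forms_lmul a (tword v)) = 0"
        unfolding Snoc snoc_tword[symmetric]
        by (simp add: rmul_snoc lmul_snoc clinear_simps[OF clinear_b] b_snoc[OF u] b_snoc[OF lmul_homog[OF u]]
            b_snoc[OF rmul_homog[OF u]] rmul_rmul lmul_lmul rmul_lmul cvec.scale_right_diff_distrib)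
      then show ?thesis
        unfolding w snoc_tword[symmetric] b_snoc[OF tword_homog]
        by (simp add: clinear_simps[OF clinear_b])
    qed
  qed
qed

section \<open>The Karoubi operator and its relations\<close>

lemma clinear_k: "clinear forms_k"
  unfolding forms_k_def[abs_def]
  by (intro clinear_diff_fun clinear_add_fun clinear_ident clinear_comp[OF clinear_b clinear_d]
      clinear_comp[OF clinear_d clinear_b])

lemma k_d: "forms_k (forms_d t) = forms_d (forms_k t)"
  by (simp add: forms_k_def forms_linear d_d clinear_simps[OF clinear_b])

lemma k_b: "forms_k (forms_b t) = forms_b (forms_k t)"
  by (simp add: forms_k_def forms_linear b_b clinear_simps[OF clinear_b])

text \<open>In bd + db the commutators of dt with a cancel; from the Leibniz terms of d(ta - at)
  there remain t da and -(-1)^n da t.\<close>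

lemma k_snoc: "t \<in> homog n \<Longrightarrow> forms_k (tens_snoc t a) = (-1) ^ n *\<^sub>C dmul a t"
proof -
  assume t: "t \<in> homog n"
  have "((-1) ^ n * (-1) ^ n :: complex) = 1"
    by (simp flip: power_mult_distrib)
  then show ?thesis
    by (simp add: forms_k_def d_snoc b_snoc[OF t] b_snoc[OF d_homog[OF t]] forms_linear d_rmul[OF t] d_lmul
      scaleC_scaleC scaleC_add_right cvec.scale_right_diff_distrib scaleC_one)
qed

lemma k_homog:
  assumes "t \<in> homog n"
  shows "forms_k t \<in> homog n"
proof -
  have "forms_d (forms_b t) \<in> homog n"
  proof (cases n)
    case 0
    then show ?thesis
      using b_homog_0[of t] assms by (simp add: forms_linear homog_simps)
  next
    case (Suc m)
    then show ?thesis
      using d_homog[OF b_homog] assms by simp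
  qed
  with b_homog[OF d_homog[OF assms]] assms show ?thesis
    unfolding forms_k_def by (intro homog_simps)
qed

text \<open>The Karoubi operator moves the letters of a form to its front one at a time.\<close>

abbreviation snocs :: "'a::complex_algebra forms \<Rightarrow> 'a list \<Rightarrow> 'a forms" where
  "snocs \<equiv> foldl tens_snoc"

abbreviation dmuls :: "'a::complex_algebra list \<Rightarrow> 'a forms \<Rightarrow> 'a forms" where
  "dmuls as t \<equiv> foldr dmul as t"

lemma snocs_homog: "t \<in> homog n \<Longrightarrow> snocs t as \<in> homog (n + length as)"
proof (induct as arbitrary: t n)
  case (Cons a as)
  then show ?case using snoc_homog[OF Cons(2)] by fastforce
qed simp

lemma dmul_snocs: "dmul a (snocs t as) = snocs (dmul a t) as"
  by (induct as arbitrary: t) (simp_all add: dmul_snoc)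

lemma dmuls_homog: "t \<in> homog n \<Longrightarrow> dmuls as t \<in> homog (n + length as)"
  by (induct as) (auto simp: dmul_homog)

lemma clinear_dmuls: "clinear (dmuls as)"
proof (induct as)
  case Nil
  then show ?case by (simp add: clinear_ident id_def)
next
  case (Cons a as)
  then show ?case using clinear_comp[OF _ clinear_dmul] by (simp add: comp_def)
qed

lemma clinear_snocs: "clinear (\<lambda>t. snocs t as)"
proof (induct as)
  case Nil
  then show ?case by (simp add: clinear_ident)
next
  case (Cons a as)
  then show ?case using clinear_comp[OF clinear_snoc] by simp
qed

text \<open>Each step moves the last letter over the remaining part, whose degree is n +
  \<open>length as\<close> - 1 every time. This gives the exponent of the sign up to parity.\<close>

lemma k_pow_snocs:
  assumes "t \<in> homog n"
  shows "(forms_k ^^ length as) (snocs t as) = (-1) ^ (length as * (n + length as + 1)) *\<^sub>C dmuls as t"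
  using assms
proof (induct as arbitrary: t n rule: rev_induct)
  case Nil
  then show ?case by (simp add: scaleC_one)
next
  case (snoc a as)
  have "(forms_k ^^ length (as @ [a])) (snocs t (as @ [a])) =
      (forms_k ^^ length as) (forms_k (tens_snoc (snocs t as) a))"
    by (simp add: funpow_swap1)
  also have "\<dots> = (-1) ^ (n + length as) *\<^sub>C (forms_k ^^ length as) (snocs (dmul a t) as)"
    by (simp add: k_snoc[OF snocs_homog[OF snoc(2)]] clinear_scale[OF clinear_funpow[OF clinear_k]] dmul_snocs)
  also have "\<dots> = (-1) ^ (length (as @ [a]) * (n + length (as @ [a]) + 1)) *\<^sub>C dmuls (as @ [a]) t"
    by (simp add: snoc(1)[OF dmul_homog[OF snoc(2)]] scaleC_scaleC algebra_simps flip: power_add)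
  finally show ?case .
qed

lemma dmuls_init_1: "dmuls as (tens_init 1) = snocs (tens_init 1) as"
  by (induct as) (simp_all add: dmul_snocs dmul_init_1)

lemma rmul_dmuls: "forms_rmul (dmuls as t) a = dmuls as (forms_rmul t a)"
  by (induct as) (simp_all add: rmul_dmul)

lemma lmul_snocs: "forms_lmul a (snocs t as) = snocs (forms_lmul a t) as"
  by (induct as arbitrary: t) (simp_all add: lmul_snoc)

lemma d_snocs: "forms_d (snocs t as) = snocs (forms_d t) as"
  by (induct as arbitrary: t) (simp_all add: d_snoc)

lemma tword_snocs: "\<exists>x as. tword w = snocs (tens_init x) as \<and> length as = word_deg w"
proof (induct w)
  case (Init x)
  show ?case by (intro exI[of _ x] exI[of _ "[]"]) simp
next
  case (Snoc w a)
  then obtain x as where "tword w = snocs (tens_init x) as" "length as = word_deg w" by blast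
  then show ?case by (intro exI[of _ x] exI[of _ "as @ [a]"]) (simp flip: snoc_tword)
qed

text \<open>k^n moves all differentials in front of x, so the difference is the commutator of da_1
  ... da_n with x. That commutator is b of da_1 ... da_n dx up to sign, and da_1 ... da_n dx is k^n
  d of the form up to the same sign.\<close>

lemma k_pow_snocs_init:
  "(forms_k ^^ length as) (snocs (tens_init x) as) =
    snocs (tens_init x) as + forms_b ((forms_k ^^ length as) (forms_d (snocs (tens_init x) as)))"
proof -
  let ?n = "length as" and ?r = "alg_part x"
  have sgn: "((-1) ^ (n * (n + 1)) :: complex) = 1" "((-1) ^ (n * (n + 2)) * (-1) ^ n :: complex) = 1" for n :: nat
    by (simp_all flip: power_add)
  note x = tens_init_decompose[of x]
  have 1: "tens_snoc (tens_init 1) ?r \<in> homog 1"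
    using snoc_homog[OF init_homog] by simp
  have 2: "dmuls as (tens_init 1) \<in> homog ?n"
    using dmuls_homog[OF init_homog, of as] by simp
  have 3: "dmuls as (tens_snoc t r) = tens_snoc (dmuls as t) r" for t r
    by (induct as) (simp_all add: dmul_snoc)
  have "(forms_k ^^ ?n) (forms_d (snocs (tens_init x) as)) =
      (-1) ^ (?n * (?n + 2)) *\<^sub>C tens_snoc (dmuls as (tens_init 1)) ?r"
    by (simp add: d_snocs d_init k_pow_snocs[OF 1] 3 ac_simps)
  also have "forms_b \<dots> = forms_rmul (dmuls as (tens_init 1)) ?r - forms_lmul ?r (dmuls as (tens_init 1))"
    using sgn(2)[of ?n] by (simp add: clinear_simps[OF clinear_b] b_snoc[OF 2] scaleC_scaleC scaleC_one)
  also have "\<dots> = dmuls as (tens_init (adj_incl ?r)) - snocs (tens_init (adj_incl ?r)) as"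
    unfolding rmul_dmuls by (simp add: rmul_init dmuls_init_1 lmul_snocs lmul_init)
  finally have "forms_b ((forms_k ^^ ?n) (forms_d (snocs (tens_init x) as))) =
      dmuls as (tens_init (adj_incl ?r)) - snocs (tens_init (adj_incl ?r)) as" .
  moreover have "(forms_k ^^ ?n) (snocs (tens_init x) as) = dmuls as (tens_init x)"
    using k_pow_snocs[OF init_homog, of as x] sgn(1)[of ?n] by (simp add: scaleC_one)
  moreover have "dmuls as (tens_init x) = scalar_part x *\<^sub>C dmuls as (tens_init 1) + dmuls as (tens_init (adj_incl ?r))"
    "snocs (tens_init x) as = scalar_part x *\<^sub>C snocs (tens_init 1) as + snocs (tens_init (adj_incl ?r)) as"
    by (subst x, simp only: clinear_add[OF clinear_dmuls] clinear_scale[OF clinear_dmuls])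
      (subst x, simp only: clinear_add[OF clinear_snocs] clinear_scale[OF clinear_snocs])
  ultimately show ?thesis
    by (simp add: dmuls_init_1)
qed

theorem karoubi_relation:
  assumes "t \<in> homog n"
  shows "(forms_k ^^ n) t = t + forms_b ((forms_k ^^ n) (forms_d t))"
proof (rule homog_eq[OF _ _ _ assms])
  show "clinear (forms_k ^^ n)"
    by (rule clinear_funpow[OF clinear_k])
  show "clinear (\<lambda>t. t + forms_b ((forms_k ^^ n) (forms_d t)))"
    by (intro clinear_add_fun clinear_ident clinear_comp[OF clinear_d clinear_comp[OF clinear_funpow[OF clinear_k] clinear_b]])
  show "(forms_k ^^ n) (tword w) = tword w + forms_b ((forms_k ^^ n) (forms_d (tword w)))"
    if "word_deg w = n" for w :: "('a adj, 'a) word"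
    using tword_snocs[of w] that k_pow_snocs_init by metis
qed

lemma k_pow_commute: "forms_b ((forms_k ^^ n) t) = (forms_k ^^ n) (forms_b t)"
    "forms_d ((forms_k ^^ n) t) = (forms_k ^^ n) (forms_d t)"
  by (induct n) (simp_all add: k_b k_d flip: k_b k_d)

text \<open>Apply b to the Karoubi relation; the correction dies because b b = 0.\<close>

lemma k_pow_b: "t \<in> homog n \<Longrightarrow> (forms_k ^^ n) (forms_b t) = forms_b t"
  using arg_cong[OF karoubi_relation, of t n forms_b]
  by (simp add: k_pow_commute clinear_simps[OF clinear_b] clinear_zero[OF clinear_funpow[OF clinear_k]] b_b)

text \<open>The Karoubi relation in degree n + 1, where the correction contains d d.\<close>

lemma k_pow_d: "t \<in> homog n \<Longrightarrow> (forms_k ^^ Suc n) (forms_d t) = forms_d t"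
  using karoubi_relation[OF d_homog]
  by (simp add: d_d clinear_zero[OF clinear_b] clinear_zero[OF clinear_funpow[OF clinear_k]] clinear_zero[OF clinear_k])

text \<open>Prescribing the operator on words makes it total and linear without decomposing a form
  into homogeneous components.\<close>

definition graded :: "(nat \<Rightarrow> 'a::complex_algebra forms \<Rightarrow> 'a forms) \<Rightarrow> 'a forms \<Rightarrow> 'a forms" where
  "graded F t = tens_lift (\<lambda>w. F (word_deg w) (tword w)) t"

lemma multilinear_graded:
  assumes "\<And>n. clinear (F n)"
  shows "multilinear_word (\<lambda>w. F (word_deg w) (tword w))"
  unfolding multilinear_word_def
  by (auto simp: tword_add tword_scale clinear_simps[OF assms] dest: word_add_deg word_scale_deg)

lemma clinear_graded: "(\<And>n. clinear (F n)) \<Longrightarrow> clinear (graded F)"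
  unfolding graded_def[abs_def] by (rule clinear_tens_lift[OF multilinear_graded])

lemma graded_homog:
  assumes "\<And>n. clinear (F n)" "t \<in> homog n"
  shows "graded F t = F n t"
  by (rule homog_eq[OF clinear_graded[OF assms(1)] assms(1) _ assms(2)])
    (auto simp: graded_def tens_lift_tword[OF multilinear_graded[of F, OF assms(1)]])

lemma eq_on_homog:
  assumes "clinear f" "clinear g" "\<And>n t. t \<in> homog n \<Longrightarrow> f t = g t"
  shows "f t = g t"
  by (rule clinear_eq_on_tword[OF assms(1,2)]) (rule assms(3)[OF tword_homog])

abbreviation kpoly :: "complex poly \<Rightarrow> 'a::complex_algebra forms \<Rightarrow> 'a forms" where
  "kpoly \<equiv> op_poly forms_k"

lemmas clinear_kpoly = clinear_op_poly[OF clinear_k]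
lemmas kpoly_linear = clinear_simps[OF clinear_kpoly]
lemmas kpoly_mult = op_poly_mult[OF clinear_k]

lemma b_kpoly: "forms_b (kpoly p t) = kpoly p (forms_b t)"
  by (rule op_poly_commute[OF clinear_k clinear_b]) (rule k_b[symmetric])

lemma d_kpoly: "forms_d (kpoly p t) = kpoly p (forms_d t)"
  by (rule op_poly_commute[OF clinear_k clinear_d]) (rule k_d[symmetric])

lemma kpoly_homog: "t \<in> homog n \<Longrightarrow> kpoly p t \<in> homog n"
  unfolding homog_def
  by (rule op_poly_closed) (use k_homog[unfolded homog_def] in auto)

lemma kpoly_cong_b:
  "t \<in> homog n \<Longrightarrow> (monom 1 n - 1) dvd (p - q) \<Longrightarrow> kpoly p (forms_b t) = kpoly q (forms_b t)"
  by (rule op_poly_cong_dvd[OF clinear_k k_pow_b])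

lemma kpoly_cong_d:
  "t \<in> homog n \<Longrightarrow> (monom 1 (Suc n) - 1) dvd (p - q) \<Longrightarrow> kpoly p (forms_d t) = kpoly q (forms_d t)"
  by (rule op_poly_cong_dvd[OF clinear_k k_pow_d])

section \<open>Geometric sums as polynomials in the Karoubi operator\<close>

definition XX :: "complex poly" where
  "XX = [:0, 1:]"

lemma kpoly_X: "kpoly XX t = forms_k t"
  by (simp add: XX_def op_poly_pCons[OF clinear_k] clinear_zero[OF clinear_k] kpoly_linear scaleC_one)

lemma kpoly_one_minus_X: "kpoly (1 - XX) t = forms_b (forms_d t) + forms_d (forms_b t)"
  by (simp only: op_poly_diff kpoly_X op_poly_1) (simp add: forms_k_def)

lemma monom_XX: "monom 1 n = XX ^ n"
  by (simp add: XX_def monom_altdef)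

definition geom :: "nat \<Rightarrow> complex poly" where
  "geom n = (\<Sum>i<n. XX ^ i)"

definition geom2 :: "nat \<Rightarrow> complex poly" where
  "geom2 n = (\<Sum>i<n. XX ^ (2 * i))"

lemma geom_telescope: "(1 - XX) * geom n = 1 - XX ^ n"
proof (induct n)
  case 0
  then show ?case by (simp add: geom_def)
next
  case (Suc n)
  have "geom (Suc n) = geom n + XX ^ n"
    by (simp add: geom_def)
  then have "(1 - XX) * geom (Suc n) = (1 - XX) * geom n + (1 - XX) * XX ^ n"
    by (simp only: distrib_left)
  then show ?case unfolding Suc by (simp add: algebra_simps)
qed

lemma geom_even: "geom (2 * n) = (1 + XX) * geom2 n"
  unfolding geom_def geom2_def
  by (induct n) (simp_all add: algebra_simps)

lemma geom2_telescope: "(1 - XX) * ((1 + XX) * geom2 n) = 1 - XX ^ (2 * n)"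
  using geom_telescope[of "2 * n"] by (simp only: geom_even)

lemma poly_geom2_1: "poly (geom2 n) 1 = of_nat n"
  by (simp add: geom2_def poly_sum XX_def)

text \<open>The quotient by 1 - X of 1 - geom2 n / n, which vanishes at X = 1: the average of the
  quotients of 1 - X^(2i).\<close>

definition geom_rest :: "nat \<Rightarrow> complex poly" where
  "geom_rest n = smult (1 / of_nat n) (\<Sum>i<n. geom (2 * i))"

lemma geom_rest: "n > 0 \<Longrightarrow> (1 - XX) * geom_rest n = 1 - smult (1 / of_nat n) (geom2 n)"
proof -
  assume "n > 0"
  have "(1 - XX) * (\<Sum>i<n. geom (2 * i)) = (\<Sum>i<n. 1 - XX ^ (2 * i))"
    by (simp only: sum_distrib_left geom_telescope)
  also have "\<dots> = of_nat n - geom2 n"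
    by (simp add: sum_subtractf geom2_def)
  finally have "(1 - XX) * geom_rest n = smult (1 / of_nat n) (of_nat n - geom2 n)"
    by (simp only: geom_rest_def mult_smult_right)
  also have "\<dots> = 1 - smult (1 / of_nat n) (geom2 n)"
    using \<open>n > 0\<close> by (simp add: smult_diff_right of_nat_poly one_pCons)
  finally show ?thesis .
qed

text \<open>The quotient by 1 + X of geom2 n - n, which vanishes at X = -1; it sums up X^(2i) - 1 =
  -(1 - X) (1 + X) geom2 i.\<close>

definition geom_rest' :: "nat \<Rightarrow> complex poly" where
  "geom_rest' n = - (1 - XX) * (\<Sum>i<n. geom2 i)"

lemma geom_rest': "geom2 n = of_nat n + (1 + XX) * geom_rest' n"
proof -
  have "(1 + XX) * geom_rest' n = - ((1 - XX) * ((1 + XX) * (\<Sum>i<n. geom2 i)))"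
    by (simp add: geom_rest'_def algebra_simps)
  also have "\<dots> = - (\<Sum>i<n. (1 - XX) * ((1 + XX) * geom2 i))"
    by (simp only: sum_distrib_left)
  also have "\<dots> = geom2 n - of_nat n"
    by (simp only: geom2_telescope) (simp add: sum_subtractf geom2_def)
  finally show ?thesis by simp
qed

section \<open>Two differentials on forms and their comparison\<close>

lemma clinear_B_summand: "clinear (\<lambda>t. kpoly (geom (Suc n)) (forms_d t))"
  by (rule clinear_comp[OF clinear_d clinear_kpoly])

lemma forms_B_graded: "forms_B = graded (\<lambda>n t. kpoly (geom (Suc n)) (forms_d t))"
proof -
  have "kpoly (geom (Suc n)) t = (\<Sum>i\<le>n. (forms_k ^^ i) t)" for n and t :: "'a forms"
    by (simp only: geom_def op_poly_sum op_poly_monom lessThan_Suc_atMost flip: monom_XX) (simp add: scaleC_one)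
  then show ?thesis
    by (intro ext) (simp add: forms_B_def graded_def)
qed

lemma clinear_B: "clinear forms_B"
  unfolding forms_B_graded by (rule clinear_graded[OF clinear_B_summand])

lemma B_homog_eq: "t \<in> homog n \<Longrightarrow> forms_B t = kpoly (geom (Suc n)) (forms_d t)"
  unfolding forms_B_graded by (rule graded_homog[OF clinear_B_summand])

lemma B_homog: "t \<in> homog n \<Longrightarrow> forms_B t \<in> homog (Suc n)"
  by (simp add: B_homog_eq kpoly_homog d_homog)

text \<open>As (1 - X) geom n = 1 - X^n, the left side is 1 - k^n + k^n b d, which the Karoubi
  relation makes zero. This is the identity behind bB + Bb = 0.\<close>

lemma b_B_geom:
  assumes "t \<in> homog n"
  shows "kpoly (geom (Suc n)) (forms_b (forms_d t)) + kpoly (geom n) (forms_d (forms_b t)) = 0"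
proof -
  have pow: "kpoly (XX ^ n) s = (forms_k ^^ n) s" for s :: "'a forms"
    by (simp only: op_poly_monom flip: monom_XX) (simp add: scaleC_one)
  have "kpoly (geom (Suc n)) (forms_b (forms_d t)) + kpoly (geom n) (forms_d (forms_b t)) =
      kpoly (geom n) (kpoly (1 - XX) t) + kpoly (XX ^ n) (forms_b (forms_d t))"
    by (simp only: kpoly_one_minus_X kpoly_linear) (simp add: geom_def op_poly_add)
  also have "\<dots> = kpoly (1 - XX ^ n) t + kpoly (XX ^ n) (forms_b (forms_d t))"
    by (simp only: geom_telescope mult.commute[of "geom n"] flip: kpoly_mult)
  also have "\<dots> = 0"
    using karoubi_relation[OF assms] by (simp only: op_poly_diff pow op_poly_1 k_pow_commute) simp
  finally show ?thesis .
qed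

definition D_hodge :: "'a::complex_algebra forms \<Rightarrow> 'a forms" where
  "D_hodge t = forms_b t + forms_B t"

text \<open>The differential of the tower \<open>\<X>\<^sub>\<delta>(TR, IR)\<close> in terms of forms on \<open>R\<close>.\<close>

definition D_X :: "'a::complex_algebra forms \<Rightarrow> 'a forms" where
  "D_X = graded (\<lambda>n t. if even n then - kpoly (geom2 (n div 2)) (forms_b t) + kpoly (geom (Suc n)) (forms_d t)
     else forms_b t - kpoly (1 + XX) (forms_d t))"

lemma clinear_D_X_summand: "clinear (\<lambda>t. if even n then - kpoly (geom2 (n div 2)) (forms_b t) + kpoly (geom (Suc n)) (forms_d t)
     else forms_b t - kpoly (1 + XX) (forms_d t))"
  by (cases "even n") (simp_all only: if_True if_False,
    intro clinear_add_fun clinear_diff_fun clinear_uminus_fun clinear_comp[OF clinear_d clinear_kpoly]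
      clinear_comp[OF clinear_b clinear_kpoly] clinear_b,
    intro clinear_add_fun clinear_diff_fun clinear_uminus_fun clinear_comp[OF clinear_d clinear_kpoly]
      clinear_comp[OF clinear_b clinear_kpoly] clinear_b)

lemma clinear_D_X: "clinear D_X"
  unfolding D_X_def by (rule clinear_graded[OF clinear_D_X_summand])

lemma clinear_D_hodge: "clinear D_hodge"
  unfolding D_hodge_def[abs_def] by (intro clinear_add_fun clinear_b clinear_B)

lemma D_X_even: "t \<in> homog (2 * n) \<Longrightarrow>
    D_X t = - kpoly (geom2 n) (forms_b t) + kpoly (geom (Suc (2 * n))) (forms_d t)"
  unfolding D_X_def by (subst graded_homog[OF clinear_D_X_summand, of t "2 * n"]) simp_all

lemma D_X_odd: "t \<in> homog (Suc (2 * n)) \<Longrightarrow> D_X t = forms_b t - kpoly (1 + XX) (forms_d t)"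
  unfolding D_X_def by (subst graded_homog[OF clinear_D_X_summand, of t "Suc (2 * n)"]) simp_all

lemmas D_X_linear = clinear_simps[OF clinear_D_X]

lemma b_even_cases:
  assumes "t \<in> homog (2 * n)"
  obtains "n = 0" "forms_b t = 0" | m where "n = Suc m" "forms_b t \<in> homog (Suc (2 * m))"
proof (cases n)
  case 0
  then show ?thesis using that(1) b_homog_0[of t] assms by simp
next
  case (Suc m)
  then show ?thesis using that(2)[of m] b_homog[of t "Suc (2 * m)"] assms by simp
qed

lemma D_hodge_D_hodge: "D_hodge (D_hodge t) = 0"
proof (rule eq_on_homog[OF clinear_comp[OF clinear_D_hodge clinear_D_hodge] clinear_zero_fun])
  fix n and t :: "'a forms" assume t: "t \<in> homog n"
  have "forms_B (forms_b t) = kpoly (geom n) (forms_d (forms_b t))"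
  proof (cases n)
    case 0
    then show ?thesis
      using b_homog_0[of t] t by (simp add: clinear_zero[OF clinear_B] forms_linear kpoly_linear)
  next
    case (Suc m)
    then show ?thesis using B_homog_eq[OF b_homog, of t m] t by simp
  qed
  then show "D_hodge (D_hodge t) = 0"
    using b_B_geom[OF t] by (simp add: D_hodge_def clinear_simps[OF clinear_b] clinear_simps[OF clinear_B] b_b
        B_homog_eq[OF t] B_homog_eq[OF kpoly_homog[OF d_homog[OF t]]] b_kpoly d_kpoly d_d kpoly_linear)
qed

lemma parity_cases: obtains m where "n = 2 * m" | m where "n = Suc (2 * m)"
  by (metis evenE oddE Suc_eq_plus1)

text \<open>\<open>D_X\<close> distributes its factors unevenly over the parities, but geom (2m) =
  (1 + X) geom2 m makes every composite of b and d carry the coefficients of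
  \<open>b_B_geom\<close>.\<close>

lemma D_X_D_X: "D_X (D_X t) = 0"
proof (rule eq_on_homog[OF clinear_comp[OF clinear_D_X clinear_D_X] clinear_zero_fun])
  fix n and t :: "'a forms" assume t: "t \<in> homog n"
  note simps = D_X_linear forms_linear b_kpoly d_kpoly d_d b_b kpoly_linear clinear_simps[OF clinear_b] kpoly_mult[symmetric]
  show "D_X (D_X t) = 0"
  proof (cases n rule: parity_cases)
    case (1 m)
    then have t: "t \<in> homog (2 * m)" using t by simp
    have 1: "D_X (kpoly p (forms_d t)) = kpoly p (forms_b (forms_d t))" for p
      using D_X_odd[OF kpoly_homog[OF d_homog[OF t]]] by (simp add: simps)
    have 2: "D_X (kpoly p (forms_b t)) = - kpoly ((1 + XX) * p) (forms_d (forms_b t))" for p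
      using t by (cases rule: b_even_cases) (simp_all add: simps D_X_odd[OF kpoly_homog])
    show ?thesis
      using b_B_geom[OF t] by (simp only: D_X_even[OF t] D_X_linear 1 2 flip: geom_even) (simp add: add.commute)
  next
    case (2 m)
    then have t: "t \<in> homog (Suc (2 * m))" using t by simp
    have 1: "D_X (kpoly p (forms_d t)) = - kpoly (geom2 (Suc m) * p) (forms_b (forms_d t))" for p
      using D_X_even[of "kpoly p (forms_d t)" "Suc m"] kpoly_homog[OF d_homog[OF t]] by (simp add: simps)
    have 2: "D_X (forms_b t) = kpoly (geom (Suc (2 * m))) (forms_d (forms_b t))"
      using D_X_even[OF b_homog[OF t]] by (simp add: simps)
    have "geom (Suc (Suc (2 * m))) = geom2 (Suc m) * (1 + XX)"
      using geom_even[of "Suc m"] by (simp add: mult.commute)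
    then show ?thesis
      using b_B_geom[OF t] by (simp only: D_X_odd[OF t] D_X_linear 1 2) (simp add: add.commute)
  qed
qed

section \<open>Comparison polynomials and their congruences\<close>

fun F_coeff :: "nat \<Rightarrow> complex poly" where
  "F_coeff 0 = 1"
| "F_coeff (Suc n) = - geom2 (Suc n) * F_coeff n"

text \<open>This is (-1)^n / n!, the inverse of the value of \<open>F_coeff n\<close> at X = 1,
  since geom2 i takes the value i there.\<close>

fun G_const :: "nat \<Rightarrow> complex" where
  "G_const 0 = 1"
| "G_const (Suc n) = - G_const n / of_nat (Suc n)"

text \<open>Degrees 2i and 2i + 1 share a coefficient because b has coefficient 1 on odd degrees in
  both differentials. From degree 2i to 2i - 1 the factor -geom2 i of \<open>D_X\<close> has to be
  absorbed.\<close>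

definition F_poly :: "nat \<Rightarrow> complex poly" where
  "F_poly n = F_coeff (n div 2)"

text \<open>\<open>G_corr n\<close> is \<open>1\<close> modulo \<open>X\<^bsup>2n+1\<^esup> - 1\<close> and \<open>geom2 (n + 1) / (n + 1)\<close> modulo \<open>X\<^bsup>2n+2\<^esup> - 1\<close>.\<close>

definition G_corr :: "nat \<Rightarrow> complex poly" where
  "G_corr n = 1 + XX * (1 - XX ^ Suc (2 * n)) * geom_rest (Suc n)"

definition G_poly :: "nat \<Rightarrow> complex poly" where
  "G_poly n = smult (G_const (n div 2)) (if even n then 1 else G_corr (n div 2))"

lemma G_corr_1: "(monom 1 (Suc (2 * n)) - 1) dvd (G_corr n - 1)"
proof
  show "G_corr n - 1 = (monom 1 (Suc (2 * n)) - 1) * (- XX * geom_rest (Suc n))"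
    unfolding G_corr_def monom_XX by (simp add: algebra_simps del: power_Suc)
qed

text \<open>The moduli of this and the preceding congruence have greatest common divisor X - 1, so
  the Chinese remainder theorem asks that the two residues agree at X = 1, where both are 1. The
  explicit solution rests on X (1 - X^(2n+1)) + (1 - X) = 1 - X^(2n+2).\<close>

lemma G_corr_2: "(monom 1 (Suc (Suc (2 * n))) - 1) dvd (G_corr n - smult (1 / of_nat (Suc n)) (geom2 (Suc n)))"
proof
  have "G_corr n - smult (1 / of_nat (Suc n)) (geom2 (Suc n)) =
      XX * (1 - XX ^ Suc (2 * n)) * geom_rest (Suc n) + (1 - smult (1 / of_nat (Suc n)) (geom2 (Suc n)))"
    by (simp add: G_corr_def)
  also have "\<dots> = XX * (1 - XX ^ Suc (2 * n)) * geom_rest (Suc n) + (1 - XX) * geom_rest (Suc n)"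
    by (subst geom_rest) simp_all
  also have "\<dots> = (monom 1 (Suc (Suc (2 * n))) - 1) * (- geom_rest (Suc n))"
    unfolding monom_XX power_Suc[of XX "Suc (2 * n)"] by (simp add: algebra_simps del: power_Suc mult_pCons_left mult_pCons_right)
  finally show "G_corr n - smult (1 / of_nat (Suc n)) (geom2 (Suc n)) = \<dots>" .
qed

definition R_poly :: "nat \<Rightarrow> complex poly" where
  "R_poly n = 1 - F_poly n * G_poly n"

lemma F_poly_G_poly_1: "poly (F_coeff n) 1 * G_const n = 1"
proof (induct n)
  case (Suc n)
  have "poly (F_coeff (Suc n)) 1 * G_const (Suc n) = poly (F_coeff n) 1 * G_const n"
    using of_nat_neq_0[of n, where 'a = complex]
    by (simp only: F_coeff.simps G_const.simps poly_mult poly_minus poly_geom2_1)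
      (simp del: of_nat_Suc)
  from this Suc show ?case by (rule trans)
qed simp

lemma poly_R_1: "poly (R_poly n) 1 = 0"
  using F_poly_G_poly_1[of "n div 2"] by (simp add: R_poly_def F_poly_def G_poly_def G_corr_def XX_def mult.commute)

text \<open>The division is exact since \<open>R_poly n\<close> vanishes at X = 1. Neighbouring
  quotients need not be congruent modulo X^(n+1) - 1; only their multiples by 1 - X are.\<close>

definition S_poly :: "nat \<Rightarrow> complex poly" where
  "S_poly n = R_poly n div (1 - XX)"

lemma R_poly_S: "R_poly n = (1 - XX) * S_poly n"
proof -
  have "[:- 1, 1:] dvd R_poly n"
    using poly_R_1[of n] by (simp add: poly_eq_0_iff_dvd)
  moreover have "1 - XX = - [:- 1, 1:]"
    by (simp add: one_pCons XX_def)
  ultimately have "(1 - XX) dvd R_poly n"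
    by (simp only: minus_dvd_iff)
  then show ?thesis by (simp add: S_poly_def)
qed

text \<open>\<open>F_poly\<close> is unchanged from 2m to 2m + 1 and gains the factor -geom2 (m + 1)
  from 2m + 1 to 2m + 2; the two residues of \<open>G_corr\<close> compensate exactly these two
  steps.\<close>

lemma R_poly_cong: "(monom 1 (Suc n) - 1) dvd (R_poly n - R_poly (Suc n))"
proof (cases n rule: parity_cases)
  case (1 m)
  have "R_poly n - R_poly (Suc n) = (G_corr m - 1) * smult (G_const m) (F_coeff m)"
    by (simp add: 1 R_poly_def F_poly_def G_poly_def algebra_simps smult_diff_right)
  then show ?thesis
    using G_corr_1[of m] 1 by (metis dvd_mult2)
next
  case (2 m)
  have "R_poly n - R_poly (Suc n) =
      (G_corr m - smult (1 / of_nat (Suc m)) (geom2 (Suc m))) * (- smult (G_const m) (F_coeff m))"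
    by (simp add: 2 R_poly_def F_poly_def G_poly_def algebra_simps smult_diff_right)
  then show ?thesis
    using G_corr_2[of m] 2 by (metis dvd_mult2)
qed

lemma kpoly_R_b:
  "t \<in> homog (Suc n) \<Longrightarrow> kpoly (R_poly n) (forms_b t) = kpoly (R_poly (Suc n)) (forms_b t)"
  by (rule kpoly_cong_b[OF _ R_poly_cong])

definition rho :: "nat \<Rightarrow> complex poly" where
  "rho n = R_poly n * S_poly n"

text \<open>Both sides equal (1 - X) S_n S_(n+1) applied to b t: on each side one factor R is
  replaced by its neighbour, and then R = (1 - X) S.\<close>

lemma kpoly_rho_b:
  assumes "t \<in> homog (Suc n)"
  shows "kpoly (rho n) (forms_b t) = kpoly (rho (Suc n)) (forms_b t)"
proof -
  have "kpoly (rho n) (forms_b t) = kpoly (S_poly n * R_poly (Suc n)) (forms_b t)"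
    by (simp add: rho_def kpoly_mult mult.commute[of "R_poly n"] kpoly_R_b[OF assms])
  also have "\<dots> = kpoly (S_poly (Suc n) * R_poly n) (forms_b t)"
    by (simp only: R_poly_S ac_simps)
  also have "\<dots> = kpoly (rho (Suc n)) (forms_b t)"
    by (simp add: rho_def kpoly_mult mult.commute[of "R_poly (Suc n)"] kpoly_R_b[OF assms])
  finally show ?thesis .
qed

text \<open>R^2 = (1 - X) rho and 1 - X acts as bd + db; \<open>kpoly_rho_b\<close> lets the term db
  carry the coefficient of the lower degree, as a homotopy produces it.\<close>

lemma kpoly_rho_laplace:
  assumes "t \<in> homog (Suc n)"
  shows "forms_b (forms_d (kpoly (rho (Suc n)) t)) + forms_d (kpoly (rho n) (forms_b t)) = kpoly (R_poly (Suc n) ^ 2) t"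
proof -
  have "kpoly (R_poly (Suc n) ^ 2) t = kpoly (1 - XX) (kpoly (rho (Suc n)) t)"
    unfolding rho_def by (simp only: power2_eq_square kpoly_mult[symmetric]) (metis R_poly_S mult.assoc mult.commute)
  also have "\<dots> = forms_b (forms_d (kpoly (rho (Suc n)) t)) + forms_d (forms_b (kpoly (rho (Suc n)) t))"
    by (rule kpoly_one_minus_X)
  finally show ?thesis
    by (simp add: b_kpoly kpoly_rho_b[OF assms])
qed

lemma kpoly_rho_laplace_0:
  assumes "t \<in> homog 0"
  shows "forms_b (forms_d (kpoly (rho 0) t)) = kpoly (R_poly 0 ^ 2) t"
proof -
  have "kpoly (R_poly 0 ^ 2) t = kpoly (1 - XX) (kpoly (rho 0) t)"
    unfolding rho_def by (simp only: power2_eq_square kpoly_mult[symmetric]) (metis R_poly_S mult.assoc mult.commute)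
  then show ?thesis
    using b_homog_0[OF kpoly_homog[OF assms]] by (simp add: kpoly_one_minus_X forms_linear)
qed

section \<open>Comparison maps and homotopies\<close>

definition F_map :: "'a::complex_algebra forms \<Rightarrow> 'a forms" where
  "F_map = graded (\<lambda>n. kpoly (F_poly n))"

text \<open>A first approximation to the inverse is \<open>G_poly\<close>, with error \<open>R_poly\<close>; one Newton step squares
  the error.\<close>

definition G_map :: "'a::complex_algebra forms \<Rightarrow> 'a forms" where
  "G_map = graded (\<lambda>n. kpoly (G_poly n * (1 + R_poly n)))"

definition h_hodge :: "'a::complex_algebra forms \<Rightarrow> 'a forms" where
  "h_hodge = graded (\<lambda>n t. - forms_d (kpoly (rho n) t))"

text \<open>The coefficients -geom2 and -(1 + X) of \<open>D_X\<close> must combine so that only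
  -rho (bd + db) is left. The factor 1 / i normalises geom2 i, and the multiple of b supplies geom2
  i / i - 1, which is divisible by 1 + X. In degree zero n - 1 is truncated and 1 / 0 = 0, but b
  vanishes there.\<close>

definition h_X :: "'a::complex_algebra forms \<Rightarrow> 'a forms" where
  "h_X = graded (\<lambda>n t. if even n
     then - (forms_d (kpoly (rho n) t) +
       kpoly (rho (n - 1) * smult (1 / of_nat (n div 2)) (geom_rest' (n div 2))) (forms_b t))
     else (1 / of_nat (Suc (n div 2))) *\<^sub>C forms_d (kpoly (rho n) t))"

lemma clinear_F_map: "clinear F_map"
  unfolding F_map_def by (rule clinear_graded[OF clinear_kpoly])

lemma clinear_G_map: "clinear G_map"
  unfolding G_map_def by (rule clinear_graded[OF clinear_kpoly])

lemma clinear_h_hodge_summand: "clinear (\<lambda>t. - forms_d (kpoly p t))"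
  by (intro clinear_uminus_fun clinear_comp[OF clinear_kpoly clinear_d])

lemma clinear_h_hodge: "clinear h_hodge"
  unfolding h_hodge_def by (rule clinear_graded[OF clinear_h_hodge_summand])

lemma clinear_h_X_summand: "clinear (\<lambda>t. if even n then - (forms_d (kpoly (p n) t) + kpoly (q n) (forms_b t))
    else c *\<^sub>C forms_d (kpoly (r n) t))"
  by (cases "even n") (simp_all only: if_True if_False,
    intro clinear_add_fun clinear_uminus_fun clinear_comp[OF clinear_kpoly clinear_d] clinear_comp[OF clinear_b clinear_kpoly],
    intro clinear_scale_fun clinear_comp[OF clinear_kpoly clinear_d])

lemma clinear_h_X: "clinear h_X"
  unfolding h_X_def by (rule clinear_graded[OF clinear_h_X_summand])

lemma F_map_homog: "t \<in> homog n \<Longrightarrow> F_map t = kpoly (F_poly n) t"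
  unfolding F_map_def by (rule graded_homog[OF clinear_kpoly])

lemma G_map_homog: "t \<in> homog n \<Longrightarrow> G_map t = kpoly (G_poly n * (1 + R_poly n)) t"
  unfolding G_map_def by (rule graded_homog[OF clinear_kpoly])

lemma h_hodge_homog: "t \<in> homog n \<Longrightarrow> h_hodge t = - forms_d (kpoly (rho n) t)"
  unfolding h_hodge_def by (rule graded_homog[OF clinear_h_hodge_summand])

lemma h_X_even: "t \<in> homog (2 * n) \<Longrightarrow> h_X t = - (forms_d (kpoly (rho (2 * n)) t) +
    kpoly (rho (2 * n - 1) * smult (1 / of_nat n) (geom_rest' n)) (forms_b t))"
  unfolding h_X_def by (subst graded_homog[OF clinear_h_X_summand, of t "2 * n"]) simp_all

lemma h_X_odd: "t \<in> homog (Suc (2 * n)) \<Longrightarrow> h_X t = (1 / of_nat (Suc n)) *\<^sub>C forms_d (kpoly (rho (Suc (2 * n))) t)"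
  unfolding h_X_def by (subst graded_homog[OF clinear_h_X_summand, of t "Suc (2 * n)"]) simp_all

text \<open>The coefficients match as polynomials, by the recursion of \<open>F_coeff\<close> and
  geom (2m) = (1 + X) geom2 m.\<close>

lemma F_map_D_X: "F_map (D_X t) = D_hodge (F_map t)"
proof (rule eq_on_homog[OF clinear_comp[OF clinear_D_X clinear_F_map] clinear_comp[OF clinear_F_map clinear_D_hodge]])
  fix n and t :: "'a forms" assume t: "t \<in> homog n"
  note linear = clinear_simps[OF clinear_F_map] forms_linear kpoly_linear clinear_simps[OF clinear_b]
  show "F_map (D_X t) = D_hodge (F_map t)"
  proof (cases n rule: parity_cases)
    case (1 m)
    then have t: "t \<in> homog (2 * m)" using t by simp
    have 1: "F_map (kpoly p (forms_d t)) = kpoly (F_coeff m * p) (forms_d t)" for p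
      by (simp add: F_map_homog[OF kpoly_homog[OF d_homog[OF t]]] F_poly_def kpoly_mult)
    have 2: "F_map (- kpoly (geom2 m) (forms_b t)) = kpoly (F_coeff m) (forms_b t)"
      using t
    proof (cases rule: b_even_cases)
      case (2 i)
      then show ?thesis
        by (simp add: linear F_map_homog[OF kpoly_homog[OF 2(2)]] F_poly_def mult.commute[of "geom2 _"] kpoly_mult op_poly_minus)
    qed (simp add: linear)
    show ?thesis
      by (simp only: D_X_even[OF t] clinear_add[OF clinear_F_map] 1 2)
        (simp add: F_map_homog[OF t] F_poly_def D_hodge_def B_homog_eq[OF kpoly_homog[OF t]] b_kpoly d_kpoly mult.commute[of "F_coeff m"] flip: kpoly_mult)
  next
    case (2 m)
    then have t: "t \<in> homog (Suc (2 * m))" using t by simp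
    have 1: "F_map (kpoly p (forms_d t)) = kpoly (F_coeff (Suc m) * p) (forms_d t)" for p
      using F_map_homog[OF kpoly_homog[OF d_homog[OF t]], of p] by (simp add: F_poly_def kpoly_mult del: F_coeff.simps)
    have 2: "F_map (forms_b t) = kpoly (F_coeff m) (forms_b t)"
      by (simp add: F_map_homog[OF b_homog[OF t]] F_poly_def)
    have "geom (Suc (Suc (2 * m))) * F_coeff m = - (F_coeff (Suc m) * (1 + XX))"
      using geom_even[of "Suc m"] by (simp add: algebra_simps)
    then show ?thesis
      by (simp only: D_X_odd[OF t] clinear_diff[OF clinear_F_map] 1 2)
        (simp add: F_map_homog[OF t] F_poly_def D_hodge_def B_homog_eq[OF kpoly_homog[OF t]] b_kpoly d_kpoly op_poly_minus flip: kpoly_mult del: F_coeff.simps)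
  qed
qed

lemma dvd_mult_diff:
  fixes m :: "'a::comm_ring_1"
  assumes "m dvd a - a'" "m dvd b - b'"
  shows "m dvd a * b - a' * b'"
proof -
  have "a * b - a' * b' = (a - a') * b + a' * (b - b')"
    by (simp add: algebra_simps)
  then show ?thesis using assms by simp
qed

abbreviation (input) G'_poly :: "nat \<Rightarrow> complex poly" where
  "G'_poly n \<equiv> G_poly n * (1 + R_poly n)"

lemma G'_poly_cong_even: "(monom 1 (Suc (2 * n)) - 1) dvd (G'_poly (2 * n) - G'_poly (Suc (2 * n)))"
proof (rule dvd_mult_diff)
  have "G_poly (2 * n) - G_poly (Suc (2 * n)) = (G_corr n - 1) * - [:G_const n:]"
    by (simp add: G_poly_def smult_diff_right algebra_simps)
  then show "(monom 1 (Suc (2 * n)) - 1) dvd (G_poly (2 * n) - G_poly (Suc (2 * n)))"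
    using G_corr_1[of n] by (metis dvd_mult2)
qed (use R_poly_cong in simp)

lemma G'_poly_cong_odd: "(monom 1 (Suc (Suc (2 * n))) - 1) dvd
    (G'_poly (Suc (2 * n)) - - geom2 (Suc n) * G'_poly (Suc (Suc (2 * n))))"
proof -
  have "G_poly (Suc (2 * n)) - - geom2 (Suc n) * G_poly (Suc (Suc (2 * n))) =
      (G_corr n - smult (1 / of_nat (Suc n)) (geom2 (Suc n))) * [:G_const n:]"
    by (simp add: G_poly_def smult_diff_right algebra_simps)
  then have "(monom 1 (Suc (Suc (2 * n))) - 1) dvd
      (G_poly (Suc (2 * n)) - - geom2 (Suc n) * G_poly (Suc (Suc (2 * n))))"
    using G_corr_2[of n] by (metis dvd_mult2)
  from dvd_mult_diff[OF this, of "1 + R_poly (Suc (2 * n))" "1 + R_poly (Suc (Suc (2 * n)))"]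
  show ?thesis
    using R_poly_cong[of "Suc (2 * n)"] by (simp add: mult.assoc)
qed

lemma dvd_mult_diff_left: "m dvd a - a' \<Longrightarrow> m dvd c * a - c * (a' :: 'a::comm_ring_1)"
  using dvd_mult_diff[of m c c a a'] by simp

text \<open>Here the coefficients agree only modulo X^(n+1) - 1 between degrees n and n + 1, which
  is enough on the images of b and d.\<close>

lemma G_map_D_hodge: "G_map (D_hodge t) = D_X (G_map t)"
proof (rule eq_on_homog[OF clinear_comp[OF clinear_D_hodge clinear_G_map] clinear_comp[OF clinear_G_map clinear_D_X]])
  fix n and t :: "'a forms" assume t: "t \<in> homog n"
  note linear = clinear_simps[OF clinear_G_map] forms_linear kpoly_linear clinear_simps[OF clinear_b]
  show "G_map (D_hodge t) = D_X (G_map t)"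
  proof (cases n rule: parity_cases)
    case (1 m)
    then have t: "t \<in> homog (2 * m)" using t by simp
    have 1: "G_map (forms_B t) = kpoly (geom (Suc (2 * m)) * G'_poly (2 * m)) (forms_d t)"
      by (simp only: B_homog_eq[OF t] G_map_homog[OF kpoly_homog[OF d_homog[OF t]]] kpoly_mult[symmetric] mult.commute[of _ "geom _"])
        (rule kpoly_cong_d[OF t], rule dvd_mult_diff_left, use G'_poly_cong_even in \<open>simp only: dvd_diff_commute\<close>)
    have 2: "G_map (forms_b t) = kpoly (- (geom2 m * G'_poly (2 * m))) (forms_b t)"
      using t
    proof (cases rule: b_even_cases)
      case (2 i)
      have "G_map (forms_b t) = kpoly (G'_poly (Suc (2 * i))) (forms_b t)"
        by (rule G_map_homog[OF 2(2)])
      also have "\<dots> = kpoly (- geom2 (Suc i) * G'_poly (Suc (Suc (2 * i)))) (forms_b t)"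
        by (rule kpoly_cong_b[OF _ G'_poly_cong_odd]) (use t 2 in simp)
      finally show ?thesis using 2 by simp
    qed (simp add: linear)
    show ?thesis
      by (simp only: G_map_homog[OF t] D_X_even[OF kpoly_homog[OF t]] D_hodge_def linear 1 2 b_kpoly d_kpoly kpoly_mult[symmetric] op_poly_minus)
  next
    case (2 m)
    then have t: "t \<in> homog (Suc (2 * m))" using t by simp
    have "geom (Suc (Suc (2 * m))) * G'_poly (Suc (Suc (2 * m))) =
        - ((1 + XX) * (- geom2 (Suc m) * G'_poly (Suc (Suc (2 * m)))))"
      using geom_even[of "Suc m"] by (simp add: mult.assoc)
    then have 1: "G_map (forms_B t) = - kpoly ((1 + XX) * G'_poly (Suc (2 * m))) (forms_d t)"
      by (simp only: B_homog_eq[OF t] G_map_homog[OF kpoly_homog[OF d_homog[OF t]]] kpoly_mult[symmetric] mult.commute[of _ "geom _"]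
          op_poly_minus neg_equal_iff_equal)
        (rule kpoly_cong_d[OF t], rule dvd_mult_diff_left, use G'_poly_cong_odd in \<open>simp only: dvd_diff_commute\<close>)
    have 2: "G_map (forms_b t) = kpoly (G'_poly (Suc (2 * m))) (forms_b t)"
      by (simp only: G_map_homog[OF b_homog[OF t]], rule kpoly_cong_b[OF t G'_poly_cong_even])
    show ?thesis
      by (simp only: G_map_homog[OF t] D_X_odd[OF kpoly_homog[OF t]] D_hodge_def linear 1 2 b_kpoly d_kpoly kpoly_mult[symmetric])
        simp
  qed
qed

lemma FG_poly: "F_poly n * G'_poly n = 1 - R_poly n ^ 2"
proof -
  have "F_poly n * G_poly n = 1 - R_poly n"
    by (simp add: R_poly_def)
  then have "F_poly n * G'_poly n = (1 - R_poly n) * (1 + R_poly n)"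
    by (simp only: mult.assoc[symmetric])
  then show ?thesis
    by (simp add: power2_eq_square algebra_simps)
qed

lemma FG_homog:
  assumes "t \<in> homog n"
  shows "F_map (G_map t) = t - kpoly (R_poly n ^ 2) t" "G_map (F_map t) = t - kpoly (R_poly n ^ 2) t"
proof -
  have "F_map (G_map t) = kpoly (F_poly n * G'_poly n) t" "G_map (F_map t) = kpoly (G'_poly n * F_poly n) t"
    by (simp_all only: F_map_homog[OF assms] G_map_homog[OF assms] F_map_homog[OF kpoly_homog[OF assms]]
        G_map_homog[OF kpoly_homog[OF assms]] flip: kpoly_mult)
  then show "F_map (G_map t) = t - kpoly (R_poly n ^ 2) t" "G_map (F_map t) = t - kpoly (R_poly n ^ 2) t"
    by (simp_all only: mult.commute[of "G'_poly n"] FG_poly op_poly_diff op_poly_1)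
qed

lemma homotopy_hodge: "F_map (G_map t) = t + (D_hodge (h_hodge t) + h_hodge (D_hodge t))"
proof (rule eq_on_homog[OF clinear_comp[OF clinear_G_map clinear_F_map] clinear_add_fun[OF clinear_ident
        clinear_add_fun[OF clinear_comp[OF clinear_h_hodge clinear_D_hodge] clinear_comp[OF clinear_D_hodge clinear_h_hodge]]]])
  fix n and t :: "'a forms" assume t: "t \<in> homog n"
  note linear = clinear_simps[OF clinear_h_hodge] forms_linear kpoly_linear clinear_simps[OF clinear_b] clinear_simps[OF clinear_B]
    clinear_simps[OF clinear_D_hodge]
  have 1: "D_hodge (h_hodge t) = - forms_b (forms_d (kpoly (rho n) t))"
    using B_homog_eq[OF d_homog[OF kpoly_homog[OF t]]]
    by (simp add: h_hodge_homog[OF t] D_hodge_def linear d_d)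
  have 2: "h_hodge (forms_B t) = 0"
    by (simp only: h_hodge_homog[OF B_homog[OF t]]) (simp add: B_homog_eq[OF t] d_kpoly d_d linear)
  have 3: "h_hodge (D_hodge t) = h_hodge (forms_b t)"
    by (simp add: D_hodge_def linear 2)
  show "F_map (G_map t) = t + (D_hodge (h_hodge t) + h_hodge (D_hodge t))"
  proof (cases n)
    case 0
    then show ?thesis
      using t kpoly_rho_laplace_0[of t] by (simp add: FG_homog[OF t] 1 3 b_homog_0 linear)
  next
    case (Suc m)
    then have t': "t \<in> homog (Suc m)" using t by simp
    then show ?thesis
      using kpoly_rho_laplace[OF t'] h_hodge_homog[OF b_homog[OF t']] Suc
      by (simp add: FG_homog[OF t] 1 3 linear algebra_simps)
  qed
qed

lemma geom_rest'_scaled: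
  "(1 + XX) * smult (1 / of_nat (Suc n)) (geom_rest' (Suc n)) = smult (1 / of_nat (Suc n)) (geom2 (Suc n)) - 1"
proof -
  have "(1 + XX) * smult (1 / of_nat (Suc n)) (geom_rest' (Suc n)) =
      smult (1 / of_nat (Suc n)) (geom2 (Suc n) - of_nat (Suc n))"
    by (subst geom_rest'[of "Suc n"]) simp
  also have "\<dots> = smult (1 / of_nat (Suc n)) (geom2 (Suc n)) - 1"
    by (simp add: smult_diff_right of_nat_poly one_pCons del: of_nat_Suc)
  finally show ?thesis .
qed

lemma homotopy_X: "G_map (F_map t) = t + (D_X (h_X t) + h_X (D_X t))"
proof (rule eq_on_homog[OF clinear_comp[OF clinear_F_map clinear_G_map] clinear_add_fun[OF clinear_ident
        clinear_add_fun[OF clinear_comp[OF clinear_h_X clinear_D_X] clinear_comp[OF clinear_D_X clinear_h_X]]]])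
  fix n and t :: "'a forms" assume t: "t \<in> homog n"
  note linear = clinear_simps[OF clinear_h_X] forms_linear kpoly_linear clinear_simps[OF clinear_b] D_X_linear
  let ?c = "\<lambda>m. smult (1 / of_nat (Suc m)) (geom_rest' (Suc m))"
  show "G_map (F_map t) = t + (D_X (h_X t) + h_X (D_X t))"
  proof (cases n rule: parity_cases)
    case (1 m)
    then have t: "t \<in> homog (2 * m)" using t by simp
    have 1: "D_X (forms_d (kpoly p t)) = forms_b (forms_d (kpoly p t))" for p
      using D_X_odd[OF d_homog[OF kpoly_homog[OF t]]] by (simp add: d_d linear)
    have 2: "h_X (kpoly p (forms_d t)) = 0" for p
      using h_X_odd[OF kpoly_homog[OF d_homog[OF t]]] by (simp add: d_kpoly d_d linear)
    from t show ?thesis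
    proof (cases rule: b_even_cases)
      case a: 1
      then show ?thesis
        using t kpoly_rho_laplace_0[of t]
        by (simp add: FG_homog[OF t] h_X_even[OF t] D_X_even[OF t] linear 1 2)
    next
      case (2 i)
      have t': "t \<in> homog (Suc (Suc (2 * i)))" using t 2 by simp
      have 3: "D_X (kpoly p (forms_b t)) = - kpoly (p * (1 + XX)) (forms_d (forms_b t))" for p
        by (simp add: D_X_odd[OF kpoly_homog[OF 2(2)]] b_kpoly b_b linear d_kpoly mult.commute[of p] flip: kpoly_mult)
      have 4: "h_X (kpoly p (forms_b t)) = (1 / of_nat (Suc i)) *\<^sub>C kpoly (rho (Suc (2 * i)) * p) (forms_d (forms_b t))" for p
        by (simp add: h_X_odd[OF kpoly_homog[OF 2(2)]] d_kpoly flip: kpoly_mult)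
      have "D_X (h_X t) + h_X (D_X t) = - forms_b (forms_d (kpoly (rho (2 * m)) t)) +
          kpoly (rho (Suc (2 * i)) * ((1 + XX) * ?c i)) (forms_d (forms_b t)) -
          kpoly (rho (Suc (2 * i)) * smult (1 / of_nat (Suc i)) (geom2 (Suc i))) (forms_d (forms_b t))"
        unfolding h_X_even[OF t] D_X_even[OF t]
        by (simp only: linear 1 \<open>\<And>p. h_X (kpoly p (forms_d t)) = 0\<close> 3 4 2(1) mult_smult_right op_poly_smult)
          (simp add: 3 ac_simps op_poly_smult)
      also have "\<dots> = - (forms_b (forms_d (kpoly (rho (2 * m)) t)) + forms_d (kpoly (rho (Suc (2 * i))) (forms_b t)))"
        by (simp only: geom_rest'_scaled right_diff_distrib op_poly_diff d_kpoly) simp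
      finally show ?thesis
        using kpoly_rho_laplace[OF t'] 2(1) by (simp add: FG_homog[OF t])
    qed
  next
    case (2 m)
    then have t: "t \<in> homog (Suc (2 * m))" using t by simp
    have d: "kpoly p (forms_d t) \<in> homog (2 * Suc m)" for p
      using kpoly_homog[OF d_homog[OF t]] by simp
    have 1: "D_X (kpoly p (forms_d t)) = - kpoly (geom2 (Suc m) * p) (forms_b (forms_d t))" for p
      by (simp add: D_X_even[OF d] d_kpoly b_kpoly d_d linear flip: kpoly_mult)
    have 2: "h_X (kpoly p (forms_d t)) = - kpoly (rho (Suc (2 * m)) * ?c m * p) (forms_b (forms_d t))" for p
      by (simp add: h_X_even[OF d] d_kpoly b_kpoly d_d linear flip: kpoly_mult)
    have 3: "h_X (forms_b t) = - forms_d (kpoly (rho (2 * m)) (forms_b t))"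
      by (simp add: h_X_even[OF b_homog[OF t]] b_b linear)
    have "D_X (h_X t) + h_X (D_X t) = - forms_d (kpoly (rho (2 * m)) (forms_b t)) +
        kpoly (rho (Suc (2 * m)) * ((1 + XX) * ?c m)) (forms_b (forms_d t)) -
        kpoly (rho (Suc (2 * m)) * smult (1 / of_nat (Suc m)) (geom2 (Suc m))) (forms_b (forms_d t))"
      unfolding h_X_odd[OF t] D_X_odd[OF t]
      by (simp only: linear 1 2 3 d_kpoly) (simp add: op_poly_smult ac_simps)
    also have "\<dots> = - (forms_b (forms_d (kpoly (rho (Suc (2 * m))) t)) + forms_d (kpoly (rho (2 * m)) (forms_b t)))"
      by (simp only: geom_rest'_scaled right_diff_distrib op_poly_diff d_kpoly b_kpoly) simp
    finally show ?thesis
      using kpoly_rho_laplace[OF t] by (simp add: FG_homog[OF t])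
  qed
qed

text \<open>These are to span the kernel from all forms onto the parity \<open>p\<close> part of
  level \<open>m\<close>. The unit occurs because degree zero of the complex is the algebra and not
  its unitization. If \<open>m\<close> does not have parity \<open>p\<close>, the boundaries are
  forms of the wrong parity anyway.\<close>

definition hodge_ker_gens :: "'a::complex_algebra forms set \<Rightarrow> nat \<Rightarrow> nat \<Rightarrow> 'a forms set" where
  "hodge_ker_gens C m p = {tword w | w. word_deg w mod 2 \<noteq> p \<or> m < word_deg w} \<union> {tens_init 1} \<union> C \<union>
     {forms_b (tword w) | w. word_deg w = Suc m}"

definition hodge_ker :: "'a::complex_algebra forms set \<Rightarrow> nat \<Rightarrow> nat \<Rightarrow> 'a forms set" where
  "hodge_ker C m p = cvec.span (hodge_ker_gens C m p)"

lemma subspace_hodge_ker: "cvec.subspace (hodge_ker C m p)"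
  by (simp add: hodge_ker_def)

lemmas hodge_ker_simps = cvec.subspace_0[OF subspace_hodge_ker] cvec.subspace_add[OF subspace_hodge_ker]
  cvec.subspace_diff[OF subspace_hodge_ker] cvec.subspace_neg[OF subspace_hodge_ker]
  cvec.subspace_scale[OF subspace_hodge_ker]

lemma homog_hodge_ker:
  assumes "t \<in> homog n" "n mod 2 \<noteq> p \<or> m < n"
  shows "t \<in> hodge_ker C m p"
proof -
  have "homog n \<subseteq> (hodge_ker C m p :: 'a forms set)"
    unfolding homog_def hodge_ker_def
    by (rule span_subset_span) (use assms(2) in \<open>auto simp: hodge_ker_gens_def intro: cvec.span_base\<close>)
  then show ?thesis using assms(1) by blast
qed

lemma b_hodge_ker_top: "t \<in> homog (Suc m) \<Longrightarrow> forms_b t \<in> hodge_ker C m p"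
  unfolding homog_def hodge_ker_def
  by (rule clinear_span_image[OF clinear_b]) (auto simp: hodge_ker_gens_def intro: cvec.span_base)

lemma init_1_hodge_ker: "tens_init 1 \<in> hodge_ker C m p"
  unfolding hodge_ker_def hodge_ker_gens_def by (rule cvec.span_base) simp

lemma span_hodge_ker: "x \<in> cvec.span C \<Longrightarrow> x \<in> hodge_ker C m p"
  using cvec.span_mono[of C "hodge_ker_gens C m p"] unfolding hodge_ker_def hodge_ker_gens_def by blast

lemma hodge_ker_map:
  assumes "clinear f" "x \<in> hodge_ker C m p"
    and "\<And>w. word_deg w mod 2 \<noteq> p \<or> m < word_deg w \<Longrightarrow> f (tword w) \<in> cvec.span B"
    and "f (tens_init 1) \<in> cvec.span B" "\<And>c. c \<in> C \<Longrightarrow> f c \<in> cvec.span B"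
    and "\<And>t. t \<in> homog (Suc m) \<Longrightarrow> f (forms_b t) \<in> cvec.span B"
  shows "f x \<in> cvec.span B"
proof (rule clinear_span_image[OF assms(1) _ assms(2)[unfolded hodge_ker_def]])
  fix x assume "x \<in> hodge_ker_gens C m p"
  then consider w where "x = tword w" "word_deg w mod 2 \<noteq> p \<or> m < word_deg w" | "x = tens_init 1" | "x \<in> C"
    | w where "x = forms_b (tword w)" "word_deg w = Suc m"
    unfolding hodge_ker_gens_def by blast
  then show "f x \<in> cvec.span B"
    by cases (use assms(3-6) tword_homog in \<open>metis+\<close>)
qed

text \<open>The set \<open>C\<close> stands for generators of the coinvariants.\<close>

locale forms_relations =
  fixes C :: "'a::complex_algebra forms set"
  assumes C_homog: "c \<in> C \<Longrightarrow> \<exists>n. c \<in> homog n"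
    and C_b: "c \<in> C \<Longrightarrow> forms_b c \<in> cvec.span C"
    and C_d: "c \<in> C \<Longrightarrow> forms_d c \<in> cvec.span C"
begin

lemma b_hodge_ker:
  assumes "x \<in> hodge_ker C m p" "p < 2"
  shows "forms_b x \<in> hodge_ker C m (1 - p)"
  unfolding hodge_ker_def
proof (rule hodge_ker_map[OF clinear_b assms(1)], fold hodge_ker_def)
  show "forms_b (tword w) \<in> hodge_ker C m (1 - p)" if w: "word_deg w mod 2 \<noteq> p \<or> m < word_deg w" for w
  proof (cases "word_deg w")
    case 0
    then show ?thesis using b_homog_0[OF tword_homog[of w, unfolded 0]] by (simp add: hodge_ker_simps)
  next
    case (Suc n)
    show ?thesis
    \<comment> \<open>Degree m + 1 is the critical case: b lands in degree m, which is not cut off,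
      but then the result is one of the listed boundaries.\<close>
    proof (cases "n = m")
      case True
      then show ?thesis using b_hodge_ker_top tword_homog[of w] Suc by metis
    next
      case False
      have "n mod 2 \<noteq> 1 - p \<or> m < n"
        using w False assms(2) unfolding Suc by presburger
      then show ?thesis
        using b_homog[of "tword w" n] tword_homog[of w] Suc by (metis homog_hodge_ker)
    qed
  qed
qed (simp_all add: b_init b_b hodge_ker_simps C_b span_hodge_ker)

lemma d_hodge_ker:
  assumes "x \<in> hodge_ker C m p" "p < 2"
  shows "forms_d x \<in> hodge_ker C m (1 - p)"
  unfolding hodge_ker_def
proof (rule hodge_ker_map[OF clinear_d assms(1)], fold hodge_ker_def)
  show "forms_d (tword w) \<in> hodge_ker C m (1 - p)" if w: "word_deg w mod 2 \<noteq> p \<or> m < word_deg w" for w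
  proof (rule homog_hodge_ker[OF d_homog[OF tword_homog]])
    show "Suc (word_deg w) mod 2 \<noteq> 1 - p \<or> m < Suc (word_deg w)"
      using w assms(2) by presburger
  qed
  show "forms_d (forms_b t) \<in> hodge_ker C m (1 - p)" if "t \<in> homog (Suc m)" for t
    by (rule homog_hodge_ker[OF d_homog[OF b_homog[OF that]]]) simp
qed (simp_all add: d_init hodge_ker_simps C_d span_hodge_ker snoc_simps)

text \<open>No degree has parity 2 or more, so every word counts as one of wrong parity. This lets
  \<open>F_map\<close> and \<open>G_map\<close> respect the kernels for every index
  \<open>p\<close>, as the tower criterion asks.\<close>

lemma hodge_ker_UNIV: "2 \<le> p \<Longrightarrow> x \<in> hodge_ker C m p"
proof -
  assume "2 \<le> p"
  then have "range tword \<subseteq> (hodge_ker_gens C m p :: 'a forms set)"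
    unfolding hodge_ker_gens_def by (auto intro: exI)
  then show ?thesis
    using span_tword[of x] cvec.span_mono unfolding hodge_ker_def by blast
qed

lemma k_hodge_ker: "x \<in> hodge_ker C m p \<Longrightarrow> forms_k x \<in> hodge_ker C m p"
proof (cases "p < 2")
  case True
  assume x: "x \<in> hodge_ker C m p"
  have "1 - p < 2" "1 - (1 - p) = p" using True by auto
  then show ?thesis
    using b_hodge_ker[OF d_hodge_ker[OF x True]] d_hodge_ker[OF b_hodge_ker[OF x True]] x
    by (simp add: forms_k_def hodge_ker_simps)
qed (simp add: hodge_ker_UNIV)

lemma kpoly_hodge_ker: "x \<in> hodge_ker C m p \<Longrightarrow> kpoly q x \<in> hodge_ker C m p"
  using op_poly_closed[of "hodge_ker_gens C m p" forms_k x q] k_hodge_ker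
  unfolding hodge_ker_def by blast

lemma hodge_ker_gens_homog:
  assumes "x \<in> hodge_ker_gens C m p"
  shows "\<exists>n. x \<in> homog n"
  using assms unfolding hodge_ker_gens_def
  by (auto intro: tword_homog init_homog C_homog) (metis b_homog tword_homog)

text \<open>All generators of the kernel are homogeneous, so on each of them a degree-dependent
  operator acts through a single \<open>F n\<close>.\<close>

lemma graded_hodge_ker:
  assumes "\<And>n. clinear (F n)" "\<And>n x. x \<in> hodge_ker C m p \<Longrightarrow> F n x \<in> hodge_ker C m q" "x \<in> hodge_ker C m p"
  shows "graded F x \<in> hodge_ker C m q"
  unfolding hodge_ker_def
proof (rule clinear_span_image[OF clinear_graded[OF assms(1)] _ assms(3)[unfolded hodge_ker_def]], fold hodge_ker_def)
  fix y assume y: "y \<in> hodge_ker_gens C m p"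
  then obtain n where "y \<in> homog n" using hodge_ker_gens_homog by blast
  moreover have "y \<in> hodge_ker C m p"
    unfolding hodge_ker_def using y by (rule cvec.span_base)
  ultimately show "graded F y \<in> hodge_ker C m q"
    by (simp add: graded_homog[OF assms(1)] assms(2))
qed

lemma F_map_hodge_ker: "x \<in> hodge_ker C m p \<Longrightarrow> F_map x \<in> hodge_ker C m p"
  unfolding F_map_def by (rule graded_hodge_ker[OF clinear_kpoly kpoly_hodge_ker])

lemma G_map_hodge_ker: "x \<in> hodge_ker C m p \<Longrightarrow> G_map x \<in> hodge_ker C m p"
  unfolding G_map_def by (rule graded_hodge_ker[OF clinear_kpoly kpoly_hodge_ker])

lemma h_hodge_hodge_ker: "x \<in> hodge_ker C m p \<Longrightarrow> p < 2 \<Longrightarrow> h_hodge x \<in> hodge_ker C m (1 - p)"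
  unfolding h_hodge_def
  by (rule graded_hodge_ker[OF clinear_h_hodge_summand])
    (simp_all add: hodge_ker_simps d_hodge_ker kpoly_hodge_ker del: One_nat_def)

lemma h_X_hodge_ker: "x \<in> hodge_ker C m p \<Longrightarrow> p < 2 \<Longrightarrow> h_X x \<in> hodge_ker C m (1 - p)"
  unfolding h_X_def
  by (rule graded_hodge_ker[OF clinear_h_X_summand])
    (simp_all add: hodge_ker_simps d_hodge_ker b_hodge_ker kpoly_hodge_ker del: One_nat_def)

lemma D_X_hodge_ker: "x \<in> hodge_ker C m p \<Longrightarrow> p < 2 \<Longrightarrow> D_X x \<in> hodge_ker C m (1 - p)"
  unfolding D_X_def
  by (rule graded_hodge_ker[OF clinear_D_X_summand])
    (simp_all add: hodge_ker_simps d_hodge_ker b_hodge_ker kpoly_hodge_ker del: One_nat_def)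

lemma D_hodge_hodge_ker: "x \<in> hodge_ker C m p \<Longrightarrow> p < 2 \<Longrightarrow> D_hodge x \<in> hodge_ker C m (1 - p)"
  unfolding D_hodge_def forms_B_graded
  by (intro hodge_ker_simps b_hodge_ker graded_hodge_ker[OF clinear_B_summand])
    (simp_all add: d_hodge_ker kpoly_hodge_ker del: One_nat_def)

theorem tower_homotopy_equivalent_D_X_D_hodge:
  assumes T: "presents_tower D_X (hodge_ker C) \<pi>e \<pi>o T" and U: "presents_tower D_hodge (hodge_ker C) \<pi>e' \<pi>o' U"
  shows "tower_homotopy_equivalent T U"
  by (rule tower_homotopy_equivalent_presents[OF T U clinear_D_X D_X_D_X clinear_D_hodge D_hodge_D_hodge
        clinear_F_map F_map_hodge_ker F_map_D_X clinear_G_map G_map_hodge_ker G_map_D_hodge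
        clinear_h_X _ _ homotopy_X clinear_h_hodge _ _ homotopy_hodge])
    (use h_X_hodge_ker[of _ _ 0] h_X_hodge_ker[of _ _ 1] h_hodge_hodge_ker[of _ _ 0] h_hodge_hodge_ker[of _ _ 1] in simp_all)

end

section \<open>Sweedler calculus\<close>

definition bilin :: "('a::complex_vector \<Rightarrow> 'b::complex_vector \<Rightarrow> 'c::complex_vector) \<Rightarrow> bool" where
  "bilin f \<longleftrightarrow> (\<forall>y. clinear (\<lambda>x. f x y)) \<and> (\<forall>x. clinear (f x))"

lemma bilinI: "(\<And>y. clinear (\<lambda>x. f x y)) \<Longrightarrow> (\<And>x. clinear (f x)) \<Longrightarrow> bilin f"
  by (simp add: bilin_def)

lemma bilinD: "bilin f \<Longrightarrow> clinear (\<lambda>x. f x y)" "bilin f \<Longrightarrow> clinear (f x)"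
  by (simp_all add: bilin_def)

lemma free_ext_tensor_eq:
  assumes "bilin f" "p - q \<in> cvec.span tensor_relators"
  shows "free_ext (\<lambda>(x, y). f x y) p = free_ext (\<lambda>(x, y). f x y) q"
proof -
  note lin = clinear_free_ext[of "\<lambda>(x, y). f x y"]
  have "free_ext (\<lambda>(x, y). f x y) r = 0" if "r \<in> tensor_relators" for r
    using that unfolding tensor_relators_def
    by (auto simp: clinear_simps[OF lin] clinear_simps[OF bilinD(1)[OF assms(1)]] clinear_simps[OF bilinD(2)[OF assms(1)]])
  from free_ext_vanishes_span[of tensor_relators "\<lambda>(x, y). f x y", OF this assms(2)] show ?thesis
    by (simp add: clinear_diff[OF lin])
qed

lemma tensor_lift_abs:
  assumes "bilin f"
  shows "tensor_lift f (abs_tensor p) = free_ext (\<lambda>(x, y). f x y) p"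
  unfolding tensor_lift_def
  by (rule free_ext_tensor_eq[OF assms])
    (use Quotient3_rep_abs[OF Quotient3_tensor] equivp_reflp[OF tensor_equivp] in blast)

lemma tensor_lift_pure [simp]: "bilin f \<Longrightarrow> tensor_lift f (x \<otimes> y) = f x y"
  by (simp add: pure_tensor.abs_eq tensor_lift_abs)

lemma clinear_tensor_lift:
  assumes "bilin f"
  shows "clinear (tensor_lift f)"
  unfolding clinear_iff
proof (intro conjI allI)
  note lin = clinear_free_ext[of "\<lambda>(x, y). f x y"]
  fix s t :: "('a, 'b) tensor" and c
  obtain p q where "s = abs_tensor p" "t = abs_tensor q"
    by (metis Quotient3_abs_rep[OF Quotient3_tensor])
  then show "tensor_lift f (s + t) = tensor_lift f s + tensor_lift f t"
    "tensor_lift f (c *\<^sub>C s) = c *\<^sub>C tensor_lift f s"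
    using lin by (simp_all add: plus_tensor.abs_eq scaleC_tensor.abs_eq tensor_lift_abs[OF assms] clinear_iff)
qed

text \<open>\<open>tensor_lift f t\<close> is a finite sum of values of \<open>f\<close>, so that the following rules hold for
  arbitrary \<open>f\<close>; bilinearity only matters for the dependence on \<open>t\<close>.\<close>

lemma tensor_lift_sum: "tensor_lift f t =
    (\<Sum>k\<in>Poly_Mapping.keys (rep_tensor t). Poly_Mapping.lookup (rep_tensor t) k *\<^sub>C f (fst k) (snd k))"
  by (simp add: tensor_lift_def free_ext_def case_prod_beta)

lemma tensor_lift_clinear: "clinear L \<Longrightarrow> L (tensor_lift f t) = tensor_lift (\<lambda>x y. L (f x y)) t"
  by (simp add: tensor_lift_sum clinear_simps)

lemma tensor_lift_add: "tensor_lift (\<lambda>x y. f x y + g x y) t = tensor_lift f t + tensor_lift g t"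
  by (simp add: tensor_lift_sum scaleC_add_right sum.distrib)

lemma tensor_lift_diff: "tensor_lift (\<lambda>x y. f x y - g x y) t = tensor_lift f t - tensor_lift g t"
  by (simp add: tensor_lift_sum cvec.scale_right_diff_distrib sum_subtractf)

lemma tensor_lift_scale: "tensor_lift (\<lambda>x y. c *\<^sub>C f x y) t = c *\<^sub>C tensor_lift f t"
  by (simp add: tensor_lift_sum cvec.scale_sum_right scaleC_scaleC mult.commute)

lemma tensor_lift_swap:
  "tensor_lift (\<lambda>x y. tensor_lift (f x y) t) s = tensor_lift (\<lambda>u v. tensor_lift (\<lambda>x y. f x y u v) s) t"
  by (simp add: tensor_lift_sum cvec.scale_sum_right scaleC_scaleC mult.commute) (rule sum.swap)

lemma clinear_tensor_lift_param:
  assumes "\<And>x y. clinear (\<lambda>p. f p x y)"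
  shows "clinear (\<lambda>p. tensor_lift (f p) t)"
  unfolding tensor_lift_sum by (intro clinear_sum_fun clinear_scale_fun assms)

lemma tensor_lift_span:
  assumes "\<And>x y. f x y \<in> cvec.span B"
  shows "tensor_lift f t \<in> cvec.span B"
  unfolding tensor_lift_sum by (intro cvec.span_sum cvec.span_scale assms)

definition trilin :: "('a::complex_vector \<Rightarrow> 'b::complex_vector \<Rightarrow> 'c::complex_vector \<Rightarrow> 'd::complex_vector) \<Rightarrow> bool" where
  "trilin f \<longleftrightarrow> (\<forall>y z. clinear (\<lambda>x. f x y z)) \<and> (\<forall>x z. clinear (\<lambda>y. f x y z)) \<and> (\<forall>x y. clinear (f x y))"

lemma trilinI: "(\<And>y z. clinear (\<lambda>x. f x y z)) \<Longrightarrow> (\<And>x z. clinear (\<lambda>y. f x y z)) \<Longrightarrow> (\<And>x y. clinear (f x y)) \<Longrightarrow> trilin f"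
  by (simp add: trilin_def)

lemma trilinD:
  assumes "trilin f"
  shows "clinear (\<lambda>x. f x y z)" "clinear (\<lambda>y. f x y z)" "clinear (f x y)" "bilin (f x)"
    "bilin (\<lambda>y z. f y z x)" "bilin (\<lambda>y z. f y x z)"
  using assms by (auto simp: trilin_def bilin_def)

context hopf_algebra
begin

abbreviation sw :: "('h \<Rightarrow> 'h \<Rightarrow> 'v::complex_vector) \<Rightarrow> 'h \<Rightarrow> 'v" where
  "sw f h \<equiv> tensor_lift f (\<Delta> h)"

lemma clinear_sw: "bilin f \<Longrightarrow> clinear (sw f)"
  by (rule clinear_comp[OF linear_comult clinear_tensor_lift])

text \<open>A trilinear map is a linear map on the iterated tensor product; both sides are its
  values on the two sides of the coassociativity axiom.\<close>

lemma sw_coassoc: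
  assumes "trilin f"
  shows "sw (\<lambda>x y. sw (\<lambda>x\<^sub>0 x\<^sub>1. f x\<^sub>0 x\<^sub>1 y) x) h = sw (\<lambda>x y. sw (f x) y) h"
proof -
  let ?L = "tensor_lift (\<lambda>x t. tensor_lift (f x) t)"
  have bl: "bilin (\<lambda>x t. tensor_lift (f x) t)"
    by (intro bilinI clinear_tensor_lift clinear_tensor_lift_param trilinD[OF assms])
  note L = tensor_lift_clinear[OF clinear_tensor_lift[OF bl]]
  have "?L (sw (\<lambda>x y. sw (\<lambda>x\<^sub>0 x\<^sub>1. x\<^sub>0 \<otimes> x\<^sub>1 \<otimes> y) x) h) = ?L (sw (\<lambda>x y. x \<otimes> \<Delta> y) h)"
    by (simp only: coassoc)
  then show ?thesis
    by (simp add: L bl trilinD[OF assms])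
qed

lemma sw_counit_left: "clinear f \<Longrightarrow> sw (\<lambda>x y. \<epsilon> x *\<^sub>C f y) h = f h"
  using arg_cong[OF counit_left[of h], of f]
  by (simp add: tensor_lift_clinear clinear_scale)

lemma sw_counit_right: "clinear f \<Longrightarrow> sw (\<lambda>x y. \<epsilon> y *\<^sub>C f x) h = f h"
  using arg_cong[OF counit_right[of h], of f]
  by (simp add: tensor_lift_clinear clinear_scale)

lemma sw_antipode_left: "clinear f \<Longrightarrow> sw (\<lambda>x y. f (S x * y)) h = \<epsilon> h *\<^sub>C f 1"
  using arg_cong[OF antipode_left[of h], of f]
  by (simp add: tensor_lift_clinear clinear_scale)

lemma sw_antipode_right: "clinear f \<Longrightarrow> sw (\<lambda>x y. f (x * S y)) h = \<epsilon> h *\<^sub>C f 1"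
  using arg_cong[OF antipode_right[of h], of f]
  by (simp add: tensor_lift_clinear clinear_scale)

lemma sw_mult:
  assumes "bilin f"
  shows "sw f (g * h) = sw (\<lambda>g\<^sub>0 g\<^sub>1. sw (\<lambda>h\<^sub>0 h\<^sub>1. f (g\<^sub>0 * h\<^sub>0) (g\<^sub>1 * h\<^sub>1)) h) g"
  unfolding comult_mult by (simp add: tensor_lift_clinear[OF clinear_tensor_lift[OF assms]] assms)

lemma sw_one: "bilin f \<Longrightarrow> sw f 1 = f 1 1"
  by (simp add: comult_one)

lemma antipode_one: "S 1 = 1"
proof -
  have "bilin (\<lambda>x y. S x * y)"
    by (intro bilinI clinear_comp[OF linear_antipode clinear_mult_left] clinear_mult_right)
  then show ?thesis
    using antipode_left[of 1] by (simp add: comult_one counit_one scaleC_one)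
qed

lemmas clinear_mult_S = clinear_comp[OF linear_antipode clinear_mult_left] clinear_comp[OF linear_antipode clinear_mult_right]

lemma antipode_mult: "S (g * h) = S h * S g"
proof -
  note cm = clinear_mult_left clinear_mult_right
  have S: "clinear (\<lambda>x. S (f x))" if "clinear f" for f :: "'h \<Rightarrow> 'h"
    by (rule clinear_comp[OF that linear_antipode])
  have ml: "clinear (\<lambda>x. f x * c)" if "clinear f" for f :: "'h \<Rightarrow> 'h" and c
    by (rule clinear_comp[OF that clinear_mult_left])
  have mr: "clinear (\<lambda>x. c * f x)" if "clinear f" for f :: "'h \<Rightarrow> 'h" and c
    by (rule clinear_comp[OF that clinear_mult_right])
  note lin = ml mr S clinear_ident
  have 1: "sw (\<lambda>a b. sw (\<lambda>c d. S (a * c) * (b * d) * z) y) x = (\<epsilon> x * \<epsilon> y) *\<^sub>C z" for x y z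
  proof -
    have "sw (\<lambda>a b. sw (\<lambda>c d. S (a * c) * (b * d) * z) y) x = sw (\<lambda>a b. S a * b * z) (x * y)"
      by (subst sw_mult) (auto intro!: bilinI lin)
    then show ?thesis
      using sw_antipode_left[of "\<lambda>u. u * z" "x * y"] by (simp add: ml clinear_ident counit_mult)
  qed
  \<comment> \<open>In Sweedler notation S(g_0 h_0) (g_1 h_1) S(h_2) S(g_2). Cancelling the first
    two factors leaves S(h) S(g); cancelling from the inside, first h and then g, leaves
    S(gh).\<close>
  let ?f = "\<lambda>g\<^sub>0 g' h\<^sub>0 h'. sw (\<lambda>a b. sw (\<lambda>c d. S (a * c) * (b * d) * (S h' * S g')) h\<^sub>0) g\<^sub>0"
  have "sw (\<lambda>g\<^sub>0 g'. sw (\<lambda>h\<^sub>0 h'. ?f g\<^sub>0 g' h\<^sub>0 h') h) g =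
      sw (\<lambda>g\<^sub>0 g'. \<epsilon> g\<^sub>0 *\<^sub>C sw (\<lambda>h\<^sub>0 h'. \<epsilon> h\<^sub>0 *\<^sub>C (S h' * S g')) h) g"
    by (simp only: 1 scaleC_scaleC[symmetric] tensor_lift_scale)
  also have "\<dots> = S h * S g"
    by (subst sw_counit_left, intro lin)+ (rule refl)
  finally have L: "sw (\<lambda>g\<^sub>0 g'. sw (\<lambda>h\<^sub>0 h'. ?f g\<^sub>0 g' h\<^sub>0 h') h) g = S h * S g" .
  have 2: "sw (\<lambda>h\<^sub>0 h'. sw (\<lambda>c d. S (a * c) * (b * d) * (S h' * S g')) h\<^sub>0) h = S (a * h) * b * S g'" for a b g'
  proof -
    have "sw (\<lambda>h\<^sub>0 h'. sw (\<lambda>c d. S (a * c) * (b * d) * (S h' * S g')) h\<^sub>0) h =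
        sw (\<lambda>c h''. sw (\<lambda>d h'. S (a * c) * (b * d) * (S h' * S g')) h'') h"
      by (rule sw_coassoc) (intro trilinI lin)
    also have "\<dots> = sw (\<lambda>c h''. sw (\<lambda>d h'. S (a * c) * b * (d * S h') * S g') h'') h"
      by (simp add: mult.assoc)
    also have "\<dots> = sw (\<lambda>c h''. \<epsilon> h'' *\<^sub>C (S (a * c) * b * S g')) h"
      by (subst sw_antipode_right) (auto intro!: lin)
    also have "\<dots> = S (a * h) * b * S g'"
      by (subst sw_counit_right) (auto intro!: lin)
    finally show ?thesis .
  qed
  have "sw (\<lambda>g\<^sub>0 g'. sw (\<lambda>h\<^sub>0 h'. ?f g\<^sub>0 g' h\<^sub>0 h') h) g =
      sw (\<lambda>g\<^sub>0 g'. sw (\<lambda>a b. sw (\<lambda>h\<^sub>0 h'. sw (\<lambda>c d. S (a * c) * (b * d) * (S h' * S g')) h\<^sub>0) h) g\<^sub>0) g"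
    by (subst tensor_lift_swap) (rule refl)
  also have "\<dots> = sw (\<lambda>g\<^sub>0 g'. sw (\<lambda>a b. S (a * h) * b * S g') g\<^sub>0) g"
    by (simp only: 2)
  also have "\<dots> = sw (\<lambda>a g''. sw (\<lambda>b g'. S (a * h) * b * S g') g'') g"
    by (rule sw_coassoc) (intro trilinI lin)
  also have "\<dots> = sw (\<lambda>a g''. sw (\<lambda>b g'. S (a * h) * (b * S g')) g'') g"
    by (simp add: mult.assoc)
  also have "\<dots> = sw (\<lambda>a g''. \<epsilon> g'' *\<^sub>C (S (a * h))) g"
    by (subst sw_antipode_right) (auto intro!: lin)
  also have "\<dots> = S (g * h)"
    by (subst sw_counit_right) (auto intro!: lin)
  finally show ?thesis using L by simp
qed

end

locale twisted_hopf = hopf_algebra \<Delta> \<epsilon> S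
  for \<Delta> :: "'h::complex_algebra_1 \<Rightarrow> ('h, 'h) tensor" and \<epsilon> S +
  fixes \<delta> :: "'h \<Rightarrow> complex"
  assumes character: "character \<delta>"
    and twisted_involutive: "twisted_antipode \<Delta> S \<delta> (twisted_antipode \<Delta> S \<delta> h) = h"
begin

abbreviation S\<^sub>\<delta> :: "'h \<Rightarrow> 'h" where
  "S\<^sub>\<delta> \<equiv> twisted_antipode \<Delta> S \<delta>"

lemma delta_linear: "clinear \<delta>" and delta_mult: "\<delta> (g * h) = \<delta> g * \<delta> h"
  using character by (simp_all add: character_def)

lemma delta_one: "\<delta> 1 = 1"
proof -
  obtain h where "\<delta> h \<noteq> 0" using character by (auto simp: character_def)
  then show ?thesis using delta_mult[of 1 h] by simp
qed

lemma clinear_delta_scale: "clinear (\<lambda>x. \<delta> x *\<^sub>C v)"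
  using delta_linear by (simp add: clinear_iff scaleC_add_left scaleC_scaleC scaleC_complex_def)

lemma bilin_twisted: "bilin (\<lambda>x y. \<delta> x *\<^sub>C S y)"
  by (intro bilinI clinear_delta_scale clinear_scale_fun linear_antipode)

lemma clinear_twisted: "clinear S\<^sub>\<delta>"
  unfolding twisted_antipode_def[abs_def] by (rule clinear_sw[OF bilin_twisted])

lemma twisted_one: "S\<^sub>\<delta> 1 = 1"
  by (simp add: twisted_antipode_def sw_one[OF bilin_twisted] delta_one antipode_one scaleC_one)

lemma twisted_mult: "S\<^sub>\<delta> (g * h) = S\<^sub>\<delta> h * S\<^sub>\<delta> g"
proof -
  have "S\<^sub>\<delta> (g * h) = sw (\<lambda>g\<^sub>0 g\<^sub>1. sw (\<lambda>h\<^sub>0 h\<^sub>1. (\<delta> h\<^sub>0 *\<^sub>C S h\<^sub>1) * (\<delta> g\<^sub>0 *\<^sub>C S g\<^sub>1)) h) g"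
    unfolding twisted_antipode_def sw_mult[OF bilin_twisted]
    by (simp add: delta_mult antipode_mult mult_scaleC_left mult_scaleC_right scaleC_scaleC mult.commute)
  also have "\<dots> = sw (\<lambda>g\<^sub>0 g\<^sub>1. S\<^sub>\<delta> h * (\<delta> g\<^sub>0 *\<^sub>C S g\<^sub>1)) g"
    by (simp add: twisted_antipode_def flip: tensor_lift_clinear[OF clinear_mult_left])
  also have "\<dots> = S\<^sub>\<delta> h * S\<^sub>\<delta> g"
    by (simp add: twisted_antipode_def flip: tensor_lift_clinear[OF clinear_mult_right])
  finally show ?thesis .
qed

lemma twisted_antipode_left: "sw (\<lambda>x y. S\<^sub>\<delta> x * y) h = \<delta> h *\<^sub>C 1"
proof -
  have "sw (\<lambda>x y. S\<^sub>\<delta> x * y) h = sw (\<lambda>x y. sw (\<lambda>x\<^sub>0 x\<^sub>1. \<delta> x\<^sub>0 *\<^sub>C (S x\<^sub>1 * y)) x) h"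
    by (simp add: twisted_antipode_def tensor_lift_clinear[OF clinear_mult_left] mult_scaleC_left)
  also have "\<dots> = sw (\<lambda>x y. sw (\<lambda>y\<^sub>0 y\<^sub>1. \<delta> x *\<^sub>C (S y\<^sub>0 * y\<^sub>1)) y) h"
    by (rule sw_coassoc) (intro trilinI clinear_delta_scale clinear_scale_fun clinear_mult_S clinear_mult_right)
  also have "\<dots> = sw (\<lambda>x y. \<epsilon> y *\<^sub>C (\<delta> x *\<^sub>C 1)) h"
    by (simp add: tensor_lift_scale antipode_left scaleC_scaleC mult.commute)
  also have "\<dots> = \<delta> h *\<^sub>C 1"
    by (rule sw_counit_right[OF clinear_delta_scale])
  finally show ?thesis .
qed

text \<open>Apply \<open>S\<^sub>\<delta>\<close> to \<open>twisted_antipode_left\<close>: it is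
  antimultiplicative and involutive, so the two factors return in the opposite order. This is the
  one place where the square being the identity is used.\<close>

lemma twisted_antipode_flip: "sw (\<lambda>x y. S\<^sub>\<delta> y * x) h = \<delta> h *\<^sub>C 1"
  using arg_cong[OF twisted_antipode_left[of h], of S\<^sub>\<delta>]
  by (simp add: tensor_lift_clinear[OF clinear_twisted] twisted_mult twisted_involutive
      clinear_scale[OF clinear_twisted] twisted_one)

end

text \<open>A complement of \<open>W\<close> gives a projection with kernel \<open>W\<close>.
  Composing with it turns congruences modulo \<open>W\<close> into equations, which can be rewritten
  inside Sweedler sums.\<close>

lemma subspace_kernel_exists:
  assumes "cvec.subspace (W :: 'w::complex_vector set)"
  shows "\<exists>q :: 'w \<Rightarrow> 'w. clinear q \<and> (\<forall>x. q x = 0 \<longleftrightarrow> x \<in> W)"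
proof -
  interpret pair: vector_space_pair "scaleC :: complex \<Rightarrow> 'w \<Rightarrow> 'w" "scaleC :: complex \<Rightarrow> 'w \<Rightarrow> 'w" ..
  obtain g where g: "range g \<subseteq> W" "clinear g" "\<forall>v\<in>W. g v = v"
    using pair.linear_exists_left_inverse_on[OF clinear_ident assms] by auto
  have "clinear (\<lambda>x. x - g x)"
    by (intro clinear_diff_fun clinear_ident g(2))
  moreover have "x - g x = 0 \<longleftrightarrow> x \<in> W" for x
    using g(1,3) by (metis eq_iff_diff_eq_0 rangeI subsetD)
  ultimately show ?thesis by blast
qed

definition hmodule :: "('h::complex_algebra_1 \<Rightarrow> 'v::complex_vector \<Rightarrow> 'v) \<Rightarrow> bool" where
  "hmodule \<alpha> \<longleftrightarrow> bilin \<alpha> \<and> (\<forall>g h v. \<alpha> (g * h) v = \<alpha> g (\<alpha> h v)) \<and> (\<forall>v. \<alpha> 1 v = v)"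

lemma hmoduleD:
  assumes "hmodule \<alpha>"
  shows "bilin \<alpha>" "clinear (\<lambda>h. \<alpha> h v)" "clinear (\<alpha> h)" "\<alpha> (g * h) v = \<alpha> g (\<alpha> h v)" "\<alpha> 1 v = v"
  using assms by (auto simp: hmodule_def bilin_def)

text \<open>In the coinvariants, two tensor factors may be exchanged: this is where the assumption on the
  twisted antipode enters.\<close>

lemma (in twisted_hopf) flip_coinvariants:
  fixes F :: "'a::complex_vector \<Rightarrow> 'b::complex_vector \<Rightarrow> 'c::complex_vector"
  assumes \<alpha>: "hmodule \<alpha>" and \<beta>: "hmodule \<beta>" and F: "bilin F" and W: "cvec.subspace W"
    and V: "\<And>h v. v \<in> V \<Longrightarrow> \<beta> h v \<in> V"
    and hyp: "\<And>g a v. v \<in> V \<Longrightarrow> sw (\<lambda>x y. F (\<alpha> x a) (\<beta> y v)) g - \<delta> g *\<^sub>C F a v \<in> W"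
    and v: "v \<in> V"
  shows "sw (\<lambda>x y. F (\<alpha> y a) (\<beta> x v)) h - \<delta> h *\<^sub>C F a v \<in> W"
proof -
  obtain q :: "'c \<Rightarrow> 'c" where q: "clinear q" "\<And>x. q x = 0 \<longleftrightarrow> x \<in> W"
    using subspace_kernel_exists[OF W] by auto
  define F' where "F' a v = q (F a v)" for a v
  have F': "bilin F'"
    unfolding F'_def by (intro bilinI clinear_comp[OF _ q(1)] bilinD[OF F])
  have hyp': "sw (\<lambda>x y. F' (\<alpha> x a) (\<beta> y v)) g = \<delta> g *\<^sub>C F' a v" if "v \<in> V" for g a v
  proof -
    have "q (sw (\<lambda>x y. F (\<alpha> x a) (\<beta> y v)) g) - q (\<delta> g *\<^sub>C F a v) = 0"
      using hyp[OF that] q by (metis clinear_diff)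
    then show ?thesis
      by (simp add: F'_def clinear_scale[OF q(1)] tensor_lift_clinear[OF q(1)])
  qed
  have lin: "clinear (\<lambda>x. F' (\<alpha> x a) w)" "clinear (\<lambda>x. F' b (\<beta> x w))" "clinear (\<lambda>x. F' b (\<beta> (f x) w))"
    if "clinear f" for a b w and f :: "'h \<Rightarrow> 'h"
    by (intro clinear_comp[OF hmoduleD(2)[OF \<alpha>] bilinD(1)[OF F']] clinear_comp[OF hmoduleD(2)[OF \<beta>] bilinD(2)[OF F']]
        clinear_comp[OF clinear_comp[OF that hmoduleD(2)[OF \<beta>]] bilinD(2)[OF F']])+
  \<comment> \<open>Integration by parts: write h as h_0 \<epsilon>(h_1), insert h_1 S(h_2) in front
    of \<open>v\<close>, and use the invariance hypothesis for the pair h_0, h_1. What remains is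
    \<delta>(h_0) S(h_1).\<close>
  have A: "F' (\<alpha> h a) v = F' a (\<beta> (S\<^sub>\<delta> h) v)" if "v \<in> V" for h a v
  proof -
    have "F' (\<alpha> h a) v = sw (\<lambda>x y. \<epsilon> y *\<^sub>C F' (\<alpha> x a) v) h"
      by (rule sw_counit_right[symmetric]) (rule lin[OF clinear_ident])
    also have "\<dots> = sw (\<lambda>x y. sw (\<lambda>y\<^sub>0 y\<^sub>1. F' (\<alpha> x a) (\<beta> (y\<^sub>0 * S y\<^sub>1) v)) y) h"
      by (subst sw_antipode_right) (simp_all add: lin[OF clinear_ident] hmoduleD(5)[OF \<beta>])
    also have "\<dots> = sw (\<lambda>x y. sw (\<lambda>x\<^sub>0 x\<^sub>1. F' (\<alpha> x\<^sub>0 a) (\<beta> (x\<^sub>1 * S y) v)) x) h"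
      by (rule sw_coassoc[symmetric]) (intro trilinI lin(1)[OF clinear_ident] lin(3) clinear_mult_left clinear_mult_S)
    also have "\<dots> = sw (\<lambda>x y. \<delta> x *\<^sub>C F' a (\<beta> (S y) v)) h"
      by (simp only: hmoduleD(4)[OF \<beta>] hyp' V that)
    also have "\<dots> = F' a (\<beta> (S\<^sub>\<delta> h) v)"
      unfolding twisted_antipode_def
      by (subst tensor_lift_clinear[OF lin(2)[OF clinear_ident]])
        (simp add: clinear_scale[OF lin(2)[OF clinear_ident]])
    finally show ?thesis .
  qed
  \<comment> \<open>Moving the action from \<open>a\<close> to \<open>v\<close> produces the twisted
    antipode of the second leg times the first leg, the reverse of the usual antipode
    identity.\<close>
  have "sw (\<lambda>x y. F' (\<alpha> y a) (\<beta> x v)) h = sw (\<lambda>x y. F' a (\<beta> (S\<^sub>\<delta> y * x) v)) h"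
    by (simp add: A V v hmoduleD(4)[OF \<beta>])
  also have "\<dots> = \<delta> h *\<^sub>C F' a v"
    by (subst tensor_lift_clinear[OF lin(2)[OF clinear_ident], symmetric])
      (simp add: twisted_antipode_flip clinear_scale[OF lin(2)[OF clinear_ident]] hmoduleD(5)[OF \<beta>])
  finally have "q (sw (\<lambda>x y. F (\<alpha> y a) (\<beta> x v)) h - \<delta> h *\<^sub>C F a v) = 0"
    by (simp add: F'_def clinear_diff[OF q(1)] clinear_scale[OF q(1)] tensor_lift_clinear[OF q(1)])
  then show ?thesis by (simp add: q(2))
qed

lemma bilin_left: "bilin f \<Longrightarrow> clinear g \<Longrightarrow> clinear (\<lambda>x. f (g x) y)"
  by (rule clinear_comp[OF _ bilinD(1)])

lemma bilin_right: "bilin f \<Longrightarrow> clinear g \<Longrightarrow> clinear (\<lambda>x. f y (g x))"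
  by (rule clinear_comp[OF _ bilinD(2)])

lemma bilin_snoc: "bilin tens_snoc"
  by (intro bilinI clinear_snoc clinear_snoc_right)

lemma bilin_lmul: "bilin forms_lmul"
  by (intro bilinI clinear_lmul clinear_lmul_right)

lemma bilin_mult: "bilin ((*) :: 'a::complex_algebra \<Rightarrow> 'a \<Rightarrow> 'a)"
  by (intro bilinI clinear_mult_left clinear_mult_right)

lemma bilin_comp:
  assumes "bilin f" "clinear g" "clinear h"
  shows "bilin (\<lambda>x y. f (g x) (h y))"
  by (rule bilinI, rule bilin_left[OF assms(1,2)], rule bilin_right[OF assms(1,3)])

lemma bilin_post:
  assumes "bilin f" "clinear g"
  shows "bilin (\<lambda>x y. g (f x y))"
  by (rule bilinI, rule clinear_comp[OF bilinD(1)[OF assms(1)] assms(2)],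
      rule clinear_comp[OF bilinD(2)[OF assms(1)] assms(2)])

section \<open>Diagonal actions\<close>

context hopf_algebra
begin

context
  fixes actX :: "'h \<Rightarrow> 'x::complex_vector \<Rightarrow> 'x" and act :: "'h \<Rightarrow> 'a::complex_vector \<Rightarrow> 'a"
  assumes actX: "hmodule actX" and act: "hmodule act"
begin

lemma clinear_diag_word: "clinear (diag_word \<Delta> actX act w)"
proof (induct w)
  case (Init x)
  show ?case by (simp add: clinear_comp[OF hmoduleD(2)[OF actX] clinear_tword_Init])
next
  case (Snoc w a)
  show ?case
    by (simp, rule clinear_sw) (intro bilin_comp[OF bilin_snoc] Snoc hmoduleD(2)[OF act])
qed

lemma multilinear_diag_word: "multilinear_word (\<lambda>w. diag_word \<Delta> actX act w h)"
proof (rule multilinear_wordI[where f = "\<lambda>h w. diag_word \<Delta> actX act w h"])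
  show "clinear (\<lambda>x. diag_word \<Delta> actX act (Init x) p)" for p
    by (simp add: clinear_comp[OF hmoduleD(3)[OF actX] clinear_tword_Init])
  show "clinear (\<lambda>a. diag_word \<Delta> actX act (Snoc w a) p)" for w p
    by (simp, intro clinear_tensor_lift_param bilin_right[OF bilin_snoc] hmoduleD(3)[OF act])
qed (simp_all add: snoc_simps tensor_lift_add tensor_lift_scale)

lemma clinear_diag: "clinear (diag_act \<Delta> actX act h)"
  unfolding diag_act_def[abs_def] by (rule clinear_tens_lift[OF multilinear_diag_word])

lemma diag_tword: "diag_act \<Delta> actX act h (tword w) = diag_word \<Delta> actX act w h"
  by (simp add: diag_act_def tens_lift_tword[OF multilinear_diag_word])

lemma diag_init: "diag_act \<Delta> actX act h (tens_init x) = tens_init (actX h x)"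
  by (simp add: diag_tword)

lemma diag_snoc:
  "diag_act \<Delta> actX act h (tens_snoc t a) = sw (\<lambda>x y. tens_snoc (diag_act \<Delta> actX act x t) (act y a)) h"
  by (rule clinear_eq_on_tword[OF clinear_comp[OF clinear_snoc clinear_diag]
        clinear_tensor_lift_param[OF clinear_comp[OF clinear_diag clinear_snoc]]])
    (simp add: snoc_tword diag_tword)

lemma bilin_diag: "bilin (diag_act \<Delta> actX act)"
proof (rule bilinI[OF _ clinear_diag], unfold clinear_iff, intro conjI allI)
  fix t g h c
  show "diag_act \<Delta> actX act (g + h) t = diag_act \<Delta> actX act g t + diag_act \<Delta> actX act h t"
    by (rule clinear_eq_on_tword[OF clinear_diag clinear_add_fun[OF clinear_diag clinear_diag]])
      (simp add: diag_tword clinear_add[OF clinear_diag_word])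
  show "diag_act \<Delta> actX act (c *\<^sub>C h) t = c *\<^sub>C diag_act \<Delta> actX act h t"
    by (rule clinear_eq_on_tword[OF clinear_diag clinear_scale_fun[OF clinear_diag]])
      (simp add: diag_tword clinear_scale[OF clinear_diag_word])
qed

lemma bilin_snoc_diag: "bilin (\<lambda>x y. tens_snoc (diag_act \<Delta> actX act x t) (act y a))"
  by (intro bilin_comp[OF bilin_snoc] bilinD(1)[OF bilin_diag] hmoduleD(2)[OF act])

lemma hmodule_diag: "hmodule (diag_act \<Delta> actX act)"
  unfolding hmodule_def
proof (intro conjI allI bilin_diag)
  fix t g h
  show "diag_act \<Delta> actX act 1 t = t"
    by (rule tens_induct[OF clinear_diag clinear_ident])
      (simp_all add: diag_init diag_snoc sw_one[OF bilin_snoc_diag] hmoduleD(5)[OF act] hmoduleD(5)[OF actX])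
  have "\<forall>g h. diag_act \<Delta> actX act (g * h) (tword w) = diag_act \<Delta> actX act g (diag_act \<Delta> actX act h (tword w))" for w
  proof (induct w)
    case (Init x)
    then show ?case by (simp add: diag_init hmoduleD(4)[OF actX])
  next
    case (Snoc w a)
    show ?case
    proof (intro allI)
      fix g h
      show "diag_act \<Delta> actX act (g * h) (tword (Snoc w a)) = diag_act \<Delta> actX act g (diag_act \<Delta> actX act h (tword (Snoc w a)))"
        by (simp only: snoc_tword[symmetric] diag_snoc sw_mult[OF bilin_snoc_diag] Snoc[rule_format] hmoduleD(4)[OF act]
            tensor_lift_clinear[OF clinear_diag]) (rule tensor_lift_swap)
    qed
  qed
  then show "diag_act \<Delta> actX act (g * h) t = diag_act \<Delta> actX act g (diag_act \<Delta> actX act h t)"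
    using clinear_eq_on_tword[OF clinear_diag clinear_comp[OF clinear_diag clinear_diag]] by blast
qed

lemma diag_homog: "t \<in> homog n \<Longrightarrow> diag_act \<Delta> actX act h t \<in> homog n"
proof (rule homog_map[OF clinear_diag])
  show "diag_act \<Delta> actX act h (tword w) \<in> homog n" if "word_deg w = n" for w n
    using that
  proof (induct w arbitrary: n h)
    case (Init x)
    then show ?case using init_homog[of "actX h x"] by (simp add: diag_init)
  next
    case (Snoc w a)
    have "tens_snoc (diag_act \<Delta> actX act x (tword w)) (act y a) \<in> homog n" for x y
      using snoc_homog[OF Snoc(1)[OF refl]] Snoc(2) by auto
    then show ?case
      by (simp add: diag_snoc tensor_lift_span homog_def flip: snoc_tword)
  qed
qed

end

lemma hmodule_module_algebra: "hopf_module_algebra \<Delta> act \<Longrightarrow> hmodule act"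
  unfolding hopf_module_algebra_def hmodule_def bilin_def by auto

lemma scaleC_complex: "c *\<^sub>C (x :: complex) = c * x"
  by (simp add: scaleC_complex_def)

lemma clinear_adj: "clinear f \<Longrightarrow> clinear g \<Longrightarrow> clinear (\<lambda>x. Adj (f x) (g x))"
  by (auto simp: clinear_iff plus_adj_def scaleC_adj_def scaleC_complex)

lemma clinear_scalar_part: "clinear scalar_part"
  by (simp add: clinear_iff scaleC_complex)

lemma adj_module_algebra:
  fixes act :: "'h \<Rightarrow> 'a::complex_algebra \<Rightarrow> 'a"
  assumes "hopf_module_algebra \<Delta> act"
  shows "hopf_module_algebra \<Delta> (adj_act \<epsilon> act)"
proof -
  interpret hopf_module_algebra \<Delta> act by (rule assms)
  have e: "clinear (\<lambda>h. \<epsilon> h * c)" for c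
    using linear_counit by (simp add: clinear_iff scaleC_complex algebra_simps)
  show "hopf_module_algebra \<Delta> (adj_act \<epsilon> act)"
  proof (rule hopf_module_algebra.intro)
    fix a b :: "'a adj" and g h :: 'h
    show "clinear (\<lambda>h. adj_act \<epsilon> act h a)"
      unfolding adj_act_def by (intro clinear_adj e act_linear_left)
    show "clinear (adj_act \<epsilon> act h)"
      unfolding adj_act_def
      by (intro clinear_adj clinear_comp[OF clinear_scalar_part clinear_mult_right]
          clinear_comp[OF clinear_alg_part act_linear_right])
    show "adj_act \<epsilon> act (g * h) a = adj_act \<epsilon> act g (adj_act \<epsilon> act h a)"
      by (simp add: adj_act_def counit_mult act_mult)
    show "adj_act \<epsilon> act 1 a = a"
      by (simp add: adj_act_def counit_one act_one)
    have s: "scalar_part (sw (\<lambda>h\<^sub>0 h\<^sub>1. adj_act \<epsilon> act h\<^sub>0 a * adj_act \<epsilon> act h\<^sub>1 b) h) =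
        sw (\<lambda>h\<^sub>0 h\<^sub>1. \<epsilon> h\<^sub>0 *\<^sub>C (\<epsilon> h\<^sub>1 * (scalar_part a * scalar_part b))) h"
      by (simp add: tensor_lift_clinear[OF clinear_scalar_part] adj_act_def scaleC_complex ac_simps)
    \<comment> \<open>The three terms of a product in the unitization; the first two collapse by the
      counit axioms.\<close>
    have t: "alg_part (sw (\<lambda>h\<^sub>0 h\<^sub>1. adj_act \<epsilon> act h\<^sub>0 a * adj_act \<epsilon> act h\<^sub>1 b) h) =
        sw (\<lambda>h\<^sub>0 h\<^sub>1. \<epsilon> h\<^sub>0 *\<^sub>C (scalar_part a *\<^sub>C act h\<^sub>1 (alg_part b))) h +
        sw (\<lambda>h\<^sub>0 h\<^sub>1. \<epsilon> h\<^sub>1 *\<^sub>C (scalar_part b *\<^sub>C act h\<^sub>0 (alg_part a))) h + act h (alg_part a * alg_part b)"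
      by (simp add: tensor_lift_clinear[OF clinear_alg_part] adj_act_def act_prod tensor_lift_add[symmetric] scaleC_scaleC ac_simps)
    show "adj_act \<epsilon> act h (a * b) = sw (\<lambda>h\<^sub>0 h\<^sub>1. adj_act \<epsilon> act h\<^sub>0 a * adj_act \<epsilon> act h\<^sub>1 b) h"
    proof (rule adj_eqI)
      show "scalar_part (adj_act \<epsilon> act h (a * b)) = scalar_part (sw (\<lambda>h\<^sub>0 h\<^sub>1. adj_act \<epsilon> act h\<^sub>0 a * adj_act \<epsilon> act h\<^sub>1 b) h)"
        unfolding s by (subst sw_counit_left[OF e]) (simp add: adj_act_def)
      show "alg_part (adj_act \<epsilon> act h (a * b)) = alg_part (sw (\<lambda>h\<^sub>0 h\<^sub>1. adj_act \<epsilon> act h\<^sub>0 a * adj_act \<epsilon> act h\<^sub>1 b) h)"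
        unfolding t
        by (subst sw_counit_left sw_counit_right; (intro clinear_scale_fun act_linear_left)?)+
          (simp add: adj_act_def clinear_simps[OF act_linear_right])
    qed
  qed
qed

end

locale twisted_module_algebra = twisted_hopf \<Delta> \<epsilon> S \<delta> + hopf_module_algebra \<Delta> act
  for \<Delta> :: "'h::complex_algebra_1 \<Rightarrow> ('h, 'h) tensor" and \<epsilon> S \<delta> and act :: "'h \<Rightarrow> 'a::complex_algebra \<Rightarrow> 'a"
begin

lemma hmodule_act: "hmodule act"
  by (rule hmodule_module_algebra[OF hopf_module_algebra_axioms])

lemma adj_algebra: "hopf_module_algebra \<Delta> (adj_act \<epsilon> act)"
  by (rule adj_module_algebra[OF hopf_module_algebra_axioms])

lemma hmodule_adj: "hmodule (adj_act \<epsilon> act)"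
  by (rule hmodule_module_algebra[OF adj_algebra])

lemma adj_act_incl: "adj_act \<epsilon> act h (adj_incl a) = adj_incl (act h a)"
  by (rule adj_eqI) (simp_all add: adj_act_def)

lemma adj_act_one: "adj_act \<epsilon> act h 1 = \<epsilon> h *\<^sub>C 1"
  by (rule adj_eqI) (simp_all add: adj_act_def clinear_zero[OF act_linear_right])

abbreviation hact :: "'h \<Rightarrow> 'a forms \<Rightarrow> 'a forms" where
  "hact \<equiv> forms_act \<Delta> \<epsilon> act"

lemma hmodule_hact: "hmodule hact"
  unfolding forms_act_def by (rule hmodule_diag[OF hmodule_adj hmodule_act])

lemmas clinear_hact = hmoduleD(3)[OF hmodule_hact]
lemmas clinear_hact_left = hmoduleD(2)[OF hmodule_hact]

lemma hact_init: "hact h (tens_init x) = tens_init (adj_act \<epsilon> act h x)"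
  unfolding forms_act_def by (rule diag_init[OF hmodule_adj hmodule_act])

lemma hact_snoc: "hact h (tens_snoc t a) = sw (\<lambda>x y. tens_snoc (hact x t) (act y a)) h"
  unfolding forms_act_def by (rule diag_snoc[OF hmodule_adj hmodule_act])

lemma hact_homog: "t \<in> homog n \<Longrightarrow> hact h t \<in> homog n"
  unfolding forms_act_def by (rule diag_homog[OF hmodule_adj hmodule_act])

text \<open>The two terms of the right multiplication rule split different legs of the coproduct;
  coassociativity brings them to the same threefold coproduct.\<close>

lemma hact_rmul: "hact h (forms_rmul t a) = sw (\<lambda>x y. forms_rmul (hact x t) (act y a)) h"
proof -
  have "\<forall>h a. hact h (forms_rmul (tword w) a) = sw (\<lambda>x y. forms_rmul (hact x (tword w)) (act y a)) h" for w
  proof (induct w)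
    case (Init x)
    show ?case
      by (simp add: rmul_init hact_init hopf_module_algebra.act_prod[OF adj_algebra] adj_act_incl
          tensor_lift_clinear[OF clinear_tword_Init])
  next
    case (Snoc w b)
    show ?case
    proof (intro allI)
      fix h a
      have "hact h (forms_rmul (tens_snoc (tword w) b) a) =
          sw (\<lambda>x y. sw (\<lambda>u v. tens_snoc (hact x (tword w)) (act u b * act v a)) y) h -
          sw (\<lambda>x y. sw (\<lambda>u v. tens_snoc (forms_rmul (hact u (tword w)) (act v b)) (act y a)) x) h"
        by (simp add: rmul_snoc clinear_diff[OF clinear_hact] hact_snoc act_prod Snoc
            tensor_lift_clinear[OF clinear_snoc_right] tensor_lift_clinear[OF clinear_snoc])
      also have "sw (\<lambda>x y. sw (\<lambda>u v. tens_snoc (hact x (tword w)) (act u b * act v a)) y) h =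
          sw (\<lambda>x y. sw (\<lambda>u v. tens_snoc (hact u (tword w)) (act v b * act y a)) x) h"
        by (rule sw_coassoc[symmetric])
          (intro trilinI bilin_left[OF bilin_snoc] bilin_right[OF bilin_snoc] clinear_hact_left
            bilin_left[OF bilin_mult] bilin_right[OF bilin_mult] act_linear_left)
      finally show "hact h (forms_rmul (tword (Snoc w b)) a) = sw (\<lambda>x y. forms_rmul (hact x (tword (Snoc w b))) (act y a)) h"
        by (simp add: hact_snoc rmul_snoc tensor_lift_clinear[OF clinear_rmul] tensor_lift_diff flip: snoc_tword)
    qed
  qed
  note * = this
  show ?thesis
    by (rule clinear_eq_on_tword[OF clinear_comp[OF clinear_rmul clinear_hact]
          clinear_tensor_lift_param[OF clinear_comp[OF clinear_hact clinear_rmul]]]) (simp add: *)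
qed

lemma hact_lmul: "hact h (forms_lmul a t) = sw (\<lambda>x y. forms_lmul (act x a) (hact y t)) h"
proof -
  have "\<forall>h. hact h (forms_lmul a (tword w)) = sw (\<lambda>x y. forms_lmul (act x a) (hact y (tword w))) h" for w
  proof (induct w)
    case (Init x)
    show ?case
      by (simp add: lmul_init hact_init hopf_module_algebra.act_prod[OF adj_algebra] adj_act_incl
          tensor_lift_clinear[OF clinear_tword_Init])
  next
    case (Snoc w b)
    show ?case
    proof (intro allI)
      fix h
      have "hact h (forms_lmul a (tens_snoc (tword w) b)) =
          sw (\<lambda>x y. sw (\<lambda>u v. tens_snoc (forms_lmul (act u a) (hact v (tword w))) (act y b)) x) h"
        by (simp add: lmul_snoc hact_snoc Snoc tensor_lift_clinear[OF clinear_snoc])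
      also have "\<dots> = sw (\<lambda>x y. sw (\<lambda>u v. tens_snoc (forms_lmul (act x a) (hact u (tword w))) (act v b)) y) h"
        by (rule sw_coassoc)
          (intro trilinI bilin_left[OF bilin_snoc] bilin_right[OF bilin_snoc] clinear_hact_left
            bilin_left[OF bilin_lmul] bilin_right[OF bilin_lmul] act_linear_left)
      finally show "hact h (forms_lmul a (tword (Snoc w b))) = sw (\<lambda>x y. forms_lmul (act x a) (hact y (tword (Snoc w b)))) h"
        by (simp add: hact_snoc lmul_snoc tensor_lift_clinear[OF clinear_lmul] flip: snoc_tword)
    qed
  qed
  note * = this
  show ?thesis
    by (rule clinear_eq_on_tword[OF clinear_comp[OF clinear_lmul clinear_hact]
          clinear_tensor_lift_param[OF clinear_comp[OF clinear_hact clinear_lmul]]]) (simp add: *)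
qed

lemma hact_d: "hact h (forms_d t) = forms_d (hact h t)"
proof -
  have "\<forall>h. hact h (forms_d (tword w)) = forms_d (hact h (tword w))" for w
  proof (induct w)
    case (Init x)
    \<comment> \<open>dx is stored as 1 dx, and \<open>h\<close> acts on that unit through the
      counit.\<close>
    have *: "sw (\<lambda>u v. \<epsilon> u *\<^sub>C tens_snoc (tens_init 1) (act v (alg_part x))) h = tens_snoc (tens_init 1) (act h (alg_part x))" for h
      by (rule sw_counit_left) (intro bilin_right[OF bilin_snoc] act_linear_left)
    have "alg_part (adj_act \<epsilon> act h x) = act h (alg_part x)" for h
      by (simp add: adj_act_def)
    then show ?case
      by (simp add: d_init hact_snoc hact_init adj_act_one clinear_scale[OF clinear_tword_Init] snoc_simps * )
  next
    case (Snoc w a)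
    then show ?case by (simp add: d_snoc hact_snoc tensor_lift_clinear[OF clinear_d] flip: snoc_tword)
  qed
  with clinear_eq_on_tword[OF clinear_comp[OF clinear_d clinear_hact] clinear_comp[OF clinear_hact clinear_d]]
  show ?thesis by blast
qed

text \<open>Words instead of arbitrary forms, so that every generator is homogeneous.\<close>

definition coinv_gens :: "'a forms set" where
  "coinv_gens = {hact h (tword w) - \<delta> h *\<^sub>C tword w | h w. True}"

lemma hact_diff_coinv: "hact h t - \<delta> h *\<^sub>C t \<in> cvec.span coinv_gens"
proof -
  have "clinear (\<lambda>t. hact h t - \<delta> h *\<^sub>C t)"
    by (intro clinear_diff_fun clinear_hact clinear_scale_fun clinear_ident)
  from clinear_span_image[OF this _ span_tword, of coinv_gens t] show ?thesis
    by (auto simp: coinv_gens_def intro: cvec.span_base)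
qed

text \<open>b(t da) is ta - at up to sign. The action reaches ta with the legs of the coproduct in
  order, but at with the legs exchanged; \<open>flip_coinvariants\<close> repairs this modulo
  coinvariants.\<close>

lemma b_coinv: "forms_b (hact h (tword w)) - \<delta> h *\<^sub>C forms_b (tword w) \<in> cvec.span coinv_gens"
proof (cases w)
  case (Init x)
  then show ?thesis by (simp add: hact_init b_init cvec.span_zero)
next
  case (Snoc v a)
  let ?t = "tword v" and ?s = "(-1) ^ word_deg v :: complex"
  have "sw (\<lambda>x y. forms_lmul (act y a) (hact x ?t)) h - \<delta> h *\<^sub>C forms_lmul a ?t \<in> cvec.span coinv_gens"
    by (rule flip_coinvariants[OF hmodule_act hmodule_hact bilin_lmul, where V = UNIV])
      (simp_all add: hact_diff_coinv flip: hact_lmul)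
  then have "?s *\<^sub>C ((hact h (forms_rmul ?t a) - \<delta> h *\<^sub>C forms_rmul ?t a) -
      (sw (\<lambda>x y. forms_lmul (act y a) (hact x ?t)) h - \<delta> h *\<^sub>C forms_lmul a ?t)) \<in> cvec.span coinv_gens"
    using cvec.span_scale[OF cvec.span_diff[OF hact_diff_coinv]] by blast
  also have "?s *\<^sub>C ((hact h (forms_rmul ?t a) - \<delta> h *\<^sub>C forms_rmul ?t a) -
      (sw (\<lambda>x y. forms_lmul (act y a) (hact x ?t)) h - \<delta> h *\<^sub>C forms_lmul a ?t)) =
      forms_b (hact h (tword w)) - \<delta> h *\<^sub>C forms_b (tword w)"
    unfolding Snoc snoc_tword[symmetric] hact_snoc
    by (simp add: tensor_lift_clinear[OF clinear_b] b_snoc[OF hact_homog[OF tword_homog]] b_snoc[OF tword_homog]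
        tensor_lift_scale tensor_lift_diff hact_rmul cvec.scale_right_diff_distrib scaleC_scaleC mult.commute)
  finally show ?thesis .
qed

sublocale forms_relations coinv_gens
proof
  fix c assume "c \<in> coinv_gens"
  then obtain h w where c: "c = hact h (tword w) - \<delta> h *\<^sub>C tword w"
    unfolding coinv_gens_def by blast
  show "\<exists>n. c \<in> homog n"
    unfolding c by (intro exI[of _ "word_deg w"] homog_simps hact_homog tword_homog)
  show "forms_b c \<in> cvec.span coinv_gens"
    unfolding c using b_coinv[of h w] by (simp add: clinear_simps[OF clinear_b])
  show "forms_d c \<in> cvec.span coinv_gens"
    unfolding c using hact_diff_coinv[of h "forms_d (tword w)"] by (simp add: forms_linear hact_d)
qed

end

section \<open>The tensor algebra and even forms\<close>

lemma clinear_Abs_talg: "clinear Abs_talg"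
  unfolding clinear_iff by (simp add: plus_talg.abs_eq scaleC_talg.abs_eq)

lemma clinear_Rep_talg: "clinear Rep_talg"
  unfolding clinear_iff by (simp add: plus_talg.rep_eq scaleC_talg.rep_eq)

definition iota :: "'a::complex_vector \<Rightarrow> 'a talg" where
  "iota a = Abs_talg (tens_init a)"

lemma clinear_iota: "clinear iota"
  unfolding iota_def[abs_def] by (rule clinear_comp[OF clinear_tword_Init clinear_Abs_talg])

lemmas iota_linear = clinear_simps[OF clinear_iota]

lemma tens_mult_init: "tens_mult t (tens_init a) = tens_snoc t a"
  by (rule clinear_eq_on_tword[OF clinear_tens_mult_left clinear_snoc]) (simp add: tens_mult_words snoc_tword)

lemma Abs_talg_snoc: "Abs_talg (tens_snoc t a) = Abs_talg t * iota a"
  by (simp add: iota_def times_talg.abs_eq tens_mult_init)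

lemma talg_induct:
  fixes t :: "'a::complex_vector talg"
  assumes "\<And>p. clinear (f p)" "\<And>p. clinear (g p)" "\<And>p a. f p (iota a) = g p (iota a)"
    and "\<And>p t a. (\<And>p. f p t = g p t) \<Longrightarrow> f p (t * iota a) = g p (t * iota a)"
  shows "f p t = g p t"
proof -
  have "\<forall>p. f p (Abs_talg (tword w)) = g p (Abs_talg (tword w))" for w :: "('a, 'a) word"
  proof (induct w)
    case (Init x)
    then show ?case using assms(3) by (simp add: iota_def)
  next
    case (Snoc w a)
    then show ?case using assms(4) by (simp add: Abs_talg_snoc flip: snoc_tword)
  qed
  then have "f p (Abs_talg s) = g p (Abs_talg s)" for p s
    using clinear_eq_on_tword[OF clinear_comp[OF clinear_Abs_talg assms(1)[of p]] clinear_comp[OF clinear_Abs_talg assms(2)[of p]]]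
    by blast
  then show ?thesis by (metis Rep_talg_inverse)
qed

text \<open>Under the Fedosov product this is to be the n-th power of the ideal of forms of positive
  degree, with the unit included for n = 0; it matches \<open>ideal_coeff IR n\<close>.\<close>

definition even_filt :: "nat \<Rightarrow> 'a::complex_algebra forms set" where
  "even_filt n = cvec.span (tword ` {w. even (word_deg w) \<and> 2 * n \<le> word_deg w})"

definition odd_filt :: "nat \<Rightarrow> 'a::complex_algebra forms set" where
  "odd_filt n = cvec.span (tword ` {w. odd (word_deg w) \<and> 2 * n < word_deg w})"

lemma subspace_even_filt: "cvec.subspace (even_filt n)" and subspace_odd_filt: "cvec.subspace (odd_filt n)"
  by (simp_all add: even_filt_def odd_filt_def)

lemmas even_filt_simps = cvec.subspace_0[OF subspace_even_filt] cvec.subspace_add[OF subspace_even_filt]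
  cvec.subspace_diff[OF subspace_even_filt] cvec.subspace_neg[OF subspace_even_filt]
  cvec.subspace_scale[OF subspace_even_filt]

lemmas odd_filt_simps = cvec.subspace_0[OF subspace_odd_filt] cvec.subspace_add[OF subspace_odd_filt]
  cvec.subspace_diff[OF subspace_odd_filt] cvec.subspace_neg[OF subspace_odd_filt]
  cvec.subspace_scale[OF subspace_odd_filt]

lemma homog_even_filt: "t \<in> homog m \<Longrightarrow> even m \<Longrightarrow> 2 * n \<le> m \<Longrightarrow> t \<in> even_filt n"
  unfolding homog_def even_filt_def by (erule rev_subsetD[OF _ cvec.span_mono]) auto

lemma even_filt_mono: "t \<in> even_filt m \<Longrightarrow> n \<le> m \<Longrightarrow> t \<in> even_filt n"
  unfolding even_filt_def by (erule rev_subsetD[OF _ cvec.span_mono]) auto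

lemma even_filt_map:
  assumes "clinear f" "\<And>w. even (word_deg w) \<Longrightarrow> 2 * n \<le> word_deg w \<Longrightarrow> f (tword w) \<in> cvec.span B" "t \<in> even_filt n"
  shows "f t \<in> cvec.span B"
  using clinear_span_image[OF assms(1) _ assms(3)[unfolded even_filt_def]] assms(2) by auto

lemma even_filt_eq:
  assumes "clinear f" "clinear g" "\<And>w. even (word_deg w) \<Longrightarrow> 2 * n \<le> word_deg w \<Longrightarrow> f (tword w) = g (tword w)"
    "t \<in> even_filt n"
  shows "f t = g t"
  using clinear_eq_on_span[OF assms(1,2) _ assms(4)[unfolded even_filt_def]] assms(3) by auto

lemma even_word_cases:
  assumes "even (word_deg w)"
  obtains x where "w = Init x" | v a b where "w = Snoc (Snoc v a) b" "even (word_deg v)"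
proof (cases w)
  case (Init x)
  then show ?thesis using that by blast
next
  case (Snoc u b)
  then show ?thesis using that assms by (cases u) auto
qed

lemma even_word_induct [consumes 1, case_names Init Snoc]:
  assumes "even (word_deg w)" "\<And>x. P (Init x)"
    "\<And>w a b. even (word_deg w) \<Longrightarrow> P w \<Longrightarrow> P (Snoc (Snoc w a) b)"
  shows "P w"
  using assms(1)
proof (induct "word_deg w" arbitrary: w rule: less_induct)
  case less
  from less(2) show ?case
    by (cases rule: even_word_cases) (use assms(2,3) less(1) in auto)
qed

lemma even_filt_tword: "even (word_deg w) \<Longrightarrow> 2 * n \<le> word_deg w \<Longrightarrow> tword w \<in> even_filt n"
  by (rule homog_even_filt[OF tword_homog])

lemma snoc_snoc_even_filt: "t \<in> even_filt n \<Longrightarrow> tens_snoc (tens_snoc t a) b \<in> even_filt (Suc n)"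
  unfolding even_filt_def[of "Suc n"]
  by (rule even_filt_map[OF clinear_comp[OF clinear_snoc clinear_snoc]])
    (auto simp: snoc_tword intro!: cvec.span_base)

lemma snoc_odd_filt: "t \<in> even_filt n \<Longrightarrow> tens_snoc t a \<in> odd_filt n"
  unfolding odd_filt_def
  by (rule even_filt_map[OF clinear_snoc]) (auto simp: snoc_tword intro!: cvec.span_base)

text \<open>Multiplication by elements of degree zero for the Fedosov product
  \<open>\<omega> \<circ> \<eta> = \<omega> \<eta> - d\<omega> d\<eta>\<close> on even forms.\<close>

definition fed_rmul :: "'a::complex_algebra forms \<Rightarrow> 'a \<Rightarrow> 'a forms" where
  "fed_rmul t a = forms_rmul t a - tens_snoc (forms_d t) a"

definition fed_lmul :: "'a::complex_algebra \<Rightarrow> 'a forms \<Rightarrow> 'a forms" where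
  "fed_lmul a t = forms_lmul a t - dmul a (forms_d t)"

lemma clinear_fed_rmul: "clinear (\<lambda>t. fed_rmul t a)"
  unfolding fed_rmul_def by (intro clinear_diff_fun clinear_rmul clinear_comp[OF clinear_d clinear_snoc])

lemma clinear_fed_rmul_right: "clinear (fed_rmul t)"
  unfolding fed_rmul_def[abs_def] by (intro clinear_diff_fun clinear_rmul_right clinear_snoc_right)

lemma clinear_fed_lmul: "clinear (fed_lmul a)"
  unfolding fed_lmul_def[abs_def] by (intro clinear_diff_fun clinear_lmul clinear_comp[OF clinear_d clinear_dmul])

lemma fed_rmul_even_filt: "t \<in> even_filt n \<Longrightarrow> fed_rmul t a \<in> even_filt n"
proof (unfold even_filt_def[of n], rule even_filt_map[OF clinear_fed_rmul], fold even_filt_def)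
  fix w :: "('a adj, 'a) word" assume w: "even (word_deg w)" "2 * n \<le> word_deg w"
  show "fed_rmul (tword w) a \<in> even_filt n"
    unfolding fed_rmul_def
    by (intro even_filt_simps homog_even_filt[OF rmul_homog[OF tword_homog]]
        homog_even_filt[OF snoc_homog[OF d_homog[OF tword_homog]]]) (use w in auto)
qed (simp add: even_filt_def)

lemma fed_lmul_even_filt: "t \<in> even_filt n \<Longrightarrow> fed_lmul a t \<in> even_filt n"
proof (unfold even_filt_def[of n], rule even_filt_map[OF clinear_fed_lmul], fold even_filt_def)
  fix w :: "('a adj, 'a) word" assume w: "even (word_deg w)" "2 * n \<le> word_deg w"
  show "fed_lmul a (tword w) \<in> even_filt n"
    unfolding fed_lmul_def
    by (intro even_filt_simps homog_even_filt[OF lmul_homog[OF tword_homog]]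
        homog_even_filt[OF dmul_homog[OF d_homog[OF tword_homog]]]) (use w in auto)
qed (simp add: even_filt_def)

lemma dmul_dmul_even_filt: "t \<in> even_filt n \<Longrightarrow> dmul a (dmul b t) \<in> even_filt (Suc n)"
proof (unfold even_filt_def[of "Suc n"], rule even_filt_map[OF clinear_comp[OF clinear_dmul clinear_dmul]], fold even_filt_def)
  fix w :: "('a adj, 'a) word" assume w: "even (word_deg w)" "2 * n \<le> word_deg w"
  show "dmul a (dmul b (tword w)) \<in> even_filt (Suc n)"
    by (intro homog_even_filt[OF dmul_homog[OF dmul_homog[OF tword_homog]]]) (use w in auto)
qed

lemma d_rmul_even: "t \<in> even_filt 0 \<Longrightarrow> forms_d (forms_rmul t a) = forms_rmul (forms_d t) a + tens_snoc t a"
  by (rule even_filt_eq[OF clinear_comp[OF clinear_rmul clinear_d]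
        clinear_add_fun[OF clinear_comp[OF clinear_d clinear_rmul] clinear_snoc]])
    (auto simp: d_rmul_tword scaleC_one)

text \<open>The Fedosov product of \<open>a\<close> and \<open>b\<close> is ab - da db, so the
  failure of the inclusion of the algebra to be multiplicative is the curvature da db.\<close>

lemma fed_rmul_curvature:
  assumes "t \<in> even_filt 0"
  shows "fed_rmul t (a * b) - fed_rmul (fed_rmul t a) b = tens_snoc (tens_snoc t a) b"
  by (simp add: fed_rmul_def forms_linear d_rmul_even[OF assms] rmul_rmul rmul_snoc d_snoc d_d)

lemma fed_lmul_curvature: "fed_lmul (a * b) t - fed_lmul a (fed_lmul b t) = dmul a (dmul b t)"
proof -
  have "forms_d (dmul b (forms_d t)) = 0"
    using dmul_d[of b "forms_d t"] by (simp add: d_d clinear_zero[OF clinear_dmul])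
  then show ?thesis
    by (simp add: fed_lmul_def forms_linear clinear_simps[OF clinear_dmul] lmul_lmul d_lmul dmul_lmul)
qed

lemma fed_lmul_snoc: "fed_lmul a (tens_snoc t b) = tens_snoc (fed_lmul a t) b"
  by (simp add: fed_lmul_def lmul_snoc d_snoc dmul_snoc forms_linear)

text \<open>The isomorphism from the tensor algebra to even forms sends \<open>a\<^sub>1 \<otimes> \<dots> \<otimes> a\<^sub>n\<close> to the Fedosov
  product \<open>a\<^sub>1 \<circ> \<dots> \<circ> a\<^sub>n\<close>.\<close>

primrec word_Lam :: "('a::complex_algebra, 'a) word \<Rightarrow> 'a forms" where
  "word_Lam (Init a) = tens_init (adj_incl a)"
| "word_Lam (Snoc w a) = fed_rmul (word_Lam w) a"

lemma multilinear_word_Lam: "multilinear_word word_Lam"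
  by (rule multilinear_wordI[where f = "\<lambda>_::unit. word_Lam"])
    (simp_all add: clinear_comp[OF clinear_adj_incl clinear_tword_Init] clinear_fed_rmul_right clinear_simps[OF clinear_fed_rmul])

definition Lam :: "'a::complex_algebra talg \<Rightarrow> 'a forms" where
  "Lam t = tens_lift word_Lam (Rep_talg t)"

lemma clinear_Lam: "clinear Lam"
  unfolding Lam_def[abs_def] by (rule clinear_comp[OF clinear_Rep_talg clinear_tens_lift[OF multilinear_word_Lam]])

lemma Lam_iota: "Lam (iota a) = tens_init (adj_incl a)"
  by (simp add: Lam_def iota_def Abs_talg_inverse tens_lift_tword[OF multilinear_word_Lam])

lemma Lam_snoc: "Lam (t * iota a) = fed_rmul (Lam t) a"
proof -
  have "Lam (Abs_talg (tens_snoc s a)) = fed_rmul (Lam (Abs_talg s)) a" for s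
    by (rule clinear_eq_on_tword[OF clinear_comp[OF clinear_comp[OF clinear_snoc clinear_Abs_talg] clinear_Lam]
          clinear_comp[OF clinear_comp[OF clinear_Abs_talg clinear_Lam] clinear_fed_rmul]])
      (simp add: Lam_def Abs_talg_inverse snoc_tword tens_lift_tword[OF multilinear_word_Lam])
  from this[of "Rep_talg t"] show ?thesis
    by (simp add: Abs_talg_snoc Rep_talg_inverse)
qed

definition Lam_adj :: "'a::complex_algebra talg adj \<Rightarrow> 'a forms" where
  "Lam_adj x = scalar_part x *\<^sub>C tens_init 1 + Lam (alg_part x)"

lemma clinear_Lam_adj: "clinear Lam_adj"
  by (auto simp: clinear_iff Lam_adj_def clinear_simps[OF clinear_Lam] scaleC_add_left scaleC_add_right scaleC_scaleC)

lemmas Lam_linear = clinear_simps[OF clinear_Lam] clinear_simps[OF clinear_Lam_adj]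

lemma Lam_adj_incl: "Lam_adj (adj_incl t) = Lam t"
  by (simp add: Lam_adj_def)

lemma Lam_adj_snoc: "Lam_adj (x * adj_incl (iota a)) = fed_rmul (Lam_adj x) a"
  by (simp add: Lam_adj_def Lam_linear Lam_iota Lam_snoc clinear_simps[OF clinear_fed_rmul])
    (simp add: fed_rmul_def rmul_init d_init forms_linear)

lemma Lam_even: "Lam t \<in> even_filt 0"
proof -
  have *: "word_Lam w \<in> even_filt 0" for w :: "('a, 'a) word"
    by (induct w) (auto intro!: fed_rmul_even_filt homog_even_filt[OF init_homog])
  show ?thesis
    unfolding Lam_def even_filt_def
    by (rule clinear_span_image[OF clinear_tens_lift[OF multilinear_word_Lam] _ span_tword])
      (use * in \<open>auto simp: tens_lift_tword[OF multilinear_word_Lam] even_filt_def\<close>)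
qed

lemma Lam_adj_even: "Lam_adj x \<in> even_filt 0"
  unfolding Lam_adj_def by (intro even_filt_simps Lam_even homog_even_filt[OF init_homog]) simp_all

text \<open>The element of the tensor algebra that corresponds to the form da db; it lies in
  \<open>IR\<close>.\<close>

definition curv :: "'a::complex_algebra \<Rightarrow> 'a \<Rightarrow> 'a talg" where
  "curv a b = iota (a * b) - iota a * iota b"

lemma bilin_curv: "bilin curv"
  unfolding curv_def[abs_def]
  by (rule bilinI; rule clinear_diff_fun)
    (rule clinear_comp[OF clinear_mult_left clinear_iota] clinear_comp[OF clinear_mult_right clinear_iota]
      clinear_comp[OF clinear_iota clinear_mult_left] clinear_comp[OF clinear_iota clinear_mult_right])+

lemma Lam_adj_curv: "Lam_adj (x * adj_incl (curv a b)) = tens_snoc (tens_snoc (Lam_adj x) a) b"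
  by (simp add: curv_def clinear_diff[OF clinear_adj_incl] adj_incl_mult right_diff_distrib Lam_linear
      Lam_adj_snoc fed_rmul_curvature[OF Lam_adj_even] flip: mult.assoc)

text \<open>The inverse of \<open>Lam_adj\<close> on even forms: each pair of letters becomes one
  curvature. An odd word ends in the second equation and goes to zero, which makes the map
  total.\<close>

fun word_Phi :: "('a::complex_algebra adj, 'a) word \<Rightarrow> 'a talg adj" where
  "word_Phi (Init x) = Adj (scalar_part x) (iota (alg_part x))"
| "word_Phi (Snoc (Init x) a) = 0"
| "word_Phi (Snoc (Snoc w a) b) = word_Phi w * adj_incl (curv a b)"

inductive_cases word_add_InitE: "word_add u v (Init x)"
inductive_cases word_add_SnocE: "word_add u v (Snoc w a)"
inductive_cases word_scale_InitE: "word_scale c u (Init x)"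
inductive_cases word_scale_SnocE: "word_scale c u (Snoc w a)"

text \<open>The recursion removes two letters at once, so the one-letter criterion
  \<open>multilinear_wordI\<close> does not fit, and the relations on words are inverted twice
  instead.\<close>

lemma multilinear_word_Phi: "multilinear_word word_Phi"
proof -
  note linear = iota_linear clinear_simps[OF clinear_adj_incl] clinear_simps[OF bilinD(1)[OF bilin_curv]]
    clinear_simps[OF bilinD(2)[OF bilin_curv]]
  have add: "word_Phi w = word_Phi u + word_Phi v" if "word_add u v w" for u v w :: "('a adj, 'a) word"
    using that
  proof (induct w arbitrary: u v rule: word_Phi.induct)
    case (3 w a b)
    from 3(2) show ?case
      by (auto elim!: word_add_SnocE dest!: 3(1) simp: linear distrib_left distrib_right)
  qed (auto elim!: word_add_InitE word_add_SnocE intro: adj_eqI simp: linear)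
  have scale: "word_Phi w = c *\<^sub>C word_Phi u" if "word_scale c u w" for c and u w :: "('a adj, 'a) word"
    using that
  proof (induct w arbitrary: u rule: word_Phi.induct)
    case (3 w a b)
    from 3(2) show ?case
      by (auto elim!: word_scale_SnocE dest!: 3(1) simp: linear mult_scaleC_left mult_scaleC_right)
  qed (auto elim!: word_scale_InitE word_scale_SnocE intro: adj_eqI simp: linear)
  show ?thesis
    unfolding multilinear_word_def using add scale by blast
qed

definition Phi :: "'a::complex_algebra forms \<Rightarrow> 'a talg adj" where
  "Phi = tens_lift word_Phi"

lemma clinear_Phi: "clinear Phi"
  unfolding Phi_def by (rule clinear_tens_lift[OF multilinear_word_Phi])

lemmas Phi_linear = clinear_simps[OF clinear_Phi]

lemma Phi_tword: "Phi (tword w) = word_Phi w"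
  by (simp add: Phi_def tens_lift_tword[OF multilinear_word_Phi])

lemma Phi_init: "Phi (tens_init x) = Adj (scalar_part x) (iota (alg_part x))"
  by (simp add: Phi_tword)

lemma Phi_init_1: "Phi (tens_init 1) = 1"
  by (rule adj_eqI) (simp_all add: Phi_init iota_linear)

lemma Phi_init_incl: "Phi (tens_init (adj_incl a)) = adj_incl (iota a)"
  by (simp add: Phi_init adj_incl_def)

lemma Phi_snoc_snoc: "Phi (tens_snoc (tens_snoc t a) b) = Phi t * adj_incl (curv a b)"
  by (rule clinear_eq_on_tword[OF clinear_comp[OF clinear_comp[OF clinear_snoc clinear_snoc] clinear_Phi]
        clinear_comp[OF clinear_Phi clinear_mult_left]]) (simp add: snoc_tword Phi_tword)

lemma Phi_odd: "t \<in> homog n \<Longrightarrow> odd n \<Longrightarrow> Phi t = 0"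
proof (rule homog_eq[OF clinear_Phi clinear_zero_fun])
  fix w :: "('a adj, 'a) word" assume "word_deg w = n" "odd n"
  then show "Phi (tword w) = 0"
    unfolding Phi_tword by (induct w arbitrary: n rule: word_Phi.induct) auto
qed

lemma Phi_fed_rmul: "t \<in> even_filt 0 \<Longrightarrow> Phi (fed_rmul t a) = Phi t * adj_incl (iota a)"
proof (rule even_filt_eq[OF clinear_comp[OF clinear_fed_rmul clinear_Phi] clinear_comp[OF clinear_Phi clinear_mult_left]])
  fix w :: "('a adj, 'a) word" assume "even (word_deg w)"
  then show "Phi (fed_rmul (tword w) a) = Phi (tword w) * adj_incl (iota a)"
  proof (induct w arbitrary: a rule: even_word_induct)
    case (Init x)
    show ?case
      by (rule adj_eqI)
        (simp_all add: fed_rmul_def rmul_init d_init Phi_linear Phi_snoc_snoc Phi_init Phi_init_1 curv_def iota_linear)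
  next
    case (Snoc w b c)
    have *: "fed_rmul (tens_snoc (tens_snoc (tword w) b) c) a = tens_snoc (tens_snoc (tword w) b) (c * a) -
        tens_snoc (tens_snoc (tword w) (b * c)) a + tens_snoc (tens_snoc (fed_rmul (tword w) b) c) a"
      by (simp add: fed_rmul_def rmul_snoc d_snoc forms_linear)
    have "Phi (fed_rmul (tens_snoc (tens_snoc (tword w) b) c) a) =
        Phi (tword w) * adj_incl (curv b (c * a) - curv (b * c) a + iota b * curv c a)"
      unfolding * by (simp add: Phi_linear Phi_snoc_snoc Snoc clinear_simps[OF clinear_adj_incl] adj_incl_mult algebra_simps)
    \<comment> \<open>Cocycle identity of the curvature, the counterpart in the tensor algebra of
      the right multiplication rule for forms.\<close>
    also have "curv b (c * a) - curv (b * c) a + iota b * curv c a = curv b c * iota a"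
      by (simp add: curv_def algebra_simps)
    finally show ?case
      by (simp add: Phi_snoc_snoc adj_incl_mult mult.assoc flip: snoc_tword)
  qed
qed

lemma Phi_fed_lmul: "t \<in> even_filt 0 \<Longrightarrow> Phi (fed_lmul a t) = adj_incl (iota a) * Phi t"
proof (rule even_filt_eq[OF clinear_comp[OF clinear_fed_lmul clinear_Phi] clinear_comp[OF clinear_Phi clinear_mult_right]])
  fix w :: "('a adj, 'a) word" assume "even (word_deg w)"
  then show "Phi (fed_lmul a (tword w)) = adj_incl (iota a) * Phi (tword w)"
  proof (induct w rule: even_word_induct)
    case (Init x)
    show ?case
      by (rule adj_eqI)
        (simp_all add: fed_lmul_def lmul_init d_init dmul_snoc dmul_init_1 Phi_linear Phi_snoc_snoc Phi_init
          Phi_init_1 curv_def iota_linear)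
  next
    case (Snoc w b c)
    then show ?case
      by (simp add: fed_lmul_snoc Phi_snoc_snoc mult.assoc flip: snoc_tword)
  qed
qed

lemma Phi_dmul_dmul: "t \<in> even_filt 0 \<Longrightarrow> Phi (dmul a (dmul b t)) = adj_incl (curv a b) * Phi t"
  by (simp add: Phi_linear Phi_fed_lmul fed_lmul_even_filt curv_def clinear_simps[OF clinear_adj_incl] adj_incl_mult
      left_diff_distrib mult.assoc flip: fed_lmul_curvature)

lemma Lam_adj_Phi: "t \<in> even_filt 0 \<Longrightarrow> Lam_adj (Phi t) = t"
proof (rule even_filt_eq[OF clinear_comp[OF clinear_Phi clinear_Lam_adj] clinear_ident])
  fix w :: "('a adj, 'a) word" assume "even (word_deg w)"
  then show "Lam_adj (Phi (tword w)) = tword w"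
  proof (induct w rule: even_word_induct)
    case (Init x)
    show ?case
      by (simp add: Phi_init Lam_adj_def Lam_iota flip: tens_init_decompose)
  next
    case (Snoc w a b)
    then show ?case by (simp add: Phi_snoc_snoc Lam_adj_curv flip: snoc_tword)
  qed
qed

lemma Phi_Lam: "Phi (Lam t) = adj_incl t"
  by (rule talg_induct[where f = "\<lambda>_::unit. \<lambda>t. Phi (Lam t)" and g = "\<lambda>_. adj_incl"])
    (simp_all add: clinear_comp[OF clinear_Lam clinear_Phi] clinear_adj_incl Lam_iota Phi_init_incl Lam_snoc
      Phi_fed_rmul Lam_even adj_incl_mult)

lemma Phi_Lam_adj: "Phi (Lam_adj x) = x"
  using adj_decompose[of x] by (simp add: Lam_adj_def Phi_linear Phi_init_1 Phi_Lam)

text \<open>\<open>Lam_adj\<close> is built by appending letters on the right, so multiplication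
  from the left is not visible in its recursion. It was checked for \<open>Phi\<close> and is
  carried over by the bijection.\<close>

lemma Lam_adj_lmul: "Lam_adj (adj_incl (iota a) * x) = fed_lmul a (Lam_adj x)"
  using Phi_fed_lmul[OF Lam_adj_even, of a x] Lam_adj_Phi[OF fed_lmul_even_filt[OF Lam_adj_even], of a x]
  by (simp add: Phi_Lam_adj)

lemma Lam_adj_curv_mult: "Lam_adj (adj_incl (curv a b) * x) = dmul a (dmul b (Lam_adj x))"
  using Phi_dmul_dmul[OF Lam_adj_even, of a b x] Lam_adj_Phi[OF even_filt_mono[OF dmul_dmul_even_filt[OF Lam_adj_even]], of a b x]
  by (simp add: Phi_Lam_adj)

lemma Lam_adj_Phi_tword: "even (word_deg w) \<Longrightarrow> Lam_adj (Phi (tword w)) = tword w"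
  by (rule Lam_adj_Phi[OF even_filt_tword]) simp_all

context twisted_module_algebra
begin

lemma hmodule_diag_act: "hmodule (diag_act \<Delta> act act)"
  by (rule hmodule_diag[OF hmodule_act hmodule_act])

lemma clinear_talg_act: "clinear (talg_act \<Delta> act h)"
  unfolding talg_act_def[abs_def]
  by (rule clinear_comp[OF clinear_comp[OF clinear_Rep_talg hmoduleD(3)[OF hmodule_diag_act]] clinear_Abs_talg])

lemma talg_act_iota: "talg_act \<Delta> act h (iota a) = iota (act h a)"
  by (simp add: talg_act_def iota_def Abs_talg_inverse diag_init[OF hmodule_act hmodule_act])

lemma talg_act_snoc: "talg_act \<Delta> act h (t * iota a) = sw (\<lambda>x y. talg_act \<Delta> act x t * iota (act y a)) h"
proof -
  have "Rep_talg (t * iota a) = tens_snoc (Rep_talg t) a"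
    by (simp add: iota_def times_talg.rep_eq Abs_talg_inverse tens_mult_init)
  then show ?thesis
    by (simp add: talg_act_def diag_snoc[OF hmodule_act hmodule_act] tensor_lift_clinear[OF clinear_Abs_talg] Abs_talg_snoc)
qed

lemma clinear_talg_act_left: "clinear (\<lambda>h. talg_act \<Delta> act h t)"
  unfolding talg_act_def
  by (rule clinear_comp[OF hmoduleD(2)[OF hmodule_diag_act] clinear_Abs_talg])

lemma talg_act_prod: "talg_act \<Delta> act h (s * t) = sw (\<lambda>x y. talg_act \<Delta> act x s * talg_act \<Delta> act y t) h"
proof (rule talg_induct[where f = "\<lambda>h t. talg_act \<Delta> act h (s * t)" and
      g = "\<lambda>h t. sw (\<lambda>x y. talg_act \<Delta> act x s * talg_act \<Delta> act y t) h"])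
  fix h
  show "clinear (\<lambda>t. talg_act \<Delta> act h (s * t))"
    by (rule clinear_comp[OF clinear_mult_right clinear_talg_act])
  show "clinear (\<lambda>t. sw (\<lambda>x y. talg_act \<Delta> act x s * talg_act \<Delta> act y t) h)"
    by (intro clinear_tensor_lift_param clinear_comp[OF clinear_talg_act clinear_mult_right])
next
  fix h a
  show "talg_act \<Delta> act h (s * iota a) = sw (\<lambda>x y. talg_act \<Delta> act x s * talg_act \<Delta> act y (iota a)) h"
    by (simp add: talg_act_snoc talg_act_iota)
next
  fix h t a assume IH: "\<And>h. talg_act \<Delta> act h (s * t) = sw (\<lambda>x y. talg_act \<Delta> act x s * talg_act \<Delta> act y t) h"
  have "talg_act \<Delta> act h (s * (t * iota a)) =
      sw (\<lambda>x y. sw (\<lambda>u v. talg_act \<Delta> act u s * talg_act \<Delta> act v t * iota (act y a)) x) h"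
    by (simp add: talg_act_snoc IH tensor_lift_clinear[OF clinear_mult_left] flip: mult.assoc)
  also have "\<dots> = sw (\<lambda>x y. sw (\<lambda>u v. talg_act \<Delta> act x s * talg_act \<Delta> act u t * iota (act v a)) y) h"
    by (rule sw_coassoc)
      (intro trilinI bilin_left[OF bilin_mult] bilin_right[OF bilin_mult] clinear_talg_act_left
        clinear_comp[OF act_linear_left clinear_iota])
  also have "\<dots> = sw (\<lambda>x y. talg_act \<Delta> act x s * talg_act \<Delta> act y (t * iota a)) h"
    by (simp add: talg_act_snoc tensor_lift_clinear[OF clinear_mult_right] mult.assoc)
  finally show "talg_act \<Delta> act h (s * (t * iota a)) = sw (\<lambda>x y. talg_act \<Delta> act x s * talg_act \<Delta> act y (t * iota a)) h" .
qed

lemma talg_module_algebra: "hopf_module_algebra \<Delta> (talg_act \<Delta> act)"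
  by (rule hopf_module_algebra.intro)
    (simp_all add: clinear_talg_act clinear_talg_act_left talg_act_prod,
      simp_all add: talg_act_def Abs_talg_inverse Rep_talg_inverse hmoduleD(4,5)[OF hmodule_diag_act])

lemma talg_twisted_module_algebra: "twisted_module_algebra \<Delta> \<epsilon> S \<delta> (talg_act \<Delta> act)"
  by (intro twisted_module_algebra.intro twisted_hopf_axioms talg_module_algebra)

end

section \<open>One-forms on the tensor algebra and odd forms\<close>

text \<open>b gives ta - at, and -(1 + k) d adds -dt da + da dt, the Fedosov correction. So on odd
  forms \<open>D_X\<close> is the commutator for the Fedosov product.\<close>

lemma D_X_snoc: "t \<in> even_filt 0 \<Longrightarrow> D_X (tens_snoc t a) = fed_rmul t a - fed_lmul a t"
proof (rule even_filt_eq[OF clinear_comp[OF clinear_snoc clinear_D_X] clinear_diff_fun[OF clinear_fed_rmul clinear_fed_lmul]])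
  fix w :: "('a adj, 'a) word" assume "even (word_deg w)"
  then obtain n where n: "word_deg w = 2 * n" by (elim evenE)
  note w = tword_homog[of w, unfolded n]
  show "D_X (tens_snoc (tword w) a) = fed_rmul (tword w) a - fed_lmul a (tword w)"
    by (simp add: D_X_odd[OF snoc_homog[OF w]] b_snoc[OF w] op_poly_add kpoly_X d_snoc k_snoc[OF d_homog[OF w]]
        fed_rmul_def fed_lmul_def scaleC_one)
qed

text \<open>The left side represents t d(\<open>curv a b\<close>) modulo commutators, after the
  Leibniz rule. The operator (1 + k) d - b found here is the building block of \<open>D_X\<close> on
  even forms.\<close>

lemma fed_curvature_b_d:
  assumes "t \<in> even_filt 0"
  shows "tens_snoc t (a * b) - tens_snoc (fed_rmul t a) b - tens_snoc (fed_lmul b t) a =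
    kpoly (1 + XX) (forms_d (tens_snoc (tens_snoc t a) b)) - forms_b (tens_snoc (tens_snoc t a) b)"
proof (rule even_filt_eq[OF _ _ _ assms])
  show "clinear (\<lambda>t. tens_snoc t (a * b) - tens_snoc (fed_rmul t a) b - tens_snoc (fed_lmul b t) a)"
    by (intro clinear_diff_fun clinear_snoc clinear_comp[OF clinear_fed_rmul clinear_snoc] clinear_comp[OF clinear_fed_lmul clinear_snoc])
  have "clinear (\<lambda>t. tens_snoc (tens_snoc t a) b)"
    by (rule clinear_comp[OF clinear_snoc clinear_snoc])
  then show "clinear (\<lambda>t. kpoly (1 + XX) (forms_d (tens_snoc (tens_snoc t a) b)) - forms_b (tens_snoc (tens_snoc t a) b))"
    by (intro clinear_diff_fun clinear_comp[OF clinear_comp[OF _ clinear_d] clinear_kpoly] clinear_comp[OF _ clinear_b])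
  fix w :: "('a adj, 'a) word" assume "even (word_deg w)"
  then obtain n where n: "word_deg w = 2 * n" by (elim evenE)
  note w = tword_homog[of w, unfolded n]
  show "tens_snoc (tword w) (a * b) - tens_snoc (fed_rmul (tword w) a) b - tens_snoc (fed_lmul b (tword w)) a =
    kpoly (1 + XX) (forms_d (tens_snoc (tens_snoc (tword w) a) b)) - forms_b (tens_snoc (tens_snoc (tword w) a) b)"
    by (simp add: b_snoc[OF snoc_homog[OF w]] op_poly_add kpoly_X d_snoc k_snoc[OF snoc_homog[OF d_homog[OF w]]]
        fed_rmul_def fed_lmul_def scaleC_one rmul_snoc lmul_snoc dmul_snoc forms_linear)
qed

text \<open>\<open>Th x y\<close> is the odd form representing \<open>x dy\<close> modulo commutators: the Leibniz rule gives
  \<open>x d(r\<^sub>1 \<dots> r\<^sub>n) \<equiv> \<Sum> r\<^sub>j\<^sub>+\<^sub>1 \<dots> r\<^sub>n x r\<^sub>1 \<dots> r\<^sub>j\<^sub>-\<^sub>1 dr\<^sub>j\<close>.\<close>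

primrec word_Th :: "('a::complex_algebra, 'a) word \<Rightarrow> 'a talg adj \<Rightarrow> 'a forms" where
  "word_Th (Init a) = (\<lambda>x. tens_snoc (Lam_adj x) a)"
| "word_Th (Snoc w a) = (\<lambda>x. tens_snoc (Lam_adj (x * adj_incl (Abs_talg (tword w)))) a + word_Th w (adj_incl (iota a) * x))"

lemma clinear_word_Th: "clinear (word_Th w)"
proof (induct w)
  case (Init x)
  show ?case by (simp add: clinear_comp[OF clinear_Lam_adj clinear_snoc])
next
  case (Snoc w a)
  show ?case
    unfolding word_Th.simps
    by (intro clinear_add_fun clinear_comp[OF clinear_comp[OF clinear_mult_left clinear_Lam_adj] clinear_snoc]
        clinear_comp[OF clinear_mult_right Snoc])
qed

lemma multilinear_word_Th: "multilinear_word (\<lambda>w. word_Th w x)"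
proof (rule multilinear_wordI[where f = "\<lambda>x w. word_Th w x"])
  show "clinear (\<lambda>a. word_Th (Init a) p)" for p :: "'a talg adj"
    by (simp add: clinear_snoc_right)
  show "clinear (\<lambda>a. word_Th (Snoc w a) p)" for w and p :: "'a talg adj"
    unfolding word_Th.simps
    by (intro clinear_add_fun clinear_snoc_right
        clinear_comp[OF clinear_comp[OF clinear_comp[OF clinear_iota clinear_adj_incl] clinear_mult_left] clinear_word_Th])
qed (simp_all add: tword_add tword_scale clinear_simps[OF clinear_Abs_talg] clinear_simps[OF clinear_adj_incl]
    distrib_left mult_scaleC_right Lam_linear snoc_simps algebra_simps scaleC_add_right)

definition Th :: "'a::complex_algebra talg adj \<Rightarrow> 'a talg \<Rightarrow> 'a forms" where
  "Th x y = tens_lift (\<lambda>w. word_Th w x) (Rep_talg y)"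

lemma clinear_Th: "clinear (Th x)"
  unfolding Th_def[abs_def] by (rule clinear_comp[OF clinear_Rep_talg clinear_tens_lift[OF multilinear_word_Th]])

lemma Th_iota: "Th x (iota a) = tens_snoc (Lam_adj x) a"
  by (simp add: Th_def iota_def Abs_talg_inverse tens_lift_tword[OF multilinear_word_Th])

lemma Th_snoc: "Th x (t * iota a) = tens_snoc (Lam_adj (x * adj_incl t)) a + Th (adj_incl (iota a) * x) t"
proof -
  have "Th x (Abs_talg (tens_snoc s a)) = tens_snoc (Lam_adj (x * adj_incl (Abs_talg s))) a + Th (adj_incl (iota a) * x) (Abs_talg s)" for s
    by (rule clinear_eq_on_tword[OF clinear_comp[OF clinear_comp[OF clinear_snoc clinear_Abs_talg] clinear_Th]
          clinear_add_fun[OF clinear_comp[OF clinear_comp[OF clinear_comp[OF clinear_comp[OF clinear_Abs_talg clinear_adj_incl]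
            clinear_mult_right] clinear_Lam_adj] clinear_snoc] clinear_comp[OF clinear_Abs_talg clinear_Th]]])
      (simp add: Th_def Abs_talg_inverse snoc_tword tens_lift_tword[OF multilinear_word_Th])
  from this[of "Rep_talg t"] show ?thesis
    by (simp add: Abs_talg_snoc Rep_talg_inverse)
qed

lemma clinear_Th_left: "clinear (\<lambda>x. Th x y)"
proof -
  have "Th (x + x') y = Th x y + Th x' y" for x x'
    by (rule talg_induct[where f = "\<lambda>(x, x') y. Th (x + x') y" and g = "\<lambda>(x, x') y. Th x y + Th x' y" and p = "(x, x')", simplified])
      (auto simp: clinear_Th clinear_add_fun Th_iota Th_snoc Lam_linear snoc_simps distrib_left distrib_right algebra_simps)
  moreover have "Th (c *\<^sub>C x) y = c *\<^sub>C Th x y" for c x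
    by (rule talg_induct[where f = "\<lambda>x y. Th (c *\<^sub>C x) y" and g = "\<lambda>x y. c *\<^sub>C Th x y"])
      (auto simp: clinear_Th clinear_scale_fun Th_iota Th_snoc Lam_linear snoc_simps mult_scaleC_left mult_scaleC_right scaleC_add_right)
  ultimately show ?thesis by (simp add: clinear_iff)
qed

lemmas Th_linear = clinear_simps[OF clinear_Th] clinear_simps[OF clinear_Th_left]

text \<open>Modulo commutators x dy z may be rotated to zx dy, which turns the Leibniz rule into
  this form. In the induction on \<open>z\<close> the coefficient gains a letter, so the pair of
  \<open>x\<close> and \<open>y\<close> serves as parameter.\<close>

lemma Th_mult: "Th x (y * z) = Th (x * adj_incl y) z + Th (adj_incl z * x) y"
proof (rule talg_induct[where f = "\<lambda>(x, y) z. Th x (y * z)" and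
      g = "\<lambda>(x, y) z. Th (x * adj_incl y) z + Th (adj_incl z * x) y" and p = "(x, y)", simplified])
  show "clinear (case p of (x, y) \<Rightarrow> \<lambda>z. Th x (y * z))" for p :: "'a talg adj \<times> 'a talg"
    by (auto simp: case_prod_beta intro: clinear_comp[OF clinear_mult_right clinear_Th])
  show "clinear (case p of (x, y) \<Rightarrow> \<lambda>z. Th (x * adj_incl y) z + Th (adj_incl z * x) y)" for p :: "'a talg adj \<times> 'a talg"
    by (auto simp: case_prod_beta intro!: clinear_add_fun clinear_Th
        clinear_comp[OF clinear_comp[OF clinear_adj_incl clinear_mult_left] clinear_Th_left])
next
  show "(case p of (x, y) \<Rightarrow> \<lambda>z. Th x (y * z)) (iota a) =
      (case p of (x, y) \<Rightarrow> \<lambda>z. Th (x * adj_incl y) z + Th (adj_incl z * x) y) (iota a)" for p :: "'a talg adj \<times> 'a talg" and a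
    by (simp add: case_prod_beta Th_iota Th_snoc)
next
  fix p :: "'a talg adj \<times> 'a talg" and t a
  obtain x y where p: "p = (x, y)" by (cases p)
  assume "\<And>p :: 'a talg adj \<times> 'a talg. (case p of (x, y) \<Rightarrow> \<lambda>z. Th x (y * z)) t = (case p of (x, y) \<Rightarrow> \<lambda>z. Th (x * adj_incl y) z + Th (adj_incl z * x) y) t"
  from this[of "(adj_incl (iota a) * x, y)"]
  have IH: "Th (adj_incl (iota a) * x) (y * t) = Th (adj_incl (iota a) * x * adj_incl y) t + Th (adj_incl t * (adj_incl (iota a) * x)) y"
    by simp
  have "Th x (y * t * iota a) = Th (x * adj_incl y) (t * iota a) + Th (adj_incl (t * iota a) * x) y"
    unfolding Th_snoc IH by (simp only: adj_incl_mult mult.assoc add.assoc)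
  then show "(case p of (x, y) \<Rightarrow> \<lambda>z. Th x (y * z)) (t * iota a) =
      (case p of (x, y) \<Rightarrow> \<lambda>z. Th (x * adj_incl y) z + Th (adj_incl z * x) y) (t * iota a)"
    by (simp add: p mult.assoc)
qed

text \<open>Extends \<open>Th\<close> by d1 = 0, so that values of \<open>Phi\<close>, which lie in
  the unitization, can be differentiated.\<close>

definition Th_adj :: "'a::complex_algebra talg adj \<Rightarrow> 'a talg adj \<Rightarrow> 'a forms" where
  "Th_adj x y = Th x (alg_part y)"

lemma Th_adj_mult: "Th_adj x (y * z) = Th_adj (x * y) z + Th_adj (z * x) y"
proof -
  have *: "u = scalar_part u *\<^sub>C 1 + adj_incl (alg_part u)" for u :: "'a talg adj"
    by (rule adj_decompose)
  have "Th_adj x (y * z) = scalar_part y *\<^sub>C Th x (alg_part z) + scalar_part z *\<^sub>C Th x (alg_part y) +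
      (Th (x * adj_incl (alg_part y)) (alg_part z) + Th (adj_incl (alg_part z) * x) (alg_part y))"
    by (simp add: Th_adj_def Th_linear Th_mult)
  also have "\<dots> = Th (x * (scalar_part y *\<^sub>C 1 + adj_incl (alg_part y))) (alg_part z) +
      Th ((scalar_part z *\<^sub>C 1 + adj_incl (alg_part z)) * x) (alg_part y)"
    by (simp add: distrib_left distrib_right mult_scaleC_left mult_scaleC_right Th_linear)
  finally show ?thesis
    unfolding Th_adj_def by (simp only: *[symmetric])
qed

lemma Th_curv:
  "Th x (curv a b) = kpoly (1 + XX) (forms_d (tens_snoc (tens_snoc (Lam_adj x) a) b)) -
    forms_b (tens_snoc (tens_snoc (Lam_adj x) a) b)"
  by (simp add: curv_def Th_linear Th_iota Th_mult Lam_adj_snoc Lam_adj_lmul diff_diff_eq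
      flip: fed_curvature_b_d[OF Lam_adj_even])

lemma Phi_dmuls:
  assumes "t \<in> even_filt 0" "even (length as)"
  shows "Phi (dmuls as t) = Phi (snocs (tens_init 1) as) * Phi t \<and> dmuls as t \<in> even_filt 0"
  using assms(2)
proof (induct "length as" arbitrary: as rule: less_induct)
  case less
  show ?case
  proof (cases as)
    case Nil
    then show ?thesis using assms(1) by (simp add: Phi_init_1)
  next
    case (Cons a bs)
    then obtain b cs where as: "as = a # b # cs"
      using less(2) by (cases bs) auto
    have cs: "dmuls cs (tens_init 1) \<in> even_filt 0"
      using dmuls_homog[OF init_homog, of cs 1] less(2) as by (intro homog_even_filt) auto
    have IH: "Phi (dmuls cs t) = Phi (dmuls cs (tens_init 1)) * Phi t" "dmuls cs t \<in> even_filt 0"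
      using less(1)[of cs] less(2) as by (simp_all add: dmuls_init_1)
    have "Phi (dmuls as t) = Phi (dmuls as (tens_init 1)) * Phi t"
      by (simp add: as Phi_dmul_dmul cs IH mult.assoc)
    then show ?thesis
      using even_filt_mono[OF dmul_dmul_even_filt[OF IH(2)], of 0] unfolding dmuls_init_1[symmetric] by (simp add: as)
  qed
qed

text \<open>The derivative of a product of curvatures, moved to a normal form modulo commutators. The
  letters \<open>as\<close> are those that have already been moved around to the front.\<close>

lemma Th_adj_Phi_word:
  assumes "even (word_deg w)" "word_deg w = 2 * m" "length as = 2 * p"
  shows "Th_adj (Phi (snocs (tens_init 1) as)) (Phi (tword w)) =
    kpoly (XX ^ (2 * (m + p))) (forms_d (snocs (tword w) as)) +
    kpoly (\<Sum>i=p..<m+p. XX ^ (2 * i)) (kpoly (1 + XX) (forms_d (snocs (tword w) as)) - forms_b (snocs (tword w) as))"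
  using assms
proof (induct w arbitrary: m as p rule: even_word_induct)
  case (Init x)
  have XX_pow: "kpoly (XX ^ n) s = (forms_k ^^ n) s" for n and s :: "'a forms"
    by (simp only: op_poly_monom flip: monom_XX) (simp add: scaleC_one)
  have 1: "tens_snoc (tens_init 1) (alg_part x) \<in> homog 1"
    using snoc_homog[OF init_homog] by simp
  have 2: "dmuls as (tens_snoc t r) = tens_snoc (dmuls as t) r" for t r
    by (induct as) (simp_all add: dmul_snoc)
  have 3: "snocs (tens_init 1) as \<in> even_filt 0"
    using snocs_homog[OF init_homog, of 1 as] Init by (intro homog_even_filt) auto
  \<comment> \<open>No curvature is left to differentiate; k^(2p) moves the letters
    \<open>as\<close> in front of dx.\<close>
  have "(forms_k ^^ length as) (snocs (tens_snoc (tens_init 1) (alg_part x)) as) = tens_snoc (snocs (tens_init 1) as) (alg_part x)"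
    using k_pow_snocs[OF 1, of as] Init(2) by (simp add: 2 dmuls_init_1 scaleC_one)
  then show ?case
    using Init by (simp add: XX_pow d_snocs d_init Th_adj_def Phi_init Th_iota Lam_adj_Phi[OF 3])
next
  case (Snoc w a b)
  obtain n where n: "word_deg w = 2 * n" using Snoc(1) by (elim evenE)
  have m: "m = Suc n" using Snoc(3) n by simp
  let ?w = "tens_snoc (tens_snoc (tword w) a) b" and ?z = "Phi (snocs (tens_init 1) as)"
  let ?x = "snocs ?w as" and ?y = "dmuls as (tword w)"
  have w: "tword w \<in> even_filt 0" by (rule even_filt_tword) (use Snoc in simp_all)
  have even: "even (length as)" using Snoc(4) by simp
  have as: "dmuls as (tens_init 1) \<in> even_filt 0"
    by (rule conjunct2[OF Phi_dmuls[OF homog_even_filt[OF init_homog] even]]) simp_all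
  note y = Phi_dmuls[OF w even]
  \<comment> \<open>The letters \<open>as\<close> are even in number, so moving all of them to the
    front is k^(2p) without a sign.\<close>
  have "tens_snoc (tens_snoc ?y a) b = dmuls as ?w"
    by (induct as) (simp_all flip: dmul_snoc)
  also have "\<dots> = kpoly (XX ^ (2 * p)) ?x"
    using k_pow_snocs[OF snoc_homog[OF snoc_homog[OF tword_homog[of w]]], of as a b] Snoc(4)
    by (simp only: op_poly_monom flip: monom_XX) (simp add: scaleC_one)
  finally have eta: "tens_snoc (tens_snoc ?y a) b = kpoly (XX ^ (2 * p)) ?x" .
  have "Th_adj (?z * Phi (tword w)) (adj_incl (curv a b)) = Th (Phi ?y) (curv a b)"
    using y by (simp add: Th_adj_def)
  also have "\<dots> = kpoly (1 + XX) (forms_d (kpoly (XX ^ (2 * p)) ?x)) - forms_b (kpoly (XX ^ (2 * p)) ?x)"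
    by (simp only: Th_curv Lam_adj_Phi[OF conjunct2[OF y]] eta)
  also have "\<dots> = kpoly (XX ^ (2 * p)) (kpoly (1 + XX) (forms_d ?x) - forms_b ?x)"
    by (simp only: d_kpoly b_kpoly kpoly_linear kpoly_mult[symmetric] mult.commute)
  finally have 1: "Th_adj (?z * Phi (tword w)) (adj_incl (curv a b)) =
      kpoly (XX ^ (2 * p)) (kpoly (1 + XX) (forms_d ?x) - forms_b ?x)" .
  \<comment> \<open>The pair a, b now joins the letters already moved, and the induction continues
    with p + 1.\<close>
  have "adj_incl (curv a b) * ?z = Phi (snocs (tens_init 1) (a # b # as))"
    using Phi_dmul_dmul[OF as, of a b] dmuls_init_1[of as] dmuls_init_1[of "a # b # as"] by simp
  moreover have "Th_adj (Phi (snocs (tens_init 1) (a # b # as))) (Phi (tword w)) =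
      kpoly (XX ^ (2 * (n + Suc p))) (forms_d ?x) +
      kpoly (\<Sum>i=Suc p..<n+Suc p. XX ^ (2 * i)) (kpoly (1 + XX) (forms_d ?x) - forms_b ?x)"
    using Snoc(2)[OF n, of "a # b # as" "Suc p"] Snoc(4) by simp
  moreover have "(\<Sum>i=p..<m+p. XX ^ (2 * i)) = XX ^ (2 * p) + (\<Sum>i=Suc p..<n+Suc p. XX ^ (2 * i))"
    by (simp add: m sum.atLeast_Suc_lessThan)
  ultimately show ?case
    using 1 m
    by (simp add: Phi_snoc_snoc Th_adj_mult op_poly_add algebra_simps flip: snoc_tword)
qed

text \<open>With no letters moved yet, the normal form is k^(2m) d + geom2 m ((1 + k) d - b), and
  X^(2m) + (1 + X) geom2 m = geom (2m + 1). This is the origin of \<open>D_X\<close> on even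
  forms.\<close>

lemma Th_1_Phi:
  assumes "t \<in> even_filt 0"
  shows "Th 1 (alg_part (Phi t)) = D_X t"
proof (rule even_filt_eq[OF clinear_comp[OF clinear_comp[OF clinear_Phi clinear_alg_part] clinear_Th] clinear_D_X _ assms])
  fix w :: "('a adj, 'a) word" assume w: "even (word_deg w)"
  then obtain m where m: "word_deg w = 2 * m" by (elim evenE)
  have "Th 1 (alg_part (Phi (tword w))) = Th_adj (Phi (snocs (tens_init 1) [])) (Phi (tword w))"
    by (simp add: Th_adj_def Phi_init_1)
  also have "\<dots> = kpoly (XX ^ (2 * m)) (forms_d (tword w)) +
      kpoly (geom2 m) (kpoly (1 + XX) (forms_d (tword w)) - forms_b (tword w))"
    using Th_adj_Phi_word[OF w m, of "[]" 0] by (simp add: geom2_def lessThan_atLeast0)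
  also have "\<dots> = D_X (tword w)"
  proof -
    have "kpoly (geom2 m) (kpoly (1 + XX) s) = kpoly (geom (2 * m)) s" for s :: "'a forms"
      by (simp only: geom_even mult.commute[of "1 + XX"] kpoly_mult)
    moreover have "geom (Suc (2 * m)) = geom (2 * m) + XX ^ (2 * m)"
      by (simp add: geom_def)
    ultimately show ?thesis
      by (simp add: D_X_even[OF tword_homog[of w, unfolded m]] kpoly_linear op_poly_add)
  qed
  finally show "Th 1 (alg_part (Phi (tword w))) = D_X (tword w)" .
qed

primrec word_Theta :: "('a::complex_algebra talg adj, 'a talg) word \<Rightarrow> 'a forms" where
  "word_Theta (Init x) = 0"
| "word_Theta (Snoc w y) = (case w of Init x \<Rightarrow> Th x y | Snoc _ _ \<Rightarrow> 0)"

text \<open>Stated for the recursor because \<open>word_Theta\<close> and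
  \<open>word_commutator\<close>, both supported in degree one, unfold to it.\<close>

lemma multilinear_one_form:
  assumes "bilin f"
  shows "multilinear_word (rec_word (\<lambda>x. 0) (\<lambda>w y _. case w of Init x \<Rightarrow> f x y | Snoc _ _ \<Rightarrow> 0))" (is "multilinear_word ?r")
proof (rule multilinear_wordI[where f = "\<lambda>_::unit. ?r"])
  show "clinear (\<lambda>a. ?r (Snoc w a))" for w
    using bilinD(2)[OF assms] by (cases w) (simp_all add: clinear_zero_fun)
  show "?r (Snoc w a) = ?r (Snoc u a) + ?r (Snoc v a)" if "word_add u v w" for u v w a
    using that by cases (simp_all add: clinear_add[OF bilinD(1)[OF assms]])
  show "?r (Snoc w a) = c *\<^sub>C ?r (Snoc u a)" if "word_scale c u w" for c u w a
    using that by cases (simp_all add: clinear_scale[OF bilinD(1)[OF assms]])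
qed (simp add: clinear_zero_fun)

lemma bilin_Th: "bilin Th"
  by (intro bilinI clinear_Th clinear_Th_left)

lemma multilinear_word_Theta: "multilinear_word word_Theta"
  unfolding word_Theta_def by (rule multilinear_one_form[OF bilin_Th])

definition Theta :: "'a::complex_algebra talg forms \<Rightarrow> 'a forms" where
  "Theta = tens_lift word_Theta"

lemma clinear_Theta: "clinear Theta"
  unfolding Theta_def by (rule clinear_tens_lift[OF multilinear_word_Theta])

lemmas Theta_linear = clinear_simps[OF clinear_Theta]

lemma Theta_snoc_init: "Theta (tens_snoc (tens_init x) y) = Th x y"
  by (simp add: Theta_def snoc_tword tens_lift_tword[OF multilinear_word_Theta])

lemma bilin_commutator: "bilin (\<lambda>x y. alg_part (x * adj_incl y - adj_incl y * x))"
  by (rule bilin_post[OF _ clinear_alg_part], rule bilinI; rule clinear_diff_fun)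
    (rule clinear_mult_left clinear_mult_right clinear_comp[OF clinear_adj_incl clinear_mult_left]
      clinear_comp[OF clinear_adj_incl clinear_mult_right])+

lemma multilinear_word_commutator: "multilinear_word word_commutator"
  unfolding word_commutator_def by (rule multilinear_one_form[OF bilin_commutator])

lemma clinear_form_commutator: "clinear form_commutator"
  unfolding form_commutator_def[abs_def] by (rule clinear_tens_lift[OF multilinear_word_commutator])

lemma form_commutator_snoc_init:
  "form_commutator (tens_snoc (tens_init x) y) = alg_part (x * adj_incl y - adj_incl y * x)"
  by (simp add: form_commutator_def snoc_tword tens_lift_tword[OF multilinear_word_commutator])

lemma homog_1_map:
  assumes "clinear f" "\<And>x y. f (tens_snoc (tens_init x) y) \<in> cvec.span B" "v \<in> homog 1"
  shows "f v \<in> cvec.span B"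
proof -
  have "f (tword w) \<in> cvec.span B" if "word_deg w = 1" for w
  proof (cases w)
    case (Snoc u y)
    then show ?thesis
      using that assms(2) by (cases u) (auto simp: snoc_tword)
  qed (use that in simp)
  then show ?thesis
    using clinear_span_image[OF assms(1), of "tword ` {w. word_deg w = 1}"] assms(3) unfolding homog_def by auto
qed

lemma homog_1_eq:
  assumes "clinear f" "clinear g" "\<And>x y. f (tens_snoc (tens_init x) y) = g (tens_snoc (tens_init x) y)" "v \<in> homog 1"
  shows "f v = g v"
  using homog_1_map[of "\<lambda>v. f v - g v" "{}" v] assms by (simp add: clinear_diff_fun)

lemma snoc_init_homog_1: "tens_snoc (tens_init x) y \<in> homog 1"
  using snoc_homog[OF init_homog] by simp

text \<open>[x, ya] = [xy, a] + [ax, y] is the recursion of \<open>Th_mult\<close>, so it is enough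
  to treat a single letter, where \<open>D_X_snoc\<close> applies.\<close>

lemma Lam_commutator: "Lam_adj (x * adj_incl y - adj_incl y * x) = D_X (Th x y)"
proof (rule talg_induct[where f = "\<lambda>x y. Lam_adj (x * adj_incl y - adj_incl y * x)" and g = "\<lambda>x y. D_X (Th x y)"])
  show "clinear (\<lambda>y. Lam_adj (p * adj_incl y - adj_incl y * p))" for p :: "'a talg adj"
    by (rule clinear_comp[OF _ clinear_Lam_adj], rule clinear_diff_fun)
      (rule clinear_comp[OF clinear_adj_incl clinear_mult_left] clinear_comp[OF clinear_adj_incl clinear_mult_right])+
  show "clinear (\<lambda>y. D_X (Th p y))" for p :: "'a talg adj"
    by (rule clinear_comp[OF clinear_Th clinear_D_X])
next
  fix p :: "'a talg adj" and a :: 'a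
  show *: "Lam_adj (p * adj_incl (iota a) - adj_incl (iota a) * p) = D_X (Th p (iota a))" for p :: "'a talg adj"
    by (simp add: Lam_linear Lam_adj_snoc Lam_adj_lmul Th_iota D_X_snoc[OF Lam_adj_even])
  fix t :: "'a talg"
  assume IH: "\<And>p. Lam_adj (p * adj_incl t - adj_incl t * p) = D_X (Th p t)"
  have "p * adj_incl (t * iota a) - adj_incl (t * iota a) * p =
      ((p * adj_incl t) * adj_incl (iota a) - adj_incl (iota a) * (p * adj_incl t)) +
      ((adj_incl (iota a) * p) * adj_incl t - adj_incl t * (adj_incl (iota a) * p))"
    by (simp add: adj_incl_mult algebra_simps)
  then show "Lam_adj (p * adj_incl (t * iota a) - adj_incl (t * iota a) * p) = D_X (Th p (t * iota a))"
    by (simp only: clinear_add[OF clinear_Lam_adj] IH * Th_mult D_X_linear)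
qed

lemma Lam_form_commutator: "v \<in> homog 1 \<Longrightarrow> Lam (form_commutator v) = D_X (Theta v)"
proof (rule homog_1_eq[OF clinear_comp[OF clinear_form_commutator clinear_Lam] clinear_comp[OF clinear_Theta clinear_D_X]])
  show "Lam (form_commutator (tens_snoc (tens_init x) y)) = D_X (Theta (tens_snoc (tens_init x) y))" for x :: "'a talg adj" and y
    using Lam_commutator[of x y] by (simp add: form_commutator_snoc_init Theta_snoc_init Lam_adj_def)
qed

text \<open>[x dy, z] = x d(yz) - xy dz - zx dy, which \<open>Th_mult\<close> sends to zero.\<close>

lemma Theta_comm: "v \<in> homog 1 \<Longrightarrow> Theta (forms_comm v z) = 0"
proof (rule homog_1_eq[OF clinear_comp[OF clinear_comm clinear_Theta] clinear_zero_fun])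
  show "Theta (forms_comm (tens_snoc (tens_init x) y) z) = 0" for x :: "'a talg adj" and y
    by (simp add: forms_comm_def rmul_snoc lmul_snoc rmul_init lmul_init Theta_linear Theta_snoc_init Th_mult)
qed

primrec word_Psi :: "('a::complex_algebra adj, 'a) word \<Rightarrow> 'a talg forms" where
  "word_Psi (Init x) = 0"
| "word_Psi (Snoc w a) = tens_snoc (tens_init (Phi (tword w))) (iota a)"

lemma multilinear_word_Psi: "multilinear_word word_Psi"
  by (rule multilinear_wordI[where f = "\<lambda>_::unit. word_Psi"])
    (simp_all add: clinear_zero_fun clinear_comp[OF clinear_iota clinear_snoc_right] tword_add tword_scale Phi_linear
      clinear_simps[OF clinear_tword_Init] snoc_simps)

definition Psi :: "'a::complex_algebra forms \<Rightarrow> 'a talg forms" where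
  "Psi = tens_lift word_Psi"

lemma clinear_Psi: "clinear Psi"
  unfolding Psi_def by (rule clinear_tens_lift[OF multilinear_word_Psi])

lemmas Psi_linear = clinear_simps[OF clinear_Psi]

lemma Psi_init: "Psi (tens_init x) = 0"
  by (simp add: Psi_def tens_lift_tword[OF multilinear_word_Psi])

lemma Psi_snoc: "Psi (tens_snoc t a) = tens_snoc (tens_init (Phi t)) (iota a)"
  by (rule clinear_eq_on_tword[OF clinear_comp[OF clinear_snoc clinear_Psi]
        clinear_comp[OF clinear_comp[OF clinear_Phi clinear_tword_Init] clinear_snoc]])
    (simp add: snoc_tword Psi_def tens_lift_tword[OF multilinear_word_Psi])

lemma Psi_homog_1: "Psi t \<in> homog 1"
  unfolding homog_def
proof (rule clinear_span_image[OF clinear_Psi _ span_tword], fold homog_def)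
  fix s :: "'a forms" assume "s \<in> range tword"
  then obtain w where "s = tword w" by blast
  then show "Psi s \<in> homog 1"
    by (cases w) (auto simp: Psi_init homog_simps Psi_snoc snoc_init_homog_1 simp del: One_nat_def simp flip: snoc_tword)
qed

lemma Psi_even_tword: "even (word_deg w) \<Longrightarrow> Psi (tword w) = 0"
  by (cases w) (auto simp: Psi_init Psi_snoc Phi_odd[OF tword_homog] snoc_simps simp flip: snoc_tword)

lemma Psi_even: "t \<in> homog n \<Longrightarrow> even n \<Longrightarrow> Psi t = 0"
  by (rule homog_eq[OF clinear_Psi clinear_zero_fun]) (auto simp: Psi_even_tword)

lemma Theta_Psi_odd_tword: "odd (word_deg w) \<Longrightarrow> Theta (Psi (tword w)) = tword w"
  by (cases w) (auto simp: Psi_snoc Theta_snoc_init Th_iota Lam_adj_Phi_tword simp flip: snoc_tword)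

abbreviation one_comms :: "'a::complex_algebra forms set" where
  "one_comms \<equiv> {forms_comm \<omega> x | \<omega> x. \<omega> \<in> homog 1}"

text \<open>Both terms obey the same Leibniz rule modulo commutators and agree when \<open>y\<close>
  is a single letter. So \<open>Psi\<close> inverts the passage to odd forms modulo
  commutators.\<close>

lemma Psi_Th: "Psi (Th x y) - tens_snoc (tens_init x) y \<in> cvec.span one_comms"
proof -
  have 0: "Psi (Th x (iota a)) = tens_snoc (tens_init x) (iota a)" for x :: "'a talg adj" and a
    by (simp add: Th_iota Psi_snoc Phi_Lam_adj)
  have "\<forall>x. Psi (Th x (Abs_talg (tword w))) - tens_snoc (tens_init x) (Abs_talg (tword w)) \<in> cvec.span one_comms" for w :: "('a, 'a) word"
  proof (induct w)
    case (Init a)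
    then show ?case
      using 0 by (simp add: cvec.span_zero flip: iota_def)
  next
    case (Snoc w a)
    show ?case
    proof
      fix x :: "'a talg adj"
      let ?y = "Abs_talg (tword w)" and ?a = "iota a"
      have "Psi (Th x (?y * ?a)) - tens_snoc (tens_init x) (?y * ?a) =
          (Psi (Th (adj_incl ?a * x) ?y) - tens_snoc (tens_init (adj_incl ?a * x)) ?y) -
          forms_comm (tens_snoc (tens_init x) ?y) ?a"
        by (simp add: Th_mult Psi_linear 0 forms_comm_def rmul_snoc lmul_snoc rmul_init lmul_init)
      also have "\<dots> \<in> cvec.span one_comms"
        by (intro cvec.span_diff Snoc[rule_format] cvec.span_base) (use snoc_init_homog_1 in blast)
      finally show "Psi (Th x (Abs_talg (tword (Snoc w a)))) - tens_snoc (tens_init x) (Abs_talg (tword (Snoc w a))) \<in> cvec.span one_comms"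
        by (simp add: Abs_talg_snoc flip: snoc_tword)
    qed
  qed
  note words = this
  have "Psi (Th x (Abs_talg s)) - tens_snoc (tens_init x) (Abs_talg s) \<in> cvec.span one_comms" for s
    by (rule clinear_span_image[OF clinear_diff_fun[OF clinear_comp[OF clinear_comp[OF clinear_Abs_talg clinear_Th] clinear_Psi]
        clinear_comp[OF clinear_Abs_talg clinear_snoc_right]] _ span_tword]) (use words in blast)
  from this[of "Rep_talg y"] show ?thesis by (simp add: Rep_talg_inverse)
qed

lemma Psi_Theta: "v \<in> homog 1 \<Longrightarrow> Psi (Theta v) - v \<in> cvec.span one_comms"
  by (rule homog_1_map[OF clinear_diff_fun[OF clinear_comp[OF clinear_Theta clinear_Psi] clinear_ident]])
    (simp only: Theta_snoc_init Psi_Th)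

section \<open>The filtration by powers of the ideal\<close>

lemma multilinear_word_prod: "multilinear_word (word_prod :: ('a::complex_algebra, 'a) word \<Rightarrow> 'a)"
  by (rule multilinear_wordI[where f = "\<lambda>_::unit. word_prod"])
    (simp_all add: clinear_ident clinear_mult_right distrib_right mult_scaleC_left)

lemma clinear_talg_prod: "clinear talg_prod"
  unfolding talg_prod_def[abs_def] by (rule clinear_comp[OF clinear_Rep_talg clinear_tens_lift[OF multilinear_word_prod]])

lemma talg_prod_iota: "talg_prod (iota a) = a"
  by (simp add: talg_prod_def iota_def Abs_talg_inverse tens_lift_tword[OF multilinear_word_prod])

lemma talg_prod_snoc: "talg_prod (t * iota a) = talg_prod t * a"
proof -
  have "talg_prod (Abs_talg (tens_snoc s a)) = talg_prod (Abs_talg s) * a" for s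
    by (rule clinear_eq_on_tword[OF clinear_comp[OF clinear_comp[OF clinear_snoc clinear_Abs_talg] clinear_talg_prod]
          clinear_comp[OF clinear_comp[OF clinear_Abs_talg clinear_talg_prod] clinear_mult_left]])
      (simp add: talg_prod_def Abs_talg_inverse snoc_tword tens_lift_tword[OF multilinear_word_prod])
  from this[of "Rep_talg t"] show ?thesis
    by (simp add: Abs_talg_snoc Rep_talg_inverse)
qed

lemma talg_prod_mult: "talg_prod (s * t) = talg_prod s * talg_prod t"
  by (rule talg_induct[where f = "\<lambda>_::unit. \<lambda>t. talg_prod (s * t)" and g = "\<lambda>_. \<lambda>t. talg_prod s * talg_prod t"])
    (simp_all add: clinear_comp[OF clinear_mult_right clinear_talg_prod] clinear_comp[OF clinear_talg_prod clinear_mult_right]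
      talg_prod_snoc talg_prod_iota flip: mult.assoc)

lemma subspace_IR: "cvec.subspace IR"
  by (rule cvec.subspaceI) (auto simp: IR_def clinear_simps[OF clinear_talg_prod])

lemma curv_IR: "curv a b \<in> IR"
  by (simp add: IR_def curv_def clinear_simps[OF clinear_talg_prod] talg_prod_snoc talg_prod_iota)

lemma IR_mult: "x \<in> IR \<or> y \<in> IR \<Longrightarrow> x * y \<in> IR"
  by (auto simp: IR_def talg_prod_mult)

lemma talg_in_span:
  assumes "clinear f" "\<And>w. f (Abs_talg (tword w)) \<in> cvec.span B"
  shows "f t \<in> cvec.span B"
proof -
  have "f (Abs_talg s) \<in> cvec.span B" for s
    by (rule clinear_span_image[OF clinear_comp[OF clinear_Abs_talg assms(1)] _ span_tword]) (use assms(2) in blast)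
  from this[of "Rep_talg t"] show ?thesis by (simp add: Rep_talg_inverse)
qed

lemma Abs_talg_Snoc: "Abs_talg (tword (Snoc w a)) = Abs_talg (tword w) * iota a"
  by (simp add: Abs_talg_snoc flip: snoc_tword)

text \<open>On elements of degree zero the Fedosov product differs from the ordinary one only by
  forms of degree two; later factors preserve the filtration.\<close>

lemma Lam_talg_prod: "Lam t - tens_init (adj_incl (talg_prod t)) \<in> even_filt 1"
  unfolding even_filt_def
proof (rule talg_in_span[OF clinear_diff_fun[OF clinear_Lam clinear_comp[OF clinear_comp[OF clinear_talg_prod clinear_adj_incl] clinear_tword_Init]]], fold even_filt_def)
  show "Lam (Abs_talg (tword w)) - tens_init (adj_incl (talg_prod (Abs_talg (tword w)))) \<in> even_filt 1" for w :: "('a, 'a) word"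
  proof (induct w)
    case (Init a)
    then show ?case by (simp add: Lam_iota talg_prod_iota even_filt_simps flip: iota_def)
  next
    case (Snoc w a)
    let ?t = "Abs_talg (tword w)" and ?p = "talg_prod (Abs_talg (tword w))"
    have "tens_snoc (tens_snoc (tens_init 1) ?p) a \<in> even_filt 1"
      using snoc_snoc_even_filt[OF homog_even_filt[OF init_homog], of 0 1 ?p a] by simp
    then have "fed_rmul (Lam ?t - tens_init (adj_incl ?p)) a - tens_snoc (tens_snoc (tens_init 1) ?p) a \<in> even_filt 1"
      by (intro even_filt_simps fed_rmul_even_filt Snoc)
    also have "fed_rmul (Lam ?t - tens_init (adj_incl ?p)) a - tens_snoc (tens_snoc (tens_init 1) ?p) a =
        Lam (?t * iota a) - tens_init (adj_incl (talg_prod (?t * iota a)))"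
      by (simp add: Lam_snoc talg_prod_snoc clinear_simps[OF clinear_fed_rmul])
        (simp add: fed_rmul_def rmul_init d_init adj_incl_mult)
    finally show ?case by (simp add: Abs_talg_Snoc)
  qed
qed

lemma Lam_IR: "t \<in> IR \<Longrightarrow> Lam t \<in> even_filt 1"
  using Lam_talg_prod[of t] by (simp add: IR_def clinear_zero[OF clinear_adj_incl])

text \<open>Each pair of letters multiplies by one curvature, which raises the degree of the form by
  two; the remaining coefficient does not lower the filtration.\<close>

lemma Lam_adj_mult_Phi:
  assumes "t \<in> even_filt m" "Lam_adj x \<in> even_filt n"
  shows "Lam_adj (x * Phi t) \<in> even_filt (n + m)"
  unfolding even_filt_def
proof (rule even_filt_map[OF clinear_comp[OF clinear_comp[OF clinear_Phi clinear_mult_right] clinear_Lam_adj] _ assms(1)], fold even_filt_def)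
  fix w :: "('a adj, 'a) word" assume w: "even (word_deg w)" "2 * m \<le> word_deg w"
  have "Lam_adj (x * Phi (tword w)) \<in> even_filt (n + word_deg w div 2)"
    using w(1)
  proof (induct w rule: even_word_induct)
    case (Init y)
    have "x * Phi (tens_init y) = scalar_part y *\<^sub>C x + x * adj_incl (iota (alg_part y))"
      by (rule adj_eqI) (simp_all add: Phi_init)
    then show ?case
      using assms(2) by (simp add: Lam_linear Lam_adj_snoc even_filt_simps fed_rmul_even_filt)
  next
    case (Snoc w a b)
    then show ?case
      using snoc_snoc_even_filt[of "Lam_adj (x * Phi (tword w))" "n + word_deg w div 2" a b]
      by (simp add: Phi_snoc_snoc Lam_adj_curv flip: snoc_tword mult.assoc)
  qed
  then show "Lam_adj (x * Phi (tword w)) \<in> even_filt (n + m)"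
    by (rule even_filt_mono) (use w in presburger)
qed

lemma Lam_adj_mult:
  "Lam_adj x \<in> even_filt n \<Longrightarrow> Lam_adj y \<in> even_filt m \<Longrightarrow> Lam_adj (x * y) \<in> even_filt (n + m)"
  using Lam_adj_mult_Phi[of "Lam_adj y" m x n] by (simp add: Phi_Lam_adj)

lemma subspace_ideal_pow: "cvec.subspace (ideal_pow IR n)"
  by (cases "(IR :: 'a talg set, n)" rule: ideal_pow.cases) (auto simp: subspace_IR)

lemma Lam_ideal_pow: "t \<in> ideal_pow IR n \<Longrightarrow> Lam t \<in> even_filt n"
proof (induct "IR :: 'a talg set" n arbitrary: t rule: ideal_pow.induct)
  case 1
  show ?case by (rule Lam_even)
next
  case 2
  then show ?case using Lam_IR by simp
next
  case (3 n)
  have "Lam (x * y) \<in> even_filt (Suc (Suc n))" if "x \<in> ideal_pow IR (Suc n)" "y \<in> IR" for x y :: "'a talg"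
    using Lam_adj_mult[of "adj_incl x" "Suc n" "adj_incl y" 1] 3(1)[OF that(1)] Lam_IR[OF that(2)]
    by (simp add: Lam_adj_incl flip: adj_incl_mult)
  then show ?case
    using clinear_span_image[OF clinear_Lam _ 3(2)[unfolded ideal_pow.simps]] unfolding even_filt_def by blast
qed

lemma ideal_pow_mult_right: "t \<in> ideal_pow IR n \<Longrightarrow> t * z \<in> ideal_pow IR n"
proof (induct "IR :: 'a talg set" n arbitrary: t z rule: ideal_pow.induct)
  case (3 n)
  show ?case
    unfolding ideal_pow.simps
  proof (rule clinear_span_image[OF clinear_mult_left _ 3(2)[unfolded ideal_pow.simps]])
    fix u :: "'a talg" assume "u \<in> {x * y | x y. x \<in> ideal_pow IR (Suc n) \<and> y \<in> IR}"
    then obtain x y where "u = x * y" "x \<in> ideal_pow IR (Suc n)" "y \<in> IR" by blast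
    then show "u * z \<in> cvec.span {x * y | x y. x \<in> ideal_pow IR (Suc n) \<and> y \<in> IR}"
      using IR_mult[of y z] by (intro cvec.span_base) (auto simp: mult.assoc)
  qed
qed (auto simp: IR_mult)

lemma ideal_pow_Suc_subset: "t \<in> ideal_pow IR (Suc n) \<Longrightarrow> t \<in> ideal_pow IR n"
proof (cases n)
  case (Suc m)
  assume "t \<in> ideal_pow IR (Suc n)"
  moreover have "cvec.span {x * y | x y. x \<in> ideal_pow IR (Suc m) \<and> y \<in> IR} \<subseteq> ideal_pow IR (Suc m)"
    by (rule cvec.span_minimal[OF _ subspace_ideal_pow]) (auto intro: ideal_pow_mult_right)
  ultimately show ?thesis using Suc by auto
qed simp

lemma ideal_pow_mono: "t \<in> ideal_pow IR m \<Longrightarrow> n \<le> m \<Longrightarrow> t \<in> ideal_pow IR n"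
  by (induct m) (auto simp: le_Suc_eq dest: ideal_pow_Suc_subset)

lemma scalar_part_Phi: "even (word_deg w) \<Longrightarrow> 0 < word_deg w \<Longrightarrow> scalar_part (Phi (tword w)) = 0"
  by (erule even_word_cases) (auto simp: Phi_snoc_snoc simp flip: snoc_tword)

lemma alg_part_Phi_ideal_pow:
  "even (word_deg w) \<Longrightarrow> alg_part (Phi (tword w)) \<in> ideal_pow IR (word_deg w div 2)"
proof (induct w rule: even_word_induct)
  case (Snoc w a b)
  show ?case
  proof (cases "word_deg w = 0")
    case True
    \<comment> \<open>At the first pair the coefficient may have a scalar part, so the curvature
      itself is needed in \<open>IR\<close>.\<close>
    have "scalar_part (Phi (tword w)) *\<^sub>C curv a b + alg_part (Phi (tword w)) * curv a b \<in> IR"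
      by (intro cvec.subspace_add[OF subspace_IR] cvec.subspace_scale[OF subspace_IR] IR_mult disjI2 curv_IR)
    then show ?thesis
      using True by (simp add: Phi_snoc_snoc flip: snoc_tword)
  next
    case False
    then obtain m where "word_deg w div 2 = Suc m"
      using Snoc(1) by (cases "word_deg w div 2") auto
    then show ?thesis
      using Snoc(2) scalar_part_Phi[OF Snoc(1)] False curv_IR[of a b]
      by (auto simp: Phi_snoc_snoc simp flip: snoc_tword intro!: cvec.span_base)
  qed
qed simp

lemma even_filt_alg_part_Phi: "t \<in> even_filt n \<Longrightarrow> alg_part (Phi t) \<in> ideal_pow IR n"
proof -
  have *: "cvec.span (ideal_pow IR n) = (ideal_pow IR n :: 'a talg set)"
    by (simp add: subspace_ideal_pow cvec.span_eq_iff)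
  assume "t \<in> even_filt n"
  then have "alg_part (Phi t) \<in> cvec.span (ideal_pow IR n)"
  proof (rule even_filt_map[OF clinear_comp[OF clinear_Phi clinear_alg_part], rotated])
    fix w :: "('a adj, 'a) word" assume w: "even (word_deg w)" "2 * n \<le> word_deg w"
    then show "alg_part (Phi (tword w)) \<in> cvec.span (ideal_pow IR n)"
      unfolding * by (intro ideal_pow_mono[OF alg_part_Phi_ideal_pow]) auto
  qed
  then show ?thesis by (simp add: *)
qed

lemma ideal_pow_iff: "t \<in> ideal_pow IR n \<longleftrightarrow> Lam t \<in> even_filt n"
  using Lam_ideal_pow even_filt_alg_part_Phi[of "Lam t" n] by (auto simp: Phi_Lam)

text \<open>The convention that the zeroth power is the unitization makes the match hold for n = 0.
  For n > 0 the scalar part must vanish, because \<open>Phi\<close> of words of positive degree has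
  none.\<close>

lemma ideal_coeff_iff: "x \<in> ideal_coeff IR n \<longleftrightarrow> Lam_adj x \<in> even_filt n"
proof (cases "n = 0")
  case True
  then show ?thesis by (simp add: ideal_coeff_def Lam_adj_even)
next
  case False
  have "scalar_part x = 0" if "Lam_adj x \<in> even_filt n"
  proof -
    have "scalar_part (Phi (Lam_adj x)) = 0"
      by (rule even_filt_eq[OF clinear_comp[OF clinear_Phi] clinear_zero_fun _ that])
        (use False in \<open>auto simp: scalar_part_Phi clinear_iff scaleC_complex_def\<close>)
    then show ?thesis by (simp add: Phi_Lam_adj)
  qed
  then have "Lam_adj x \<in> even_filt n \<Longrightarrow> x = adj_incl (alg_part x) \<and> alg_part x \<in> ideal_pow IR n"
    using adj_decompose[of x] by (simp add: ideal_pow_iff Lam_adj_def)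
  then show ?thesis
    using False by (auto simp: ideal_coeff_def image_iff Lam_adj_incl ideal_pow_iff)
qed

lemma Th_odd_filt:
  assumes "Lam_adj x \<in> even_filt n"
  shows "Th x y \<in> odd_filt n"
  unfolding odd_filt_def
proof (rule talg_in_span[OF clinear_Th], fold odd_filt_def)
  show "Th x (Abs_talg (tword w)) \<in> odd_filt n" for w :: "('a, 'a) word"
    using assms
  proof (induct w arbitrary: x)
    case (Init a)
    then show ?case by (simp add: Th_iota snoc_odd_filt flip: iota_def)
  next
    case (Snoc w a)
    have "Lam_adj (x * adj_incl (Abs_talg (tword w))) \<in> even_filt n"
      using Lam_adj_mult[OF Snoc(2) Lam_adj_even] by simp
    moreover have "Lam_adj (adj_incl (iota a) * x) \<in> even_filt n"
      using Lam_adj_mult[OF Lam_adj_even Snoc(2)] by simp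
    ultimately show ?case
      by (simp add: Abs_talg_Snoc Th_snoc odd_filt_simps snoc_odd_filt Snoc(1))
  qed
qed

section \<open>Equivariance of the comparison maps\<close>

context twisted_module_algebra
begin

interpretation T: twisted_module_algebra \<Delta> \<epsilon> S \<delta> "talg_act \<Delta> act"
  by (rule talg_twisted_module_algebra)

lemma hact_fed_rmul: "hact h (fed_rmul t a) = sw (\<lambda>x y. fed_rmul (hact x t) (act y a)) h"
  by (simp add: fed_rmul_def clinear_diff[OF clinear_hact] hact_rmul hact_snoc hact_d tensor_lift_diff)

lemma Lam_act: "Lam (talg_act \<Delta> act h t) = hact h (Lam t)"
proof (rule talg_induct[where f = "\<lambda>h t. Lam (talg_act \<Delta> act h t)" and g = "\<lambda>h t. hact h (Lam t)"])
  show "clinear (\<lambda>t. Lam (talg_act \<Delta> act p t))" for p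
    by (rule clinear_comp[OF clinear_talg_act clinear_Lam])
  show "clinear (\<lambda>t. hact p (Lam t))" for p
    by (rule clinear_comp[OF clinear_Lam clinear_hact])
qed (simp_all add: talg_act_iota Lam_iota hact_init adj_act_incl talg_act_snoc Lam_snoc hact_fed_rmul
    tensor_lift_clinear[OF clinear_Lam])

lemma Lam_adj_act: "Lam_adj (adj_act \<epsilon> (talg_act \<Delta> act) h x) = hact h (Lam_adj x)"
proof -
  have "scalar_part (adj_act \<epsilon> (talg_act \<Delta> act) h x) = \<epsilon> h * scalar_part x"
    "alg_part (adj_act \<epsilon> (talg_act \<Delta> act) h x) = talg_act \<Delta> act h (alg_part x)"
    by (simp_all add: adj_act_def)
  then show ?thesis
    by (simp add: Lam_adj_def Lam_act clinear_simps[OF clinear_hact] hact_init adj_act_one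
        clinear_simps[OF clinear_tword_Init] scaleC_scaleC mult.commute)
qed

text \<open>Inherited from \<open>Lam_adj\<close>, which \<open>Phi\<close> inverts on even forms;
  odd forms go to zero on both sides.\<close>

lemma Phi_act_tword: "Phi (hact h (tword w)) = adj_act \<epsilon> (talg_act \<Delta> act) h (Phi (tword w))"
proof (cases "even (word_deg w)")
  case True
  have "Phi (hact h (Lam_adj (Phi (tword w)))) = adj_act \<epsilon> (talg_act \<Delta> act) h (Phi (tword w))"
    by (simp add: Phi_Lam_adj flip: Lam_adj_act)
  then show ?thesis by (simp add: Lam_adj_Phi_tword True)
next
  case False
  then have "Phi (hact h (tword w)) = 0" "Phi (tword w) = 0"
    using Phi_odd[OF hact_homog[OF tword_homog]] Phi_odd[OF tword_homog] by auto
  then show ?thesis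
    by (simp add: clinear_zero[OF hmoduleD(3)[OF T.hmodule_adj]])
qed

lemma Phi_act: "Phi (hact h t) = adj_act \<epsilon> (talg_act \<Delta> act) h (Phi t)"
  by (rule clinear_eq_on_tword[OF clinear_comp[OF clinear_hact clinear_Phi]
        clinear_comp[OF clinear_Phi hmoduleD(3)[OF T.hmodule_adj]] Phi_act_tword])

lemma Psi_act: "Psi (hact h t) = T.hact h (Psi t)"
proof (rule tens_induct[OF clinear_comp[OF clinear_hact clinear_Psi] clinear_comp[OF clinear_Psi T.clinear_hact]])
  show "Psi (hact h (tens_init x)) = T.hact h (Psi (tens_init x))" for x
    by (simp add: hact_init Psi_init clinear_zero[OF T.clinear_hact])
  show "Psi (hact h (tens_snoc (tword w) a)) = T.hact h (Psi (tens_snoc (tword w) a))" for w a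
    by (simp add: hact_snoc Psi_snoc T.hact_snoc T.hact_init Phi_act talg_act_iota tensor_lift_clinear[OF clinear_Psi])
qed

text \<open>The diagonal action preserves the tensor length of the differentiated element, which
  makes an induction on that length possible.\<close>

lemma T_hact_words:
  assumes "v \<in> cvec.span {tens_snoc (tens_init x) (Abs_talg (tword w)) | x w. word_deg w = n}"
  shows "T.hact h v \<in> cvec.span {tens_snoc (tens_init x) (Abs_talg (tword w)) | x w. word_deg w = n}" (is "_ \<in> cvec.span ?B")
proof (rule clinear_span_image[OF T.clinear_hact _ assms])
  fix u assume "u \<in> ?B"
  then obtain x w where u: "u = tens_snoc (tens_init x) (Abs_talg (tword w))" "word_deg w = n" by blast
  have "tens_snoc (tens_init z) (Abs_talg s) \<in> cvec.span ?B" if "s \<in> homog n" for z s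
    by (rule clinear_span_image[OF clinear_comp[OF clinear_Abs_talg clinear_snoc_right] _ that[unfolded homog_def]])
      (auto intro!: cvec.span_base)
  moreover have "diag_act \<Delta> act act y (tword w) \<in> homog n" for y
    using diag_homog[OF hmodule_act hmodule_act tword_homog[of w]] u(2) by simp
  ultimately show "T.hact h u \<in> cvec.span ?B"
    unfolding u(1) T.hact_snoc T.hact_init talg_act_def
    by (intro tensor_lift_span) (simp add: Abs_talg_inverse)
qed

text \<open>\<open>Th\<close> rotates letters to the front of the coefficient, so the legs of the
  coproduct come out in a rotated order and equivariance is obtained only modulo coinvariants. The
  induction is on the length of the differentiated word.\<close>

lemma Theta_act_words:
  assumes "v \<in> cvec.span {tens_snoc (tens_init x) (Abs_talg (tword w)) | x w. word_deg w = n}"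
  shows "Theta (T.hact h v) - \<delta> h *\<^sub>C Theta v \<in> cvec.span coinv_gens"
  using assms
proof (induct n arbitrary: v h)
  have lin: "clinear (\<lambda>v. Theta (T.hact h v) - \<delta> h *\<^sub>C Theta v)" for h
    by (intro clinear_diff_fun clinear_comp[OF T.clinear_hact clinear_Theta] clinear_scale_fun clinear_Theta)
  have iota: "Theta (T.hact h (tens_snoc (tens_init x) (iota a))) - \<delta> h *\<^sub>C Theta (tens_snoc (tens_init x) (iota a)) \<in> cvec.span coinv_gens" for h x a
    using hact_diff_coinv[of h "tens_snoc (Lam_adj x) a"]
    by (simp add: T.hact_snoc T.hact_init talg_act_iota tensor_lift_clinear[OF clinear_Theta] Theta_snoc_init Th_iota
        Lam_adj_act hact_snoc)
  {
    case 0
    show ?case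
    proof (rule clinear_span_image[OF lin _ 0])
      fix u :: "'a talg forms" assume "u \<in> {tens_snoc (tens_init x) (Abs_talg (tword w)) | x w. word_deg w = 0}"
      then obtain x w where u: "u = tens_snoc (tens_init x) (Abs_talg (tword w))" "word_deg w = 0" by blast
      then obtain a where "w = Init a" by (cases w) auto
      then show "Theta (T.hact h u) - \<delta> h *\<^sub>C Theta u \<in> cvec.span coinv_gens"
        using iota[of h x a] u by (simp add: iota_def)
    qed
  next
    case (Suc n)
    let ?V = "\<lambda>n. cvec.span {tens_snoc (tens_init x) (Abs_talg (tword w)) | x w. word_deg w = n}"
    show ?case
    proof (rule clinear_span_image[OF lin _ Suc(2)])
      fix u :: "'a talg forms" assume "u \<in> {tens_snoc (tens_init x) (Abs_talg (tword w)) | x w. word_deg w = Suc n}"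
      then obtain x w' where u: "u = tens_snoc (tens_init x) (Abs_talg (tword w'))" "word_deg w' = Suc n" by blast
      then obtain w a where w: "w' = Snoc w a" "word_deg w = n" by (cases w') auto
      define y v where "y = Abs_talg (tword w)" and "v = tens_snoc (tens_init x) y"
      have v: "v \<in> ?V n" unfolding v_def y_def by (rule cvec.span_base) (use w in blast)
      have v1: "T.hact h v \<in> homog 1" for h
        unfolding v_def by (rule T.hact_homog[OF snoc_init_homog_1])
      have V_lmul: "forms_lmul b v' \<in> ?V n" if "v' \<in> ?V n" for b :: "'a talg" and v'
      proof (rule clinear_span_image[OF clinear_lmul _ that])
        fix s :: "'a talg forms" assume "s \<in> {tens_snoc (tens_init x) (Abs_talg (tword w)) | x w. word_deg w = n}"
        then obtain x w where "s = tens_snoc (tens_init x) (Abs_talg (tword w))" "word_deg w = n" by blast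
        then have "forms_lmul b s = tens_snoc (tens_init (adj_incl b * x)) (Abs_talg (tword w))"
          by (simp add: lmul_snoc lmul_init)
        then show "forms_lmul b s \<in> ?V n"
          using \<open>word_deg w = n\<close> by (intro cvec.span_base) blast
      qed
      have comm: "Theta (forms_rmul v' z) = Theta (forms_lmul z v')" if "v' \<in> homog 1" for v' :: "'a talg forms" and z
        using Theta_comm[OF that, of z] by (simp add: forms_comm_def Theta_linear)
      \<comment> \<open>The induction hypothesis covers a v with the legs in order, but only for
        \<open>v\<close> of length n; this is why \<open>flip_coinvariants\<close> is relative to a
        subset. After the exchange, a v becomes v a because \<open>Theta\<close> kills
        commutators.\<close>
      have "sw (\<lambda>p q. Theta (forms_lmul (iota (act q a)) (T.hact p v))) h - \<delta> h *\<^sub>C Theta (forms_lmul (iota a) v) \<in> cvec.span coinv_gens"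
      proof (rule flip_coinvariants[OF hmodule_act T.hmodule_hact, where V = "?V n"])
        show "bilin (\<lambda>a v. Theta (forms_lmul (iota a) v))"
          by (rule bilin_post[OF bilin_comp[OF bilin_lmul clinear_iota clinear_ident] clinear_Theta])
        show "sw (\<lambda>p q. Theta (forms_lmul (iota (act p b)) (T.hact q v'))) g - \<delta> g *\<^sub>C Theta (forms_lmul (iota b) v') \<in> cvec.span coinv_gens"
          if "v' \<in> ?V n" for g b v'
          using Suc(1)[OF V_lmul[OF that], of g "iota b"]
          by (simp add: T.hact_lmul talg_act_iota tensor_lift_clinear[OF clinear_Theta])
      qed (simp_all add: v T_hact_words)
      also have "sw (\<lambda>p q. Theta (forms_lmul (iota (act q a)) (T.hact p v))) h = Theta (T.hact h (forms_rmul v (iota a)))"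
        by (simp add: T.hact_rmul talg_act_iota tensor_lift_clinear[OF clinear_Theta] comm[OF v1])
      also have "Theta (forms_lmul (iota a) v) = Theta (forms_rmul v (iota a))"
        by (simp add: comm snoc_init_homog_1 v_def del: One_nat_def)
      finally have 1: "Theta (T.hact h (forms_rmul v (iota a))) - \<delta> h *\<^sub>C Theta (forms_rmul v (iota a)) \<in> cvec.span coinv_gens" .
      \<comment> \<open>Leibniz rule x d(ya) = (x dy) a + xy da.\<close>
      have "u = forms_rmul v (iota a) + tens_snoc (tens_init (x * adj_incl y)) (iota a)"
        by (simp add: u w v_def y_def Abs_talg_Snoc rmul_snoc rmul_init)
      then show "Theta (T.hact h u) - \<delta> h *\<^sub>C Theta u \<in> cvec.span coinv_gens"
        using cvec.span_add[OF 1 iota[of h "x * adj_incl y" a]]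
        by (simp add: clinear_add[OF T.clinear_hact] Theta_linear scaleC_add_right algebra_simps)
    qed
  }
qed

lemma Theta_act: "v \<in> homog 1 \<Longrightarrow> Theta (T.hact h v) - \<delta> h *\<^sub>C Theta v \<in> cvec.span coinv_gens"
proof (rule homog_1_map[where f = "\<lambda>v. Theta (T.hact h v) - \<delta> h *\<^sub>C Theta v"])
  show "clinear (\<lambda>v. Theta (T.hact h v) - \<delta> h *\<^sub>C Theta v)"
    by (intro clinear_diff_fun clinear_comp[OF T.clinear_hact clinear_Theta] clinear_scale_fun clinear_Theta)
  show "Theta (T.hact h (tens_snoc (tens_init x) y)) - \<delta> h *\<^sub>C Theta (tens_snoc (tens_init x) y) \<in> cvec.span coinv_gens" for x :: "'a talg adj" and y
  proof (rule talg_in_span[where f = "\<lambda>y. Theta (T.hact h (tens_snoc (tens_init x) y)) - \<delta> h *\<^sub>C Theta (tens_snoc (tens_init x) y)"])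
    show "clinear (\<lambda>y. Theta (T.hact h (tens_snoc (tens_init x) y)) - \<delta> h *\<^sub>C Theta (tens_snoc (tens_init x) y))"
      by (intro clinear_diff_fun clinear_comp[OF clinear_comp[OF clinear_snoc_right T.clinear_hact] clinear_Theta]
          clinear_scale_fun clinear_comp[OF clinear_snoc_right clinear_Theta])
  qed (rule Theta_act_words, rule cvec.span_base, blast)
qed

end

section \<open>The tower \<open>\<X>\<^sub>\<delta>(TR, IR)\<close> as a tower of quotients of forms\<close>

lemma Forms_Suc: "Forms (Suc n) = homog (Suc n)"
  by (simp add: Forms_def homog_def)

lemma Forms_1: "Forms 1 = homog 1"
  using Forms_Suc[of 0] by simp

lemma even_filt_hodge_ker: "t \<in> even_filt n \<Longrightarrow> m < 2 * n \<Longrightarrow> t \<in> hodge_ker C m p"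
  unfolding hodge_ker_def
  by (rule even_filt_map[OF clinear_ident]) (auto intro: homog_hodge_ker[OF tword_homog, unfolded hodge_ker_def])

lemma odd_filt_hodge_ker: "t \<in> odd_filt n \<Longrightarrow> m \<le> 2 * n \<Longrightarrow> t \<in> hodge_ker C m p"
proof -
  assume "t \<in> odd_filt n" "m \<le> 2 * n"
  moreover have "odd_filt n \<subseteq> hodge_ker C m p" if "m \<le> 2 * n"
    unfolding odd_filt_def
    by (rule cvec.span_minimal[OF _ subspace_hodge_ker]) (use that in \<open>auto intro: homog_hodge_ker[OF tword_homog]\<close>)
  ultimately show ?thesis by blast
qed

lemma hodge_ker_Suc_subset:
  assumes "t \<in> hodge_ker C (Suc m) p"
  shows "t \<in> hodge_ker C m p"
  unfolding hodge_ker_def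
proof (rule hodge_ker_map[OF clinear_ident assms], fold hodge_ker_def)
  show "tword w \<in> hodge_ker C m p" if "word_deg w mod 2 \<noteq> p \<or> Suc m < word_deg w" for w
    by (rule homog_hodge_ker[OF tword_homog]) (use that in auto)
  show "forms_b t \<in> hodge_ker C m p" if "t \<in> homog (Suc (Suc m))" for t
    by (rule homog_hodge_ker[OF b_homog[OF that]]) simp
qed (auto intro: init_1_hodge_ker span_hodge_ker cvec.span_base)

context twisted_module_algebra
begin

interpretation T: twisted_module_algebra \<Delta> \<epsilon> S \<delta> "talg_act \<Delta> act"
  by (rule talg_twisted_module_algebra)

abbreviation K :: "nat \<Rightarrow> nat \<Rightarrow> 'a forms set" where
  "K \<equiv> hodge_ker coinv_gens"

abbreviation X_ev :: "nat \<Rightarrow> 'a talg set" where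
  "X_ev \<equiv> X_ev_relations \<delta> (talg_act \<Delta> act) IR"

abbreviation X_od :: "nat \<Rightarrow> 'a talg forms set" where
  "X_od \<equiv> X_od_relations IR"

abbreviation X_nat :: "'a talg forms set" where
  "X_nat \<equiv> nat_relations \<Delta> \<epsilon> \<delta> (talg_act \<Delta> act)"

section \<open>Even part: relations in the tensor algebra and kernels in forms\<close>

lemma subspace_X_ev: "cvec.subspace (X_ev m)"
  by (simp add: X_ev_relations_def Let_def)

lemma X_ev_pow: "t \<in> ideal_pow IR (Suc (m div 2)) \<Longrightarrow> t \<in> X_ev m"
  by (auto simp: X_ev_relations_def Let_def intro: cvec.span_base)

lemma X_ev_coinv: "talg_act \<Delta> act h t - \<delta> h *\<^sub>C t \<in> X_ev m"
proof -
  have "talg_act \<Delta> act h t - \<delta> h *\<^sub>C t \<in> coinv (talg_act \<Delta> act) \<delta> UNIV"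
    unfolding coinv_def by (rule cvec.span_base) blast
  then show ?thesis
    by (auto simp: X_ev_relations_def Let_def intro: cvec.span_base)
qed

lemma Lam_coinv: "t \<in> coinv (talg_act \<Delta> act) \<delta> UNIV \<Longrightarrow> Lam t \<in> K m p"
proof (rule span_hodge_ker)
  assume "t \<in> coinv (talg_act \<Delta> act) \<delta> UNIV"
  then show "Lam t \<in> cvec.span coinv_gens"
    unfolding coinv_def
    by (rule clinear_span_image[OF clinear_Lam, rotated])
      (auto simp: clinear_simps[OF clinear_Lam] Lam_act hact_diff_coinv)
qed

lemma Lam_X_ev:
  assumes "t \<in> X_ev m"
  shows "Lam t \<in> K m 0"
proof -
  have pow: "Lam s \<in> K m 0" if "s \<in> ideal_pow IR (Suc (m div 2))" for s
    using that by (intro even_filt_hodge_ker[of _ "Suc (m div 2)"]) (auto simp: ideal_pow_iff)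
  \<comment> \<open>The commutator is \<open>D_X\<close> of an odd form all of whose components have
    degree greater than m, and \<open>D_X\<close> respects the kernels.\<close>
  have comm: "Lam (x * y - y * x) \<in> K m 0" if "x \<in> ideal_pow IR (m div 2)" "even m" for x y
  proof -
    have "Lam_adj (adj_incl x) \<in> even_filt (m div 2)"
      using that by (simp add: Lam_adj_incl ideal_pow_iff)
    moreover have "m \<le> 2 * (m div 2)" using that(2) by presburger
    ultimately have "Th (adj_incl x) y \<in> K m 1"
      by (rule odd_filt_hodge_ker[OF Th_odd_filt])
    from D_X_hodge_ker[OF this] show ?thesis
      using Lam_commutator[of "adj_incl x" y] by (simp add: Lam_adj_incl clinear_diff[OF clinear_adj_incl] flip: adj_incl_mult)
        (simp add: Lam_adj_incl flip: clinear_diff[OF clinear_adj_incl])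
  qed
  show ?thesis
  proof (cases "odd m")
    case True
    have "t \<in> cvec.span (ideal_pow IR (Suc (m div 2)) \<union> coinv (talg_act \<Delta> act) \<delta> UNIV)"
      using assms True by (simp add: X_ev_relations_def Let_def)
    then show ?thesis
      unfolding hodge_ker_def
      by (rule clinear_span_image[OF clinear_Lam, rotated], fold hodge_ker_def) (use pow Lam_coinv in blast)
  next
    case False
    then have even: "even m" by simp
    have "t \<in> cvec.span (ideal_pow IR (Suc (m div 2)) \<union> {x * y - y * x | x y. x \<in> ideal_pow IR (m div 2)} \<union>
        coinv (talg_act \<Delta> act) \<delta> UNIV)"
      using assms False by (simp add: X_ev_relations_def Let_def)
    then show ?thesis
      unfolding hodge_ker_def
      by (rule clinear_span_image[OF clinear_Lam, rotated], fold hodge_ker_def) (use pow comm[OF _ even] Lam_coinv in blast)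
  qed
qed

text \<open>Trades b for a Fedosov commutator. The correction (1 + k) d has degree two higher than b
  of the form, hence is cut off at the level whose top boundary is being computed.\<close>

lemma form_b_last:
  assumes "even (word_deg v)"
  shows "forms_b (tens_snoc (tword v) a) =
    D_X (tens_snoc (tword v) a) + kpoly (1 + XX) (forms_d (tens_snoc (tword v) a))"
proof -
  obtain n where "word_deg v = 2 * n" using assms by (elim evenE)
  then show ?thesis
    using D_X_odd[OF snoc_homog, of "tword v" n a] tword_homog[of v] by simp
qed

lemma even_filt_Phi_X_ev:
  assumes "t \<in> homog n" "m < n"
  shows "alg_part (Phi t) \<in> X_ev m"
proof (cases "even n")
  case True
  have "t \<in> even_filt (Suc (m div 2))"
    by (rule homog_even_filt[OF assms(1) True]) (use assms(2) True in presburger)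
  then show ?thesis by (intro X_ev_pow even_filt_alg_part_Phi)
next
  case False
  then show ?thesis
    using Phi_odd[OF assms(1)] cvec.subspace_0[OF subspace_X_ev] by simp
qed

lemma alg_part_Phi_X_ev:
  assumes "t \<in> K m 0"
  shows "alg_part (Phi t) \<in> X_ev m"
proof -
  have span: "cvec.span (X_ev m) = X_ev m"
    by (simp add: subspace_X_ev cvec.span_eq_iff)
  have lin: "clinear (\<lambda>t. alg_part (Phi t))"
    by (rule clinear_comp[OF clinear_Phi clinear_alg_part])
  have "alg_part (Phi t) \<in> cvec.span (X_ev m)"
  proof (rule hodge_ker_map[OF lin assms])
    fix w :: "('a adj, 'a) word" assume "word_deg w mod 2 \<noteq> 0 \<or> m < word_deg w"
    then show "alg_part (Phi (tword w)) \<in> cvec.span (X_ev m)"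
      using even_filt_Phi_X_ev[OF tword_homog[of w]] Phi_odd[OF tword_homog[of w]]
      by (auto simp: span cvec.subspace_0[OF subspace_X_ev] odd_iff_mod_2_eq_one)
  next
    show "alg_part (Phi (tens_init 1)) \<in> cvec.span (X_ev m)"
      by (simp add: Phi_init_1 cvec.span_zero)
  next
    fix c assume "c \<in> coinv_gens"
    then obtain h w where "c = hact h (tword w) - \<delta> h *\<^sub>C tword w"
      unfolding coinv_gens_def by blast
    then have "alg_part (Phi c) = talg_act \<Delta> act h (alg_part (Phi (tword w))) - \<delta> h *\<^sub>C alg_part (Phi (tword w))"
      by (simp add: Phi_linear Phi_act) (simp add: adj_act_def)
    then show "alg_part (Phi c) \<in> cvec.span (X_ev m)"
      by (simp add: span X_ev_coinv)
  next
    \<comment> \<open>Only even m matters, since \<open>Phi\<close> kills odd forms. Then b of a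
      word of degree m + 1 is, up to higher degree, a commutator with coefficient in the power m / 2
      of the ideal.\<close>
    fix s :: "'a forms" assume s: "s \<in> homog (Suc m)"
    show "alg_part (Phi (forms_b s)) \<in> cvec.span (X_ev m)"
    proof (cases "even m")
      case False
      then show ?thesis
        using Phi_odd[OF b_homog[OF s]] by (simp add: cvec.span_zero)
    next
      case True
      have "alg_part (Phi (forms_b (tword w))) \<in> cvec.span (X_ev m)" if w: "word_deg w = Suc m" for w
      proof -
        obtain v a where v: "w = Snoc v a" "word_deg v = m" using w by (cases w) auto
        have even: "tword v \<in> even_filt (m div 2)"
          by (rule even_filt_tword) (use v True in auto)
        let ?x = "alg_part (Phi (tword v))"
        have "Phi (forms_b (tword w)) = (Phi (tword v) * adj_incl (iota a) - adj_incl (iota a) * Phi (tword v)) +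
            Phi (kpoly (1 + XX) (forms_d (tword w)))"
          using even_filt_mono[OF even, of 0] v True
          by (simp add: form_b_last D_X_snoc Phi_linear Phi_fed_rmul Phi_fed_lmul flip: snoc_tword)
        then have "alg_part (Phi (forms_b (tword w))) = (?x * iota a - iota a * ?x) +
            alg_part (Phi (kpoly (1 + XX) (forms_d (tword w))))"
          by simp
        moreover have "?x * iota a - iota a * ?x \<in> X_ev m"
          using even_filt_alg_part_Phi[OF even] True
          by (auto simp: X_ev_relations_def Let_def intro!: cvec.span_base)
        moreover have "alg_part (Phi (kpoly (1 + XX) (forms_d (tword w)))) \<in> X_ev m"
          using even_filt_Phi_X_ev[OF kpoly_homog[OF d_homog[OF tword_homog[of w]]], of m] w by simp
        ultimately show ?thesis
          by (simp add: span cvec.subspace_add[OF subspace_X_ev])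
      qed
      then show ?thesis
        using clinear_span_image[OF clinear_comp[OF clinear_b lin], of "tword ` {w. word_deg w = Suc m}" "X_ev m" s] s
        unfolding homog_def by auto
    qed
  qed
  then show ?thesis by (simp only: span)
qed

lemma tword_minus_Lam: "tword w - Lam (alg_part (Phi (tword w))) \<in> K m 0"
proof (cases "even (word_deg w)")
  case True
  then have "tword w - Lam (alg_part (Phi (tword w))) = scalar_part (Phi (tword w)) *\<^sub>C tens_init 1"
    using Lam_adj_Phi_tword[OF True] by (simp add: Lam_adj_def algebra_simps)
  then show ?thesis by (simp add: hodge_ker_simps init_1_hodge_ker)
next
  case False
  then show ?thesis
    using homog_hodge_ker[OF tword_homog[of w], of 0 m coinv_gens] Phi_odd[OF tword_homog[of w]]
    by (simp add: clinear_zero[OF clinear_Lam] odd_iff_mod_2_eq_one)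
qed

lemma minus_Lam: "t - Lam (alg_part (Phi t)) \<in> K m 0"
  unfolding hodge_ker_def
  by (rule clinear_span_image[OF clinear_diff_fun[OF clinear_ident clinear_comp[OF clinear_comp[OF clinear_Phi clinear_alg_part] clinear_Lam]] _ span_tword])
    (use tword_minus_Lam in \<open>auto simp: hodge_ker_def\<close>)

text \<open>Forms differ from their image under \<open>Phi\<close> and back under \<open>Lam\<close>
  only by the kernel, so the two inclusions already shown give equality.\<close>

lemma alg_part_Phi_X_ev_iff: "alg_part (Phi t) \<in> X_ev m \<longleftrightarrow> t \<in> K m 0"
proof
  assume "alg_part (Phi t) \<in> X_ev m"
  from hodge_ker_simps(2)[OF Lam_X_ev[OF this] minus_Lam[of t m]] show "t \<in> K m 0"
    by simp
qed (rule alg_part_Phi_X_ev)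

lemma X_ev_iff: "t \<in> X_ev m \<longleftrightarrow> Lam t \<in> K m 0"
  using alg_part_Phi_X_ev_iff[of "Lam t" m] by (simp add: Phi_Lam)

section \<open>Odd part: relations among one-forms and kernels in forms\<close>

lemma subspace_X_nat: "cvec.subspace X_nat"
  by (simp add: nat_relations_def)

lemma X_nat_homog_1: "v \<in> X_nat \<Longrightarrow> v \<in> homog 1"
proof -
  have "X_nat \<subseteq> homog 1"
    unfolding nat_relations_def coinv_forms_def coinv_def Forms_1
    by (intro cvec.span_minimal subspace_homog Un_least) (auto intro!: comm_homog homog_simps T.hact_homog)
  then show "v \<in> X_nat \<Longrightarrow> v \<in> homog 1" by blast
qed

lemma one_comms_X_nat: "v \<in> cvec.span one_comms \<Longrightarrow> v \<in> X_nat"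
  unfolding nat_relations_def Forms_1 by (erule rev_subsetD[OF _ cvec.span_mono]) blast

lemma Theta_X_nat:
  assumes "v \<in> X_nat"
  shows "Theta v \<in> cvec.span coinv_gens"
proof (rule clinear_span_image[OF clinear_Theta _ assms[unfolded nat_relations_def]])
  fix u assume "u \<in> {forms_comm \<omega> x | \<omega> x. \<omega> \<in> Forms 1} \<union> coinv_forms \<Delta> \<epsilon> \<delta> (talg_act \<Delta> act) 1"
  then consider \<omega> x where "u = forms_comm \<omega> x" "\<omega> \<in> homog 1" | "u \<in> coinv_forms \<Delta> \<epsilon> \<delta> (talg_act \<Delta> act) 1"
    unfolding Forms_1 by blast
  then show "Theta u \<in> cvec.span coinv_gens"
  proof cases
    case 1
    then show ?thesis by (simp add: Theta_comm cvec.span_zero del: One_nat_def)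
  next
    case 2
    then show ?thesis
      unfolding coinv_forms_def coinv_def Forms_1
      by (rule clinear_span_image[OF clinear_Theta, rotated]) (auto simp: Theta_linear Theta_act simp del: One_nat_def)
  qed
qed

lemma X_nat_coinv: "v \<in> homog 1 \<Longrightarrow> T.hact h v - \<delta> h *\<^sub>C v \<in> X_nat"
  unfolding nat_relations_def coinv_forms_def coinv_def Forms_1
  by (intro cvec.span_base UnI2) blast

lemma subspace_X_od: "cvec.subspace (X_od m)"
  by (simp add: X_od_relations_def one_forms_def Let_def)

lemma X_od_odd_base:
  "Lam_adj x \<in> even_filt (Suc n) \<Longrightarrow> tens_snoc (tens_init x) y \<in> X_od (Suc (2 * n))"
  "Lam_adj x \<in> even_filt n \<Longrightarrow> y \<in> IR \<Longrightarrow> tens_snoc (tens_init x) y \<in> X_od (Suc (2 * n))"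
  by (auto simp: X_od_relations_def one_forms_def snoc_tword ideal_coeff_iff intro!: cvec.span_base)

lemma X_od_even_base:
  "Lam_adj x \<in> even_filt n \<Longrightarrow> tens_snoc (tens_init x) y \<in> X_od (2 * n)"
  by (auto simp: X_od_relations_def one_forms_def snoc_tword ideal_coeff_iff intro!: cvec.span_base)

lemma X_od_map:
  assumes "v \<in> X_od m" "clinear f"
    and "\<And>n x y. m = 2 * n \<Longrightarrow> Lam_adj x \<in> even_filt n \<Longrightarrow> f (tens_snoc (tens_init x) y) \<in> cvec.span B"
    and "\<And>n x y. m = Suc (2 * n) \<Longrightarrow> Lam_adj x \<in> even_filt (Suc n) \<Longrightarrow> f (tens_snoc (tens_init x) y) \<in> cvec.span B"
    and "\<And>n x y. m = Suc (2 * n) \<Longrightarrow> Lam_adj x \<in> even_filt n \<Longrightarrow> y \<in> IR \<Longrightarrow> f (tens_snoc (tens_init x) y) \<in> cvec.span B"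
  shows "f v \<in> cvec.span B"
proof (cases m rule: parity_cases)
  case (1 n)
  then have "v \<in> cvec.span {tword (Snoc (Init x) y) | x y. x \<in> ideal_coeff IR n \<and> y \<in> UNIV}"
    using assms(1) by (simp add: X_od_relations_def one_forms_def)
  then show ?thesis
    by (rule clinear_span_image[OF assms(2), rotated]) (use assms(3)[OF 1] in \<open>auto simp: ideal_coeff_iff snoc_tword\<close>)
next
  case (2 n)
  have v: "v \<in> cvec.span (one_forms (ideal_coeff IR (Suc n)) UNIV \<union> one_forms (ideal_coeff IR n) IR)"
    using assms(1) 2 by (simp add: X_od_relations_def)
  show ?thesis
  proof (rule clinear_span_image[OF assms(2) _ v])
    fix u :: "'a talg forms" assume "u \<in> one_forms (ideal_coeff IR (Suc n)) UNIV \<union> one_forms (ideal_coeff IR n) IR"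
    then show "f u \<in> cvec.span B"
      unfolding one_forms_def
      by (elim UnE; elim clinear_span_image[OF assms(2), rotated])
        (use assms(4,5)[OF 2] in \<open>auto simp: ideal_coeff_iff snoc_tword\<close>)
  qed
qed

lemma X_od_homog_1: "v \<in> X_od m \<Longrightarrow> v \<in> homog 1"
  unfolding homog_def
  by (rule X_od_map[OF _ clinear_ident]) (use snoc_init_homog_1 in \<open>auto simp: homog_def\<close>)

text \<open>Elements of \<open>IR\<close> are combinations of products zc with c a curvature, and x
  d(zc) becomes xz dc + cx dz. The first term is (1 + k) d - b of forms of degree at least 2n + 2,
  so only boundaries survive the truncation; in the second the coefficient gains one power of the
  ideal.\<close>

lemma Th_IR:
  assumes x: "Lam_adj x \<in> even_filt n" and y: "y \<in> IR"
  shows "Th x y \<in> K (Suc (2 * n)) 1"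
proof -
  have "Th_adj x (Phi t) \<in> cvec.span (hodge_ker_gens coinv_gens (Suc (2 * n)) 1)" if "t \<in> even_filt 1" for t
  proof (rule even_filt_map[OF _ _ that], fold hodge_ker_def)
    show "clinear (\<lambda>t. Th_adj x (Phi t))"
      unfolding Th_adj_def by (rule clinear_comp[OF clinear_comp[OF clinear_Phi clinear_alg_part] clinear_Th])
    fix w :: "('a adj, 'a) word" assume w: "even (word_deg w)" "2 * 1 \<le> word_deg w"
    then obtain v a b where v: "w = Snoc (Snoc v a) b" "even (word_deg v)"
      by (cases rule: even_word_cases) auto
    let ?\<eta> = "tens_snoc (tens_snoc (Lam_adj (x * Phi (tword v))) a) b"
    have "Lam_adj (x * Phi (tword v)) \<in> even_filt n"
      using Lam_adj_mult_Phi[OF even_filt_tword[OF v(2), of 0] x] by simp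
    then have "?\<eta> \<in> K (Suc (2 * n)) 0"
      by (intro even_filt_hodge_ker[OF snoc_snoc_even_filt]) auto
    from kpoly_hodge_ker[OF d_hodge_ker[OF this]] b_hodge_ker[OF this]
    have 1: "Th (x * Phi (tword v)) (curv a b) \<in> K (Suc (2 * n)) 1"
      unfolding Th_curv by (intro hodge_ker_simps) (simp_all del: One_nat_def)
    have "Lam_adj (adj_incl (curv a b) * x) \<in> even_filt (Suc n)"
      unfolding Lam_adj_curv_mult by (rule dmul_dmul_even_filt[OF x])
    then have 2: "Th (adj_incl (curv a b) * x) (alg_part (Phi (tword v))) \<in> K (Suc (2 * n)) 1"
      by (intro odd_filt_hodge_ker[OF Th_odd_filt]) auto
    show "Th_adj x (Phi (tword w)) \<in> K (Suc (2 * n)) 1"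
      using hodge_ker_simps(2)[OF 1 2]
      by (simp only: v(1) snoc_tword[symmetric] Phi_snoc_snoc Th_adj_mult) (simp add: Th_adj_def)
  qed
  from this[OF Lam_IR[OF y]] show ?thesis
    by (simp add: Phi_Lam Th_adj_def hodge_ker_def)
qed

lemma Theta_X_od: "v \<in> X_od m \<Longrightarrow> Theta v \<in> K m 1"
  unfolding hodge_ker_def
proof (rule X_od_map[OF _ clinear_Theta], assumption, fold hodge_ker_def, unfold Theta_snoc_init)
  show "Th x y \<in> K m 1" if "m = 2 * n" "Lam_adj x \<in> even_filt n" for n x y
    using that by (intro odd_filt_hodge_ker[OF Th_odd_filt]) auto
  show "Th x y \<in> K m 1" if "m = Suc (2 * n)" "Lam_adj x \<in> even_filt (Suc n)" for n x y
    using that by (intro odd_filt_hodge_ker[OF Th_odd_filt]) auto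
  show "Th x y \<in> K m 1" if "m = Suc (2 * n)" "Lam_adj x \<in> even_filt n" "y \<in> IR" for n x y
    using Th_IR[OF that(2,3)] that(1) by simp
qed

lemma Psi_X_od_homog:
  assumes "t \<in> homog n" "m < n"
  shows "Psi t \<in> X_od m"
proof -
  have "Psi (tword w) \<in> X_od m" if w: "word_deg w = n" for w
  proof (cases "even n")
    case True
    then show ?thesis using Psi_even_tword[of w] w by (simp add: cvec.subspace_0[OF subspace_X_od])
  next
    case False
    then obtain v a where v: "w = Snoc v a" "even (word_deg v)" "n = Suc (word_deg v)" using w by (cases w) auto
    show ?thesis
    proof (cases m rule: parity_cases)
      case (1 k)
      then show ?thesis
        using v assms(2) by (auto simp: Psi_snoc Lam_adj_Phi_tword simp flip: snoc_tword intro!: X_od_even_base even_filt_tword)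
    next
      case (2 k)
      have "2 * Suc k \<le> word_deg v" using 2 v assms(2) by presburger
      then show ?thesis
        using v 2 by (auto simp: Psi_snoc Lam_adj_Phi_tword simp flip: snoc_tword intro!: X_od_odd_base(1) even_filt_tword)
    qed
  qed
  then have "Psi t \<in> cvec.span (X_od m)"
    using clinear_span_image[OF clinear_Psi, of "tword ` {w. word_deg w = n}" "X_od m" t] assms(1)
    unfolding homog_def by (auto intro: cvec.span_base)
  then show ?thesis by (metis cvec.span_eq_iff subspace_X_od)
qed

text \<open>For odd m this is \<open>Th_curv\<close> read backwards: up to higher degree, b of a
  word of degree m + 1 is minus z d(curvature) with z in the matching filtration step. For even m,
  \<open>Psi\<close> kills b of the form.\<close>

lemma Psi_b_top:
  assumes "t \<in> homog (Suc m)"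
  shows "Psi (forms_b t) \<in> cvec.span (X_od m \<union> X_nat)"
proof -
  have "Psi (forms_b (tword w)) \<in> cvec.span (X_od m \<union> X_nat)" if w: "word_deg w = Suc m" for w
  proof (cases m rule: parity_cases)
    case (1 n)
    then show ?thesis
      using Psi_even[OF b_homog[of "tword w" m]] tword_homog[of w] w by (simp add: cvec.span_zero)
  next
    case (2 n)
    then have "even (word_deg w)" using w by simp
    then obtain v a b where v: "w = Snoc (Snoc v a) b" "word_deg v = 2 * n"
      by (cases rule: even_word_cases) (use w 2 in auto)
    let ?z = "Phi (tword v)"
    have z: "Lam_adj ?z = tword v" "Lam_adj ?z \<in> even_filt n"
      using v(2) by (simp_all add: Lam_adj_Phi_tword even_filt_tword)
    have "forms_b (tword w) = kpoly (1 + XX) (forms_d (tword w)) - Th ?z (curv a b)"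
      using v(1) by (simp add: Th_curv z(1) snoc_tword)
    then have "Psi (forms_b (tword w)) = Psi (kpoly (1 + XX) (forms_d (tword w))) -
        (Psi (Th ?z (curv a b)) - tens_snoc (tens_init ?z) (curv a b)) - tens_snoc (tens_init ?z) (curv a b)"
      (is "_ = ?p - ?q - ?r")
      by (simp add: Psi_linear)
    moreover have "Psi (kpoly (1 + XX) (forms_d (tword w))) \<in> X_od m"
      using Psi_X_od_homog[OF kpoly_homog[OF d_homog[OF tword_homog[of w]]]] w by simp
    moreover have "tens_snoc (tens_init ?z) (curv a b) \<in> X_od m"
      using X_od_odd_base(2)[OF z(2) curv_IR] 2 by simp
    moreover have "Psi (Th ?z (curv a b)) - tens_snoc (tens_init ?z) (curv a b) \<in> X_nat"
      by (rule one_comms_X_nat[OF Psi_Th])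
    ultimately show ?thesis
      by (simp only:) (intro cvec.span_diff cvec.span_base UnI1 UnI2; assumption)
  qed
  then show ?thesis
    using clinear_span_image[OF clinear_comp[OF clinear_b clinear_Psi], of "tword ` {w. word_deg w = Suc m}" "X_od m \<union> X_nat" t] assms(1)
    unfolding homog_def by auto
qed

lemma Psi_hodge_ker:
  assumes "t \<in> K m 1"
  shows "Psi t \<in> cvec.span (X_od m \<union> X_nat)"
proof (rule hodge_ker_map[OF clinear_Psi assms])
  fix w :: "('a adj, 'a) word" assume "word_deg w mod 2 \<noteq> 1 \<or> m < word_deg w"
  then show "Psi (tword w) \<in> cvec.span (X_od m \<union> X_nat)"
    using Psi_X_od_homog[OF tword_homog[of w]] Psi_even_tword[of w]
    by (auto simp: cvec.span_zero even_iff_mod_2_eq_zero intro: cvec.span_base)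
next
  show "Psi (tens_init 1) \<in> cvec.span (X_od m \<union> X_nat)"
    by (simp add: Psi_init cvec.span_zero)
next
  fix c assume "c \<in> coinv_gens"
  then obtain h w where "c = hact h (tword w) - \<delta> h *\<^sub>C tword w"
    unfolding coinv_gens_def by blast
  then show "Psi c \<in> cvec.span (X_od m \<union> X_nat)"
    using X_nat_coinv[OF Psi_homog_1, of h "tword w"]
    by (auto simp: Psi_linear Psi_act intro: cvec.span_base)
qed (rule Psi_b_top)

lemma minus_Theta_Psi: "t - Theta (Psi t) \<in> K m 1"
  unfolding hodge_ker_def
proof (rule clinear_span_image[OF clinear_diff_fun[OF clinear_ident clinear_comp[OF clinear_Psi clinear_Theta]] _ span_tword], fold hodge_ker_def)
  fix s :: "'a forms" assume "s \<in> range tword"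
  then obtain w where s: "s = tword w" by blast
  show "s - Theta (Psi s) \<in> K m 1"
  proof (cases "even (word_deg w)")
    case True
    then show ?thesis
      using homog_hodge_ker[OF tword_homog[of w], of 1 m coinv_gens]
      by (simp add: s Psi_even_tword Theta_linear even_iff_mod_2_eq_zero)
  qed (simp add: s Theta_Psi_odd_tword hodge_ker_simps)
qed

text \<open>The kernel corresponds to the sum of \<open>X_od m\<close> and \<open>X_nat\<close>,
  since the odd levels are quotients of a quotient. \<open>Theta\<close> gives one direction and
  \<open>Psi\<close> the other.\<close>

lemma Psi_X_od_iff: "(\<exists>v\<in>X_od m. Psi t - v \<in> X_nat) \<longleftrightarrow> t \<in> K m 1"
proof
  assume "\<exists>v\<in>X_od m. Psi t - v \<in> X_nat"
  then obtain v where v: "v \<in> X_od m" "Psi t - v \<in> X_nat" by blast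
  have "(t - Theta (Psi t)) + (Theta (Psi t - v) + Theta v) \<in> K m 1"
    by (intro hodge_ker_simps minus_Theta_Psi Theta_X_od v span_hodge_ker[OF Theta_X_nat])
  then show "t \<in> K m 1" by (simp add: Theta_linear)
next
  assume "t \<in> K m 1"
  then have "Psi t \<in> cvec.span (X_od m \<union> X_nat)" by (rule Psi_hodge_ker)
  then obtain u v where "u \<in> X_od m" "v \<in> X_nat" "Psi t = u + v"
    unfolding cvec.span_Un by (auto simp: cvec.span_eq_iff[THEN iffD2, OF subspace_X_od]
        cvec.span_eq_iff[THEN iffD2, OF subspace_X_nat])
  then show "\<exists>v\<in>X_od m. Psi t - v \<in> X_nat"
    by (intro bexI[of _ u]) auto
qed

end

text \<open>A total linear projection, so that the space of one-forms is presented by a whole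
  type.\<close>

definition homog_proj :: "nat \<Rightarrow> 'a::complex_algebra forms \<Rightarrow> 'a forms" where
  "homog_proj n = graded (\<lambda>i t. if i = n then t else 0)"

lemma clinear_homog_proj_summand: "clinear (\<lambda>t. if i = n then t else 0)" for i n :: nat
  by (cases "i = n") (simp_all add: clinear_ident clinear_zero_fun)

lemma clinear_homog_proj: "clinear (homog_proj n)"
  unfolding homog_proj_def by (rule clinear_graded[OF clinear_homog_proj_summand])

lemma homog_proj_homog: "t \<in> homog m \<Longrightarrow> homog_proj n t = (if m = n then t else 0)"
  unfolding homog_proj_def by (simp add: graded_homog[OF clinear_homog_proj_summand])

lemma homog_proj_in_homog: "homog_proj n t \<in> homog n"
  unfolding homog_def
proof (rule clinear_span_image[OF clinear_homog_proj _ span_tword], fold homog_def)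
  fix s :: "'a forms" assume "s \<in> range tword"
  then obtain w where "s = tword w" by blast
  then show "homog_proj n s \<in> homog n"
    using tword_homog[of w] by (auto simp: homog_proj_homog[OF tword_homog] homog_simps)
qed

lemma range_homog_proj: "range (homog_proj n) = homog n"
proof (intro equalityI subsetI)
  fix t :: "'a forms" assume "t \<in> homog n"
  then have "t = homog_proj n t" by (simp add: homog_proj_homog)
  then show "t \<in> range (homog_proj n)" by blast
qed (auto simp: homog_proj_in_homog)

context twisted_module_algebra
begin

section \<open>Levels, differentials and structure maps presented by forms\<close>

abbreviation X_O1 :: "'a talg forms set cspace" where
  "X_O1 \<equiv> Omega1_nat \<Delta> \<epsilon> \<delta> (talg_act \<Delta> act)"

abbreviation X_class :: "'a talg forms \<Rightarrow> 'a talg forms set" where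
  "X_class \<equiv> nat_class \<Delta> \<epsilon> \<delta> (talg_act \<Delta> act)"

lemma presents_Forms_1: "presents (homog_proj 1) {t :: 'a talg forms. homog_proj 1 t = 0} (cspace_on (Forms 1))"
  unfolding Forms_1 range_homog_proj[symmetric]
  by (rule presents_projection[OF clinear_homog_proj]) simp

lemma X_nat_subset: "X_nat \<subseteq> carrier (cspace_on (Forms 1))"
  using X_nat_homog_1 by (auto simp: cspace_on_def Forms_1 simp del: One_nat_def)

lemma subspace_proj_X_nat: "cvec.subspace {t. homog_proj 1 t \<in> X_nat}"
  by (rule cvec.subspaceI)
    (auto simp: clinear_simps[OF clinear_homog_proj] cvec.subspace_0[OF subspace_X_nat] cvec.subspace_add[OF subspace_X_nat]
      cvec.subspace_scale[OF subspace_X_nat])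

lemma presents_O1: "presents (\<lambda>t. X_class (homog_proj 1 t)) {t. homog_proj 1 t \<in> X_nat} X_O1"
  unfolding nat_class_def Omega1_nat_def
  by (rule presents_quotient[OF presents_Forms_1 X_nat_subset _ subspace_proj_X_nat]) simp

lemma X_class_eq_iff: "v \<in> homog 1 \<Longrightarrow> v' \<in> homog 1 \<Longrightarrow> X_class v = X_class v' \<longleftrightarrow> v - v' \<in> X_nat"
  using presentsD(5)[OF presents_O1, of v v'] homog_proj_homog[of "v - v'" 1 1]
  by (simp add: homog_proj_homog homog_simps)

text \<open>Up to commutators every one-form is \<open>Psi\<close> of its image under
  \<open>Theta\<close>, so forms on the original algebra can serve as the ambient space.\<close>

lemma presents_O1_Psi: "presents (\<lambda>u. X_class (Psi u)) {u. Psi u \<in> X_nat} X_O1"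
proof -
  have "presents (\<lambda>u. X_class (homog_proj 1 (Psi u))) {u. Psi u \<in> X_nat} X_O1"
  proof (rule presents_pullback[OF presents_O1 clinear_Psi])
    fix v :: "'a talg forms"
    have "homog_proj 1 (v - Psi (Theta (homog_proj 1 v))) = - (Psi (Theta (homog_proj 1 v)) - homog_proj 1 v)"
      by (simp add: clinear_simps[OF clinear_homog_proj] homog_proj_homog[OF Psi_homog_1])
    also have "\<dots> \<in> X_nat"
      using one_comms_X_nat[OF Psi_Theta[OF homog_proj_in_homog]] by (rule cvec.subspace_neg[OF subspace_X_nat])
    finally show "\<exists>u. v - Psi u \<in> {t. homog_proj 1 t \<in> X_nat}" by blast
  qed (simp add: homog_proj_homog[OF Psi_homog_1])
  then show ?thesis by (simp add: homog_proj_homog[OF Psi_homog_1])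
qed

lemma X_class_carrier: "v \<in> homog 1 \<Longrightarrow> X_class v \<in> carrier X_O1"
proof -
  assume "v \<in> homog 1"
  then have "X_class v = X_class (homog_proj 1 v)" by (simp add: homog_proj_homog)
  then show ?thesis by (simp add: presentsD(1)[OF presents_O1])
qed

lemma X_od_class_subset: "X_class ` X_od m \<subseteq> carrier X_O1"
  using X_class_carrier X_od_homog_1 by blast

lemma X_class_Psi_iff: "X_class (Psi u) \<in> X_class ` X_od m \<longleftrightarrow> u \<in> K m 1"
  unfolding Psi_X_od_iff[symmetric] image_iff using X_class_eq_iff[OF Psi_homog_1 X_od_homog_1] by blast

definition X_pi_ev :: "nat \<Rightarrow> 'a forms \<Rightarrow> 'a talg set" where
  "X_pi_ev m t = coset (cspace_on UNIV) (X_ev m) (alg_part (Phi t))"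

definition X_pi_od :: "nat \<Rightarrow> 'a forms \<Rightarrow> 'a talg forms set set" where
  "X_pi_od m t = coset X_O1 (X_class ` X_od m) (X_class (Psi t))"

lemma presents_talg: "presents (\<lambda>t. alg_part (Phi t)) {t :: 'a forms. alg_part (Phi t) = 0} (cspace_on UNIV)"
proof -
  have R: "range (\<lambda>t. alg_part (Phi t)) = (UNIV :: 'a talg set)"
  proof (rule surjI)
    show "alg_part (Phi (Lam t)) = t" for t :: "'a talg" by (simp add: Phi_Lam)
  qed
  show ?thesis
    unfolding R[symmetric] by (rule presents_projection[OF clinear_comp[OF clinear_Phi clinear_alg_part]]) simp
qed

lemma X_ev_subset: "X_ev m \<subseteq> carrier (cspace_on UNIV)"
  by (simp add: cspace_on_def)

lemma presents_X_ev: "presents (X_pi_ev m) (K m 0) (quotient (cspace_on UNIV) (X_ev m))"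
  unfolding X_pi_ev_def[abs_def]
  by (rule presents_quotient[OF presents_talg X_ev_subset alg_part_Phi_X_ev_iff subspace_hodge_ker])

lemma presents_X_od: "presents (X_pi_od m) (K m 1) (quotient X_O1 (X_class ` X_od m))"
  unfolding X_pi_od_def[abs_def]
  by (rule presents_quotient[OF presents_O1_Psi X_od_class_subset X_class_Psi_iff subspace_hodge_ker])

lemmas descend_X_ev = descend_coset[OF presents_talg X_ev_subset alg_part_Phi_X_ev_iff subspace_hodge_ker, folded X_pi_ev_def]
lemmas descend_X_od = descend_coset[OF presents_O1_Psi X_od_class_subset X_class_Psi_iff subspace_hodge_ker, folded X_pi_od_def]

lemma X_pi_ev_eq: "x - y \<in> K m 0 \<Longrightarrow> X_pi_ev m x = X_pi_ev m y"
  using presentsD(5)[OF presents_X_ev] by blast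

lemma X_pi_od_eq: "x - y \<in> K m 1 \<Longrightarrow> X_pi_od m x = X_pi_od m y"
  using presentsD(5)[OF presents_X_od] by blast

text \<open>dx is stored as 1 dx, which \<open>Th 1 x\<close> represents, and
  \<open>Th_1_Phi\<close> identifies the latter with \<open>D_X\<close>.\<close>

lemma X_class_d: "X_class (forms_d (tens_init (adj_incl (alg_part (Phi t))))) = X_class (Psi (D_X (Lam (alg_part (Phi t)))))"
proof -
  let ?x = "alg_part (Phi t)"
  have "D_X (Lam ?x) = Th 1 ?x"
    using Th_1_Phi[OF Lam_even, of ?x] by (simp add: Phi_Lam)
  then have "Psi (D_X (Lam ?x)) - forms_d (tens_init (adj_incl ?x)) \<in> X_nat"
    using one_comms_X_nat[OF Psi_Th[of 1 ?x]] by (simp add: d_init)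
  then have "X_class (Psi (D_X (Lam ?x))) = X_class (forms_d (tens_init (adj_incl ?x)))"
    by (subst X_class_eq_iff[OF Psi_homog_1]) (use d_homog[OF init_homog] in simp_all)
  then show ?thesis by simp
qed

lemma X_diff_ev: "descend (\<lambda>x. coset X_O1 (X_class ` X_od m) (X_class (forms_d (tens_init (adj_incl x))))) (X_pi_ev m t) =
    X_pi_od m (D_X t)"
proof -
  have *: "coset X_O1 (X_class ` X_od m) (X_class (forms_d (tens_init (adj_incl (alg_part (Phi s)))))) = X_pi_od m (D_X s)" for s
  proof -
    have "D_X (Lam (alg_part (Phi s))) - D_X s \<in> K m 1"
      using D_X_hodge_ker[OF hodge_ker_simps(4)[OF minus_Lam[of s m]]] by (simp add: D_X_linear)
    from X_pi_od_eq[OF this] show ?thesis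
      unfolding X_class_d X_pi_od_def .
  qed
  have "X_pi_od m (D_X s) = X_pi_od m (D_X t)" if "s - t \<in> K m 0" for s
    using D_X_hodge_ker[OF that] by (intro X_pi_od_eq) (simp add: D_X_linear)
  then show ?thesis
    using descend_X_ev[of t m "\<lambda>x. coset X_O1 (X_class ` X_od m) (X_class (forms_d (tens_init (adj_incl x))))"] by (simp add: *)
qed

text \<open>\<open>Lam\<close> turns the commutator into \<open>D_X\<close> of \<open>Theta\<close>,
  and \<open>Theta\<close> sends the relations to coinvariants, so the fact that \<open>D_X\<close>
  respects the kernels settles it.\<close>

lemma form_commutator_X_nat: "v \<in> X_nat \<Longrightarrow> form_commutator v \<in> X_ev m"
proof -
  assume v: "v \<in> X_nat"
  have "D_X (Theta v) \<in> K m 0"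
    using D_X_hodge_ker[OF span_hodge_ker[OF Theta_X_nat[OF v]], of 1 m] by simp
  then show ?thesis
    by (simp add: X_ev_iff Lam_form_commutator[OF X_nat_homog_1[OF v]])
qed

lemma coset_X_ev_eq: "x - y \<in> X_ev m \<Longrightarrow> coset (cspace_on UNIV) (X_ev m) x = coset (cspace_on UNIV) (X_ev m) y"
  by (subst coset_eq_iff[OF presents_id X_ev_subset refl subspace_X_ev])

lemma X_diff_od_class:
  assumes "v \<in> homog 1"
  shows "descend (\<lambda>\<omega>. coset (cspace_on UNIV) (X_ev m) (form_commutator \<omega>)) (X_class v) =
    coset (cspace_on UNIV) (X_ev m) (form_commutator v)"
proof -
  have "descend (\<lambda>\<omega>. coset (cspace_on UNIV) (X_ev m) (form_commutator \<omega>)) (X_class (homog_proj 1 v)) =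
      coset (cspace_on UNIV) (X_ev m) (form_commutator (homog_proj 1 v))"
    unfolding nat_class_def
  proof (rule descend_coset[OF presents_Forms_1 X_nat_subset _ subspace_proj_X_nat])
    fix y :: "'a talg forms" assume "y - v \<in> {t. homog_proj 1 t \<in> X_nat}"
    then have "form_commutator (homog_proj 1 (y - v)) \<in> X_ev m"
      using form_commutator_X_nat by blast
    then show "coset (cspace_on UNIV) (X_ev m) (form_commutator (homog_proj 1 y)) =
        coset (cspace_on UNIV) (X_ev m) (form_commutator (homog_proj 1 v))"
      by (intro coset_X_ev_eq) (simp add: clinear_simps[OF clinear_homog_proj] clinear_simps[OF clinear_form_commutator])
  qed simp
  then show ?thesis by (simp add: homog_proj_homog[OF assms])
qed

lemma X_diff_od: "descend (descend (\<lambda>\<omega>. coset (cspace_on UNIV) (X_ev m) (form_commutator \<omega>))) (X_pi_od m t) =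
    X_pi_ev m (D_X t)"
proof -
  have *: "descend (\<lambda>\<omega>. coset (cspace_on UNIV) (X_ev m) (form_commutator \<omega>)) (X_class (Psi s)) = X_pi_ev m (D_X s)" for s
  proof -
    \<comment> \<open>Passing to even forms by \<open>Lam\<close>, both round trips differ from the
      identity by the kernels only.\<close>
    have "Lam (form_commutator (Psi s)) - Lam (alg_part (Phi (D_X s))) =
        (D_X s - Lam (alg_part (Phi (D_X s)))) - D_X (s - Theta (Psi s))"
      by (simp add: Lam_form_commutator[OF Psi_homog_1] D_X_linear)
    also have "\<dots> \<in> K m 0"
      using D_X_hodge_ker[OF minus_Theta_Psi[of s m]] by (intro hodge_ker_simps minus_Lam) simp
    finally have "form_commutator (Psi s) - alg_part (Phi (D_X s)) \<in> X_ev m"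
      by (simp add: X_ev_iff Lam_linear)
    from coset_X_ev_eq[OF this] show ?thesis
      by (simp add: X_diff_od_class[OF Psi_homog_1] X_pi_ev_def)
  qed
  have "X_pi_ev m (D_X s) = X_pi_ev m (D_X t)" if "s - t \<in> K m 1" for s
    using D_X_hodge_ker[OF that] by (intro X_pi_ev_eq) (simp add: D_X_linear)
  then show ?thesis
    using descend_X_od[of t m "descend (\<lambda>\<omega>. coset (cspace_on UNIV) (X_ev m) (form_commutator \<omega>))"] by (simp add: *)
qed

lemma X_proj_ev: "descend (coset (cspace_on UNIV) (X_ev m)) (X_pi_ev (Suc m) t) = X_pi_ev m t"
  using descend_X_ev[of t "Suc m" "coset (cspace_on UNIV) (X_ev m)"] X_pi_ev_eq[of _ t m]
  by (simp add: hodge_ker_Suc_subset flip: X_pi_ev_def)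

lemma X_proj_od: "descend (coset X_O1 (X_class ` X_od m)) (X_pi_od (Suc m) t) = X_pi_od m t"
  using descend_X_od[of t "Suc m" "coset X_O1 (X_class ` X_od m)"] X_pi_od_eq[of _ t m]
  by (simp add: hodge_ker_Suc_subset flip: X_pi_od_def)

theorem presents_X_tower: "presents_tower D_X K X_pi_ev X_pi_od (X_tower \<Delta> \<epsilon> \<delta> (talg_act \<Delta> act) IR)"
  unfolding presents_tower_def X_tower_def Let_def
  using presents_X_ev presents_X_od X_diff_ev X_diff_od X_proj_ev X_proj_od by simp

end

section \<open>The Hodge tower as a tower of quotients of forms\<close>

text \<open>In degree zero the type of forms contains the unit; \<open>reduce\<close> removes it.\<close>

primrec word_reduce :: "('a::complex_algebra adj, 'a) word \<Rightarrow> 'a forms" where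
  "word_reduce (Init x) = tens_init (adj_incl (alg_part x))"
| "word_reduce (Snoc w a) = tword (Snoc w a)"

lemma multilinear_word_reduce: "multilinear_word word_reduce"
  by (rule multilinear_wordI[where f = "\<lambda>_::unit. word_reduce"])
    (simp_all add: clinear_comp[OF clinear_comp[OF clinear_alg_part clinear_adj_incl] clinear_tword_Init]
      clinear_snoc_right tword_add tword_scale snoc_simps flip: snoc_tword)

definition reduce :: "'a::complex_algebra forms \<Rightarrow> 'a forms" where
  "reduce = tens_lift word_reduce"

lemma clinear_reduce: "clinear reduce"
  unfolding reduce_def by (rule clinear_tens_lift[OF multilinear_word_reduce])

lemma reduce_tword: "reduce (tword w) = word_reduce w"
  by (simp add: reduce_def tens_lift_tword[OF multilinear_word_reduce])

lemma reduce_init: "reduce (tens_init x) = tens_init (adj_incl (alg_part x))"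
  by (simp add: reduce_tword)

lemma reduce_pos: "t \<in> homog n \<Longrightarrow> 0 < n \<Longrightarrow> reduce t = t"
proof (rule homog_eq[OF clinear_reduce clinear_ident])
  show "reduce (tword w) = tword w" if "word_deg w = n" "0 < n" for w :: "('a adj, 'a) word"
    using that by (cases w) (auto simp: reduce_tword)
qed

lemma subspace_Forms: "cvec.subspace (Forms n :: 'a::complex_algebra forms set)"
proof (cases "n = 0")
  case True
  have lin: "clinear (\<lambda>a. tens_init (adj_incl a) :: 'a forms)"
    by (rule clinear_comp[OF clinear_adj_incl clinear_tword_Init])
  have "Forms n = range (\<lambda>a. tens_init (adj_incl a) :: 'a forms)"
    by (simp add: Forms_def True)
  then show ?thesis
    by (auto intro!: cvec.subspaceI image_eqI simp: clinear_simps[OF lin, symmetric])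
qed (simp add: Forms_def)

lemma Forms_homog: "t \<in> Forms n \<Longrightarrow> t \<in> homog n"
  by (cases n) (auto simp: Forms_Suc Forms_def[of 0] init_homog)

definition form_comp :: "nat \<Rightarrow> 'a::complex_algebra forms \<Rightarrow> 'a forms" where
  "form_comp n t = homog_proj n (reduce t)"

lemma clinear_form_comp: "clinear (form_comp n)"
  unfolding form_comp_def[abs_def] by (rule clinear_comp[OF clinear_reduce clinear_homog_proj])

lemmas form_comp_linear = clinear_simps[OF clinear_form_comp]

lemma reduce_Forms: "t \<in> Forms n \<Longrightarrow> reduce t = t"
  by (cases n) (auto simp: Forms_Suc reduce_pos Forms_def[of 0] reduce_init)

lemma form_comp_Forms: "t \<in> Forms m \<Longrightarrow> form_comp n t = (if m = n then t else 0)"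
  by (simp add: form_comp_def reduce_Forms homog_proj_homog[OF Forms_homog])

lemma reduce_tword_Forms: "reduce (tword w) \<in> Forms (word_deg w)"
  by (cases w) (auto simp: reduce_tword Forms_Suc Forms_def[of 0] intro: tword_homog[of "Snoc _ _", simplified])

lemma form_comp_tword: "form_comp n (tword w) = (if word_deg w = n then reduce (tword w) else 0)"
  using homog_proj_homog[OF Forms_homog[OF reduce_tword_Forms[of w]], of n] by (simp add: form_comp_def)

lemma form_comp_in_Forms: "form_comp n t \<in> Forms n"
proof -
  have "form_comp n t \<in> cvec.span (Forms n)"
    by (rule clinear_span_image[OF clinear_form_comp _ span_tword])
      (auto simp: form_comp_tword cvec.span_zero intro!: cvec.span_base[OF reduce_tword_Forms])
  then show ?thesis by (metis cvec.span_eq_iff subspace_Forms)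
qed

lemma range_form_comp: "range (form_comp n) = Forms n"
proof (intro equalityI subsetI)
  fix t :: "'a forms" assume "t \<in> Forms n"
  then have "t = form_comp n t" by (simp add: form_comp_Forms)
  then show "t \<in> range (form_comp n)" by blast
qed (auto simp: form_comp_in_Forms)

text \<open>Beyond the degree, the point is that a commutator in the unitization has no scalar
  part.\<close>

lemma b_Forms: "t \<in> homog (Suc n) \<Longrightarrow> forms_b t \<in> Forms n"
proof (cases n)
  case 0
  assume t: "t \<in> homog (Suc n)"
  have "forms_b (tword w) \<in> Forms 0" if "word_deg w = Suc 0" for w :: "('a adj, 'a) word"
  proof -
    obtain x a where w: "w = Snoc (Init x) a"
    proof (cases w)
      case (Snoc v a)
      then show thesis using that \<open>word_deg w = Suc 0\<close> by (cases v) auto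
    qed (use \<open>word_deg w = Suc 0\<close> in simp)
    have "x * adj_incl a - adj_incl a * x = adj_incl (alg_part (x * adj_incl a - adj_incl a * x))"
      by (rule adj_eqI) simp_all
    moreover have "forms_b (tword w) = tens_init (x * adj_incl a - adj_incl a * x)"
      by (simp add: w b_snoc[OF init_homog] scaleC_one rmul_init lmul_init clinear_diff[OF clinear_tword_Init] flip: snoc_tword)
    ultimately show ?thesis by (auto simp: Forms_def)
  qed
  then have "forms_b t \<in> cvec.span (Forms 0)"
    using clinear_span_image[OF clinear_b, of "tword ` {w. word_deg w = Suc 0}" "Forms 0" t] t 0
    unfolding homog_def by (auto intro: cvec.span_base)
  then show ?thesis using 0 by (metis cvec.span_eq_iff subspace_Forms)
qed (simp add: Forms_Suc b_homog)

lemma B_Forms: "t \<in> homog n \<Longrightarrow> forms_B t \<in> Forms (Suc n)"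
  by (simp add: Forms_Suc B_homog)

lemma b_reduce: "forms_b (reduce t) = forms_b t"
proof (rule clinear_eq_on_tword[OF clinear_comp[OF clinear_reduce clinear_b] clinear_b])
  show "forms_b (reduce (tword w)) = forms_b (tword w)" for w :: "('a adj, 'a) word"
    by (cases w) (simp_all add: reduce_tword b_init)
qed

lemma B_reduce: "forms_B (reduce t) = forms_B t"
proof (rule clinear_eq_on_tword[OF clinear_comp[OF clinear_reduce clinear_B] clinear_B])
  show "forms_B (reduce (tword w)) = forms_B (tword w)" for w :: "('a adj, 'a) word"
    by (cases w) (simp_all add: reduce_tword B_homog_eq[OF init_homog] d_init)
qed

lemma form_comp_b: "form_comp n (forms_b t) = forms_b (form_comp (Suc n) t)"
proof (rule clinear_eq_on_tword[OF clinear_comp[OF clinear_b clinear_form_comp] clinear_comp[OF clinear_form_comp clinear_b]])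
  fix w :: "('a adj, 'a) word"
  show "form_comp n (forms_b (tword w)) = forms_b (form_comp (Suc n) (tword w))"
  proof (cases "word_deg w")
    case 0
    then show ?thesis
      using b_homog_0[of "tword w"] tword_homog[of w] by (simp add: form_comp_linear form_comp_tword clinear_zero[OF clinear_b])
  next
    case (Suc m)
    then show ?thesis
      using form_comp_Forms[OF b_Forms, of "tword w" m n] tword_homog[of w]
      by (auto simp: form_comp_tword b_reduce clinear_zero[OF clinear_b])
  qed
qed

lemma form_comp_B_Suc: "form_comp (Suc n) (forms_B t) = forms_B (form_comp n t)"
proof (rule clinear_eq_on_tword[OF clinear_comp[OF clinear_B clinear_form_comp] clinear_comp[OF clinear_form_comp clinear_B]])
  fix w :: "('a adj, 'a) word"
  show "form_comp (Suc n) (forms_B (tword w)) = forms_B (form_comp n (tword w))"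
    using form_comp_Forms[OF B_Forms[OF tword_homog[of w]], of "Suc n"]
    by (auto simp: form_comp_tword B_reduce clinear_zero[OF clinear_B])
qed

lemma form_comp_B_0: "form_comp 0 (forms_B t) = 0"
proof (rule clinear_eq_on_tword[OF clinear_comp[OF clinear_B clinear_form_comp] clinear_zero_fun])
  show "form_comp 0 (forms_B (tword w)) = 0" for w :: "('a adj, 'a) word"
    using form_comp_Forms[OF B_Forms[OF tword_homog[of w]], of 0] by simp
qed

context twisted_module_algebra
begin

section \<open>The mixed complex of coinvariant forms\<close>

abbreviation coinv_n :: "nat \<Rightarrow> 'a forms set" where
  "coinv_n \<equiv> coinv_forms \<Delta> \<epsilon> \<delta> act"

abbreviation M :: "'a forms set mixed_complex" where
  "M \<equiv> forms_mixed \<Delta> \<epsilon> \<delta> act"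

abbreviation cls :: "nat \<Rightarrow> 'a forms \<Rightarrow> 'a forms set" where
  "cls n \<equiv> coset (cspace_on (Forms n)) (coinv_n n)"

lemma subspace_coinv_n: "cvec.subspace (coinv_n n)"
  by (simp add: coinv_forms_def coinv_def)

lemma coinv_n_span: "t \<in> coinv_n n \<Longrightarrow> t \<in> cvec.span coinv_gens"
  unfolding coinv_forms_def coinv_def
  by (erule subspace_span_le) (auto simp: hact_diff_coinv)

lemma reduce_hact: "reduce (hact h (tword w)) = hact h (reduce (tword w))"
proof (cases w)
  case (Init x)
  have "alg_part (adj_act \<epsilon> act h x) = act h (alg_part x)"
    by (simp add: adj_act_def)
  then show ?thesis by (simp add: Init hact_init reduce_init adj_act_incl)
next
  case (Snoc v a)
  then show ?thesis
    using reduce_pos[OF hact_homog[OF tword_homog[of w]]] reduce_pos[OF tword_homog[of w]] by simp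
qed

lemma form_comp_coinv: "c \<in> cvec.span coinv_gens \<Longrightarrow> form_comp n c \<in> coinv_n n"
proof -
  have *: "form_comp n c \<in> coinv_n n" if c: "c \<in> coinv_gens" for c
  proof -
    obtain h w where c: "c = hact h (tword w) - \<delta> h *\<^sub>C tword w"
      using c unfolding coinv_gens_def by blast
    have "reduce (hact h (tword w)) \<in> homog (word_deg w)"
      using reduce_pos[OF hact_homog[OF tword_homog[of w]]] hact_homog[OF tword_homog[of w]]
      by (cases w) (auto simp: hact_init reduce_init init_homog)
    then have "form_comp n (hact h (tword w)) = (if word_deg w = n then hact h (reduce (tword w)) else 0)"
      by (simp add: form_comp_def homog_proj_homog reduce_hact)
    then have "form_comp n c = (if word_deg w = n then hact h (reduce (tword w)) - \<delta> h *\<^sub>C reduce (tword w) else 0)"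
      by (simp add: c form_comp_linear form_comp_tword)
    then show ?thesis
      using reduce_tword_Forms[of w]
      by (auto simp: coinv_forms_def coinv_def cvec.span_zero intro!: cvec.span_base)
  qed
  assume "c \<in> cvec.span coinv_gens"
  from clinear_span_image[OF clinear_form_comp _ this, of n "coinv_n n"] * show ?thesis
    by (metis cvec.span_eq_iff subspace_coinv_n)
qed

lemma coinv_n_Forms: "coinv_n n \<subseteq> Forms n"
proof
  fix t assume t: "t \<in> coinv_n n"
  have "hact h v \<in> Forms n" if "v \<in> Forms n" for h v
    using that hact_homog[of v n h] by (cases n) (auto simp: Forms_Suc Forms_def[of 0] hact_init adj_act_incl)
  then have "{hact h v - \<delta> h *\<^sub>C v | h v. v \<in> Forms n} \<subseteq> Forms n"
    by (auto intro!: cvec.subspace_diff[OF subspace_Forms] cvec.subspace_scale[OF subspace_Forms])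
  from cvec.span_minimal[OF this subspace_Forms] t show "t \<in> Forms n"
    unfolding coinv_forms_def coinv_def by blast
qed

text \<open>Coinvariants formed in one degree agree with those of all forms, because
  \<open>form_comp\<close> sends each generator to a generator of its own degree or to zero.\<close>

lemma coinv_n_iff: "t \<in> Forms n \<Longrightarrow> t \<in> coinv_n n \<longleftrightarrow> t \<in> cvec.span coinv_gens"
  using coinv_n_span form_comp_coinv[of t n] by (auto simp: form_comp_Forms)

lemma b_coinv_n: "t \<in> coinv_n (Suc n) \<Longrightarrow> forms_b t \<in> coinv_n n"
proof -
  assume t: "t \<in> coinv_n (Suc n)"
  have "forms_b t \<in> cvec.span coinv_gens"
    by (rule clinear_span_image[OF clinear_b C_b coinv_n_span[OF t]])
  moreover have "forms_b t \<in> Forms n"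
    using t coinv_n_Forms by (intro b_Forms Forms_homog) blast
  ultimately show ?thesis by (simp add: coinv_n_iff)
qed

lemma B_coinv_n: "t \<in> coinv_n n \<Longrightarrow> forms_B t \<in> coinv_n (Suc n)"
proof -
  assume t: "t \<in> coinv_n n"
  have F: "t \<in> Forms n" using t coinv_n_Forms by blast
  have d: "forms_d s \<in> cvec.span coinv_gens" if "s \<in> cvec.span coinv_gens" for s
    by (rule clinear_span_image[OF clinear_d C_d that])
  have b: "forms_b s \<in> cvec.span coinv_gens" if "s \<in> cvec.span coinv_gens" for s
    by (rule clinear_span_image[OF clinear_b C_b that])
  have "forms_k s \<in> cvec.span coinv_gens" if "s \<in> cvec.span coinv_gens" for s
    unfolding forms_k_def by (intro cvec.span_diff cvec.span_add d b that)
  then have "forms_B t \<in> cvec.span coinv_gens"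
    unfolding B_homog_eq[OF Forms_homog[OF F]] by (intro op_poly_closed d coinv_n_span[OF t]) auto
  then show ?thesis using B_Forms[OF Forms_homog[OF F]] by (simp add: coinv_n_iff)
qed

lemma presents_Forms: "presents (form_comp n) {t. form_comp n t = 0} (cspace_on (Forms n))"
  unfolding range_form_comp[symmetric]
  by (rule presents_projection[OF clinear_form_comp]) simp

lemma coinv_n_subset: "coinv_n n \<subseteq> carrier (cspace_on (Forms n))"
  using coinv_n_Forms by (simp add: cspace_on_def)

lemma subspace_comp_coinv: "cvec.subspace {t. form_comp n t \<in> coinv_n n}"
  by (rule cvec.subspaceI)
    (auto simp: form_comp_linear cvec.subspace_0[OF subspace_coinv_n] cvec.subspace_add[OF subspace_coinv_n]
      cvec.subspace_scale[OF subspace_coinv_n])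

lemma mc_M: "mc M n = quotient (cspace_on (Forms n)) (coinv_n n)"
  by (simp add: forms_mixed_def Let_def)

lemma presents_mc: "presents (\<lambda>t. cls n (form_comp n t)) {t. form_comp n t \<in> coinv_n n} (mc M n)"
  unfolding mc_M
  by (rule presents_quotient[OF presents_Forms coinv_n_subset _ subspace_comp_coinv]) simp

lemma descend_cls:
  assumes "t \<in> Forms n" "\<And>s. s \<in> Forms n \<Longrightarrow> s - t \<in> coinv_n n \<Longrightarrow> F s = F t"
  shows "descend F (cls n t) = F t"
proof -
  have "descend F (cls n (form_comp n t)) = F (form_comp n t)"
    by (rule descend_coset[OF presents_Forms coinv_n_subset _ subspace_comp_coinv])
      (use assms(2)[OF form_comp_in_Forms] assms(1) in \<open>auto simp: form_comp_linear form_comp_Forms\<close>)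
  then show ?thesis using assms(1) by (simp add: form_comp_Forms)
qed

lemma cls_eq_iff: "s \<in> Forms n \<Longrightarrow> t \<in> Forms n \<Longrightarrow> cls n s = cls n t \<longleftrightarrow> s - t \<in> coinv_n n"
  using presentsD(5)[OF presents_mc, of n s t] by (simp add: form_comp_linear form_comp_Forms)

lemma mc_b_cls: "t \<in> Forms (Suc n) \<Longrightarrow> mc_b M (Suc n) (cls (Suc n) t) = cls n (forms_b t)"
proof -
  assume t: "t \<in> Forms (Suc n)"
  have "descend (\<lambda>t. cls n (forms_b t)) (cls (Suc n) t) = cls n (forms_b t)"
  proof (rule descend_cls[OF t])
    fix s assume "s \<in> Forms (Suc n)" "s - t \<in> coinv_n (Suc n)"
    then show "cls n (forms_b s) = cls n (forms_b t)"
      using b_coinv_n[of "s - t"] t by (subst cls_eq_iff) (auto simp: b_Forms Forms_homog clinear_simps[OF clinear_b])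
  qed
  then show ?thesis by (simp add: forms_mixed_def Let_def)
qed

lemma mc_B_cls: "t \<in> Forms n \<Longrightarrow> mc_B M n (cls n t) = cls (Suc n) (forms_B t)"
proof -
  assume t: "t \<in> Forms n"
  have "descend (\<lambda>t. cls (Suc n) (forms_B t)) (cls n t) = cls (Suc n) (forms_B t)"
  proof (rule descend_cls[OF t])
    fix s assume "s \<in> Forms n" "s - t \<in> coinv_n n"
    then show "cls (Suc n) (forms_B s) = cls (Suc n) (forms_B t)"
      using B_coinv_n[of "s - t"] t by (subst cls_eq_iff) (auto simp: B_Forms Forms_homog clinear_simps[OF clinear_B])
  qed
  then show ?thesis by (simp add: forms_mixed_def Let_def)
qed

lemma vzero_mc: "vzero (mc M n) = cls n 0"
  using presentsD(2)[OF presents_mc, of n] by (simp add: form_comp_linear)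

lemma vadd_mc: "s \<in> Forms n \<Longrightarrow> t \<in> Forms n \<Longrightarrow> vadd (mc M n) (cls n s) (cls n t) = cls n (s + t)"
  using presentsD(3)[OF presents_mc, of n s t] by (simp add: form_comp_linear form_comp_Forms)

lemma vscale_mc: "t \<in> Forms n \<Longrightarrow> vscale (mc M n) c (cls n t) = cls n (c *\<^sub>C t)"
  using presentsD(4)[OF presents_mc, of n c t] by (simp add: form_comp_linear form_comp_Forms)

lemma carrier_mc: "carrier (mc M n) = cls n ` Forms n"
proof -
  have "carrier (mc M n) = range (\<lambda>t. cls n (form_comp n t))"
    by (rule presentsD(1)[OF presents_mc])
  also have "\<dots> = cls n ` range (form_comp n)" by blast
  finally show ?thesis by (simp only: range_form_comp)
qed

section \<open>Truncated direct sums and the levels of the Hodge tower\<close>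

abbreviation in_range :: "nat \<Rightarrow> nat \<Rightarrow> nat \<Rightarrow> bool" where
  "in_range n p k \<equiv> k \<le> n \<and> k mod 2 = p"

definition trunc_comp :: "nat \<Rightarrow> nat \<Rightarrow> nat \<Rightarrow> 'a forms \<Rightarrow> 'a forms" where
  "trunc_comp n p k t = (if in_range n p k then form_comp k t else 0)"

definition trunc_pi :: "nat \<Rightarrow> nat \<Rightarrow> 'a forms \<Rightarrow> nat \<Rightarrow> 'a forms set" where
  "trunc_pi n p t = (\<lambda>k. cls k (trunc_comp n p k t))"

lemma clinear_trunc_comp: "clinear (trunc_comp n p k)"
proof -
  have "trunc_comp n p k = (if in_range n p k then form_comp k else (\<lambda>_. 0))"
    by (auto simp: trunc_comp_def)
  then show ?thesis by (simp add: clinear_form_comp clinear_zero_fun)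
qed

lemma trunc_comp_Forms: "trunc_comp n p k t \<in> Forms k"
  by (simp add: trunc_comp_def form_comp_in_Forms cvec.subspace_0[OF subspace_Forms])

text \<open>A family of classes supported in degrees at most n has finitely many nonzero members, so
  the sum of chosen representatives is a single form that represents it.\<close>

lemma presents_trunc_sum:
  "presents (trunc_pi n p) {t. \<forall>k. trunc_comp n p k t \<in> coinv_n k} (trunc_sum M n p)"
proof -
  have "f \<in> range (trunc_pi n p)" if f: "f \<in> carrier (trunc_sum M n p)" for f
  proof -
    have "\<forall>k. \<exists>t\<in>Forms k. f k = cls k t"
      using f by (auto simp: trunc_sum_def carrier_mc image_iff)
    then obtain r where r: "\<And>k. r k \<in> Forms k" "\<And>k. f k = cls k (r k)" by metis
    let ?t = "\<Sum>k | in_range n p k. r k"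
    have fin: "finite {k. in_range n p k}" by (rule finite_subset[of _ "{..n}"]) auto
    have "form_comp k ?t = (\<Sum>j | in_range n p j. if j = k then r j else 0)" for k
      using form_comp_Forms[OF r(1)] by (simp add: form_comp_linear)
    then have comp: "form_comp k ?t = (if in_range n p k then r k else 0)" for k
      using fin by (simp add: sum.delta)
    have "f = trunc_pi n p ?t"
    proof
      fix k
      show "f k = trunc_pi n p ?t k"
        using r(2)[of k] f unfolding trunc_pi_def trunc_comp_def comp
        by (auto simp: trunc_sum_def vzero_mc)
    qed
    then show ?thesis by blast
  qed
  moreover have "trunc_pi n p t \<in> carrier (trunc_sum M n p)" for t
    unfolding trunc_sum_def trunc_pi_def using trunc_comp_Forms
    by (auto simp: carrier_mc vzero_mc) (auto simp: trunc_comp_def)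
  ultimately have "carrier (trunc_sum M n p) = range (trunc_pi n p)" by blast
  then show ?thesis
    unfolding presents_def
    by (auto simp: trunc_sum_def trunc_pi_def vzero_mc vadd_mc vscale_mc trunc_comp_Forms clinear_simps[OF clinear_trunc_comp]
        fun_eq_iff cls_eq_iff)
qed

lemma top_boundaries_subset: "top_boundaries M n p \<subseteq> carrier (trunc_sum M n p)"
  by (auto simp: top_boundaries_def)

text \<open>The preimage of \<open>top_boundaries\<close>, read degree by degree; it turns out to be
  the kernel \<open>K n p\<close>.\<close>

definition hodge_good :: "nat \<Rightarrow> nat \<Rightarrow> 'a forms set" where
  "hodge_good n p = {t. (\<forall>k<n. trunc_comp n p k t \<in> coinv_n k) \<and> (\<exists>s\<in>Forms (Suc n). trunc_comp n p n t - forms_b s \<in> coinv_n n)}"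

lemma trunc_pi_top_boundaries: "trunc_pi n p t \<in> top_boundaries M n p \<longleftrightarrow> t \<in> hodge_good n p"
proof -
  have car: "trunc_pi n p t \<in> carrier (trunc_sum M n p)"
    by (simp add: presentsD(1)[OF presents_trunc_sum])
  have low: "trunc_pi n p t k = vzero (mc M k) \<longleftrightarrow> trunc_comp n p k t \<in> coinv_n k" for k
    using cls_eq_iff[of "trunc_comp n p k t" k 0]
    by (simp add: trunc_pi_def vzero_mc trunc_comp_Forms cvec.subspace_0[OF subspace_Forms])
  have high: "trunc_comp n p k t \<in> coinv_n k" if "n < k" for k
    using that by (simp add: trunc_comp_def cvec.subspace_0[OF subspace_coinv_n])
  have "mc_b M (Suc n) ` carrier (mc M (Suc n)) = (\<lambda>s. cls n (forms_b s)) ` Forms (Suc n)"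
    by (auto simp: carrier_mc mc_b_cls image_iff)
  then have top: "trunc_pi n p t n \<in> mc_b M (Suc n) ` carrier (mc M (Suc n)) \<longleftrightarrow>
      (\<exists>s\<in>Forms (Suc n). trunc_comp n p n t - forms_b s \<in> coinv_n n)"
    using cls_eq_iff[OF trunc_comp_Forms b_Forms[OF Forms_homog], of _ n n p t]
    by (auto simp: trunc_pi_def image_iff)
  show ?thesis
    unfolding top_boundaries_def hodge_good_def using car low high top
    by (auto simp: nat_neq_iff)
qed

lemma subspace_hodge_good: "cvec.subspace (hodge_good n p)"
proof (rule cvec.subspaceI)
  note simps = clinear_simps[OF clinear_trunc_comp] clinear_simps[OF clinear_b]
  show "0 \<in> hodge_good n p"
    by (auto simp: hodge_good_def simps cvec.subspace_0[OF subspace_coinv_n] cvec.subspace_0[OF subspace_Forms] intro!: bexI[of _ 0])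
  fix x y :: "'a forms" and c
  assume x: "x \<in> hodge_good n p"
  then obtain s where s: "s \<in> Forms (Suc n)" "trunc_comp n p n x - forms_b s \<in> coinv_n n"
    unfolding hodge_good_def by blast
  show "c *\<^sub>C x \<in> hodge_good n p"
    using x s cvec.subspace_scale[OF subspace_coinv_n s(2), of c]
    by (auto simp: hodge_good_def simps cvec.subspace_scale[OF subspace_coinv_n] cvec.subspace_scale[OF subspace_Forms]
        cvec.scale_right_diff_distrib intro!: bexI[of _ "c *\<^sub>C s"])
  assume y: "y \<in> hodge_good n p"
  then obtain s' where s': "s' \<in> Forms (Suc n)" "trunc_comp n p n y - forms_b s' \<in> coinv_n n"
    unfolding hodge_good_def by blast
  show "x + y \<in> hodge_good n p"
    using x y s s' cvec.subspace_add[OF subspace_coinv_n s(2) s'(2)]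
    by (auto simp: hodge_good_def simps cvec.subspace_add[OF subspace_coinv_n] cvec.subspace_add[OF subspace_Forms]
        algebra_simps intro!: bexI[of _ "s + s'"])
qed

lemma hodge_goodI:
  assumes "\<And>k. trunc_comp n p k t \<in> coinv_n k"
  shows "t \<in> hodge_good n p"
  using assms cvec.subspace_0[OF subspace_Forms] by (auto simp: hodge_good_def clinear_simps[OF clinear_b] intro!: bexI[of _ 0])

lemma hodge_ker_good: "t \<in> K n p \<Longrightarrow> t \<in> hodge_good n p"
proof -
  assume t: "t \<in> K n p"
  have span: "cvec.span (hodge_good n p) = hodge_good n p"
    by (simp add: subspace_hodge_good cvec.span_eq_iff)
  have "t \<in> cvec.span (hodge_good n p)"
  proof (rule hodge_ker_map[OF clinear_ident t], unfold span)
    fix w :: "('a adj, 'a) word" assume "word_deg w mod 2 \<noteq> p \<or> n < word_deg w"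
    then show "tword w \<in> hodge_good n p"
      by (intro hodge_goodI) (auto simp: trunc_comp_def form_comp_tword cvec.subspace_0[OF subspace_coinv_n])
  next
    show "tens_init 1 \<in> hodge_good n p"
      by (intro hodge_goodI) (auto simp: trunc_comp_def form_comp_tword reduce_init clinear_zero[OF clinear_adj_incl]
          cvec.subspace_0[OF subspace_coinv_n])
  next
    show "c \<in> hodge_good n p" if "c \<in> coinv_gens" for c
      by (intro hodge_goodI) (auto simp: trunc_comp_def cvec.subspace_0[OF subspace_coinv_n]
          intro: form_comp_coinv cvec.span_base that)
  next
    fix s :: "'a forms" assume s: "s \<in> homog (Suc n)"
    show "forms_b s \<in> hodge_good n p"
    proof (cases "n mod 2 = p")
      case True
      then show ?thesis
        using s form_comp_Forms[OF b_Forms[OF s]]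
        by (auto simp: hodge_good_def trunc_comp_def Forms_Suc cvec.subspace_0[OF subspace_coinv_n] intro!: bexI[of _ s])
    next
      case False
      then show ?thesis
        using form_comp_Forms[OF b_Forms[OF s]]
        by (intro hodge_goodI) (auto simp: trunc_comp_def cvec.subspace_0[OF subspace_coinv_n])
    qed
  qed
  then show ?thesis by (simp only: span)
qed

text \<open>The representative of \<open>t\<close> modulo the kernel that has only the components
  retained at level n and parity p.\<close>

definition trunc :: "nat \<Rightarrow> nat \<Rightarrow> 'a forms \<Rightarrow> 'a forms" where
  "trunc n p t = (\<Sum>k\<le>n. trunc_comp n p k t)"

lemma clinear_trunc: "clinear (trunc n p)"
  unfolding trunc_def[abs_def] by (intro clinear_sum_fun clinear_trunc_comp)

lemma minus_trunc: "t - trunc n p t \<in> K n p"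
  unfolding hodge_ker_def
proof (rule clinear_span_image[OF clinear_diff_fun[OF clinear_ident clinear_trunc] _ span_tword], fold hodge_ker_def)
  fix s :: "'a forms" assume "s \<in> range tword"
  then obtain w where s: "s = tword w" by blast
  have "trunc n p s = (\<Sum>k\<le>n. if word_deg w = k then (if in_range n p k then reduce s else 0) else 0)"
    unfolding s trunc_def by (rule sum.cong) (auto simp: trunc_comp_def form_comp_tword)
  then have trunc: "trunc n p s = (if in_range n p (word_deg w) then reduce s else 0)"
    by simp
  show "s - trunc n p s \<in> K n p"
  proof (cases "in_range n p (word_deg w)")
    case True
    have "s - reduce s = (case w of Init x \<Rightarrow> scalar_part x *\<^sub>C tens_init 1 | _ \<Rightarrow> 0)"
      using tens_init_decompose by (cases w) (auto simp: s reduce_tword diff_eq_eq)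
    then have "s - reduce s \<in> K n p"
      by (cases w) (auto simp: hodge_ker_simps init_1_hodge_ker)
    with True show ?thesis by (simp add: trunc)
  next
    case False
    then have "word_deg w mod 2 \<noteq> p \<or> n < word_deg w" by auto
    then have "tword w \<in> K n p"
      by (rule homog_hodge_ker[OF tword_homog])
    then show ?thesis
      unfolding trunc if_not_P[OF False] by (simp add: s)
  qed
qed

lemma form_comp_trunc: "form_comp k (trunc n p t) = trunc_comp n p k t"
proof -
  have "form_comp k (trunc n p t) = (\<Sum>j\<le>n. if j = k then trunc_comp n p j t else 0)"
    using form_comp_Forms[OF trunc_comp_Forms] by (simp add: trunc_def form_comp_linear)
  then show ?thesis by (auto simp: trunc_comp_def)
qed

lemma hodge_good_iff: "t \<in> hodge_good n p \<longleftrightarrow> t \<in> K n p"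
proof
  assume t: "t \<in> hodge_good n p"
  then obtain s where s: "s \<in> Forms (Suc n)" "trunc_comp n p n t - forms_b s \<in> coinv_n n"
    unfolding hodge_good_def by blast
  have coinv: "c \<in> K n p" if "c \<in> coinv_n k" for c k
    by (rule span_hodge_ker[OF coinv_n_span[OF that]])
  have "(trunc_comp n p n t - forms_b s) + forms_b s \<in> K n p"
    using s by (intro hodge_ker_simps coinv[OF s(2)] b_hodge_ker_top) (simp add: Forms_Suc)
  then have top: "trunc_comp n p n t \<in> K n p" by simp
  have "trunc_comp n p k t \<in> K n p" if "k \<le> n" for k
  proof (cases "k = n")
    case False
    then show ?thesis using t that coinv[of _ k] by (auto simp: hodge_good_def)
  qed (simp add: top)
  then have "trunc n p t \<in> K n p"
    unfolding trunc_def by (intro cvec.subspace_sum[OF subspace_hodge_ker]) simp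
  from hodge_ker_simps(2)[OF minus_trunc[of t n p] this] show "t \<in> K n p" by simp
qed (rule hodge_ker_good)

definition H_pi :: "nat \<Rightarrow> nat \<Rightarrow> 'a forms \<Rightarrow> (nat \<Rightarrow> 'a forms set) set" where
  "H_pi p n t = hodge_proj M n p (trunc_pi n p t)"

lemmas trunc_pi_hodge_ker = trunc_pi_top_boundaries[unfolded hodge_good_iff]

lemma presents_H: "presents (H_pi p n) (K n p) (quotient (trunc_sum M n p) (top_boundaries M n p))"
  unfolding H_pi_def[abs_def]
  by (rule presents_quotient[OF presents_trunc_sum top_boundaries_subset trunc_pi_hodge_ker subspace_hodge_ker])

lemmas descend_H = descend_coset[OF presents_trunc_sum top_boundaries_subset trunc_pi_hodge_ker subspace_hodge_ker, folded H_pi_def]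

lemma H_pi_eq: "x - y \<in> K n p \<Longrightarrow> H_pi p n x = H_pi p n y"
  using presentsD(5)[OF presents_H] by blast

text \<open>The truncated form must stand on the right: the component of degree n + 1 of
  \<open>t\<close> would contribute its b in degree n, while the truncated sum has no such
  component. The two differ by a boundary, which disappears in the level.\<close>

lemma hodge_diff_trunc_pi:
  assumes "p < 2"
  shows "hodge_diff M n (trunc_pi n p t) = trunc_pi n (1 - p) (D_hodge (trunc n p t))"
proof
  fix k
  let ?t = "trunc n p t"
  have b: "mc_b M (Suc k) (trunc_pi n p t (Suc k)) = cls k (forms_b (trunc_comp n p (Suc k) t))"
    unfolding trunc_pi_def by (rule mc_b_cls[OF trunc_comp_Forms])
  have "(case k of 0 \<Rightarrow> vzero (mc M 0) | Suc j \<Rightarrow> mc_B M j (trunc_pi n p t j)) =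
      cls k (form_comp k (forms_B ?t))"
    by (cases k) (auto simp: vzero_mc form_comp_B_0 form_comp_B_Suc form_comp_trunc trunc_pi_def mc_B_cls[OF trunc_comp_Forms])
  then have *: "vadd (mc M k) (mc_b M (Suc k) (trunc_pi n p t (Suc k)))
      (case k of 0 \<Rightarrow> vzero (mc M 0) | Suc j \<Rightarrow> mc_B M j (trunc_pi n p t j)) = cls k (form_comp k (D_hodge ?t))"
    by (simp add: b vadd_mc b_Forms Forms_homog trunc_comp_Forms form_comp_in_Forms D_hodge_def form_comp_linear
        form_comp_b form_comp_trunc)
  have zero: "form_comp k (D_hodge ?t) = 0" if "k mod 2 \<noteq> 1 - p"
  proof -
    have "Suc k mod 2 \<noteq> p" "\<And>j. k = Suc j \<Longrightarrow> j mod 2 \<noteq> p"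
      using that assms by presburger+
    then show ?thesis
      by (cases k) (simp_all add: D_hodge_def form_comp_linear form_comp_b form_comp_trunc form_comp_B_0 form_comp_B_Suc
          trunc_comp_def clinear_zero[OF clinear_b] clinear_zero[OF clinear_B])
  qed
  have "hodge_diff M n (trunc_pi n p t) k = (if n < k then cls k 0 else cls k (form_comp k (D_hodge ?t)))"
    unfolding hodge_diff_def * by (simp only: vzero_mc)
  then show "hodge_diff M n (trunc_pi n p t) k = trunc_pi n (1 - p) (D_hodge ?t) k"
    using zero by (auto simp: trunc_pi_def trunc_comp_def)
qed

lemma H_diff:
  assumes "p < 2"
  shows "descend (\<lambda>f. hodge_proj M n (1 - p) (hodge_diff M n f)) (H_pi p n t) = H_pi (1 - p) n (D_hodge t)"
proof -
  have *: "hodge_proj M n (1 - p) (hodge_diff M n (trunc_pi n p s)) = H_pi (1 - p) n (D_hodge s)" for s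
  proof -
    have "D_hodge (trunc n p s) - D_hodge s \<in> K n (1 - p)"
      using D_hodge_hodge_ker[OF hodge_ker_simps(4)[OF minus_trunc[of s n p]] assms]
      by (simp add: clinear_simps[OF clinear_D_hodge])
    from H_pi_eq[OF this] show ?thesis
      by (simp add: hodge_diff_trunc_pi[OF assms] H_pi_def)
  qed
  have "H_pi (1 - p) n (D_hodge s) = H_pi (1 - p) n (D_hodge t)" if "s - t \<in> K n p" for s
    using D_hodge_hodge_ker[OF that assms] by (intro H_pi_eq) (simp add: clinear_simps[OF clinear_D_hodge])
  then show ?thesis
    using descend_H[of t n p "\<lambda>f. hodge_proj M n (1 - p) (hodge_diff M n f)"] by (simp add: * del: One_nat_def)
qed

lemma H_proj: "descend (\<lambda>f. hodge_proj M n p (hodge_trunc M n f)) (H_pi p (Suc n) t) = H_pi p n t"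
proof -
  have *: "hodge_proj M n p (hodge_trunc M n (trunc_pi (Suc n) p s)) = H_pi p n s" for s
    unfolding H_pi_def
    by (intro arg_cong[where f = "hodge_proj M n p"] ext) (auto simp: hodge_trunc_def trunc_pi_def trunc_comp_def vzero_mc)
  show ?thesis
    using descend_H[of t "Suc n" p "\<lambda>f. hodge_proj M n p (hodge_trunc M n f)"] H_pi_eq[OF hodge_ker_Suc_subset, of _ t n p]
    by (simp add: *)
qed

theorem presents_hodge_tower: "presents_tower D_hodge K (H_pi 0) (H_pi 1) (hodge_tower M)"
  unfolding presents_tower_def hodge_tower_def
  using presents_H H_diff[of 0] H_diff[of 1] H_proj by simp

end

theorem theorem2p7:
  fixes \<Delta> :: "'h::complex_algebra_1 \<Rightarrow> ('h, 'h) tensor"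
    and \<epsilon> :: "'h \<Rightarrow> complex"
    and S :: "'h \<Rightarrow> 'h"
    and \<delta> :: "'h \<Rightarrow> complex"
    and act :: "'h \<Rightarrow> 'r::complex_algebra \<Rightarrow> 'r"
  assumes "hopf_algebra \<Delta> \<epsilon> S"
    and "character \<delta>"
    and "\<forall>h. twisted_antipode \<Delta> S \<delta> (twisted_antipode \<Delta> S \<delta> h) = h"
    and "hopf_module_algebra \<Delta> act"
  shows "tower_homotopy_equivalent
    (X_tower \<Delta> \<epsilon> \<delta> (talg_act \<Delta> act) (IR :: 'r talg set))
    (hodge_tower (forms_mixed \<Delta> \<epsilon> \<delta> act))"
proof -
  interpret twisted_module_algebra \<Delta> \<epsilon> S \<delta> act
    using assms by (intro twisted_module_algebra.intro twisted_hopf.intro twisted_hopf_axioms.intro) auto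
  show ?thesis
    by (rule tower_homotopy_equivalent_D_X_D_hodge[OF presents_X_tower presents_hodge_tower])
qed

end
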